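(* Let $\mathfrak g\subset\mathfrak t$ be rational, let $\alpha\in\mathfrak t^*$ be of type $J=J_+\cup J_-$ and put $\chi=\sum_{k=1}^n\alpha_k\eta_k$. Assume $\alpha_J\neq z$, let $a_0\in\mathbb Q$ be such that $z\in a_0\alpha_J+V_0$ (then $a_0\ne1$), and put $f(x)=\frac{x-a_0}{1-a_0}$. Then for every $x\in\mathbb Z_{>0}$ such that $x\alpha$ is also of type $J$ (with the same $J_+$ and $J_-$), the Goldie rank of the primitive quotient $B^{x\chi}/J(x\alpha)$ is a quasi-polynomial in $x$ given by $$\mathrm{Grk}\big(B^{x\chi}/J(x\alpha)\big)=\mathrm{EHP}^{\mathbb Q}_{P_J-z}(f(x)),$$ where $\mathrm{EHP}^{\mathbb Q}_{P_J-z}$ is the rational Ehrhart quasi-polynomial of the rational polytope $P_J-z$ with respect to the standard lattice $L=\mathbb Z^J$, evaluated at the linear rescaling $f(x)\in\mathbb Q$.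
   Context: Algebraic setup. Let $k$ be an algebraically closed field of characteristic $0$ and $n=r+s$ with $r,s\in\mathbb Z_{\ge0}$. The Weyl algebra $\mathcal A$ is the $k$-algebra generated by $x_1,\dots,x_r,x_{r+1}^{\pm1},\dots,x_n^{\pm1},\partial_1,\dots,\partial_n$ with relations $[x_i,x_j]=0$, $[\partial_i,\partial_j]=0$, $[\partial_i,x_j]=\delta_{ij}$, $x_ix_i^{-1}=1$ for $i>r$. Put $\pi_i=x_i\partial_i$, $\mathfrak t=\mathrm{span}_k\{\pi_1,\dots,\pi_n\}$, and identify $\mathfrak t^*$ with $k^n$ via the dual basis $\pi_i^*$. For a subspace $\mathfrak g\subset\mathfrak t$ and $\chi\in\mathfrak g^*$ let $\mathcal A^{\mathfrak g}=\{a:[t,a]=0\ \forall t\in\mathfrak g\}$ and $B^\chi=\mathcal A^{\mathfrak g}/(\mathfrak g-\chi(\mathfrak g))$, the quotient by the two-sided ideal generated by all $t-\chi(t)$, $t\in\mathfrak g$. Put $\eta_i=\pi_i^*|_{\mathfrak g}$, $V(\mathfrak g)=\{\gamma\in k^n:\sum_i\gamma_i\eta_i=0\}$ and $V(\mathfrak g-\chi(\mathfrak g))=\{\gamma\in k^n:\sum_i\gamma_i\eta_i=\chi\}$. For $\alpha\in V(\mathfrak g-\chi(\mathfrak g))$ let $\mathfrak m_\alpha\subset\mathrm{Sym}(\mathfrak t)$ be the maximal ideal of $\alpha$ (acting via $\mathrm{Sym}(\mathfrak t)\subset\mathcal A^{\mathfrak g}\to B^\chi$), let $L(\alpha)$ be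 the unique simple quotient of the left module $B^\chi/B^\chi\mathfrak m_\alpha$, and $J(\alpha)=\mathrm{Ann}_{B^\chi}L(\alpha)$. $\mathrm{Grk}(R)$, for a prime noetherian ring $R$, is the maximal $m$ such that $R$ contains a direct sum of $m$ nonzero left ideals. Sign configuration and type. $\mathfrak g$ is called rational if the defining equations of $V(\mathfrak g)\subset k^n$ have coefficients in $\mathbb Q$. Let $E=V(\mathfrak g)\cap\mathbb Q^n$. For $\alpha\in\mathbb Q^n$ let $T_\alpha=\{i:1\le i\le r,\ \alpha_i\in\mathbb Z\}$ and for $i\in T_\alpha$ let $\lambda_i\in E^*$ be $\lambda_i(u)=-u_i$ if $\alpha_i\ge0$ and $\lambda_i(u)=u_i$ if $\alpha_i<0$. There is a unique decomposition $T_\alpha=I'\,\dot\cup\,J$ for which there exist $e\in E$ and rational numbers $(c_i)_{i\in T_\alpha}$ with $\sum_i c_i\lambda_i=0$, $\lambda_i(e)>0$ and $c_i=0$ for $i\in I'$, and $\lambda_j(e)=0$ and $c_j>0$ for $j\in J$. The sign configuration of $\alpha$ is this $J$ together with $J_+=\{j\in J:\alpha_j\ge0\}$, $J_-=\{j\in J:\alpha_j<0\}$; put $I=\{1,\dots,n\}\setminus J$. We say $\alpha$ is of type $J=J_+\cup J_-$ if $\mathfrak g$ is rational, $\alpha\in\mathbb Q^n$ has sign configuration $J=J_+\cup J_-$, and $\mathfrak g^*=\mathrm{span}_k\{\eta_j:j\in J\}\oplus\mathrm{span}_k\{\eta_i:i\in I\}$. Polytope. Put $\alpha_J=(\alpha_j)_{j\in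 J}\in\mathbb Q^J$, $V_0=\{v\in\mathbb Q^J:\sum_{j\in J}v_j\eta_j=0\}$, $L=\mathbb Z^J$, let $z\in\mathbb Z^J$ have coordinates $z_j=0$ for $j\in J_+$ and $z_j=-1$ for $j\in J_-$, and let $$P_J=\Big\{d\in\mathbb Q^J:\ \sum_{j\in J}d_j\eta_j=\sum_{j\in J}\alpha_j\eta_j,\ d_j\ge0\text{ for }j\in J_+,\ d_j\le-1\text{ for }j\in J_-\Big\},$$ a rational polytope (also regarded in $\mathbb R^J$). Ehrhart theory. A quasi-polynomial in $t$ is an expression $\sum_i c_i(t)t^i$ with finitely many terms and periodic coefficient functions $c_i$. For a rational polytope $P\subset\mathbb R^J$ the rational Ehrhart quasi-polynomial (Linke) is the function $\mathrm{EHP}^{\mathbb Q}_P(t)=\#(tP\cap\mathbb Z^J)$ of rational $t\ge0$, which has the form $\sum_i c_i(t)t^i$ with $c_i$ periodic functions of the rational variable $t$. *)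

theory Defs
  imports
    "HOL-Algebra.Algebra"
    "HOL-Algebra.Algebraic_Closure_Type"
    "HOL-Library.Poly_Mapping"
begin

section \<open>Left modules over noncommutative rings\<close>

text \<open>The locale \<^locale>\<open>module\<close> requires a commutative ring of scalars; the record
  \<^typ>\<open>('a, 'b) module\<close> and the locale \<^locale>\<open>submodule\<close> are reused.
  As in the library, the ring multiplication and unit of such a record carry no meaning for a
  module.\<close>

locale left_module = R?: ring R + M?: abelian_group M
  for R :: "('a, 'm) ring_scheme" (structure) and M :: "('a, 'b, 'c) module_scheme" (structure) +
  assumes smult_closed:
      "\<lbrakk>a \<in> carrier R; x \<in> carrier M\<rbrakk> \<Longrightarrow> a \<odot>\<^bsub>M\<^esub> x \<in> carrier M"
    and smult_l_distr:
      "\<lbrakk>a \<in> carrier R; b \<in> carrier R; x \<in> carrier M\<rbrakk> \<Longrightarrow>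
        (a \<oplus> b) \<odot>\<^bsub>M\<^esub> x = a \<odot>\<^bsub>M\<^esub> x \<oplus>\<^bsub>M\<^esub> b \<odot>\<^bsub>M\<^esub> x"
    and smult_r_distr:
      "\<lbrakk>a \<in> carrier R; x \<in> carrier M; y \<in> carrier M\<rbrakk> \<Longrightarrow>
        a \<odot>\<^bsub>M\<^esub> (x \<oplus>\<^bsub>M\<^esub> y) = a \<odot>\<^bsub>M\<^esub> x \<oplus>\<^bsub>M\<^esub> a \<odot>\<^bsub>M\<^esub> y"
    and smult_assoc:
      "\<lbrakk>a \<in> carrier R; b \<in> carrier R; x \<in> carrier M\<rbrakk> \<Longrightarrow>
        (a \<otimes> b) \<odot>\<^bsub>M\<^esub> x = a \<odot>\<^bsub>M\<^esub> (b \<odot>\<^bsub>M\<^esub> x)"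
    and smult_one:
      "x \<in> carrier M \<Longrightarrow> \<one> \<odot>\<^bsub>M\<^esub> x = x"

definition simple_left_module ::
    "('a, 'm) ring_scheme \<Rightarrow> ('a, 'b, 'c) module_scheme \<Rightarrow> bool" where
  "simple_left_module R M \<longleftrightarrow>
     left_module R M \<and> carrier M \<noteq> {\<zero>\<^bsub>M\<^esub>} \<and>
     (\<forall>N. submodule N R M \<longrightarrow> N = {\<zero>\<^bsub>M\<^esub>} \<or> N = carrier M)"

definition left_regular :: "('a, 'm) ring_scheme \<Rightarrow> ('a, 'a) module" where
  "left_regular R =
     \<lparr>carrier = carrier R, monoid.mult = monoid.mult R, one = one R,
      ring.zero = ring.zero R, add = add R, module.smult = monoid.mult R\<rparr>"

definition quotient_module ::
    "('a, 'b, 'c) module_scheme \<Rightarrow> 'b set \<Rightarrow> ('a, 'b set) module" where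
  "quotient_module M N =
     \<lparr>carrier = a_rcosets\<^bsub>M\<^esub> N, monoid.mult = rcoset_mult M N,
      one = N +>\<^bsub>M\<^esub> \<one>\<^bsub>M\<^esub>, ring.zero = N, add = set_add M,
      module.smult = (\<lambda>a C. \<Union>x\<in>C. N +>\<^bsub>M\<^esub> (a \<odot>\<^bsub>M\<^esub> x))\<rparr>"

definition generated_submodule ::
    "('a, 'm) ring_scheme \<Rightarrow> ('a, 'b, 'c) module_scheme \<Rightarrow> 'b set \<Rightarrow> 'b set" where
  "generated_submodule R M S = \<Inter>{N. submodule N R M \<and> S \<subseteq> N}"

text \<open>Meaningful only for modules that have exactly one simple quotient.\<close>

definition unique_simple_quotient ::
    "('a, 'm) ring_scheme \<Rightarrow> ('a, 'b, 'c) module_scheme \<Rightarrow> ('a, 'b set) module" where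
  "unique_simple_quotient R M =
     quotient_module M
       (THE N. submodule N R M \<and> simple_left_module R (quotient_module M N))"

definition annihilator ::
    "('a, 'm) ring_scheme \<Rightarrow> ('a, 'b, 'c) module_scheme \<Rightarrow> 'a set" where
  "annihilator R M = {a \<in> carrier R. \<forall>x\<in>carrier M. a \<odot>\<^bsub>M\<^esub> x = \<zero>\<^bsub>M\<^esub>}"

definition left_ideal :: "'a set \<Rightarrow> ('a, 'm) ring_scheme \<Rightarrow> bool" where
  "left_ideal I R \<longleftrightarrow> submodule I R (left_regular R)"

definition contains_direct_sum :: "('a, 'm) ring_scheme \<Rightarrow> nat \<Rightarrow> bool" where
  "contains_direct_sum R m \<longleftrightarrow>
     (\<exists>I :: nat \<Rightarrow> 'a set.
        (\<forall>i<m. left_ideal (I i) R \<and> I i \<noteq> {\<zero>\<^bsub>R\<^esub>}) \<and>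
        (\<forall>a. (\<forall>i<m. a i \<in> I i) \<and> (\<Oplus>\<^bsub>R\<^esub>i\<in>{..<m}. a i) = \<zero>\<^bsub>R\<^esub>
              \<longrightarrow> (\<forall>i<m. a i = \<zero>\<^bsub>R\<^esub>)))"

definition goldie_rank :: "('a, 'm) ring_scheme \<Rightarrow> nat" where
  "goldie_rank R = (GREATEST m. contains_direct_sum R m)"


section \<open>The Weyl algebra\<close>

datatype 'a free_monoid = Word (letters: "'a list")

instantiation free_monoid :: (type) monoid_add
begin

definition zero_free_monoid :: "'a free_monoid" where
  "0 = Word []"

definition plus_free_monoid :: "'a free_monoid \<Rightarrow> 'a free_monoid \<Rightarrow> 'a free_monoid" where
  "v + w = Word (letters v @ letters w)"

instance
  by standard (simp_all add: zero_free_monoid_def plus_free_monoid_def)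

end

text \<open>\<open>VarInv i\<close> stands for the inverse of the variable \<open>Var i\<close>.\<close>

datatype gen = Var nat | VarInv nat | Der nat

text \<open>Elements of the free algebra are finitely supported functions on words, with convolution
  as multiplication.\<close>

type_synonym 'k free = "gen free_monoid \<Rightarrow>\<^sub>0 'k"
type_synonym 'k weyl = "'k free set"

definition gens :: "nat \<Rightarrow> nat \<Rightarrow> gen set" where
  "gens r s = Var ` {1..r+s} \<union> VarInv ` {r+1..r+s} \<union> Der ` {1..r+s}"

definition free_alg :: "nat \<Rightarrow> nat \<Rightarrow> ('k::field) free ring" where
  "free_alg r s =
     ring_of_type_algebra
       \<lparr>carrier := {p. \<forall>w \<in> Poly_Mapping.keys p. set (letters w) \<subseteq> gens r s}\<rparr>"

definition letter :: "gen \<Rightarrow> ('k::field) free" where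
  "letter u = Poly_Mapping.single (Word [u]) 1"

text \<open>Since \<open>x\<^sub>i\<^sup>-\<^sup>1\<close> is a two-sided inverse, the commutation relations
  involving it follow from the ones listed.\<close>

definition weyl_relations :: "nat \<Rightarrow> nat \<Rightarrow> ('k::field) free set" where
  "weyl_relations r s =
     {letter (Var i) * letter (Var j) - letter (Var j) * letter (Var i) | i j. i \<in> {1..r+s} \<and> j \<in> {1..r+s}} \<union>
     {letter (Der i) * letter (Der j) - letter (Der j) * letter (Der i) | i j.
        i \<in> {1..r+s} \<and> j \<in> {1..r+s}} \<union>
     {letter (Der i) * letter (Var j) - letter (Var j) * letter (Der i) - (if i = j then 1 else 0) | i j.
        i \<in> {1..r+s} \<and> j \<in> {1..r+s}} \<union>
     {letter (Var i) * letter (VarInv i) - 1 | i. i \<in> {r+1..r+s}} \<union>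
     {letter (VarInv i) * letter (Var i) - 1 | i. i \<in> {r+1..r+s}}"

definition weyl_class :: "nat \<Rightarrow> nat \<Rightarrow> ('k::field) free \<Rightarrow> 'k weyl" where
  "weyl_class r s p = (Idl\<^bsub>free_alg r s\<^esub> (weyl_relations r s)) +>\<^bsub>free_alg r s\<^esub> p"

definition weyl_alg :: "nat \<Rightarrow> nat \<Rightarrow> ('k::field) weyl ring" where
  "weyl_alg r s = free_alg r s Quot (Idl\<^bsub>free_alg r s\<^esub> (weyl_relations r s))"

definition scalar :: "nat \<Rightarrow> nat \<Rightarrow> 'k::field \<Rightarrow> 'k weyl" where
  "scalar r s c = weyl_class r s (Poly_Mapping.single 0 c)"

definition euler :: "nat \<Rightarrow> nat \<Rightarrow> nat \<Rightarrow> ('k::field) weyl" where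
  "euler r s i = weyl_class r s (letter (Var i) * letter (Der i))"


section \<open>The torus and its subspaces\<close>

definition coord_space :: "nat set \<Rightarrow> (nat \<Rightarrow> 'c::zero) set" where
  "coord_space S = {v. \<forall>i. i \<notin> S \<longrightarrow> v i = 0}"

definition torus_elem :: "nat \<Rightarrow> nat \<Rightarrow> (nat \<Rightarrow> 'k::field) \<Rightarrow> 'k weyl" where
  "torus_elem r s c =
     (\<Oplus>\<^bsub>weyl_alg r s\<^esub>i\<in>{1..r+s}. scalar r s (c i) \<otimes>\<^bsub>weyl_alg r s\<^esub> euler r s i)"

definition torus :: "nat \<Rightarrow> nat \<Rightarrow> ('k::field) weyl set" where
  "torus r s = torus_elem r s ` coord_space {1..r+s}"

definition torus_subspace :: "nat \<Rightarrow> nat \<Rightarrow> ('k::field) weyl set \<Rightarrow> bool" where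
  "torus_subspace r s \<gg> \<longleftrightarrow>
     \<gg> \<subseteq> torus r s \<and> \<zero>\<^bsub>weyl_alg r s\<^esub> \<in> \<gg> \<and>
     (\<forall>t\<in>\<gg>. \<forall>u\<in>\<gg>. t \<oplus>\<^bsub>weyl_alg r s\<^esub> u \<in> \<gg>) \<and>
     (\<forall>c. \<forall>t\<in>\<gg>. scalar r s c \<otimes>\<^bsub>weyl_alg r s\<^esub> t \<in> \<gg>)"

text \<open>The basis of \<open>\<tt>\<^sup>*\<close> dual to \<open>\<pi>\<^sub>1, \<dots>, \<pi>\<^sub>n\<close>.\<close>

definition dual_basis :: "nat \<Rightarrow> nat \<Rightarrow> nat \<Rightarrow> ('k::field) weyl \<Rightarrow> 'k" where
  "dual_basis r s i t =
     (THE c. c \<in> coord_space {1..r+s} \<and> t = torus_elem r s c) i"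

text \<open>Functionals on \<open>\<gg>\<close> are represented by functions vanishing outside \<open>\<gg>\<close>.\<close>

definition dual_space ::
    "nat \<Rightarrow> nat \<Rightarrow> ('k::field) weyl set \<Rightarrow> ('k weyl \<Rightarrow> 'k) set" where
  "dual_space r s \<gg> =
     {\<phi>. (\<forall>t\<in>\<gg>. \<forall>u\<in>\<gg>. \<phi> (t \<oplus>\<^bsub>weyl_alg r s\<^esub> u) = \<phi> t + \<phi> u) \<and>
         (\<forall>c. \<forall>t\<in>\<gg>. \<phi> (scalar r s c \<otimes>\<^bsub>weyl_alg r s\<^esub> t) = c * \<phi> t) \<and>
         (\<forall>t. t \<notin> \<gg> \<longrightarrow> \<phi> t = 0)}"

definition eta :: "nat \<Rightarrow> nat \<Rightarrow> ('k::field) weyl set \<Rightarrow> nat \<Rightarrow> 'k weyl \<Rightarrow> 'k" where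
  "eta r s \<gg> i = (\<lambda>t. if t \<in> \<gg> then dual_basis r s i t else 0)"

definition eta_comb ::
    "nat \<Rightarrow> nat \<Rightarrow> ('k::field) weyl set \<Rightarrow> nat set \<Rightarrow> (nat \<Rightarrow> 'k) \<Rightarrow> 'k weyl \<Rightarrow> 'k" where
  "eta_comb r s \<gg> S c = (\<lambda>t. \<Sum>i\<in>S. c i * eta r s \<gg> i t)"

definition Vg :: "nat \<Rightarrow> nat \<Rightarrow> ('k::field) weyl set \<Rightarrow> (nat \<Rightarrow> 'k) set" where
  "Vg r s \<gg> = {\<gamma> \<in> coord_space {1..r+s}. eta_comb r s \<gg> {1..r+s} \<gamma> = (\<lambda>_. 0)}"


section \<open>The algebras \<open>B\<^sup>\<chi>\<close> and the primitive ideals \<open>J(\<alpha>)\<close>\<close>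

definition invariants :: "nat \<Rightarrow> nat \<Rightarrow> ('k::field) weyl set \<Rightarrow> 'k weyl ring" where
  "invariants r s \<gg> =
     weyl_alg r s
       \<lparr>carrier := {a \<in> carrier (weyl_alg r s).
          \<forall>t\<in>\<gg>. t \<otimes>\<^bsub>weyl_alg r s\<^esub> a \<ominus>\<^bsub>weyl_alg r s\<^esub> a \<otimes>\<^bsub>weyl_alg r s\<^esub> t = \<zero>\<^bsub>weyl_alg r s\<^esub>}\<rparr>"

definition char_ideal ::
    "nat \<Rightarrow> nat \<Rightarrow> ('k::field) weyl set \<Rightarrow> ('k weyl \<Rightarrow> 'k) \<Rightarrow> 'k weyl set" where
  "char_ideal r s \<gg> \<chi> =
     Idl\<^bsub>invariants r s \<gg>\<^esub> {t \<ominus>\<^bsub>weyl_alg r s\<^esub> scalar r s (\<chi> t) | t. t \<in> \<gg>}"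

definition B_alg ::
    "nat \<Rightarrow> nat \<Rightarrow> ('k::field) weyl set \<Rightarrow> ('k weyl \<Rightarrow> 'k) \<Rightarrow> 'k weyl set ring" where
  "B_alg r s \<gg> \<chi> = invariants r s \<gg> Quot char_ideal r s \<gg> \<chi>"

definition sym_torus :: "nat \<Rightarrow> nat \<Rightarrow> ('k::field) weyl ring" where
  "sym_torus r s =
     weyl_alg r s
       \<lparr>carrier := generate_ring (weyl_alg r s) (range (scalar r s) \<union> torus r s)\<rparr>"

text \<open>The maximal ideal of the point \<open>\<alpha>\<close> of the affine space \<open>\<tt>\<^sup>*\<close>.\<close>

definition max_ideal :: "nat \<Rightarrow> nat \<Rightarrow> (nat \<Rightarrow> 'k::field) \<Rightarrow> 'k weyl set" where
  "max_ideal r s \<alpha> =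
     Idl\<^bsub>sym_torus r s\<^esub>
       {euler r s i \<ominus>\<^bsub>weyl_alg r s\<^esub> scalar r s (\<alpha> i) | i. i \<in> {1..r+s}}"

text \<open>\<open>B\<^sup>\<chi> / B\<^sup>\<chi> \<mm>\<^sub>\<alpha>\<close>\<close>

definition M_module ::
    "nat \<Rightarrow> nat \<Rightarrow> ('k::field) weyl set \<Rightarrow> ('k weyl \<Rightarrow> 'k) \<Rightarrow> (nat \<Rightarrow> 'k) \<Rightarrow>
      ('k weyl set, 'k weyl set set) module" where
  "M_module r s \<gg> \<chi> \<alpha> =
     quotient_module (left_regular (B_alg r s \<gg> \<chi>))
       (generated_submodule (B_alg r s \<gg> \<chi>) (left_regular (B_alg r s \<gg> \<chi>))
         ((\<lambda>a. char_ideal r s \<gg> \<chi> +>\<^bsub>invariants r s \<gg>\<^esub> a) ` max_ideal r s \<alpha>))"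

definition L_module ::
    "nat \<Rightarrow> nat \<Rightarrow> ('k::field) weyl set \<Rightarrow> ('k weyl \<Rightarrow> 'k) \<Rightarrow> (nat \<Rightarrow> 'k) \<Rightarrow>
      ('k weyl set, 'k weyl set set set) module" where
  "L_module r s \<gg> \<chi> \<alpha> = unique_simple_quotient (B_alg r s \<gg> \<chi>) (M_module r s \<gg> \<chi> \<alpha>)"

definition J_ideal ::
    "nat \<Rightarrow> nat \<Rightarrow> ('k::field) weyl set \<Rightarrow> ('k weyl \<Rightarrow> 'k) \<Rightarrow> (nat \<Rightarrow> 'k) \<Rightarrow>
      'k weyl set set" where
  "J_ideal r s \<gg> \<chi> \<alpha> = annihilator (B_alg r s \<gg> \<chi>) (L_module r s \<gg> \<chi> \<alpha>)"


section \<open>Sign configurations and types\<close>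

definition rational_subspace :: "nat \<Rightarrow> nat \<Rightarrow> ('k::field_char_0) weyl set \<Rightarrow> bool" where
  "rational_subspace r s \<gg> \<longleftrightarrow>
     (\<exists>Q :: (nat \<Rightarrow> rat) set.
        Vg r s \<gg> = {\<gamma> \<in> coord_space {1..r+s}. \<forall>q\<in>Q. (\<Sum>i=1..r+s. of_rat (q i) * \<gamma> i) = 0})"

definition rat_Vg :: "nat \<Rightarrow> nat \<Rightarrow> ('k::field_char_0) weyl set \<Rightarrow> (nat \<Rightarrow> rat) set" where
  "rat_Vg r s \<gg> = {u. (\<lambda>i. of_rat (u i)) \<in> Vg r s \<gg>}"

definition integral_idx :: "nat \<Rightarrow> (nat \<Rightarrow> rat) \<Rightarrow> nat set" where
  "integral_idx r \<alpha> = {i. 1 \<le> i \<and> i \<le> r \<and> \<alpha> i \<in> \<int>}"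

definition sign_form :: "(nat \<Rightarrow> rat) \<Rightarrow> nat \<Rightarrow> (nat \<Rightarrow> rat) \<Rightarrow> rat" where
  "sign_form \<alpha> i u = (if \<alpha> i \<ge> 0 then - u i else u i)"

text \<open>\<open>J\<close> is the second part of the distinguished decomposition of \<^term>\<open>integral_idx r \<alpha>\<close>; the
  first part is its complement.\<close>

definition sign_decomposition ::
    "nat \<Rightarrow> nat \<Rightarrow> ('k::field_char_0) weyl set \<Rightarrow> (nat \<Rightarrow> rat) \<Rightarrow> nat set \<Rightarrow> bool" where
  "sign_decomposition r s \<gg> \<alpha> J \<longleftrightarrow>
     J \<subseteq> integral_idx r \<alpha> \<and>
     (\<exists>e \<in> rat_Vg r s \<gg>. \<exists>c :: nat \<Rightarrow> rat.
        (\<forall>u \<in> rat_Vg r s \<gg>. (\<Sum>i\<in>integral_idx r \<alpha>. c i * sign_form \<alpha> i u) = 0) \<and>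
        (\<forall>i \<in> integral_idx r \<alpha> - J. sign_form \<alpha> i e > 0 \<and> c i = 0) \<and>
        (\<forall>j \<in> J. sign_form \<alpha> j e = 0 \<and> c j > 0))"

definition sign_configuration ::
    "nat \<Rightarrow> nat \<Rightarrow> ('k::field_char_0) weyl set \<Rightarrow> (nat \<Rightarrow> rat) \<Rightarrow>
      nat set \<Rightarrow> nat set \<Rightarrow> bool" where
  "sign_configuration r s \<gg> \<alpha> Jp Jm \<longleftrightarrow>
     (\<exists>J. sign_decomposition r s \<gg> \<alpha> J \<and> Jp = {j \<in> J. \<alpha> j \<ge> 0} \<and> Jm = {j \<in> J. \<alpha> j < 0})"

definition dual_splits :: "nat \<Rightarrow> nat \<Rightarrow> ('k::field) weyl set \<Rightarrow> nat set \<Rightarrow> bool" where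
  "dual_splits r s \<gg> J \<longleftrightarrow>
     (let U = range (eta_comb r s \<gg> J); W = range (eta_comb r s \<gg> ({1..r+s} - J)) in
        dual_space r s \<gg> = {(\<lambda>t. \<phi> t + \<psi> t) | \<phi> \<psi>. \<phi> \<in> U \<and> \<psi> \<in> W} \<and>
        U \<inter> W = {\<lambda>_. 0})"

text \<open>A point of \<open>\<tt>\<^sup>* = k\<^sup>n\<close> that has a type is rational, so it is given here by its
  vector of rational coordinates.\<close>

definition of_type ::
    "nat \<Rightarrow> nat \<Rightarrow> ('k::field_char_0) weyl set \<Rightarrow> (nat \<Rightarrow> rat) \<Rightarrow>
      nat set \<Rightarrow> nat set \<Rightarrow> bool" where
  "of_type r s \<gg> \<alpha> Jp Jm \<longleftrightarrow>
     rational_subspace r s \<gg> \<and> \<alpha> \<in> coord_space {1..r+s} \<and>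
     sign_configuration r s \<gg> \<alpha> Jp Jm \<and> dual_splits r s \<gg> (Jp \<union> Jm)"


section \<open>The polytope \<open>P\<^sub>J\<close> and Ehrhart theory\<close>

definition restrict_coords :: "nat set \<Rightarrow> (nat \<Rightarrow> 'c::zero) \<Rightarrow> nat \<Rightarrow> 'c" where
  "restrict_coords J v = (\<lambda>j. if j \<in> J then v j else 0)"

definition V0 :: "nat \<Rightarrow> nat \<Rightarrow> ('k::field_char_0) weyl set \<Rightarrow> nat set \<Rightarrow> (nat \<Rightarrow> rat) set" where
  "V0 r s \<gg> J = {v \<in> coord_space J. eta_comb r s \<gg> J (\<lambda>j. of_rat (v j)) = (\<lambda>_. 0)}"

definition z_point :: "nat set \<Rightarrow> nat \<Rightarrow> rat" where
  "z_point Jm = (\<lambda>j. if j \<in> Jm then -1 else 0)"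

definition P_polytope ::
    "nat \<Rightarrow> nat \<Rightarrow> ('k::field_char_0) weyl set \<Rightarrow> (nat \<Rightarrow> rat) \<Rightarrow>
      nat set \<Rightarrow> nat set \<Rightarrow> (nat \<Rightarrow> rat) set" where
  "P_polytope r s \<gg> \<alpha> Jp Jm =
     {d \<in> coord_space (Jp \<union> Jm).
        eta_comb r s \<gg> (Jp \<union> Jm) (\<lambda>j. of_rat (d j)) =
        eta_comb r s \<gg> (Jp \<union> Jm) (\<lambda>j. of_rat (\<alpha> j)) \<and>
        (\<forall>j\<in>Jp. d j \<ge> 0) \<and> (\<forall>j\<in>Jm. d j \<le> -1)}"

definition translate_by :: "(nat \<Rightarrow> rat) set \<Rightarrow> (nat \<Rightarrow> rat) \<Rightarrow> (nat \<Rightarrow> rat) set" where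
  "translate_by P v = (\<lambda>d j. d j + v j) ` P"

definition std_lattice :: "nat set \<Rightarrow> (nat \<Rightarrow> rat) set" where
  "std_lattice J = {v \<in> coord_space J. \<forall>j\<in>J. v j \<in> \<int>}"

text \<open>The polytope is represented by its rational points. This suffices because every lattice
  point of a rational dilate \<open>tP\<close>, \<open>t > 0\<close>, comes from a rational point of \<open>P\<close>.
  The value is the one intended only for \<open>t \<ge> 0\<close>.\<close>

definition ehrhart :: "nat set \<Rightarrow> (nat \<Rightarrow> rat) set \<Rightarrow> rat \<Rightarrow> nat" where
  "ehrhart J P t = card ((\<lambda>d j. t * d j) ` P \<inter> std_lattice J)"

definition quasi_polynomial :: "(int \<Rightarrow> rat) \<Rightarrow> bool" where
  "quasi_polynomial q \<longleftrightarrow>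
     (\<exists>m :: nat. \<exists>c :: nat \<Rightarrow> int \<Rightarrow> rat.
        (\<forall>i\<le>m. \<exists>p>0. \<forall>x. c i (x + p) = c i x) \<and>
        (\<forall>x. q x = (\<Sum>i\<le>m. c i x * of_int x ^ i)))"

end

theory Submission
  imports Defs "HOL-Library.Function_Algebras"
begin

text \<open>Let \<open>\<A>\<^sup>\<gg>\<close> act on the span of the monomials \<open>x\<^sup>\<alpha>\<^sup>+\<^sup>b\<close>, where \<open>b\<close> runs over the lattice of integral points
  of \<open>V(\<gg>)\<close>. Fixing the signs of the integral coordinates of \<open>\<alpha> + b\<close> among the first \<open>r\<close> cuts out a
  set \<open>S\<close> of weights whose span is a subquotient; it is \<open>L(\<alpha>)\<close>, and the annihilator consists of the
  elements whose matrix vanishes on \<open>S \<times> S\<close>. The entries of these matrices are polynomial in the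
  weight. Since \<open>\<alpha>\<close> is of type \<open>J\<close>, \<open>S\<close> is the product of a finite set \<open>S\<^sub>J\<close> and a set containing a
  cone that is Zariski dense in the lattice in the \<open>I\<close>-coordinates.

  The Goldie rank is the cardinality of \<open>S\<^sub>J\<close>: elements concentrated in the columns over one point of
  \<open>S\<^sub>J\<close> form independent left ideals, and more left ideals cannot be independent because the numbers
  of lattice points in boxes grow polynomially, so that a linear system over the domain of polynomial
  functions has more unknowns than equations.

  Translating by \<open>z\<close> and changing signs identifies \<open>S\<^sub>J\<close> for \<open>x\<alpha>\<close> both with the lattice points of
  \<open>f(x)(P\<^sub>J - z)\<close> and with the points of an orthant lying on linear equations with right-hand side
  proportional to \<open>x - a\<^sub>0\<close>. Elliott's elimination of linear equations turns the number of the latter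
  into a quasi-polynomial in \<open>x\<close> if \<open>a\<^sub>0 < 1\<close>; if \<open>a\<^sub>0 > 1\<close>, only finitely many \<open>x\<close> have the same
  type.\<close>

section \<open>Quasi-polynomial counting functions\<close>

text \<open>Cosets of cosets are avoided by computing in the free algebra: there
  \<open>entry\<close> behaves like a matrix and vanishes on the defining relations, so that
  membership in the maximal left ideal and in the annihilator becomes vanishing of entries. The
  upper bound for the rank has to cope with arbitrary left ideals, whose elements need not be
  homogeneous. Multiplying from the left by polynomials in the Euler operators multiplies the rows
  by polynomial functions of the weight, so linear relations over these functions can be formed
  inside a left ideal, and rows over all but one point of \<open>S_J\<close> can be switched off.
  Every point of \<open>S_J\<close> then contributes one family of columns, that is of equations,
  and every left ideal one family of unknowns; this makes the size of \<open>S_J\<close> the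
  threshold. The translation by \<open>z\<close> exploits that an integral coordinate is negative
  exactly if it is at most -1. It puts the apex of the orthant at the origin, and so makes the sets
  for different \<open>x\<close> dilates of a single polytope.\<close>

definition poly_fun :: "(nat \<Rightarrow> rat) \<Rightarrow> bool" where
  "poly_fun h \<longleftrightarrow> (\<exists>p. \<forall>y. h y = poly p (of_nat y))"

lemma poly_fun_const: "poly_fun (\<lambda>_. c)"
  unfolding poly_fun_def by (rule exI[of _ "[:c:]"]) simp

lemma poly_fun_add:
  assumes "poly_fun f" "poly_fun g"
  shows "poly_fun (\<lambda>y. f y + g y)"
proof -
  obtain p q where "\<forall>y. f y = poly p (of_nat y)" "\<forall>y. g y = poly q (of_nat y)"
    using assms unfolding poly_fun_def by blast
  then have "\<forall>y. f y + g y = poly (p + q) (of_nat y)" by simp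
  then show ?thesis unfolding poly_fun_def by blast
qed

lemma poly_fun_sum:
  assumes "\<And>k. k \<in> K \<Longrightarrow> poly_fun (f k)"
  shows "poly_fun (\<lambda>y. \<Sum>k\<in>K. f k y)"
  using assms
  by (induction K rule: infinite_finite_induct) (auto intro: poly_fun_const poly_fun_add)

lemma poly_fun_affine:
  assumes "poly_fun f"
  shows "poly_fun (\<lambda>y. f (b + a * y))"
proof -
  obtain p where "\<forall>y. f y = poly p (of_nat y)"
    using assms unfolding poly_fun_def by blast
  then have "\<forall>y. f (b + a * y) = poly (pcompose p [:of_nat b, of_nat a:]) (of_nat y)"
    by (simp add: poly_pcompose mult.commute)
  then show ?thesis unfolding poly_fun_def by blast
qed

text \<open>Telescoping \<open>(j + 1) ^ Suc i - j ^ Suc i\<close> and expanding by the binomial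
  theorem expresses the sum of \<open>i\<close>-th powers through sums of lower powers.\<close>

lemma power_sum_poly: "\<exists>P :: rat poly. \<forall>y. (\<Sum>j<y. of_nat j ^ i) = poly P (of_nat y)"
proof (induction i rule: less_induct)
  case (less i)
  then have "\<forall>k. \<exists>P :: rat poly. k < i \<longrightarrow> (\<forall>y. (\<Sum>j<y. of_nat j ^ k) = poly P (of_nat y))"
    by blast
  then obtain P :: "nat \<Rightarrow> rat poly"
    where P: "\<And>k y. k < i \<Longrightarrow> (\<Sum>j<y. of_nat j ^ k) = poly (P k) (of_nat y)"
    by metis
  let ?R = "smult (1 / of_nat (Suc i))
    (monom 1 (Suc i) - (\<Sum>k<i. smult (of_nat (Suc i choose k)) (P k)))"
  have "(\<Sum>j<y. of_nat j ^ i) = poly ?R (of_nat y)" for y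
  proof -
    have bin: "(of_nat (Suc j) ^ Suc i - of_nat j ^ Suc i :: rat) =
        (\<Sum>k<i. of_nat (Suc i choose k) * of_nat j ^ k) + of_nat (Suc i) * of_nat j ^ i" for j
    proof -
      have "(of_nat (Suc j) :: rat) ^ Suc i = (of_nat j + 1) ^ Suc i"
        by (simp add: add.commute)
      also have "\<dots> = (\<Sum>k\<le>Suc i. of_nat (Suc i choose k) * of_nat j ^ k)"
        by (subst binomial_ring) simp
      also have "\<dots> = (\<Sum>k<i. of_nat (Suc i choose k) * of_nat j ^ k)
          + of_nat (Suc i) * of_nat j ^ i + of_nat j ^ Suc i"
        by (simp add: lessThan_Suc_atMost[symmetric] del: binomial_Suc_Suc)
      finally show ?thesis by simp
    qed
    have "(of_nat y :: rat) ^ Suc i = (\<Sum>j<y. of_nat (Suc j) ^ Suc i - of_nat j ^ Suc i)"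
      by (subst sum_lessThan_telescope) simp
    also have "\<dots> = (\<Sum>k<i. of_nat (Suc i choose k) * (\<Sum>j<y. of_nat j ^ k))
        + of_nat (Suc i) * (\<Sum>j<y. of_nat j ^ i)"
      unfolding bin sum.distrib sum_distrib_left by (subst sum.swap) simp
    also have "(\<Sum>k<i. of_nat (Suc i choose k) * (\<Sum>j<y. of_nat j ^ k)) =
        (\<Sum>k<i. of_nat (Suc i choose k) * poly (P k) (of_nat y))"
      by (intro sum.cong refl) (simp add: P)
    finally show ?thesis
      by (simp add: poly_monom poly_sum field_simps del: of_nat_Suc power_Suc)
  qed
  then show ?case by blast
qed

lemma poly_fun_partial_sums:
  assumes "poly_fun f"
  shows "poly_fun (\<lambda>y. \<Sum>j<y. f j)"
proof -
  obtain p where p: "\<forall>y. f y = poly p (of_nat y)"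
    using assms unfolding poly_fun_def by blast
  obtain P :: "nat \<Rightarrow> rat poly"
    where P: "\<And>i y. (\<Sum>j<y. of_nat j ^ i) = poly (P i) (of_nat y)"
    using power_sum_poly by metis
  have "(\<Sum>j<y. f j) = poly (\<Sum>i\<le>degree p. smult (coeff p i) (P i)) (of_nat y)" for y
  proof -
    have "(\<Sum>j<y. f j) = (\<Sum>i\<le>degree p. coeff p i * (\<Sum>j<y. of_nat j ^ i))"
      by (simp add: p poly_altdef sum_distrib_left sum.swap[of _ _ "{..<y}"])
    then show ?thesis by (simp add: P poly_sum)
  qed
  then show ?thesis unfolding poly_fun_def by blast
qed

text \<open>Quasi-polynomials of period \<open>D\<close> on the positive integers. The stride
  \<open>D * e\<close> makes every multiple of \<open>D\<close> a period as well, so that two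
  functions can be brought to a common one. Nonpositive arguments are left out because the counts
  below vanish at negative arguments, where a quasi-polynomial need not.\<close>

definition quasi_poly_pos :: "(int \<Rightarrow> rat) \<Rightarrow> bool" where
  "quasi_poly_pos h \<longleftrightarrow>
     (\<exists>D::nat. D > 0 \<and> (\<forall>c>0. \<forall>e. poly_fun (\<lambda>y. h (c + int D * int e * int y))))"

text \<open>Residues are represented in \<open>1..D\<close>, so that every positive argument is
  reached from its representative by a nonnegative number of steps.\<close>

lemma quasi_poly_posI:
  assumes D: "D > 0"
    and r: "\<And>\<rho>. \<lbrakk>1 \<le> \<rho>; \<rho> \<le> int D\<rbrakk> \<Longrightarrow> poly_fun (\<lambda>y. h (\<rho> + int D * int y))"
  shows "quasi_poly_pos h"
  unfolding quasi_poly_pos_def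
proof (intro exI[of _ D] conjI allI impI)
  fix c :: int and e :: nat assume c: "c > 0"
  define y0 where "y0 = nat ((c - 1) div int D)"
  define \<rho> where "\<rho> = (c - 1) mod int D + 1"
  have \<rho>: "1 \<le> \<rho>" "\<rho> \<le> int D"
    using D pos_mod_bound[of "int D" "c - 1"] pos_mod_sign[of "int D" "c - 1"]
    unfolding \<rho>_def by linarith+
  have "(c - 1) div int D \<ge> 0"
    using c D by (simp add: pos_imp_zdiv_nonneg_iff)
  then have "c = \<rho> + int D * int y0"
    by (simp add: \<rho>_def y0_def)
  then have "(\<lambda>y. h (c + int D * int e * int y)) = (\<lambda>y. h (\<rho> + int D * int (y0 + e * y)))"
    by (simp add: algebra_simps)
  then show "poly_fun (\<lambda>y. h (c + int D * int e * int y))"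
    using poly_fun_affine[OF r[OF \<rho>], of y0 e] by simp
qed (rule D)

lemma quasi_poly_pos_zero: "quasi_poly_pos (\<lambda>_. 0)"
  unfolding quasi_poly_pos_def by (auto intro: poly_fun_const)

lemma quasi_poly_pos_cong:
  assumes "quasi_poly_pos f" "\<And>m. m > 0 \<Longrightarrow> f m = g m"
  shows "quasi_poly_pos g"
proof -
  obtain D where D: "D > 0" "\<And>c e. c > 0 \<Longrightarrow> poly_fun (\<lambda>y. f (c + int D * int e * int y))"
    using assms(1) unfolding quasi_poly_pos_def by blast
  show ?thesis
  proof (rule quasi_poly_posI[OF D(1)])
    fix \<rho> :: int assume "1 \<le> \<rho>"
    then have "(\<lambda>y. g (\<rho> + int D * int y)) = (\<lambda>y. f (\<rho> + int D * int 1 * int y))"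
      by (intro ext) (subst assms(2), auto intro: add_pos_nonneg)
    then show "poly_fun (\<lambda>y. g (\<rho> + int D * int y))"
      using D(2)[of \<rho> 1] \<open>1 \<le> \<rho>\<close> by simp
  qed
qed

lemma quasi_poly_pos_add:
  assumes "quasi_poly_pos f" "quasi_poly_pos g"
  shows "quasi_poly_pos (\<lambda>m. f m + g m)"
proof -
  obtain D where D: "D > 0" "\<And>c e. c > 0 \<Longrightarrow> poly_fun (\<lambda>y. f (c + int D * int e * int y))"
    using assms(1) unfolding quasi_poly_pos_def by blast
  obtain E where E: "E > 0" "\<And>c e. c > 0 \<Longrightarrow> poly_fun (\<lambda>y. g (c + int E * int e * int y))"
    using assms(2) unfolding quasi_poly_pos_def by blast
  show ?thesis
  proof (rule quasi_poly_posI[of "D * E"])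
    fix \<rho> :: int assume "1 \<le> \<rho>"
    then have "poly_fun (\<lambda>y. f (\<rho> + int D * int E * int y) + g (\<rho> + int E * int D * int y))"
      using D E by (intro poly_fun_add) auto
    then show "poly_fun (\<lambda>y. f (\<rho> + int (D * E) * int y) + g (\<rho> + int (D * E) * int y))"
      by (simp add: mult.commute)
  qed (use D E in simp)
qed

text \<open>If \<open>D\<close> is a period of \<open>h\<close>, then \<open>D\<close> steps of the
  recurrence advance the argument by \<open>D * a\<close> and add an amount that is polynomial in
  the number of rounds already made; partial sums of polynomials are polynomial.\<close>

lemma quasi_poly_pos_recurrence:
  assumes h: "quasi_poly_pos h" and a: "a > 0" and s: "s \<ge> 0"
    and rec: "\<And>m. m > 0 \<Longrightarrow> g (m + int a) = g m + h (m + s)"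
  shows "quasi_poly_pos g"
proof -
  obtain D where D: "D > 0" "\<And>c e. c > 0 \<Longrightarrow> poly_fun (\<lambda>y. h (c + int D * int e * int y))"
    using h unfolding quasi_poly_pos_def by blast
  have iter: "g (m + int k * int a) = g m + (\<Sum>j<k. h (m + int j * int a + s))" if "m > 0" for m k
  proof (induction k)
    case (Suc k)
    have "m + int k * int a > 0" using that by (simp add: add_pos_nonneg)
    from rec[OF this] Suc show ?case by (simp add: algebra_simps)
  qed simp
  show ?thesis
  proof (rule quasi_poly_posI[of "D * a"])
    fix \<rho> :: int assume \<rho>: "1 \<le> \<rho>"
    define u where "u = (\<lambda>y. \<Sum>j<D. h ((\<rho> + int j * int a + s) + int D * int a * int y))"
    have "g (\<rho> + int (D * a) * int y) = g \<rho> + (\<Sum>j<y. u j)" for y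
    proof (induction y)
      case (Suc y)
      have "\<rho> + int (D * a) * int y > 0" using \<rho> by (simp add: add_pos_nonneg)
      from iter[OF this, of D] Suc show ?case
        by (simp add: u_def algebra_simps)
    qed simp
    moreover have "poly_fun u"
      unfolding u_def using \<rho> s by (intro poly_fun_sum D(2)) (simp add: add_pos_nonneg)
    ultimately show "poly_fun (\<lambda>y. g (\<rho> + int (D * a) * int y))"
      by (simp add: poly_fun_add poly_fun_const poly_fun_partial_sums)
  qed (use D a in simp)
qed

lemma quasi_poly_pos_affine:
  assumes h: "quasi_poly_pos h" and N: "int N > c"
  shows "quasi_poly_pos (\<lambda>x. h (int N * x - c))"
proof -
  obtain D where D: "D > 0" "\<And>c e. c > 0 \<Longrightarrow> poly_fun (\<lambda>y. h (c + int D * int e * int y))"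
    using h unfolding quasi_poly_pos_def by blast
  show ?thesis
  proof (rule quasi_poly_posI[OF D(1)])
    fix \<rho> :: int assume "1 \<le> \<rho>"
    then have "int N * 1 \<le> int N * \<rho>" by (intro mult_left_mono) auto
    then have "int N * \<rho> - c > 0" using N by simp
    from D(2)[OF this, of N] show "poly_fun (\<lambda>y. h (int N * (\<rho> + int D * int y) - c))"
      by (simp add: algebra_simps)
  qed
qed

lemma quasi_poly_pos_imp_quasi_polynomial:
  assumes "quasi_poly_pos h"
  shows "\<exists>q. quasi_polynomial q \<and> (\<forall>x>0. q x = h x)"
proof -
  obtain D where D: "D > 0" "\<And>c e. c > 0 \<Longrightarrow> poly_fun (\<lambda>y. h (c + int D * int e * int y))"
    using assms unfolding quasi_poly_pos_def by blast
  have "\<forall>\<rho>. \<exists>p. 0 < \<rho> \<longrightarrow> (\<forall>y. h (\<rho> + int D * int y) = poly p (of_nat y))"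
    using D(2)[where e = 1] unfolding poly_fun_def by simp
  then obtain p where p: "\<And>\<rho> y. 0 < \<rho> \<Longrightarrow> h (\<rho> + int D * int y) = poly (p \<rho>) (of_nat y)"
    by metis
  define res where "res x = (x - 1) mod int D + 1" for x
  \<comment> \<open>Substituting \<open>y = (x - \<rho>) / D\<close> rewrites the polynomial on the
    class of \<open>\<rho>\<close> in terms of \<open>x\<close>, so that the coefficients depend on
    \<open>x\<close> through \<open>res x\<close> alone.\<close>
  define P where "P \<rho> = pcompose (p \<rho>) [:- (of_int \<rho> / of_nat D), 1 / of_nat D:]" for \<rho>
  define m where "m = Max ((\<lambda>\<rho>. degree (P \<rho>)) ` {1..int D})"
  define q where "q x = (\<Sum>i\<le>m. coeff (P (res x)) i * of_int x ^ i)" for x :: int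
  have res: "res x \<in> {1..int D}" for x
    using D(1) pos_mod_bound[of "int D" "x - 1"] pos_mod_sign[of "int D" "x - 1"]
    unfolding res_def atLeastAtMost_iff by linarith
  have "res (x + int D) = res x" for x
  proof -
    have "(x + int D - 1) mod int D = ((x - 1) + int D) mod int D" by (simp add: algebra_simps)
    then show ?thesis unfolding res_def by simp
  qed
  then have "quasi_polynomial q"
    unfolding quasi_polynomial_def
    by (intro exI[of _ m] exI[of _ "\<lambda>i x. coeff (P (res x)) i"] conjI allI impI exI[of _ "int D"])
       (use D(1) in \<open>auto simp: q_def\<close>)
  moreover have "q x = h x" if "x > 0" for x
  proof -
    have deg: "degree (P (res x)) \<le> m"
      unfolding m_def using res by (intro Max_ge) auto
    have "q x = poly (P (res x)) (of_int x)"
      unfolding q_def poly_altdef using deg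
      by (intro sum.mono_neutral_right) (auto simp: coeff_eq_0)
    also have "\<dots> = poly (p (res x)) ((of_int x - of_int (res x)) / of_nat D)"
      using D(1) by (simp add: P_def poly_pcompose diff_divide_distrib)
    also have "(of_int x - of_int (res x)) / of_nat D = (of_nat (nat ((x - 1) div int D)) :: rat)"
    proof -
      have "(x - 1) div int D \<ge> 0" using that D(1) by (simp add: pos_imp_zdiv_nonneg_iff)
      moreover have "x - res x = int D * ((x - 1) div int D)"
        unfolding res_def using mult_div_mod_eq[of "int D" "x - 1"] by linarith
      then have "(of_int x - of_int (res x) :: rat) = of_nat D * of_int ((x - 1) div int D)"
        by (metis of_int_diff of_int_mult of_int_of_nat_eq)
      ultimately show ?thesis using D(1) by simp
    qed
    also have "poly (p (res x)) (of_nat (nat ((x - 1) div int D))) =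
        h (res x + int D * int (nat ((x - 1) div int D)))"
      using res[of x] by (subst p) auto
    also have "res x + int D * int (nat ((x - 1) div int D)) = x"
    proof -
      have "(x - 1) div int D \<ge> 0" using that D(1) by (simp add: pos_imp_zdiv_nonneg_iff)
      then show ?thesis unfolding res_def by simp
    qed
    finally show ?thesis .
  qed
  ultimately show ?thesis by blast
qed

section \<open>Lattice points of an orthant on linear equations\<close>

definition orthant_sols ::
    "nat set \<Rightarrow> (nat \<Rightarrow> int) set \<Rightarrow> (nat \<Rightarrow> int) \<Rightarrow> (nat \<Rightarrow> int) \<Rightarrow> int \<Rightarrow> (nat \<Rightarrow> int) set" where
  "orthant_sols I Q \<epsilon> l m =
     {n. (\<forall>i\<in>I. \<epsilon> i \<le> n i) \<and> (\<forall>i. i \<notin> I \<longrightarrow> n i = 0) \<and>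
         (\<forall>q\<in>Q. (\<Sum>i\<in>I. q i * n i) = 0) \<and> (\<Sum>i\<in>I. l i * n i) = m}"

text \<open>Finiteness is recorded because \<open>card\<close> of an infinite set is 0, so that
  cardinalities of disjoint pieces would not add up.\<close>

definition countable_orthant ::
    "nat set \<Rightarrow> (nat \<Rightarrow> int) set \<Rightarrow> (nat \<Rightarrow> int) \<Rightarrow> (nat \<Rightarrow> int) \<Rightarrow> bool" where
  "countable_orthant I Q \<epsilon> l \<longleftrightarrow>
     (\<forall>m. finite (orthant_sols I Q \<epsilon> l m)) \<and>
     quasi_poly_pos (\<lambda>m. of_nat (card (orthant_sols I Q \<epsilon> l m)))"

lemma finite_orthant_sols:
  assumes I: "finite I" and l: "\<And>i. i \<in> I \<Longrightarrow> l i > 0" and \<epsilon>: "\<And>i. i \<in> I \<Longrightarrow> 0 \<le> \<epsilon> i"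
  shows "finite (orthant_sols I Q \<epsilon> l m)"
proof (rule finite_subset)
  show "orthant_sols I Q \<epsilon> l m \<subseteq> {f. \<forall>x. (x \<in> I \<longrightarrow> f x \<in> {0..m}) \<and> (x \<notin> I \<longrightarrow> f x = 0)}"
  proof (clarsimp simp: orthant_sols_def)
    fix n i assume n: "\<forall>i\<in>I. \<epsilon> i \<le> n i" and i: "i \<in> I"
    have nn: "0 \<le> n j" if "j \<in> I" for j using n \<epsilon> that by fastforce
    have "n i \<le> l i * n i"
      using l[OF i] nn[OF i] mult_right_mono[of 1 "l i" "n i"] by simp
    also have "\<dots> \<le> (\<Sum>i\<in>I. l i * n i)"
      using I i l nn by (intro member_le_sum) (auto intro: mult_nonneg_nonneg simp: less_imp_le)
    finally show "0 \<le> n i \<and> n i \<le> (\<Sum>i\<in>I. l i * n i)" using nn[OF i] by simp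
  qed
qed (rule finite_set_of_finite_funs[OF I finite_atLeastAtMost_int])

text \<open>A solution of degree \<open>m + l a\<close> either arises from one of degree
  \<open>m\<close> by raising \<open>n a\<close> by one, or has \<open>n a = \<epsilon> a\<close>
  and is counted with one variable less. This recurrence adds the variables one at a time.\<close>

lemma countable_orthant_free:
  assumes "finite I" and "\<And>i. i \<in> I \<Longrightarrow> l i > 0" and "\<And>i. i \<in> I \<Longrightarrow> \<epsilon> i \<in> {0, 1}"
  shows "countable_orthant I {} \<epsilon> l"
  unfolding countable_orthant_def
proof (intro conjI allI)
  show "finite (orthant_sols I {} \<epsilon> l m)" for m
    using assms(1,2)
  proof (rule finite_orthant_sols)
    show "0 \<le> \<epsilon> i" if "i \<in> I" for i using assms(3)[OF that] by auto
  qed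
  show "quasi_poly_pos (\<lambda>m. of_nat (card (orthant_sols I {} \<epsilon> l m)))"
    using assms
  proof (induction I rule: finite_induct)
    case empty
    \<comment> \<open>Without variables only the degree 0 is attained, which positive arguments do
      not see.\<close>
    show ?case
      by (rule quasi_poly_pos_cong[OF quasi_poly_pos_zero]) (auto simp: orthant_sols_def)
  next
    case (insert a I)
    have l: "l a > 0" and \<epsilon>: "\<epsilon> a \<in> {0, 1}" using insert.prems by auto
    have fin: "finite (orthant_sols I {} \<epsilon> l m)" "finite (orthant_sols (insert a I) {} \<epsilon> l m)" for m
    proof -
      have "0 \<le> \<epsilon> i" if "i \<in> insert a I" for i using insert.prems(2)[OF that] by auto
      then show "finite (orthant_sols I {} \<epsilon> l m)" "finite (orthant_sols (insert a I) {} \<epsilon> l m)"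
        using insert by (auto intro!: finite_orthant_sols)
    qed
    have card: "card (orthant_sols (insert a I) {} \<epsilon> l (m + l a)) =
        card (orthant_sols (insert a I) {} \<epsilon> l m) + card (orthant_sols I {} \<epsilon> l (m + (l a - \<epsilon> a * l a)))"
      for m
    proof -
      let ?up = "\<lambda>n::nat \<Rightarrow> int. n(a := n a + 1)" and ?st = "\<lambda>n::nat \<Rightarrow> int. n(a := \<epsilon> a)"
      let ?A = "orthant_sols (insert a I) {} \<epsilon> l m"
      let ?B = "orthant_sols I {} \<epsilon> l (m + (l a - \<epsilon> a * l a))"
      have [simp]: "(\<Sum>i\<in>I. l i * (if i = a then x else n i)) = (\<Sum>i\<in>I. l i * n i)" for n x
        using insert.hyps by (intro sum.cong) auto
      have "orthant_sols (insert a I) {} \<epsilon> l (m + l a) = ?up ` ?A \<union> ?st ` ?B"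
      proof (intro Set.set_eqI iffI)
        fix n assume n: "n \<in> orthant_sols (insert a I) {} \<epsilon> l (m + l a)"
        show "n \<in> ?up ` ?A \<union> ?st ` ?B"
        proof (cases "n a = \<epsilon> a")
          case True
          then have "n(a := 0) \<in> ?B" "n = ?st (n(a := 0))"
            using n insert.hyps by (auto simp: orthant_sols_def algebra_simps)
          then show ?thesis by blast
        next
          case False
          then have "n(a := n a - 1) \<in> ?A" "n = ?up (n(a := n a - 1))"
            using n insert.hyps by (auto simp: orthant_sols_def algebra_simps)
          then show ?thesis by blast
        qed
      next
        fix n assume "n \<in> ?up ` ?A \<union> ?st ` ?B"
        then show "n \<in> orthant_sols (insert a I) {} \<epsilon> l (m + l a)"
          using insert.hyps by (auto simp: orthant_sols_def algebra_simps)
      qed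
      moreover have "?up ` ?A \<inter> ?st ` ?B = {}"
      proof -
        have "?up n \<noteq> ?st n'" if "n \<in> ?A" for n n'
        proof
          assume "?up n = ?st n'"
          from fun_cong[OF this, of a] have "n a + 1 = \<epsilon> a" by simp
          then show False using that by (auto simp: orthant_sols_def)
        qed
        then show ?thesis by blast
      qed
      moreover have "inj_on ?up ?A"
      proof (rule inj_onI)
        fix n n' assume eq: "?up n = ?up n'"
        show "n = n'"
        proof
          fix i show "n i = n' i" using fun_cong[OF eq, of i] by (cases "i = a") auto
        qed
      qed
      moreover have "inj_on ?st ?B"
      proof (rule inj_onI)
        fix n n' assume mem: "n \<in> ?B" "n' \<in> ?B" and eq: "?st n = ?st n'"
        have "n a = 0" "n' a = 0" using mem insert.hyps by (auto simp: orthant_sols_def)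
        show "n = n'"
        proof
          fix i show "n i = n' i"
            using fun_cong[OF eq, of i] \<open>n a = 0\<close> \<open>n' a = 0\<close> by (cases "i = a") auto
        qed
      qed
      ultimately show ?thesis
        using fin by (simp add: card_Un_disjoint card_image)
    qed
    show ?case
    proof (rule quasi_poly_pos_recurrence[where a = "nat (l a)" and s = "l a - \<epsilon> a * l a"])
      show "quasi_poly_pos (\<lambda>m. of_nat (card (orthant_sols I {} \<epsilon> l m)))"
        using insert by simp
      \<comment> \<open>Here \<open>\<epsilon> a \<le> 1\<close> matters: the shift is nonnegative,
        so the count over \<open>I\<close> is evaluated at positive degrees.\<close>
      show "0 < nat (l a)" "0 \<le> l a - \<epsilon> a * l a" using l \<epsilon> by auto
    next
      fix m
      show "of_nat (card (orthant_sols (insert a I) {} \<epsilon> l (m + int (nat (l a))))) =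
          of_nat (card (orthant_sols (insert a I) {} \<epsilon> l m)) +
          (of_nat (card (orthant_sols I {} \<epsilon> l (m + (l a - \<epsilon> a * l a)))) :: rat)"
        using card[of m] l by simp
    qed
  qed
qed

lemma sum_shear:
  fixes q n :: "nat \<Rightarrow> int"
  assumes "finite I" "i \<in> I" "j \<in> I" "i \<noteq> j"
  shows "(\<Sum>k\<in>I. (q(j := q i + q j)) k * n k) = (\<Sum>k\<in>I. q k * (n(i := n i + n j)) k)"
proof -
  have I: "I = insert i (insert j (I - {i, j}))" using assms by auto
  have "(\<Sum>k\<in>I - {i, j}. (q(j := q i + q j)) k * n k) = (\<Sum>k\<in>I - {i, j}. q k * (n(i := n i + n j)) k)"
    by (intro sum.cong) auto
  then show ?thesis using assms by (subst (1 2) I) (simp add: algebra_simps)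
qed

text \<open>Elliott's reduction: on the part \<open>n i - n j \<ge> \<delta>\<close>, the coordinates \<open>n i - n j, n j\<close> turn the
  coefficient \<open>q j\<close> into \<open>q i + q j\<close>, so that coefficients of opposite signs cancel.\<close>

lemma orthant_sols_region:
  assumes I: "finite I" "i \<in> I" "j \<in> I" "i \<noteq> j" and \<epsilon>: "\<epsilon> i \<le> \<epsilon> j + \<delta>"
  shows "{n \<in> orthant_sols I Q \<epsilon> l m. \<delta> \<le> n i - n j} =
    (\<lambda>n. n(i := n i + n j)) `
      orthant_sols I ((\<lambda>q. q(j := q i + q j)) ` Q) (\<epsilon>(i := \<delta>)) (l(j := l i + l j)) m"
    (is "?L = ?T ` ?R")
proof (intro Set.set_eqI iffI)
  fix n assume n: "n \<in> ?L"
  have "n(i := n i - n j) \<in> ?R"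
    using n I unfolding orthant_sols_def mem_Collect_eq ball_simps sum_shear[OF I] by auto
  moreover have "n = ?T (n(i := n i - n j))" using I by auto
  ultimately show "n \<in> ?T ` ?R" by blast
next
  fix n assume "n \<in> ?T ` ?R"
  then obtain n' where n': "n' \<in> ?R" "n = ?T n'" by blast
  then have "\<forall>k\<in>I. (\<epsilon>(i := \<delta>)) k \<le> n' k" by (simp add: orthant_sols_def)
  from bspec[OF this I(2)] bspec[OF this I(3)] have "\<epsilon> i \<le> n i"
    using I(4) \<epsilon> n'(2) by simp
  then show "n \<in> ?L"
    using n' I unfolding orthant_sols_def mem_Collect_eq ball_simps sum_shear[OF I]
    by (auto split: if_splits)
qed

lemma inj_shear:
  fixes i j :: nat
  assumes "i \<noteq> j"
  shows "inj_on (\<lambda>n::nat \<Rightarrow> int. n(i := n i + n j)) A"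
proof (rule inj_onI, rule ext)
  fix n n' :: "nat \<Rightarrow> int" and k
  assume eq: "n(i := n i + n j) = n'(i := n' i + n' j)"
  show "n k = n' k" using assms fun_cong[OF eq, of k] fun_cong[OF eq, of j] by (cases "k = i") auto
qed

text \<open>Positivity is asked on the nonzero solutions, while single coefficients of
  \<open>l\<close> may be negative. In this form the condition passes to the pieces of a
  subdivision, and for trivial equations it yields positive coefficients.\<close>

definition grading ::
    "nat set \<Rightarrow> (nat \<Rightarrow> int) set \<Rightarrow> (nat \<Rightarrow> int) \<Rightarrow> bool" where
  "grading I Q l \<longleftrightarrow>
     (\<forall>n. (\<forall>i\<in>I. 0 \<le> n i) \<and> (\<forall>i. i \<notin> I \<longrightarrow> n i = 0) \<and> n \<noteq> (\<lambda>_. 0) \<and>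
          (\<forall>q\<in>Q. (\<Sum>i\<in>I. q i * n i) = 0) \<longrightarrow> 0 < (\<Sum>i\<in>I. l i * n i))"

lemma grading_shear:
  assumes I: "finite I" "i \<in> I" "j \<in> I" "i \<noteq> j" and g: "grading I Q l"
  shows "grading I ((\<lambda>q. q(j := q i + q j)) ` Q) (l(j := l i + l j))"
  unfolding grading_def ball_simps sum_shear[OF I]
proof (intro allI impI)
  fix n :: "nat \<Rightarrow> int" assume n: "(\<forall>i\<in>I. 0 \<le> n i) \<and> (\<forall>i. i \<notin> I \<longrightarrow> n i = 0) \<and> n \<noteq> (\<lambda>_. 0) \<and>
    (\<forall>q\<in>Q. (\<Sum>k\<in>I. q k * (n(i := n i + n j)) k) = 0)"
  have "n(i := n i + n j) \<noteq> (\<lambda>_. 0)"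
  proof
    assume z: "n(i := n i + n j) = (\<lambda>_. 0)"
    have "n k = 0" for k
    proof (cases "k = i")
      case False then show ?thesis using fun_cong[OF z, of k] by simp
    next
      case True
      then show ?thesis using fun_cong[OF z, of i] fun_cong[OF z, of j] I by simp
    qed
    then show False using n by auto
  qed
  then show "0 < (\<Sum>k\<in>I. l k * (n(i := n i + n j)) k)"
    using g n I unfolding grading_def by (auto simp del: fun_upd_apply) (auto simp: fun_upd_def)
qed

text \<open>The orthant is cut along \<open>n i = n j\<close>; the diagonal goes to the first piece
  if \<open>\<delta> = 0\<close> and to the second if \<open>\<delta> = 1\<close>. This choice makes
  the old bound of the replaced coordinate a consequence of the new ones,
  \<open>\<epsilon> i \<le> \<epsilon> j + \<delta>\<close> and
  \<open>\<epsilon> j \<le> \<epsilon> i + (1 - \<delta>)\<close>. Disjointness of the pieces forces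
  one new bound to be 1, so both bounds 0 and 1 occur.\<close>

lemma countable_orthant_split:
  assumes I: "finite I" "i \<in> I" "j \<in> I" "i \<noteq> j" and \<epsilon>: "\<And>k. k \<in> I \<Longrightarrow> \<epsilon> k \<in> {0, 1}"
    and \<delta>: "\<delta> = (if \<epsilon> i = 1 \<and> \<epsilon> j = 0 then 1 else 0)"
    and 1: "countable_orthant I ((\<lambda>q. q(j := q i + q j)) ` Q) (\<epsilon>(i := \<delta>)) (l(j := l i + l j))"
    and 2: "countable_orthant I ((\<lambda>q. q(i := q j + q i)) ` Q) (\<epsilon>(j := 1 - \<delta>)) (l(i := l j + l i))"
  shows "countable_orthant I Q \<epsilon> l"
proof -
  let ?S1 = "orthant_sols I ((\<lambda>q. q(j := q i + q j)) ` Q) (\<epsilon>(i := \<delta>)) (l(j := l i + l j))"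
  let ?S2 = "orthant_sols I ((\<lambda>q. q(i := q j + q i)) ` Q) (\<epsilon>(j := 1 - \<delta>)) (l(i := l j + l i))"
  have e: "\<epsilon> i \<le> \<epsilon> j + \<delta>" "\<epsilon> j \<le> \<epsilon> i + (1 - \<delta>)" using \<epsilon>[of i] \<epsilon>[of j] I \<delta> by auto
  have r1: "(\<lambda>n. n(i := n i + n j)) ` ?S1 m = {n \<in> orthant_sols I Q \<epsilon> l m. \<delta> \<le> n i - n j}"
    and r2: "(\<lambda>n. n(j := n j + n i)) ` ?S2 m = {n \<in> orthant_sols I Q \<epsilon> l m. 1 - \<delta> \<le> n j - n i}" for m
    using orthant_sols_region[OF I e(1), of Q l m]
      orthant_sols_region[OF I(1,3,2) not_sym[OF I(4)] e(2), of Q l m] by simp_all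
  have un: "orthant_sols I Q \<epsilon> l m =
      (\<lambda>n. n(i := n i + n j)) ` ?S1 m \<union> (\<lambda>n. n(j := n j + n i)) ` ?S2 m"
    and dis: "(\<lambda>n. n(i := n i + n j)) ` ?S1 m \<inter> (\<lambda>n. n(j := n j + n i)) ` ?S2 m = {}" for m
    unfolding r1 r2 by auto
  have fin: "finite (?S1 m)" "finite (?S2 m)" for m
    using 1 2 by (auto simp: countable_orthant_def)
  have "card (orthant_sols I Q \<epsilon> l m) = card (?S1 m) + card (?S2 m)" for m
    unfolding un using fin dis[of m] I(4)
    by (subst card_Un_disjoint) (auto simp: card_image inj_shear)
  moreover have "finite (orthant_sols I Q \<epsilon> l m)" for m
    unfolding un using fin by simp
  ultimately show ?thesis
    using 1 2 quasi_poly_pos_add unfolding countable_orthant_def by auto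
qed


lemma countable_orthant_one_sign:
  assumes I: "finite I" and \<epsilon>: "\<And>k. k \<in> I \<Longrightarrow> \<epsilon> k \<in> {0, 1}" and g: "grading I Q l"
    and q: "q \<in> Q" and sgn: "(\<forall>i\<in>I. 0 \<le> q i) \<or> (\<forall>i\<in>I. q i \<le> 0)"
    and IH: "\<And>I'. \<lbrakk>I' \<subseteq> I; I' = {i \<in> I. q i = 0}; grading I' Q l\<rbrakk> \<Longrightarrow> countable_orthant I' Q \<epsilon> l"
  shows "countable_orthant I Q \<epsilon> l"
proof -
  define I' where "I' = {i \<in> I. q i = 0}"
  have I'_sub: "I' \<subseteq> I" by (auto simp: I'_def)
  have vanish: "n i = 0" if "i \<in> I" "i \<notin> I'" "n \<in> orthant_sols I Q \<epsilon> l m" for n i m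
  proof -
    have nn: "0 \<le> n k" if "k \<in> I" for k
    proof -
      have "\<epsilon> k \<le> n k" using \<open>n \<in> _\<close> that by (simp add: orthant_sols_def)
      then show ?thesis using \<epsilon>[OF that] by auto
    qed
    have "(\<Sum>i\<in>I. q i * n i) = 0" using that(3) q by (simp add: orthant_sols_def)
    moreover from this have "(\<Sum>i\<in>I. - q i * n i) = 0" by (simp add: sum_negf)
    ultimately have "\<forall>i\<in>I. q i * n i = 0"
    proof (rule_tac disjE[OF sgn])
      assume "\<forall>i\<in>I. 0 \<le> q i" and z: "(\<Sum>i\<in>I. q i * n i) = 0"
      then have "0 \<le> q i * n i" if "i \<in> I" for i using nn that by simp
      then show ?thesis using sum_nonneg_eq_0_iff[OF I, of "\<lambda>i. q i * n i"] z by blast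
    next
      assume "\<forall>i\<in>I. q i \<le> 0" and z: "(\<Sum>i\<in>I. - q i * n i) = 0"
      then have "0 \<le> - q i * n i" if "i \<in> I" for i using nn that by (simp add: mult_nonpos_nonneg)
      then have "\<forall>i\<in>I. - q i * n i = 0"
        using sum_nonneg_eq_0_iff[OF I, of "\<lambda>i. - q i * n i"] z by blast
      then show ?thesis by simp
    qed
    then show ?thesis using that by (auto simp: I'_def)
  qed
  have sums: "(\<Sum>i\<in>I. p i * n i) = (\<Sum>i\<in>I'. p i * n i)" if "\<And>i. i \<in> I - I' \<Longrightarrow> n i = 0"
    for p n :: "nat \<Rightarrow> int"
    using that I by (intro sum.mono_neutral_right) (auto simp: I'_def)
  show ?thesis
  proof (cases "\<exists>i\<in>I - I'. \<epsilon> i = 1")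
    case True
    then obtain i where i: "i \<in> I" "i \<notin> I'" "\<epsilon> i = 1" by blast
    have "n \<notin> orthant_sols I Q \<epsilon> l m" for n m
    proof
      assume n: "n \<in> orthant_sols I Q \<epsilon> l m"
      then have "\<epsilon> i \<le> n i" using i(1) by (simp add: orthant_sols_def)
      then show False using vanish[OF i(1,2) n] i by simp
    qed
    then have "orthant_sols I Q \<epsilon> l m = {}" for m by blast
    then show ?thesis by (simp add: countable_orthant_def quasi_poly_pos_zero)
  next
    case False
    then have e0: "\<epsilon> i = 0" if "i \<in> I - I'" for i using \<epsilon> that by blast
    have "orthant_sols I Q \<epsilon> l m = orthant_sols I' Q \<epsilon> l m" for m
    proof (intro Set.set_eqI iffI)
      fix n assume n: "n \<in> orthant_sols I Q \<epsilon> l m"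
      then have "\<And>i. i \<in> I - I' \<Longrightarrow> n i = 0" using vanish by blast
      then show "n \<in> orthant_sols I' Q \<epsilon> l m"
        using n sums[of n] by (auto simp: orthant_sols_def I'_def)
    next
      fix n assume n: "n \<in> orthant_sols I' Q \<epsilon> l m"
      then have n0: "n i = 0" if "i \<in> I - I'" for i using that by (simp add: orthant_sols_def)
      have e0': "\<epsilon> i \<le> n i" if "i \<in> I" for i
      proof (cases "i \<in> I'")
        case True then show ?thesis using n by (simp add: orthant_sols_def)
      next
        case False then show ?thesis using n0[of i] e0[of i] that by simp
      qed
      then show "n \<in> orthant_sols I Q \<epsilon> l m"
        using n sums[of n, OF n0] e0' I'_sub unfolding orthant_sols_def mem_Collect_eq by auto
    qed
    moreover have "grading I' Q l"
      unfolding grading_def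
    proof (intro allI impI)
      fix n assume n: "(\<forall>i\<in>I'. 0 \<le> n i) \<and> (\<forall>i. i \<notin> I' \<longrightarrow> n i = 0) \<and> n \<noteq> (\<lambda>_. 0) \<and>
        (\<forall>q\<in>Q. (\<Sum>i\<in>I'. q i * n i) = 0)"
      then have "\<forall>i\<in>I. 0 \<le> n i" "\<forall>i. i \<notin> I \<longrightarrow> n i = 0" by (auto simp: I'_def)
      then show "0 < (\<Sum>i\<in>I'. l i * n i)"
        using n sums[of n] g unfolding grading_def by auto
    qed
    ultimately show ?thesis
      using IH[of I'] by (auto simp: countable_orthant_def I'_def)
  qed
qed

text \<open>Fix an equation with coefficients between \<open>- b\<close> and \<open>a\<close>.
  Splitting at a pair with the coefficients \<open>a\<close> and \<open>- b\<close> replaces one of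
  them by \<open>a - b\<close>, which lies strictly between; once one of the extreme values is gone,
  its bound drops. When all coefficients have one sign, variables disappear and the outer induction
  on \<open>card I\<close> takes over.\<close>

theorem countable_orthant_graded:
  assumes "finite I" and "\<And>k. k \<in> I \<Longrightarrow> \<epsilon> k \<in> {0, 1}" and "grading I Q l"
  shows "countable_orthant I Q \<epsilon> l"
  using assms
proof (induction "card I" arbitrary: I Q \<epsilon> l rule: less_induct)
  case (less I)
  note I = less.prems(1) and outer = less.hyps
  have reduce: "countable_orthant I Q \<epsilon> l"
    if "q \<in> Q" "\<exists>i\<in>I. q i \<noteq> 0" "\<And>i. i \<in> I \<Longrightarrow> - int b \<le> q i \<and> q i \<le> int a"
      "\<And>k. k \<in> I \<Longrightarrow> \<epsilon> k \<in> {0, 1}" "grading I Q l"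
    for q Q \<epsilon> l a b
    using that
  proof (induction "(a + b) * Suc (card I) + card {i \<in> I. q i = int a \<or> q i = - int b}"
      arbitrary: q Q \<epsilon> l a b rule: less_induct)
    case (less q a b Q \<epsilon> l)
    note IH = less.hyps and bnd = less.prems(3)
    show ?case
    proof (cases "(\<forall>i\<in>I. 0 \<le> q i) \<or> (\<forall>i\<in>I. q i \<le> 0)")
      case True
      show ?thesis
      proof (rule countable_orthant_one_sign[OF I less.prems(4,5,1) True])
        fix I' assume I': "I' \<subseteq> I" "I' = {i \<in> I. q i = 0}" "grading I' Q l"
        have "card I' < card I"
          using I less.prems(2) I' by (intro psubset_card_mono) auto
        moreover have "\<epsilon> k \<in> {0, 1}" if "k \<in> I'" for k
          using less.prems(4) I'(1) that by blast
        ultimately show "countable_orthant I' Q \<epsilon> l"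
          using finite_subset[OF I'(1) I] I'(3) by (intro outer)
      qed
    next
      case False
      then obtain i j where "i \<in> I" "q i < 0" "j \<in> I" "0 < q j" by (meson not_le)
      with bnd[of i] bnd[of j] have ab: "a \<ge> 1" "b \<ge> 1" by linarith+
      \<comment> \<open>The factor \<open>Suc (card I)\<close> exceeds the number of coefficients,
        so a drop of \<open>a + b\<close> outweighs any increase in the number of extreme
        ones.\<close>
      have smaller: "(a' + b') * Suc (card I) + card {i \<in> I. P i} <
          (a + b) * Suc (card I) + card {i \<in> I. q i = int a \<or> q i = - int b}"
        if "a' + b' < a + b" for a' b' P
      proof -
        have "card {i \<in> I. P i} \<le> card I" using I by (intro card_mono) auto
        then have "(a' + b') * Suc (card I) + card {i \<in> I. P i} < Suc (a' + b') * Suc (card I)" by simp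
        also have "\<dots> \<le> (a + b) * Suc (card I)" using that by (intro mult_le_mono1) simp
        finally show ?thesis by simp
      qed
      consider "\<forall>i\<in>I. q i \<noteq> int a" | "\<forall>i\<in>I. q i \<noteq> - int b"
        | i j where "i \<in> I" "q i = int a" "j \<in> I" "q j = - int b" by blast
      then show ?thesis
      proof cases
        case 1
        show ?thesis
        proof (rule IH[OF smaller[of "a - 1" b] less.prems(1,2) _ less.prems(4,5)])
          show "- int b \<le> q i \<and> q i \<le> int (a - 1)" if "i \<in> I" for i
            using bnd[OF that] bspec[OF 1 that] ab by linarith
        qed (use ab in auto)
      next
        case 2
        show ?thesis
        proof (rule IH[OF smaller[of a "b - 1"] less.prems(1,2) _ less.prems(4,5)])
          show "- int (b - 1) \<le> q i \<and> q i \<le> int a" if "i \<in> I" for i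
            using bnd[OF that] bspec[OF 2 that] ab by linarith
        qed (use ab in auto)
      next
        case (3 i j)
        have ij: "i \<noteq> j" using 3 ab by auto
        define \<delta> :: int where "\<delta> = (if \<epsilon> i = 1 \<and> \<epsilon> j = 0 then 1 else 0)"
        have qij: "q i + q j = int a - int b" "q j + q i = int a - int b" using 3 by simp_all
        have fewer: "card {k \<in> I. (q(i' := int a - int b)) k = int a \<or> (q(i' := int a - int b)) k = - int b} <
            card {i \<in> I. q i = int a \<or> q i = - int b}" (is "card ?A < card ?B")
          if "i' = i \<or> i' = j" for i'
        proof -
          have A: "?A = ?B - {i'}" using ab by (intro Set.set_eqI) simp
          have "i' \<in> ?B" using that 3 by auto
          moreover have "finite ?B" by (rule finite_subset[OF _ I]) auto
          ultimately show ?thesis unfolding A by (rule card_Diff1_less[rotated])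
        qed
        have bnd': "- int b \<le> (q(i' := int a - int b)) k \<and> (q(i' := int a - int b)) k \<le> int a"
          if "k \<in> I" for i' k
          using bnd[OF that] ab by simp
        have \<epsilon>': "(\<epsilon>(i' := e)) k \<in> {0, 1}" if "e \<in> {0, 1}" "k \<in> I" for i' e k
          using less.prems(4)[OF that(2)] that(1) by simp
        show ?thesis
        proof (rule countable_orthant_split[OF I \<open>i \<in> I\<close> \<open>j \<in> I\<close> ij less.prems(4) \<delta>_def])
          show "countable_orthant I ((\<lambda>q. q(j := q i + q j)) ` Q) (\<epsilon>(i := \<delta>)) (l(j := l i + l j))"
          proof (rule IH[of a b "q(j := q i + q j)"], unfold qij)
            show "q(j := int a - int b) \<in> (\<lambda>q. q(j := q i + q j)) ` Q"
              using less.prems(1) qij by (metis (no_types, lifting) image_eqI)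
            show "\<exists>k\<in>I. (q(j := int a - int b)) k \<noteq> 0" using 3 ij ab by (intro bexI[of _ i]) auto
            show "grading I ((\<lambda>q. q(j := q i + q j)) ` Q) (l(j := l i + l j))"
              using I 3 ij less.prems(5) by (intro grading_shear)
            show "(\<epsilon>(i := \<delta>)) k \<in> {0, 1}" if "k \<in> I" for k
              by (rule \<epsilon>'[OF _ that]) (simp add: \<delta>_def)
          qed (use fewer[of j] bnd' in simp_all)
          show "countable_orthant I ((\<lambda>q. q(i := q j + q i)) ` Q) (\<epsilon>(j := 1 - \<delta>)) (l(i := l j + l i))"
          proof (rule IH[of a b "q(i := q j + q i)"], unfold qij)
            show "q(i := int a - int b) \<in> (\<lambda>q. q(i := q j + q i)) ` Q"
              using less.prems(1) qij by (metis (no_types, lifting) image_eqI)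
            show "\<exists>k\<in>I. (q(i := int a - int b)) k \<noteq> 0" using 3 ij ab by (intro bexI[of _ j]) auto
            show "grading I ((\<lambda>q. q(i := q j + q i)) ` Q) (l(i := l j + l i))"
              using I 3 ij less.prems(5) by (intro grading_shear) auto
            show "(\<epsilon>(j := 1 - \<delta>)) k \<in> {0, 1}" if "k \<in> I" for k
              by (rule \<epsilon>'[OF _ that]) (simp add: \<delta>_def)
          qed (use fewer[of i] bnd' in simp_all)
        qed
      qed
    qed
  qed
  show ?case
  proof (cases "\<exists>q\<in>Q. \<exists>i\<in>I. q i \<noteq> 0")
    case True
    then obtain q where q: "q \<in> Q" "\<exists>i\<in>I. q i \<noteq> 0" by blast
    define a where "a = Max ((\<lambda>i. nat \<bar>q i\<bar>) ` I)"
    have "- int a \<le> q i \<and> q i \<le> int a" if "i \<in> I" for i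
    proof -
      have "nat \<bar>q i\<bar> \<le> a" unfolding a_def using I that by (intro Max_ge) auto
      then show ?thesis by linarith
    qed
    from reduce[OF q this less.prems(2,3)] show ?thesis .
  next
    case False
    then have "orthant_sols I Q \<epsilon> l m = orthant_sols I {} \<epsilon> l m" for m
      by (auto simp: orthant_sols_def)
    \<comment> \<open>Unit vectors solve the trivial equations, so the grading forces every
      coefficient of \<open>l\<close> to be positive.\<close>
    moreover have "0 < l i" if "i \<in> I" for i
    proof -
      define e :: "nat \<Rightarrow> int" where "e = (\<lambda>k. if k = i then 1 else 0)"
      have "e i = 1" by (simp add: e_def)
      then have "e \<noteq> (\<lambda>_. 0)" by auto
      moreover have "\<forall>k\<in>I. 0 \<le> e k" "\<forall>k. k \<notin> I \<longrightarrow> e k = 0" using that by (auto simp: e_def)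
      moreover have "\<forall>q\<in>Q. (\<Sum>k\<in>I. q k * e k) = 0"
        using False by (auto intro: sum.neutral)
      ultimately have "0 < (\<Sum>k\<in>I. l k * e k)"
        using less.prems(3) unfolding grading_def by blast
      also have "(\<Sum>k\<in>I. l k * e k) = (\<Sum>k\<in>I. if k = i then l k else 0)"
        by (intro sum.cong) (simp_all add: e_def)
      finally show ?thesis using I that by simp
    qed
    then have "countable_orthant I {} \<epsilon> l"
      using I less.prems(2) by (intro countable_orthant_free)
    ultimately show ?thesis by (simp add: countable_orthant_def)
  qed
qed

section \<open>From rational affine equations to graded integral ones\<close>

lemma common_denominator:
  fixes g :: "'a \<Rightarrow> rat"
  assumes "finite A"
  shows "\<exists>M>0. \<forall>a\<in>A. of_nat M * g a \<in> \<int>"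
  using assms
proof (induction A rule: finite_induct)
  case (insert a A)
  then obtain M where M: "M > 0" "\<forall>a\<in>A. of_nat M * g a \<in> \<int>" by blast
  obtain p q where pq: "q > 0" "g a = of_int p / of_int q"
    by (metis quotient_of_denom_pos quotient_of_div surj_pair)
  define K where "K = nat q"
  have K: "K > 0" "of_nat K = (of_int q :: rat)" using pq by (auto simp: K_def)
  have "of_nat (M * K) * g a = of_int (int M * p)"
    using K pq by simp
  then have "of_nat (M * K) * g a \<in> \<int>" by (metis Ints_of_int)
  moreover have "of_nat (M * K) * g b \<in> \<int>" if "b \<in> A" for b
  proof -
    have "of_nat (M * K) * g b = of_nat K * (of_nat M * g b)" by simp
    then show ?thesis using M(2) that by (metis Ints_mult Ints_of_nat)
  qed
  ultimately show ?case using M(1) K(1) by (intro exI[of _ "M * K"]) auto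
qed auto

text \<open>The parameter \<open>t\<close> of a point is its value under the linear form
  \<open>\<phi>\<close> obtained from the equation \<open>q0\<close>. Eliminating \<open>t\<close>
  leaves homogeneous equations with coefficients \<open>q j - \<phi> j * \<beta> q\<close>, and
  \<open>pos\<close> says that \<open>\<phi>\<close> is a grading on their solutions. After scaling
  by \<open>N\<close>, the points with \<open>t = x - a0\<close> are those of degree
  \<open>N * x - c\<close>, which is positive for all \<open>x > 0\<close> because
  \<open>a0 < 1\<close>.\<close>

lemma cone_line_quasi_poly:
  fixes Q :: "(nat \<Rightarrow> rat) set" and \<beta> :: "(nat \<Rightarrow> rat) \<Rightarrow> rat"
  assumes J: "finite J" and a0: "a0 < 1" and q0: "q0 \<in> Q" "\<beta> q0 \<noteq> 0"
    and pos: "\<And>n t. \<lbrakk>\<forall>j\<in>J. 0 \<le> n j; \<forall>j. j \<notin> J \<longrightarrow> n j = 0; n \<noteq> (\<lambda>_. 0);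
      \<forall>q\<in>Q. (\<Sum>j\<in>J. q j * of_int (n j)) = t * \<beta> q\<rbrakk> \<Longrightarrow> 0 < t"
  shows "quasi_poly_pos (\<lambda>x. of_nat (card {n. (\<forall>j\<in>J. 0 \<le> n j) \<and> (\<forall>j. j \<notin> J \<longrightarrow> n j = 0) \<and>
    (\<forall>q\<in>Q. (\<Sum>j\<in>J. q j * of_int (n j)) = (of_int x - a0) * \<beta> q)}))"
proof -
  define \<phi> where "\<phi> j = q0 j / \<beta> q0" for j
  obtain M where M: "M > 0" "\<forall>j\<in>J. of_nat M * \<phi> j \<in> \<int>"
    using common_denominator[OF J, of \<phi>] by blast
  obtain K where K: "K > 0" "of_nat K * a0 \<in> \<int>"
    using common_denominator[of "{a0}" id] by auto
  define N where "N = M * K"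
  have "N > 0" using M K by (simp add: N_def)
  have "of_nat N * a0 = of_nat M * (of_nat K * a0)" by (simp add: N_def)
  then have "of_nat N * a0 \<in> \<int>" using K by (metis Ints_mult Ints_of_nat)
  then obtain c where c: "of_nat N * a0 = of_int c" by (auto elim: Ints_cases)
  have "\<exists>l. of_nat N * \<phi> j = of_int l" if "j \<in> J" for j
  proof -
    have "of_nat N * \<phi> j = of_nat K * (of_nat M * \<phi> j)" by (simp add: N_def)
    then have "of_nat N * \<phi> j \<in> \<int>" using M that by (metis Ints_mult Ints_of_nat)
    then show ?thesis by (auto elim: Ints_cases)
  qed
  then obtain l where l: "\<And>j. j \<in> J \<Longrightarrow> of_nat N * \<phi> j = of_int (l j)" by metis
  \<comment> \<open>\<open>Q\<close> may be infinite, so each equation gets its own multiplier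
    \<open>k\<close>; taking all integral multiples avoids a choice.\<close>
  define Q' where "Q' = {p :: nat \<Rightarrow> int. \<exists>q\<in>Q. \<exists>k>0. \<forall>j\<in>J. of_int (p j) = of_nat k * (q j - \<phi> j * \<beta> q)}"
  have l_sum: "of_nat N * (\<Sum>j\<in>J. \<phi> j * of_int (n j)) = of_int (\<Sum>j\<in>J. l j * n j)" for n
    by (simp add: sum_distrib_left l flip: mult.assoc)
  have eqs: "(\<forall>p\<in>Q'. (\<Sum>j\<in>J. p j * n j) = 0) \<longleftrightarrow>
      (\<forall>q\<in>Q. (\<Sum>j\<in>J. q j * of_int (n j)) = (\<Sum>j\<in>J. \<phi> j * of_int (n j)) * \<beta> q)"
    (is "?A = ?B") for n
  proof -
    have expand: "of_int (\<Sum>j\<in>J. p j * n j) =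
        of_nat k * ((\<Sum>j\<in>J. q j * of_int (n j)) - (\<Sum>j\<in>J. \<phi> j * of_int (n j)) * \<beta> q)"
      if "\<forall>j\<in>J. of_int (p j) = of_nat k * (q j - \<phi> j * \<beta> q)" for p k q
    proof -
      have "of_int (\<Sum>j\<in>J. p j * n j) = (\<Sum>j\<in>J. of_nat k * (q j - \<phi> j * \<beta> q) * of_int (n j))"
        using that by simp
      then show ?thesis
        by (simp add: sum_distrib_left sum_distrib_right algebra_simps flip: sum_subtractf)
    qed
    show ?thesis
    proof
      assume A: ?A
      show ?B
      proof
        fix q assume "q \<in> Q"
        obtain k where k: "k > 0" "\<forall>j\<in>J. of_nat k * (q j - \<phi> j * \<beta> q) \<in> \<int>"
          using common_denominator[OF J, of "\<lambda>j. q j - \<phi> j * \<beta> q"] by blast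
        define p where "p j = \<lfloor>of_nat k * (q j - \<phi> j * \<beta> q)\<rfloor>" for j
        have p: "\<forall>j\<in>J. of_int (p j) = of_nat k * (q j - \<phi> j * \<beta> q)"
          using k(2) unfolding p_def by (simp add: of_int_floor)
        then have "p \<in> Q'" using k \<open>q \<in> Q\<close> by (auto simp: Q'_def)
        then have "of_int (\<Sum>j\<in>J. p j * n j) = (0::rat)" using A by simp
        then show "(\<Sum>j\<in>J. q j * of_int (n j)) = (\<Sum>j\<in>J. \<phi> j * of_int (n j)) * \<beta> q"
          using expand[OF p] k by simp
      qed
    next
      assume B: ?B
      show ?A
      proof
        fix p assume "p \<in> Q'"
        then obtain q k where "q \<in> Q" "\<forall>j\<in>J. of_int (p j) = of_nat k * (q j - \<phi> j * \<beta> q)"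
          by (auto simp: Q'_def)
        then have "of_int (\<Sum>j\<in>J. p j * n j) = (0::rat)" using expand B by auto
        then show "(\<Sum>j\<in>J. p j * n j) = 0" by (simp only: of_int_eq_0_iff)
      qed
    qed
  qed
  have "grading J Q' l"
    unfolding grading_def
  proof (intro allI impI, elim conjE)
    fix n assume n: "\<forall>j\<in>J. 0 \<le> n j" "\<forall>j. j \<notin> J \<longrightarrow> n j = 0" "n \<noteq> (\<lambda>_. 0)"
      and "\<forall>p\<in>Q'. (\<Sum>j\<in>J. p j * n j) = 0"
    from pos[OF n this(4)[unfolded eqs]]
    have "0 < of_nat N * (\<Sum>j\<in>J. \<phi> j * of_int (n j))" using \<open>N > 0\<close> by simp
    then show "0 < (\<Sum>j\<in>J. l j * n j)" unfolding l_sum by (simp only: of_int_0_less_iff)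
  qed
  then have "quasi_poly_pos (\<lambda>m. of_nat (card (orthant_sols J Q' (\<lambda>_. 0) l m)))"
    using countable_orthant_graded[OF J, of "\<lambda>_. 0"] by (simp add: countable_orthant_def)
  moreover have "int N > c"
  proof -
    have "of_nat N * a0 < of_nat N * 1" using a0 \<open>N > 0\<close> by (intro mult_strict_left_mono) auto
    then have "of_int c < (of_int (int N) :: rat)" using c by simp
    then show ?thesis by (simp only: of_int_less_iff)
  qed
  ultimately have "quasi_poly_pos (\<lambda>x. of_nat (card (orthant_sols J Q' (\<lambda>_. 0) l (int N * x - c))))"
    by (rule quasi_poly_pos_affine)
  moreover have "orthant_sols J Q' (\<lambda>_. 0) l (int N * x - c) =
      {n. (\<forall>j\<in>J. 0 \<le> n j) \<and> (\<forall>j. j \<notin> J \<longrightarrow> n j = 0) \<and>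
        (\<forall>q\<in>Q. (\<Sum>j\<in>J. q j * of_int (n j)) = (of_int x - a0) * \<beta> q)}" for x
  proof -
    have deg: "(\<Sum>j\<in>J. l j * n j) = int N * x - c \<longleftrightarrow> (\<Sum>j\<in>J. \<phi> j * of_int (n j)) = of_int x - a0" for n
    proof -
      have "(\<Sum>j\<in>J. l j * n j) = int N * x - c \<longleftrightarrow>
          (of_int (\<Sum>j\<in>J. l j * n j) :: rat) = of_int (int N * x - c)"
        by (simp only: of_int_eq_iff)
      also have "\<dots> \<longleftrightarrow> of_nat N * (\<Sum>j\<in>J. \<phi> j * of_int (n j)) = of_nat N * (of_int x - a0)"
        unfolding l_sum[symmetric] by (simp add: c right_diff_distrib)
      finally show ?thesis using \<open>N > 0\<close> by simp
    qed
    have "(\<Sum>j\<in>J. \<phi> j * of_int (n j)) = of_int x - a0"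
      if "\<forall>q\<in>Q. (\<Sum>j\<in>J. q j * of_int (n j)) = (of_int x - a0) * \<beta> q" for n
    proof -
      have "(\<Sum>j\<in>J. \<phi> j * of_int (n j)) = (\<Sum>j\<in>J. q0 j * of_int (n j)) / \<beta> q0"
        by (simp add: \<phi>_def sum_divide_distrib)
      then show ?thesis using that q0 by simp
    qed
    then show ?thesis
      unfolding orthant_sols_def eqs deg by auto
  qed
  ultimately show ?thesis by simp
qed

text \<open>A periodic function is a quasi-polynomial of degree 0, and a period of length
  \<open>b + 1\<close> leaves the values up to \<open>b\<close> arbitrary.\<close>

lemma quasi_polynomial_finite_values:
  "\<exists>q. quasi_polynomial q \<and> (\<forall>x::nat. 0 < x \<and> x \<le> b \<longrightarrow> q (int x) = h x)"
proof -
  define q where "q x = h (nat (x mod int (Suc b)))" for x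
  have "quasi_polynomial q"
    unfolding quasi_polynomial_def
    by (intro exI[of _ 0] exI[of _ "\<lambda>_. q"] conjI allI impI exI[of _ "int (Suc b)"])
       (auto simp: q_def)
  moreover have "q (int x) = h x" if "x \<le> b" for x
    using that by (simp add: q_def flip: of_nat_mod)
  ultimately show ?thesis by blast
qed

section \<open>Quotients of left modules\<close>

definition module_epi ::
    "('a, 'm) ring_scheme \<Rightarrow> ('a, 'b, 'c) module_scheme \<Rightarrow> ('a, 'd, 'e) module_scheme \<Rightarrow>
      ('b \<Rightarrow> 'd) \<Rightarrow> bool" where
  "module_epi R M N h \<longleftrightarrow>
     h ` carrier M = carrier N \<and>
     (\<forall>x\<in>carrier M. \<forall>y\<in>carrier M. h (x \<oplus>\<^bsub>M\<^esub> y) = h x \<oplus>\<^bsub>N\<^esub> h y) \<and>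
     (\<forall>a\<in>carrier R. \<forall>x\<in>carrier M. h (a \<odot>\<^bsub>M\<^esub> x) = a \<odot>\<^bsub>N\<^esub> h x) \<and>
     h \<zero>\<^bsub>M\<^esub> = \<zero>\<^bsub>N\<^esub>"

lemma module_epi_comp:
  assumes "module_epi R M N h" "module_epi R N K g"
  shows "module_epi R M K (g \<circ> h)"
proof -
  have "h x \<in> carrier N" if "x \<in> carrier M" for x
    using assms(1) that unfolding module_epi_def by blast
  moreover have "(g \<circ> h) ` carrier M = carrier K"
    using assms unfolding module_epi_def by (metis image_comp)
  ultimately show ?thesis using assms unfolding module_epi_def by simp
qed

lemma left_module_epi:
  assumes M: "left_module R M" and h: "module_epi R M N h"
  shows "left_module R N"
proof -
  interpret left_module R M by fact
  have car: "carrier N = h ` carrier M" and add: "\<And>x y. \<lbrakk>x \<in> carrier M; y \<in> carrier M\<rbrakk> \<Longrightarrow> h x \<oplus>\<^bsub>N\<^esub> h y = h (x \<oplus>\<^bsub>M\<^esub> y)"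
    and sm: "\<And>a x. \<lbrakk>a \<in> carrier R; x \<in> carrier M\<rbrakk> \<Longrightarrow> a \<odot>\<^bsub>N\<^esub> h x = h (a \<odot>\<^bsub>M\<^esub> x)" and z: "\<zero>\<^bsub>N\<^esub> = h \<zero>\<^bsub>M\<^esub>"
    using h by (auto simp: module_epi_def)
  have "abelian_group N"
  proof (rule abelian_groupI)
    fix x assume "x \<in> carrier N"
    then obtain x' where x': "x' \<in> carrier M" "x = h x'" by (auto simp: car)
    then show "\<exists>y\<in>carrier N. y \<oplus>\<^bsub>N\<^esub> x = \<zero>\<^bsub>N\<^esub>"
      by (intro bexI[of _ "h (\<ominus>\<^bsub>M\<^esub> x')"]) (auto simp: car add z M.l_neg)
  qed (auto simp: car add z M.a_ac)
  then show ?thesis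
    by (intro left_module.intro left_module_axioms.intro)
      (auto simp: car add sm smult_closed smult_l_distr smult_r_distr smult_assoc smult_one
        R.ring_axioms)
qed

lemma (in left_module) submodule_iff:
  "submodule H R M \<longleftrightarrow> H \<subseteq> carrier M \<and> \<zero>\<^bsub>M\<^esub> \<in> H \<and> (\<forall>x\<in>H. \<forall>y\<in>H. x \<oplus>\<^bsub>M\<^esub> y \<in> H) \<and>
     (\<forall>a\<in>carrier R. \<forall>x\<in>H. a \<odot>\<^bsub>M\<^esub> x \<in> H)"
proof
  assume "submodule H R M"
  then interpret submodule H R M .
  show "H \<subseteq> carrier M \<and> \<zero>\<^bsub>M\<^esub> \<in> H \<and> (\<forall>x\<in>H. \<forall>y\<in>H. x \<oplus>\<^bsub>M\<^esub> y \<in> H) \<and>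
     (\<forall>a\<in>carrier R. \<forall>x\<in>H. a \<odot>\<^bsub>M\<^esub> x \<in> H)"
    using subset one_closed m_closed by auto
next
  assume H: "H \<subseteq> carrier M \<and> \<zero>\<^bsub>M\<^esub> \<in> H \<and> (\<forall>x\<in>H. \<forall>y\<in>H. x \<oplus>\<^bsub>M\<^esub> y \<in> H) \<and>
     (\<forall>a\<in>carrier R. \<forall>x\<in>H. a \<odot>\<^bsub>M\<^esub> x \<in> H)"
  have zero: "\<zero> \<odot>\<^bsub>M\<^esub> x = \<zero>\<^bsub>M\<^esub>" if "x \<in> carrier M" for x
  proof -
    have "\<zero> \<odot>\<^bsub>M\<^esub> x \<oplus>\<^bsub>M\<^esub> \<zero> \<odot>\<^bsub>M\<^esub> x = \<zero> \<odot>\<^bsub>M\<^esub> x"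
      using smult_l_distr[of \<zero> \<zero> x] that by simp
    then show ?thesis
      using that by (metis M.add.l_cancel_one R.zero_closed smult_closed)
  qed
  have neg: "\<ominus>\<^bsub>M\<^esub> x \<in> H" if "x \<in> H" for x
  proof -
    have x: "x \<in> carrier M" using that H by blast
    have "(\<ominus> \<one>) \<odot>\<^bsub>M\<^esub> x \<oplus>\<^bsub>M\<^esub> x = \<zero>\<^bsub>M\<^esub>"
      using smult_l_distr[of "\<ominus> \<one>" \<one> x] x by (simp add: smult_one zero R.l_neg)
    then have "\<ominus>\<^bsub>M\<^esub> x = (\<ominus> \<one>) \<odot>\<^bsub>M\<^esub> x"
      using x smult_closed[of "\<ominus> \<one>" x] by (simp add: M.minus_equality)
    then show ?thesis using H that by simp
  qed
  have "subgroup H (add_monoid M)"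
    by (rule subgroup.intro) (use H neg in \<open>auto simp: a_inv_def\<close>)
  then show "submodule H R M"
    by (rule submodule.intro) (use H in \<open>simp add: submodule_axioms_def\<close>)
qed

lemma submodule_vimage:
  assumes M: "left_module R M" and h: "module_epi R M N h" and K: "submodule K R N"
  shows "submodule {x \<in> carrier M. h x \<in> K} R M"
proof -
  interpret left_module R M by fact
  show ?thesis
    using K h left_module.submodule_iff[OF left_module_epi[OF M h]]
    unfolding submodule_iff module_epi_def by (auto simp: smult_closed)
qed

lemma submodule_image:
  assumes M: "left_module R M" and h: "module_epi R M N h" and K: "submodule K R M"
  shows "submodule (h ` K) R N"
proof -
  interpret left_module R M by fact
  interpret N: left_module R N by (rule left_module_epi[OF M h])
  have K': "K \<subseteq> carrier M" "\<zero>\<^bsub>M\<^esub> \<in> K" "\<And>x y. \<lbrakk>x \<in> K; y \<in> K\<rbrakk> \<Longrightarrow> x \<oplus>\<^bsub>M\<^esub> y \<in> K"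
    "\<And>a x. \<lbrakk>a \<in> carrier R; x \<in> K\<rbrakk> \<Longrightarrow> a \<odot>\<^bsub>M\<^esub> x \<in> K"
    using K unfolding submodule_iff by auto
  have h': "h ` carrier M = carrier N" "\<And>x y. \<lbrakk>x \<in> carrier M; y \<in> carrier M\<rbrakk> \<Longrightarrow> h x \<oplus>\<^bsub>N\<^esub> h y = h (x \<oplus>\<^bsub>M\<^esub> y)"
     "\<And>a x. \<lbrakk>a \<in> carrier R; x \<in> carrier M\<rbrakk> \<Longrightarrow> a \<odot>\<^bsub>N\<^esub> h x = h (a \<odot>\<^bsub>M\<^esub> x)" "\<zero>\<^bsub>N\<^esub> = h \<zero>\<^bsub>M\<^esub>"
    using h by (auto simp: module_epi_def)
  show ?thesis
    unfolding N.submodule_iff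
  proof (intro conjI ballI)
    show "h ` K \<subseteq> carrier N" using K'(1) h'(1) by blast
    show "\<zero>\<^bsub>N\<^esub> \<in> h ` K" using K'(2) h'(4) by simp
  next
    fix x y assume "x \<in> h ` K" "y \<in> h ` K"
    then obtain x' y' where "x' \<in> K" "y' \<in> K" "x = h x'" "y = h y'" by blast
    then show "x \<oplus>\<^bsub>N\<^esub> y \<in> h ` K" using h'(2)[of x' y'] K' by blast
  next
    fix a x assume a: "a \<in> carrier R" and "x \<in> h ` K"
    then obtain x' where "x' \<in> K" "x = h x'" by blast
    then show "a \<odot>\<^bsub>N\<^esub> x \<in> h ` K" using h'(3)[OF a, of x'] K' a by blast
  qed
qed

lemma quotient_module_epi:
  assumes M: "left_module R M" and N: "submodule N R M"
  shows "module_epi R M (quotient_module M N) (\<lambda>x. N +>\<^bsub>M\<^esub> x)"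
    and "x \<in> carrier M \<Longrightarrow> N +>\<^bsub>M\<^esub> x = \<zero>\<^bsub>quotient_module M N\<^esub> \<longleftrightarrow> x \<in> N"
proof -
  interpret left_module R M by fact
  interpret N: submodule N R M by fact
  have sub: "subgroup N (add_monoid M)" by (rule N.subgroup_axioms)
  interpret Q: abelian_subgroup N M
    by (rule abelian_subgroupI3[OF additive_subgroup.intro[OF sub] M.abelian_group_axioms])
  have sm: "(\<Union>z\<in>N +>\<^bsub>M\<^esub> x. N +>\<^bsub>M\<^esub> (a \<odot>\<^bsub>M\<^esub> z)) = N +>\<^bsub>M\<^esub> (a \<odot>\<^bsub>M\<^esub> x)"
    if a: "a \<in> carrier R" and x: "x \<in> carrier M" for a x
  proof -
    have "N +>\<^bsub>M\<^esub> (a \<odot>\<^bsub>M\<^esub> z) = N +>\<^bsub>M\<^esub> (a \<odot>\<^bsub>M\<^esub> x)" if "z \<in> N +>\<^bsub>M\<^esub> x" for z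
    proof -
      from that obtain n where n: "n \<in> N" "z = n \<oplus>\<^bsub>M\<^esub> x"
        by (auto simp: a_r_coset_def')
      have nc: "n \<in> carrier M" using n N.subset by auto
      have "a \<odot>\<^bsub>M\<^esub> z = a \<odot>\<^bsub>M\<^esub> n \<oplus>\<^bsub>M\<^esub> a \<odot>\<^bsub>M\<^esub> x" using n nc a x by (simp add: smult_r_distr)
      then have "a \<odot>\<^bsub>M\<^esub> z \<in> N +>\<^bsub>M\<^esub> (a \<odot>\<^bsub>M\<^esub> x)"
        using N.smult_closed[OF a n(1)] by (auto simp: a_r_coset_def')
      then show ?thesis
        using M.a_repr_independence[OF _ _ sub] smult_closed[OF a x] by blast
    qed
    moreover have "x \<in> N +>\<^bsub>M\<^esub> x" using x Q.a_rcos_self by blast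
    ultimately show ?thesis by blast
  qed
  have zero: "N +>\<^bsub>M\<^esub> \<zero>\<^bsub>M\<^esub> = N" using N.subset by (auto simp: a_r_coset_def' subset_iff)
  show "module_epi R M (quotient_module M N) (\<lambda>x. N +>\<^bsub>M\<^esub> x)"
    unfolding module_epi_def quotient_module_def
    by (auto simp: sm Q.a_rcos_sum zero A_RCOSETS_def' )
  show "N +>\<^bsub>M\<^esub> x = \<zero>\<^bsub>quotient_module M N\<^esub> \<longleftrightarrow> x \<in> N" if "x \<in> carrier M" 
    using that zero by (metis Q.a_rcos_const Q.a_rcos_self quotient_module_def ring.simps(1))
qed

text \<open>Correspondence theorem: the submodules of \<open>N\<close> are the images of the
  submodules of \<open>M\<close> that contain the kernel \<open>P\<close>, so simplicity of
  \<open>N\<close> becomes maximality of \<open>P\<close>. Thus simplicity of iterated quotients can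
  be tested on left ideals of the ring.\<close>

lemma simple_left_module_iff:
  assumes M: "left_module R M" and h: "module_epi R M N h"
    and P: "P = {x \<in> carrier M. h x = \<zero>\<^bsub>N\<^esub>}"
  shows "simple_left_module R N \<longleftrightarrow>
    P \<noteq> carrier M \<and> (\<forall>Q. submodule Q R M \<and> P \<subseteq> Q \<longrightarrow> Q = P \<or> Q = carrier M)"
proof -
  interpret left_module R M by fact
  interpret N: left_module R N by (rule left_module_epi[OF M h])
  have h': "h ` carrier M = carrier N" "\<And>x y. \<lbrakk>x \<in> carrier M; y \<in> carrier M\<rbrakk> \<Longrightarrow> h (x \<oplus>\<^bsub>M\<^esub> y) = h x \<oplus>\<^bsub>N\<^esub> h y"
     "h \<zero>\<^bsub>M\<^esub> = \<zero>\<^bsub>N\<^esub>"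
    using h by (auto simp: module_epi_def)
  have neg: "h (\<ominus>\<^bsub>M\<^esub> x) = \<ominus>\<^bsub>N\<^esub> h x" if "x \<in> carrier M" for x
  proof -
    have "h (\<ominus>\<^bsub>M\<^esub> x) \<oplus>\<^bsub>N\<^esub> h x = \<zero>\<^bsub>N\<^esub>" using that h' by (metis M.add.inv_closed M.l_neg)
    then show ?thesis using that h'(1) by (metis M.add.inv_closed N.minus_equality imageI)
  qed
  have im: "carrier N \<noteq> {\<zero>\<^bsub>N\<^esub>} \<longleftrightarrow> P \<noteq> carrier M"
    unfolding P h'(1)[symmetric] using h'(3) by force
  have vi: "{x \<in> carrier M. h x \<in> h ` Q} = Q" if Q: "submodule Q R M" "P \<subseteq> Q" for Q
  proof (intro Set.set_eqI iffI)
    fix x assume "x \<in> {x \<in> carrier M. h x \<in> h ` Q}"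
    then obtain y where x: "x \<in> carrier M" and y: "y \<in> Q" "h x = h y" by blast
    have Q': "Q \<subseteq> carrier M" "\<And>x y. \<lbrakk>x \<in> Q; y \<in> Q\<rbrakk> \<Longrightarrow> x \<oplus>\<^bsub>M\<^esub> y \<in> Q" using Q submodule_iff by auto
    have yc: "y \<in> carrier M" using y Q' by blast
    have "h (x \<oplus>\<^bsub>M\<^esub> \<ominus>\<^bsub>M\<^esub> y) = \<zero>\<^bsub>N\<^esub>"
      using x yc y h' neg by (metis M.add.inv_closed N.r_neg imageI)
    then have "x \<oplus>\<^bsub>M\<^esub> \<ominus>\<^bsub>M\<^esub> y \<in> Q" using x yc Q(2) by (auto simp: P)
    from Q'(2)[OF this y(1)] show "x \<in> Q" using x yc by (simp add: M.a_assoc M.l_neg)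
  qed (use Q submodule_iff in auto)
  have "(\<forall>K. submodule K R N \<longrightarrow> K = {\<zero>\<^bsub>N\<^esub>} \<or> K = carrier N) \<longleftrightarrow>
      (\<forall>Q. submodule Q R M \<and> P \<subseteq> Q \<longrightarrow> Q = P \<or> Q = carrier M)" (is "?A \<longleftrightarrow> ?B")
  proof
    assume A: ?A
    show ?B
    proof (intro allI impI, elim conjE)
      fix Q assume Q: "submodule Q R M" "P \<subseteq> Q"
      have "h ` Q = {\<zero>\<^bsub>N\<^esub>} \<or> h ` Q = carrier N" using A submodule_image[OF M h Q(1)] by blast
      then show "Q = P \<or> Q = carrier M"
      proof
        assume "h ` Q = {\<zero>\<^bsub>N\<^esub>}"
        then show ?thesis using vi[OF Q] by (simp add: P)
      next
        assume "h ` Q = carrier N"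
        moreover have "{x \<in> carrier M. h x \<in> carrier N} = carrier M" using h'(1) by blast
        ultimately show ?thesis using vi[OF Q] by simp
      qed
    qed
  next
    assume B: ?B
    show ?A
    proof (intro allI impI)
      fix K assume K: "submodule K R N"
      let ?Q = "{x \<in> carrier M. h x \<in> K}"
      have K': "K \<subseteq> carrier N" "\<zero>\<^bsub>N\<^esub> \<in> K" using K N.submodule_iff by auto
      then have "P \<subseteq> ?Q" by (auto simp: P)
      then have "?Q = P \<or> ?Q = carrier M" using B submodule_vimage[OF M h K] by blast
      then show "K = {\<zero>\<^bsub>N\<^esub>} \<or> K = carrier N"
      proof
        assume "?Q = P"
        then have "y = \<zero>\<^bsub>N\<^esub>" if "y \<in> K" for y
          using that K'(1) h'(1) unfolding P by (smt (verit, best) image_iff mem_Collect_eq subsetD)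
        then show ?thesis using K'(2) by blast
      next
        assume "?Q = carrier M"
        then have "h ` carrier M \<subseteq> K" by blast
        then show ?thesis using K'(1) h'(1) by blast
      qed
    qed
  qed
  then show ?thesis
    unfolding simple_left_module_def using im N.left_module_axioms by blast
qed

lemma (in ring) left_module_left_regular: "left_module R (left_regular R)"
proof -
  have "abelian_group (left_regular R)"
    by (rule abelian_groupI)
      (auto simp: left_regular_def a_ac intro: bexI[of _ "\<ominus> x" for x] l_neg)
  then show ?thesis
    by (intro left_module.intro left_module_axioms.intro)
      (auto simp: left_regular_def l_distr r_distr m_assoc ring_axioms)
qed

lemma (in ring) left_ideal_iff:
  "left_ideal I R \<longleftrightarrow> I \<subseteq> carrier R \<and> \<zero> \<in> I \<and> (\<forall>x\<in>I. \<forall>y\<in>I. x \<oplus> y \<in> I) \<and>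
     (\<forall>a\<in>carrier R. \<forall>x\<in>I. a \<otimes> x \<in> I)"
  unfolding left_ideal_def left_module.submodule_iff[OF left_module_left_regular]
  by (simp add: left_regular_def)

text \<open>\<open>P\<close> is the largest proper left ideal above \<open>N\<close>, so its image
  is the only maximal submodule of the quotient by \<open>N\<close>, and the description in
  \<open>unique_simple_quotient\<close> picks it. An element annihilates the quotient by
  \<open>P\<close> if and only if it maps the whole ring into \<open>P\<close>.\<close>

lemma (in ring) annihilator_unique_simple_quotient:
  assumes N: "left_ideal N R" and P: "left_ideal P R" "N \<subseteq> P" "P \<noteq> carrier R"
    and max: "\<And>Q. \<lbrakk>left_ideal Q R; N \<subseteq> Q; Q \<noteq> carrier R\<rbrakk> \<Longrightarrow> Q \<subseteq> P"
  shows "annihilator R (unique_simple_quotient R (quotient_module (left_regular R) N)) =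
    {a \<in> carrier R. \<forall>b\<in>carrier R. a \<otimes> b \<in> P}"
proof -
  let ?L = "left_regular R"
  note L = left_module_left_regular
  have [simp]: "carrier ?L = carrier R" by (simp add: left_regular_def)
  let ?M = "quotient_module ?L N"
  define p where "p = (\<lambda>x. N +>\<^bsub>?L\<^esub> x)"
  have subN: "submodule N R ?L" using N by (simp add: left_ideal_def)
  have p: "module_epi R ?L ?M p" "\<And>x. x \<in> carrier R \<Longrightarrow> p x = \<zero>\<^bsub>?M\<^esub> \<longleftrightarrow> x \<in> N"
    using quotient_module_epi[OF L subN] by (auto simp: p_def)
  have M: "left_module R ?M" by (rule left_module_epi[OF L p(1)])
  interpret M: left_module R ?M by (rule M)
  define \<pi> where "\<pi> K = (\<lambda>x. K +>\<^bsub>?M\<^esub> p x)" for K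
  have \<pi>: "module_epi R ?L (quotient_module ?M K) (\<pi> K)"
    "{x \<in> carrier ?L. \<pi> K x = \<zero>\<^bsub>quotient_module ?M K\<^esub>} = {x \<in> carrier R. p x \<in> K}"
    if "submodule K R ?M" for K
  proof -
    show "module_epi R ?L (quotient_module ?M K) (\<pi> K)"
      using module_epi_comp[OF p(1) quotient_module_epi(1)[OF M that]] by (simp add: \<pi>_def comp_def)
    show "{x \<in> carrier ?L. \<pi> K x = \<zero>\<^bsub>quotient_module ?M K\<^esub>} = {x \<in> carrier R. p x \<in> K}"
    proof -
      have "p x \<in> carrier ?M" if "x \<in> carrier R" for x
        using p(1) that unfolding module_epi_def by auto
      then show ?thesis
        using quotient_module_epi(2)[OF M that] by (auto simp: \<pi>_def)
    qed
  qed
  have maxP: "Q = P \<or> Q = carrier R" if "left_ideal Q R" "P \<subseteq> Q" for Q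
    using max[OF that(1)] that(2) P(2) by blast
  have simple: "simple_left_module R (quotient_module ?M K) \<longleftrightarrow> {x \<in> carrier R. p x \<in> K} = P"
    if K: "submodule K R ?M" for K
  proof -
    let ?Q = "{x \<in> carrier R. p x \<in> K}"
    have Q: "left_ideal ?Q R"
      using submodule_vimage[OF L p(1) K] by (simp add: left_ideal_def)
    have "\<zero>\<^bsub>?M\<^esub> \<in> K" using K M.submodule_iff by blast
    then have "p x \<in> K" if "x \<in> N" for x using p(2)[of x] that N left_ideal_iff by auto
    then have NQ: "N \<subseteq> ?Q" using N left_ideal_iff by auto
    show ?thesis
      unfolding simple_left_module_iff[OF L \<pi>(1)[OF K] refl] \<pi>(2)[OF K]
      using max[OF Q NQ] maxP P Q by (auto simp flip: left_ideal_def)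
  qed
  have subP: "submodule P R ?L" using P by (simp add: left_ideal_def)
  have subK: "submodule (p ` P) R ?M" by (rule submodule_image[OF L p(1) subP])
  have Pc: "P \<subseteq> carrier R" and Padd: "\<And>x y. \<lbrakk>x \<in> P; y \<in> P\<rbrakk> \<Longrightarrow> x \<oplus> y \<in> P"
    and Pmult: "\<And>a x. \<lbrakk>a \<in> carrier R; x \<in> P\<rbrakk> \<Longrightarrow> a \<otimes> x \<in> P" and N0: "\<zero> \<in> N"
    using P(1)[unfolded left_ideal_iff] N[unfolded left_ideal_iff] by blast+
  have padd: "p (x \<oplus> y) = p x \<oplus>\<^bsub>?M\<^esub> p y" if "x \<in> carrier R" "y \<in> carrier R" for x y
    using p(1) that unfolding module_epi_def by (simp add: left_regular_def)
  \<comment> \<open>By maximality of \<open>P\<close> the preimage of its image only has to be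
    proper. If it were everything, 1 would differ by an element of \<open>N\<close> from an element
    of \<open>P\<close> and so lie in \<open>P\<close>.\<close>
  have vim: "{x \<in> carrier R. p x \<in> p ` P} = P"
  proof -
    let ?Q = "{x \<in> carrier R. p x \<in> p ` P}"
    have "left_ideal ?Q R"
      using submodule_vimage[OF L p(1) subK] by (simp add: left_ideal_def)
    moreover have "P \<subseteq> ?Q" using Pc by blast
    moreover have "?Q \<noteq> carrier R"
    proof
      assume "?Q = carrier R"
      then have "\<one> \<in> ?Q" by simp
      then obtain y where y: "y \<in> P" "p \<one> = p y" by auto
      have yc: "y \<in> carrier R" using y(1) Pc by blast
      have m: "(\<ominus> \<one>) \<otimes> y \<in> carrier R" using yc by simp
      have "p (\<one> \<oplus> (\<ominus> \<one>) \<otimes> y) = p (y \<oplus> (\<ominus> \<one>) \<otimes> y)"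
        using padd[OF one_closed m] padd[OF yc m] y(2) by simp
      also have "y \<oplus> (\<ominus> \<one>) \<otimes> y = \<zero>" using yc by (simp add: l_minus r_neg)
      finally have "\<one> \<oplus> (\<ominus> \<one>) \<otimes> y \<in> N" using p(2)[of "\<one> \<oplus> (\<ominus> \<one>) \<otimes> y"] p(2)[of \<zero>] N0 m by simp
      then have "(\<one> \<oplus> (\<ominus> \<one>) \<otimes> y) \<oplus> y \<in> P" using P(2) Padd y(1) by blast
      then have "\<one> \<in> P" using yc by (simp add: l_minus a_assoc l_neg)
      then have "a \<in> P" if "a \<in> carrier R" for a using Pmult[OF that] that by fastforce
      then show False using Pc P(3) by blast
    qed
    ultimately show ?thesis using maxP by blast
  qed
  have the: "(THE K. submodule K R ?M \<and> simple_left_module R (quotient_module ?M K)) = p ` P"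
  proof (rule the_equality)
    show "submodule (p ` P) R ?M \<and> simple_left_module R (quotient_module ?M (p ` P))"
      using subK simple[OF subK] vim by simp
  next
    fix K assume K: "submodule K R ?M \<and> simple_left_module R (quotient_module ?M K)"
    then have "{x \<in> carrier R. p x \<in> K} = P" using simple by blast
    moreover have "K \<subseteq> p ` carrier R"
      using K M.submodule_iff p(1) by (auto simp: module_epi_def)
    ultimately show "K = p ` P" by blast
  qed
  have epi: "module_epi R ?L (quotient_module ?M (p ` P)) (\<pi> (p ` P))" by (rule \<pi>(1)[OF subK])
  have ker: "\<pi> (p ` P) x = \<zero>\<^bsub>quotient_module ?M (p ` P)\<^esub> \<longleftrightarrow> x \<in> P" if "x \<in> carrier R" for x
    using \<pi>(2)[OF subK] vim that by auto
  have "a \<odot>\<^bsub>quotient_module ?M (p ` P)\<^esub> \<pi> (p ` P) b = \<pi> (p ` P) (a \<otimes> b)"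
    if "a \<in> carrier R" "b \<in> carrier R" for a b
    using epi that unfolding module_epi_def by (auto simp: left_regular_def)
  moreover have "carrier (quotient_module ?M (p ` P)) = \<pi> (p ` P) ` carrier R"
    using epi unfolding module_epi_def by simp
  ultimately show ?thesis
    unfolding unique_simple_quotient_def the annihilator_def
    by (intro Collect_cong conj_cong refl) (simp add: ker)
qed

section \<open>The action of the free algebra on functions of a weight\<close>

fun gen_index :: "gen \<Rightarrow> nat" where
  "gen_index (Var i) = i" | "gen_index (VarInv i) = i" | "gen_index (Der i) = i"

fun gen_sign :: "gen \<Rightarrow> int" where
  "gen_sign (Var i) = 1" | "gen_sign (VarInv i) = -1" | "gen_sign (Der i) = -1"

definition gen_weight :: "gen \<Rightarrow> nat \<Rightarrow> int" where
  "gen_weight l = (\<lambda>j. if j = gen_index l then gen_sign l else 0)"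

fun gen_coeff :: "(nat \<Rightarrow> 'k::field_char_0) \<Rightarrow> gen \<Rightarrow> (nat \<Rightarrow> int) \<Rightarrow> 'k" where
  "gen_coeff \<alpha> (Der i) b = \<alpha> i + of_int (b i)"
| "gen_coeff \<alpha> (Var i) b = 1"
| "gen_coeff \<alpha> (VarInv i) b = 1"

fun word_weight :: "gen list \<Rightarrow> nat \<Rightarrow> int" where
  "word_weight [] = 0"
| "word_weight (l # w) = gen_weight l + word_weight w"

text \<open>Words are operators, so \<open>w\<close> acts before \<open>l\<close>; hence
  \<open>l\<close> is evaluated at the weight shifted by \<open>w\<close>.\<close>

fun word_coeff :: "(nat \<Rightarrow> 'k::field_char_0) \<Rightarrow> gen list \<Rightarrow> (nat \<Rightarrow> int) \<Rightarrow> 'k" where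
  "word_coeff \<alpha> [] b = 1"
| "word_coeff \<alpha> (l # w) b = gen_coeff \<alpha> l (b + word_weight w) * word_coeff \<alpha> w b"

lemma word_weight_append: "word_weight (v @ w) = word_weight v + word_weight w"
  by (induction v) (simp_all add: add.assoc)

lemma word_coeff_append:
  fixes b :: "nat \<Rightarrow> int"
  shows "word_coeff \<alpha> (v @ w) b = word_coeff \<alpha> v (b + word_weight w) * word_coeff \<alpha> w b"
proof (induction v)
  case (Cons l v)
  have "b + (word_weight v + word_weight w) = b + word_weight w + word_weight v"
    by (simp only: add.assoc add.commute add.left_commute)
  then show ?case
    unfolding append_Cons word_coeff.simps word_weight_append Cons.IH by (simp only: mult.assoc)
qed simp

text \<open>The word \<open>w\<close> maps the monomial \<open>x\<^sup>\<alpha>\<^sup>+\<^sup>b\<close> to \<open>word_coeff \<alpha> w b\<close> times \<open>x\<^sup>\<alpha>\<^sup>+\<^sup>b\<^sup>+\<^sup>wt(w)\<close>; \<open>act\<close> is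
  the transposed action on functions of \<open>b\<close>, hence an anti-representation.\<close>

definition act ::
    "(nat \<Rightarrow> 'k::field_char_0) \<Rightarrow> 'k free \<Rightarrow> ((nat \<Rightarrow> int) \<Rightarrow> 'k) \<Rightarrow> (nat \<Rightarrow> int) \<Rightarrow> 'k" where
  "act \<alpha> p g b = (\<Sum>w\<in>Poly_Mapping.keys p.
     Poly_Mapping.lookup p w * word_coeff \<alpha> (letters w) b * g (b + word_weight (letters w)))"

lemma act_superset:
  fixes b :: "nat \<Rightarrow> int"
  assumes "finite A" "Poly_Mapping.keys p \<subseteq> A"
  shows "act \<alpha> p g b = (\<Sum>w\<in>A.
     Poly_Mapping.lookup p w * word_coeff \<alpha> (letters w) b * g (b + word_weight (letters w)))"
  unfolding act_def using assms
  by (intro sum.mono_neutral_left) (auto simp: in_keys_iff)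

lemma act_0 [simp]: "act \<alpha> 0 g b = 0"
  by (simp add: act_def)

lemma act_add: "act \<alpha> (p + q) g b = act \<alpha> p g b + act \<alpha> q g b"
proof -
  let ?A = "Poly_Mapping.keys p \<union> Poly_Mapping.keys q"
  have "Poly_Mapping.keys (p + q) \<subseteq> ?A" by (rule keys_add)
  then show ?thesis
    by (simp add: act_superset[of ?A] lookup_add algebra_simps sum.distrib)
qed

lemma act_uminus: "act \<alpha> (- p) g b = - act \<alpha> p g b"
  by (simp add: act_def sum_negf)

lemma act_diff: "act \<alpha> (p - q) g b = act \<alpha> p g b - act \<alpha> q g b"
  using act_add[of \<alpha> p "- q"] act_uminus[of \<alpha> q] by simp

lemma act_sum: "act \<alpha> (sum f A) g b = (\<Sum>i\<in>A. act \<alpha> (f i) g b)"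
  by (induction A rule: infinite_finite_induct) (simp_all add: act_add)

lemma act_single:
  fixes b :: "nat \<Rightarrow> int"
  shows "act \<alpha> (Poly_Mapping.single w c) g b =
     c * word_coeff \<alpha> (letters w) b * g (b + word_weight (letters w))"
  by (cases "c = 0") (simp_all add: act_def)

lemma act_const: "act \<alpha> (Poly_Mapping.single 0 c) g b = c * g b"
  by (simp add: act_single zero_free_monoid_def add_0_right)

lemma act_1 [simp]: "act \<alpha> 1 g b = g b"
  using act_const[of \<alpha> 1] by simp

lemma poly_mapping_eq_sum_single:
  "p = (\<Sum>w\<in>Poly_Mapping.keys p. Poly_Mapping.single w (Poly_Mapping.lookup p w))"
  by (rule poly_mapping_eqI) (auto simp: lookup_sum lookup_single when_def in_keys_iff)

lemma act_decomp: "act \<alpha> p g b =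
    (\<Sum>w\<in>Poly_Mapping.keys p. act \<alpha> (Poly_Mapping.single w (Poly_Mapping.lookup p w)) g b)"
  unfolding act_single by (simp add: act_def)

lemma act_mult: "act \<alpha> (p * q) g b = act \<alpha> q (act \<alpha> p g) b"
proof -
  have ss: "act \<alpha> (Poly_Mapping.single v c * Poly_Mapping.single w d) g b =
      act \<alpha> (Poly_Mapping.single w d) (act \<alpha> (Poly_Mapping.single v c) g) b" for v w c d g b
  proof -
    have eq: "b + (word_weight (letters v) + word_weight (letters w)) =
        b + word_weight (letters w) + word_weight (letters v)"
      by (simp only: add.assoc add.commute add.left_commute)
    show ?thesis
      by (simp add: eq mult_single act_single plus_free_monoid_def word_coeff_append
          word_weight_append mult_ac)
  qed
  have sp: "act \<alpha> (p * Poly_Mapping.single w d) g b = act \<alpha> (Poly_Mapping.single w d) (act \<alpha> p g) b"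
    for w d
  proof -
    have "act \<alpha> (p * Poly_Mapping.single w d) g b = (\<Sum>v\<in>Poly_Mapping.keys p.
        act \<alpha> (Poly_Mapping.single v (Poly_Mapping.lookup p v) * Poly_Mapping.single w d) g b)"
      by (subst poly_mapping_eq_sum_single[of p]) (simp add: sum_distrib_right act_sum)
    also have "\<dots> = (\<Sum>v\<in>Poly_Mapping.keys p.
        act \<alpha> (Poly_Mapping.single w d) (act \<alpha> (Poly_Mapping.single v (Poly_Mapping.lookup p v)) g) b)"
      by (simp add: ss)
    also have "\<dots> = act \<alpha> (Poly_Mapping.single w d) (act \<alpha> p g) b"
      unfolding act_single[of _ w] act_decomp[of \<alpha> p] by (rule sum_distrib_left[symmetric])
    finally show ?thesis .
  qed
  have "act \<alpha> (p * q) g b = (\<Sum>w\<in>Poly_Mapping.keys q.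
      act \<alpha> (p * Poly_Mapping.single w (Poly_Mapping.lookup q w)) g b)"
    by (subst poly_mapping_eq_sum_single[of q]) (simp add: sum_distrib_left act_sum)
  also have "\<dots> = act \<alpha> q (act \<alpha> p g) b"
    unfolding sp by (rule act_decomp[symmetric])
  finally show ?thesis .
qed

lemma act_fun_add: "act \<alpha> p (\<lambda>b. g b + h b) b = act \<alpha> p g b + act \<alpha> p h b"
  by (simp add: act_def algebra_simps sum.distrib)

lemma act_fun_scale: "act \<alpha> p (\<lambda>b. c * g b) b = c * act \<alpha> p g b"
  by (simp add: act_def sum_distrib_left mult_ac)

lemma act_fun_zero: "act \<alpha> p (\<lambda>_. 0) b = 0"
  by (simp add: act_def)

lemma act_fun_sum: "act \<alpha> p (\<lambda>b. \<Sum>i\<in>A. g i b) b = (\<Sum>i\<in>A. act \<alpha> p (g i) b)"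
  by (induction A rule: infinite_finite_induct) (simp_all add: act_fun_add act_fun_zero)

lemma act_letter: fixes b :: "nat \<Rightarrow> int" shows "act \<alpha> (letter l) g b = gen_coeff \<alpha> l b * g (b + gen_weight l)"
  by (simp add: letter_def act_single add_0_right)

text \<open>A finite set of rows outside which column \<open>b\<close> vanishes; cancellation
  between words may produce further zeros inside it. It serves to write matrix products as finite
  sums.\<close>

definition targets :: "('k::zero) free \<Rightarrow> (nat \<Rightarrow> int) \<Rightarrow> (nat \<Rightarrow> int) set" where
  "targets p b = (\<lambda>w. b + word_weight (letters w)) ` Poly_Mapping.keys p"

lemma finite_targets: "finite (targets p b)"
  by (simp add: targets_def)

text \<open>The coefficient of \<open>x\<^sup>\<alpha>\<^sup>+\<^sup>b\<^sup>'\<close> in \<open>p x\<^sup>\<alpha>\<^sup>+\<^sup>b\<close>.\<close>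

definition entry :: "(nat \<Rightarrow> 'k::field_char_0) \<Rightarrow> 'k free \<Rightarrow> (nat \<Rightarrow> int) \<Rightarrow> (nat \<Rightarrow> int) \<Rightarrow> 'k" where
  "entry \<alpha> p b' b = act \<alpha> p (\<lambda>x. if x = b' then 1 else 0) b"

lemma act_eq_sum_entry:
  assumes "finite A" "targets p b \<subseteq> A"
  shows "act \<alpha> p g b = (\<Sum>b'\<in>A. entry \<alpha> p b' b * g b')"
proof -
  have "act \<alpha> p g b = act \<alpha> p (\<lambda>x. \<Sum>b'\<in>A. g b' * (if x = b' then 1 else 0)) b"
    unfolding act_def
  proof (intro sum.cong refl arg_cong2[of _ _ _ _ "(*)"])
    fix w assume "w \<in> Poly_Mapping.keys p"
    then have "b + word_weight (letters w) \<in> A" using assms(2) by (auto simp: targets_def)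
    then show "g (b + word_weight (letters w)) =
        (\<Sum>b'\<in>A. g b' * (if b + word_weight (letters w) = b' then 1 else 0))"
      using assms(1) by (simp add: if_distrib[of "(*) _"] cong: if_cong)
  qed
  also have "\<dots> = (\<Sum>b'\<in>A. entry \<alpha> p b' b * g b')"
    by (simp add: act_fun_sum act_fun_scale entry_def mult.commute)
  finally show ?thesis .
qed

lemma entry_eq_0:
  assumes "b' \<notin> targets p b"
  shows "entry \<alpha> p b' b = 0"
  unfolding entry_def act_def
  by (rule sum.neutral) (use assms in \<open>auto simp: targets_def\<close>)

lemma act_entry: "act \<alpha> p g b = (\<Sum>b'\<in>targets p b. entry \<alpha> p b' b * g b')"
  by (rule act_eq_sum_entry[OF finite_targets order_refl])

lemma entry_mult:
  "entry \<alpha> (p * q) b'' b = (\<Sum>b'\<in>targets q b. entry \<alpha> p b'' b' * entry \<alpha> q b' b)"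
  by (subst entry_def) (simp add: act_mult act_entry[of \<alpha> q] entry_def[of \<alpha> p] mult.commute)

lemma entry_0 [simp]: "entry \<alpha> 0 b' b = 0"
  by (simp add: entry_def)

lemma entry_add: "entry \<alpha> (p + q) b' b = entry \<alpha> p b' b + entry \<alpha> q b' b"
  by (simp add: entry_def act_add)

lemma entry_diff: "entry \<alpha> (p - q) b' b = entry \<alpha> p b' b - entry \<alpha> q b' b"
  by (simp add: entry_def act_diff)

lemma entry_sum: "entry \<alpha> (sum f A) b' b = (\<Sum>i\<in>A. entry \<alpha> (f i) b' b)"
  by (simp add: entry_def act_sum)

lemma entry_word:
  fixes b :: "nat \<Rightarrow> int"
  shows "entry \<alpha> (Poly_Mapping.single w c) b' b =
     (if b' = b + word_weight (letters w) then c * word_coeff \<alpha> (letters w) b else 0)"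
  by (auto simp: entry_def act_single)

section \<open>Polynomial functions of a weight\<close>

text \<open>Functions instead of formal polynomials, since only values at weights matter. The four
  rules parallel those of \<open>tpoly\<close>, whose elements realize these functions as diagonal
  operators.\<close>

inductive pfun :: "nat \<Rightarrow> ((nat \<Rightarrow> int) \<Rightarrow> 'k::field_char_0) \<Rightarrow> bool" for n where
  pfun_const: "pfun n (\<lambda>_. c)"
| pfun_coord: "i \<in> {1..n} \<Longrightarrow> pfun n (\<lambda>b. of_int (b i))"
| pfun_add: "\<lbrakk>pfun n f; pfun n g\<rbrakk> \<Longrightarrow> pfun n (\<lambda>b. f b + g b)"
| pfun_mult: "\<lbrakk>pfun n f; pfun n g\<rbrakk> \<Longrightarrow> pfun n (\<lambda>b. f b * g b)"

lemma pfun_sum: "(\<And>i. i \<in> A \<Longrightarrow> pfun n (f i)) \<Longrightarrow> pfun n (\<lambda>b. \<Sum>i\<in>A. f i b)"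
  by (induction A rule: infinite_finite_induct) (auto intro: pfun.intros)

lemma pfun_prod: "(\<And>i. i \<in> A \<Longrightarrow> pfun n (f i)) \<Longrightarrow> pfun n (\<lambda>b. \<Prod>i\<in>A. f i b)"
  by (induction A rule: infinite_finite_induct) (auto intro: pfun.intros)

lemma pfun_diff: "\<lbrakk>pfun n f; pfun n g\<rbrakk> \<Longrightarrow> pfun n (\<lambda>b. f b - g b)"
  using pfun_add[of n f "\<lambda>b. -1 * g b"] pfun_mult[OF pfun_const, of n g "-1"] by simp

lemma pfun_shift:
  fixes u :: "nat \<Rightarrow> int"
  assumes "pfun n f"
  shows "pfun n (\<lambda>b. f (b + u))"
  using assms
proof (induction rule: pfun.induct)
  case (pfun_coord i)
  then show ?case
    using pfun_add[OF pfun.pfun_coord[OF pfun_coord] pfun_const[of n "of_int (u i)"]] by simp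
qed (auto intro: pfun.intros)

lemma pfun_shift_diff: fixes u :: "nat \<Rightarrow> int" shows "pfun n f \<Longrightarrow> pfun n (\<lambda>b. f (b - u))"
  using pfun_shift[of n f "- u"] by simp

lemma pfun_word_coeff:
  assumes "set w \<subseteq> gens r s"
  shows "pfun (r + s) (word_coeff \<alpha> w)"
  using assms
proof (induction w)
  case Nil
  have "word_coeff \<alpha> [] = (\<lambda>_. 1)" by (rule ext) simp
  then show ?case by (simp add: pfun_const)
next
  case (Cons l w)
  have "pfun (r + s) (gen_coeff \<alpha> l)"
  proof (cases l)
    case (Der i)
    have "i \<in> {1..r+s}" using Cons.prems Der by (auto simp: gens_def)
    moreover have "gen_coeff \<alpha> l = (\<lambda>b. \<alpha> i + of_int (b i))" by (rule ext) (simp add: Der)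
    ultimately show ?thesis
      using pfun_add[OF pfun_const pfun_coord, of i "r + s" "\<alpha> i"] by simp
  next
    case (Var i)
    have "gen_coeff \<alpha> l = (\<lambda>_. 1)" by (rule ext) (simp add: Var)
    then show ?thesis by (simp add: pfun_const)
  next
    case (VarInv i)
    have "gen_coeff \<alpha> l = (\<lambda>_. 1)" by (rule ext) (simp add: VarInv)
    then show ?thesis by (simp add: pfun_const)
  qed
  then have "pfun (r + s) (\<lambda>b. gen_coeff \<alpha> l (b + word_weight w) * word_coeff \<alpha> w b)"
    using Cons by (intro pfun_mult pfun_shift) auto
  moreover have "word_coeff \<alpha> (l # w) = (\<lambda>b. gen_coeff \<alpha> l (b + word_weight w) * word_coeff \<alpha> w b)"
    by (rule ext) simp
  ultimately show ?case by simp
qed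

lemma pfun_entry:
  fixes u :: "nat \<Rightarrow> int"
  assumes "\<forall>w\<in>Poly_Mapping.keys p. set (letters w) \<subseteq> gens r s"
  shows "pfun (r + s) (\<lambda>b. entry \<alpha> p (b + u) b)"
proof -
  have "pfun (r + s) (\<lambda>b. Poly_Mapping.lookup p w * word_coeff \<alpha> (letters w) b *
      (if word_weight (letters w) = u then 1 else 0))" if "w \<in> Poly_Mapping.keys p" for w
    using assms that by (intro pfun_mult pfun_const pfun_word_coeff) auto
  then show ?thesis
    unfolding entry_def act_def by (intro pfun_sum) simp
qed

text \<open>The curve passes through \<open>x\<close> at \<open>t = 0\<close> and through
  \<open>x + y\<close> at \<open>t = 1\<close> whatever \<open>z\<close> is. This leaves
  \<open>z\<close> free to steer all its other integral points, while one-variable polynomials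
  decide about vanishing.\<close>

lemma pfun_curve:
  assumes "pfun n f"
  shows "\<exists>P. \<forall>t::int. f (\<lambda>i. x i + t * y i + t * (t - 1) * z i) = poly P (of_int t)"
  using assms
proof (induction rule: pfun.induct)
  case (pfun_const c)
  show ?case by (rule exI[of _ "[:c:]"]) simp
next
  case (pfun_coord i)
  show ?case
    by (rule exI[of _ "[:of_int (x i), of_int (y i) - of_int (z i), of_int (z i):]"])
      (simp add: algebra_simps)
next
  case (pfun_add f g)
  then obtain P Q where "\<forall>t::int. f (\<lambda>i. x i + t * y i + t * (t - 1) * z i) = poly P (of_int t)"
    "\<forall>t::int. g (\<lambda>i. x i + t * y i + t * (t - 1) * z i) = poly Q (of_int t)" by blast
  then show ?case by (intro exI[of _ "P + Q"]) simp
next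
  case (pfun_mult f g)
  then obtain P Q where "\<forall>t::int. f (\<lambda>i. x i + t * y i + t * (t - 1) * z i) = poly P (of_int t)"
    "\<forall>t::int. g (\<lambda>i. x i + t * y i + t * (t - 1) * z i) = poly Q (of_int t)" by blast
  then show ?case by (intro exI[of _ "P * Q"]) simp
qed

lemma poly_eq_0_if_almost_all_ints:
  fixes P :: "'k::field_char_0 poly"
  assumes "finite A" "\<And>t::int. t \<notin> A \<Longrightarrow> poly P (of_int t) = 0"
  shows "P = 0"
proof (rule ccontr)
  assume "P \<noteq> 0"
  then have "finite {x. poly P x = 0}" by (rule poly_roots_finite)
  moreover have "of_int ` (UNIV - A) \<subseteq> {x. poly P x = 0}" using assms(2) by auto
  ultimately have "finite ((of_int :: int \<Rightarrow> 'k) ` (UNIV - A))" by (rule finite_subset[rotated])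
  then have "finite (UNIV - A)" by (rule finite_imageD) (simp add: inj_on_def)
  then show False using assms(1) by (simp add: infinite_UNIV_int)
qed

section \<open>The Weyl algebra as a quotient of the free algebra\<close>

locale weyl_data =
  fixes r s :: nat and \<gg> :: "('k::field_char_0) weyl set" and \<alpha> :: "nat \<Rightarrow> rat"
begin

abbreviation ak :: "nat \<Rightarrow> 'k" where "ak i \<equiv> of_rat (\<alpha> i)"
abbreviation n :: nat where "n \<equiv> r + s"
abbreviation F :: "'k free ring" where "F \<equiv> free_alg r s"

definition I0 :: "'k free set" where "I0 = Idl\<^bsub>F\<^esub> (weyl_relations r s)"

abbreviation const :: "'k \<Rightarrow> 'k free" where "const c \<equiv> Poly_Mapping.single 0 c"
abbreviation word :: "gen list \<Rightarrow> 'k free" where "word w \<equiv> Poly_Mapping.single (Word w) 1"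

definition euler0 :: "nat \<Rightarrow> 'k free" where "euler0 i = letter (Var i) * letter (Der i)"

definition lin :: "(nat \<Rightarrow> 'k) \<Rightarrow> 'k free" where "lin c = (\<Sum>i=1..n. const (c i) * euler0 i)"

lemma carrier_F: "p \<in> carrier F \<longleftrightarrow> (\<forall>w\<in>Poly_Mapping.keys p. set (letters w) \<subseteq> gens r s)"
  by (simp add: free_alg_def)

lemma F_simps [simp]:
  "monoid.mult F = (*)" "add F = (+)" "one F = 1" "ring.zero F = 0"
  by (simp_all add: free_alg_def ring_of_type_algebra_def)

lemma F_closed [simp, intro]:
  "0 \<in> carrier F" "const c \<in> carrier F"
  "\<lbrakk>p \<in> carrier F; q \<in> carrier F\<rbrakk> \<Longrightarrow> p + q \<in> carrier F"
  "p \<in> carrier F \<Longrightarrow> - p \<in> carrier F"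
  "\<lbrakk>p \<in> carrier F; q \<in> carrier F\<rbrakk> \<Longrightarrow> p - q \<in> carrier F"
  "\<lbrakk>p \<in> carrier F; q \<in> carrier F\<rbrakk> \<Longrightarrow> p * q \<in> carrier F"
proof -
  show "0 \<in> carrier F" by (simp add: carrier_F)
  show "const c \<in> carrier F" by (auto simp: carrier_F zero_free_monoid_def)
  show "p + q \<in> carrier F" if "p \<in> carrier F" "q \<in> carrier F"
    using that keys_add[of p q] unfolding carrier_F by blast
  show "- p \<in> carrier F" if "p \<in> carrier F" using that by (simp add: carrier_F)
  show "p - q \<in> carrier F" if "p \<in> carrier F" "q \<in> carrier F"
    using that keys_diff[of p q] unfolding carrier_F by blast
  show "p * q \<in> carrier F" if "p \<in> carrier F" "q \<in> carrier F"
  proof -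
    have "set (letters w) \<subseteq> gens r s" if w: "w \<in> Poly_Mapping.keys (p * q)" for w
    proof -
      obtain u v where "w = u + v" "u \<in> Poly_Mapping.keys p" "v \<in> Poly_Mapping.keys q"
        using w keys_mult[of p q] by blast
      then show ?thesis
        using \<open>p \<in> carrier F\<close> \<open>q \<in> carrier F\<close> by (auto simp: carrier_F plus_free_monoid_def)
    qed
    then show ?thesis by (simp add: carrier_F)
  qed
qed

lemma F_one [simp, intro]: "1 \<in> carrier F"
  using F_closed(2)[of 1] by simp

lemma F_sum [intro]: "(\<And>i. i \<in> A \<Longrightarrow> f i \<in> carrier F) \<Longrightarrow> sum f A \<in> carrier F"
  by (induction A rule: infinite_finite_induct) auto

lemma F_word [intro]: "set w \<subseteq> gens r s \<Longrightarrow> Poly_Mapping.single (Word w) c \<in> carrier F"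
  by (auto simp: carrier_F)

lemma F_letter [intro]: "l \<in> gens r s \<Longrightarrow> letter l \<in> carrier F"
  by (auto simp: letter_def)

lemma gens_iff:
  "Var i \<in> gens r s \<longleftrightarrow> i \<in> {1..n}" "Der i \<in> gens r s \<longleftrightarrow> i \<in> {1..n}"
  "VarInv i \<in> gens r s \<longleftrightarrow> i \<in> {r+1..n}"
  by (auto simp: gens_def)

lemma F_euler0 [intro]: "i \<in> {1..n} \<Longrightarrow> euler0 i \<in> carrier F"
  unfolding euler0_def by (intro F_closed F_letter) (simp_all add: gens_iff)

lemma F_lin [intro]: "lin c \<in> carrier F"
  unfolding lin_def by (intro F_sum F_closed F_euler0)

lemma ring_F: "ring F"
proof (rule ringI)
  show "abelian_group F"
  proof (rule abelian_groupI)
    fix x assume "x \<in> carrier F"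
    then show "\<exists>y\<in>carrier F. y \<oplus>\<^bsub>F\<^esub> x = \<zero>\<^bsub>F\<^esub>" by (intro bexI[of _ "- x"]) auto
  qed (auto simp: add.assoc add.commute)
  show "Group.monoid F" by (rule monoidI) (auto simp: mult.assoc)
qed (auto simp: distrib_left distrib_right)

lemma F_uminus [simp]: "p \<in> carrier F \<Longrightarrow> \<ominus>\<^bsub>F\<^esub> p = - p"
  using abelian_group.minus_equality[OF ring.is_abelian_group[OF ring_F], of "- p" p] by simp

lemma ideal_F_iff:
  "ideal I F \<longleftrightarrow> I \<subseteq> carrier F \<and> 0 \<in> I \<and> (\<forall>x\<in>I. \<forall>y\<in>I. x + y \<in> I) \<and>
     (\<forall>x\<in>I. \<forall>a\<in>carrier F. a * x \<in> I \<and> x * a \<in> I)"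
proof
  assume "ideal I F"
  then interpret ideal I F .
  show "I \<subseteq> carrier F \<and> 0 \<in> I \<and> (\<forall>x\<in>I. \<forall>y\<in>I. x + y \<in> I) \<and>
     (\<forall>x\<in>I. \<forall>a\<in>carrier F. a * x \<in> I \<and> x * a \<in> I)"
    using a_subset additive_subgroup.zero_closed[OF is_additive_subgroup]
      additive_subgroup.a_closed[OF is_additive_subgroup] I_l_closed I_r_closed by auto
next
  assume I: "I \<subseteq> carrier F \<and> 0 \<in> I \<and> (\<forall>x\<in>I. \<forall>y\<in>I. x + y \<in> I) \<and>
     (\<forall>x\<in>I. \<forall>a\<in>carrier F. a * x \<in> I \<and> x * a \<in> I)"
  have neg: "- x \<in> I" if "x \<in> I" for x
  proof -
    have "(-1) * x \<in> I" using I that by (metis F_closed(4) F_one)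
    then show ?thesis by simp
  qed
  have "subgroup I (add_monoid F)"
  proof (rule subgroup.intro)
    fix x assume "x \<in> I"
    then show "inv\<^bsub>add_monoid F\<^esub> x \<in> I"
      using neg[of x] F_uminus[of x] I by (auto simp: a_inv_def)
  qed (use I in auto)
  then show "ideal I F" by (rule idealI[OF ring_F]) (use I in auto)
qed

lemma weyl_relations_F: "weyl_relations r s \<subseteq> carrier F"
  unfolding weyl_relations_def
  by (auto intro!: F_closed(3-6) F_letter simp: gens_iff)

lemma ideal_I0: "ideal I0 F"
  unfolding I0_def by (rule ring.genideal_ideal[OF ring_F weyl_relations_F])

lemma I0_F: "I0 \<subseteq> carrier F"
  and I0_0 [simp]: "0 \<in> I0"
  and I0_add: "\<lbrakk>p \<in> I0; q \<in> I0\<rbrakk> \<Longrightarrow> p + q \<in> I0"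
  and I0_l: "\<lbrakk>p \<in> I0; a \<in> carrier F\<rbrakk> \<Longrightarrow> a * p \<in> I0"
  and I0_r: "\<lbrakk>p \<in> I0; a \<in> carrier F\<rbrakk> \<Longrightarrow> p * a \<in> I0"
  using ideal_I0 unfolding ideal_F_iff by auto

lemma I0_uminus: "p \<in> I0 \<Longrightarrow> - p \<in> I0"
  using I0_l[of p "- 1"] by simp

lemma I0_diff: "\<lbrakk>p \<in> I0; q \<in> I0\<rbrakk> \<Longrightarrow> p - q \<in> I0"
  using I0_add[of p "- q"] I0_uminus[of q] by simp

lemma I0_sum: "(\<And>i. i \<in> A \<Longrightarrow> f i \<in> I0) \<Longrightarrow> sum f A \<in> I0"
  by (induction A rule: infinite_finite_induct) (auto intro: I0_add)

lemma relation_I0: "p \<in> weyl_relations r s \<Longrightarrow> p \<in> I0"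
  unfolding I0_def using ring.genideal_self[OF ring_F weyl_relations_F] by blast

text \<open>The elements that act by zero on all functions form an ideal, and it contains the
  defining relations. Hence entries are well defined on the Weyl algebra.\<close>

lemma act_I0:
  assumes "p \<in> I0"
  shows "act ak p g b = 0"
proof -
  let ?Z = "{p \<in> carrier F. \<forall>g. act ak p g = (\<lambda>_. 0)}"
  have z: "act ak a (act ak p g) = (\<lambda>_. 0)" if "\<forall>g. act ak p g = (\<lambda>_. 0)" for a p g
  proof -
    have e: "act ak p g = (\<lambda>_. 0)" using that by blast
    show ?thesis unfolding e by (rule ext) (rule act_fun_zero)
  qed
  have z0: "act ak 0 g = (\<lambda>_. 0)" "act ak p (\<lambda>_. 0) = (\<lambda>_. 0)" for p g
    by (rule ext, simp add: act_fun_zero)+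
  have "ideal ?Z F"
    unfolding ideal_F_iff by (simp add: act_add act_mult z z0 fun_eq_iff[of "act _ (_ + _) _"] act_mult[abs_def])
  moreover have "weyl_relations r s \<subseteq> ?Z"
  proof
    fix p :: "'k free" assume p: "p \<in> weyl_relations r s"
    have sw: "g (b + gen_weight l + gen_weight l') = g (b + gen_weight l' + gen_weight l)"
      for g :: "(nat \<Rightarrow> int) \<Rightarrow> 'k" and b l l' by (metis add.assoc add.commute)
    have w: "b + gen_weight (Var i) + gen_weight (VarInv i) = b"
      "b + gen_weight (VarInv i) + gen_weight (Var i) = b"
      "b + gen_weight (Var i) + gen_weight (Der i) = b"
      "b + gen_weight (Der i) + gen_weight (Var i) = b"
      "gen_weight (Var i) j = (if i = j then 1 else 0)" "gen_weight (Der i) j = (if i = j then -1 else 0)"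
      for b i j by (auto simp: gen_weight_def fun_eq_iff)
    have one: "act ak (if P then 1 else 0) g b = (if P then g b else 0)" for P g b by simp
    have "act ak p g b = 0" for g b
      using p unfolding weyl_relations_def
    proof (elim UnE CollectE exE conjE)
      fix i j assume e: "p = letter (Der i) * letter (Var j) - letter (Var j) * letter (Der i) - (if i = j then 1 else 0)"
      show ?thesis
      proof (cases "i = j")
        case True
        have "act ak p g b = (ak j + of_int (b j) + 1) * g b - (ak j + of_int (b j)) * g b - g b"
          unfolding e using True by (simp add: act_diff act_mult act_letter w)
        then show ?thesis by (simp add: algebra_simps)
      next
        case False
        then show ?thesis unfolding e by (simp add: act_diff act_mult act_letter sw[of g b "Var j"] w)
      qed
    next
      fix i assume "p = letter (Var i) * letter (VarInv i) - 1"
      then show ?thesis by (simp add: act_diff act_mult act_letter w)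
    next
      fix i assume "p = letter (VarInv i) * letter (Var i) - 1"
      then show ?thesis by (simp add: act_diff act_mult act_letter w)
    next
      fix i j assume "p = letter (Var i) * letter (Var j) - letter (Var j) * letter (Var i)"
      then show ?thesis by (simp add: act_diff act_mult act_letter sw[of g b "Var i"])
    next
      fix i j assume "p = letter (Der i) * letter (Der j) - letter (Der j) * letter (Der i)"
      then show ?thesis
        by (cases "i = j") (simp_all add: act_diff act_mult act_letter sw[of g b "Der i"] w)
    qed
    then show "p \<in> ?Z" using p weyl_relations_F by auto
  qed
  ultimately have "I0 \<subseteq> ?Z"
    unfolding I0_def by (rule ring.genideal_minimal[OF ring_F])
  then show ?thesis using assms by (auto simp: fun_eq_iff)
qed

lemma entry_I0: "p \<in> I0 \<Longrightarrow> entry ak p b' b = 0"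
  by (simp add: entry_def act_I0)

lemma entry_cong_I0: "p - q \<in> I0 \<Longrightarrow> entry ak p b' b = entry ak q b' b"
  using entry_I0[of "p - q"] by (simp add: entry_diff)

lemma const_comm: "const c * p = p * const c"
proof -
  have "const c * Poly_Mapping.single w d = Poly_Mapping.single w d * const c" for w d
    by (simp add: mult_single mult.commute)
  then have "(\<Sum>w\<in>Poly_Mapping.keys p. const c * Poly_Mapping.single w (Poly_Mapping.lookup p w)) =
      (\<Sum>w\<in>Poly_Mapping.keys p. Poly_Mapping.single w (Poly_Mapping.lookup p w) * const c)"
    by simp
  then have "const c * (\<Sum>w\<in>Poly_Mapping.keys p. Poly_Mapping.single w (Poly_Mapping.lookup p w)) =
      (\<Sum>w\<in>Poly_Mapping.keys p. Poly_Mapping.single w (Poly_Mapping.lookup p w)) * const c"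
    unfolding sum_distrib_left sum_distrib_right .
  then show ?thesis unfolding poly_mapping_eq_sum_single[symmetric] .
qed

lemma const_left_comm: "p * (const c * q) = const c * (p * q)"
  by (metis const_comm mult.assoc)

lemma of_int_left_comm: "p * (of_int k * q) = of_int k * (p * q :: 'k free)"
  by (metis mult_of_int_commute mult.assoc)

lemma const_add: "const (c + d) = const c + const d"
  by (rule single_add)

lemma const_diff: "const (c - d) = const c - const d"
  by (metis add_diff_cancel_right' diff_add_cancel const_add)

lemma const_mult: "const (c * d) = const c * const d"
  by (simp add: mult_single)

lemma const_uminus: "const (- c) = - const c"
  using const_diff[of 0 c] by simp

lemma const_sum: "const (sum f A) = (\<Sum>i\<in>A. const (f i))"
  by (induction A rule: infinite_finite_induct) (simp_all add: const_add)

lemma word_Cons: "word (l # w) = letter l * word w"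
  by (simp add: letter_def mult_single plus_free_monoid_def)

lemma word_Nil: "word [] = 1"
  by (simp flip: zero_free_monoid_def)

lemma single_word: "Poly_Mapping.single (Word w) c = const c * word w"
  by (simp add: mult_single plus_free_monoid_def zero_free_monoid_def)

subsection \<open>Commutation relations\<close>

lemma
  assumes "i \<in> {1..n}" "j \<in> {1..n}"
  shows rel_xx: "letter (Var i) * letter (Var j) - letter (Var j) * letter (Var i) \<in> I0"
    and rel_dd: "letter (Der i) * letter (Der j) - letter (Der j) * letter (Der i) \<in> I0"
    and rel_dx: "letter (Der i) * letter (Var j) - letter (Var j) * letter (Der i) - (if i = j then 1 else 0) \<in> I0"
  using assms by (intro relation_I0, unfold weyl_relations_def, blast)+

lemma
  assumes "i \<in> {r+1..n}"
  shows rel_xz: "letter (Var i) * letter (VarInv i) - 1 \<in> I0"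
    and rel_zx: "letter (VarInv i) * letter (Var i) - 1 \<in> I0"
  using assms by (intro relation_I0, unfold weyl_relations_def, blast)+

lemma rel_dx_same: "i \<in> {1..n} \<Longrightarrow> letter (Der i) * letter (Var i) - letter (Var i) * letter (Der i) - 1 \<in> I0"
  using rel_dx[of i i] by simp

text \<open>Multiply the commutator with \<open>Var i\<close> by the inverse from both sides; the
  two relations for the inverse account for the difference.\<close>

lemma var_inv_comm:
  assumes i: "i \<in> {r+1..n}" and y: "y \<in> carrier F"
    and c: "letter (Var i) * y - y * letter (Var i) \<in> I0"
  shows "letter (VarInv i) * y - y * letter (VarInv i) \<in> I0"
proof -
  let ?x = "letter (Var i) :: 'k free" and ?z = "letter (VarInv i) :: 'k free"
  have F: "?x \<in> carrier F" "?z \<in> carrier F" using i by (auto simp: gens_iff intro!: F_letter)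
  note 1 = rel_xz[OF i] and 2 = rel_zx[OF i]
  have "?z * (?x * y - y * ?x) * ?z - (?z * ?x - 1) * (y * ?z) + (?z * y) * (?x * ?z - 1) \<in> I0"
    using F y by (intro I0_add I0_diff I0_r[OF I0_l[OF c]] I0_r[OF 2] I0_l[OF 1]) auto
  moreover have "?z * (?x * y - y * ?x) * ?z - (?z * ?x - 1) * (y * ?z) + (?z * y) * (?x * ?z - 1) =
      y * ?z - ?z * y"
    by (simp add: algebra_simps)
  ultimately show ?thesis using I0_uminus by (metis minus_diff_eq)
qed

lemma letters_comm:
  assumes l: "l \<in> gens r s" and m: "m \<in> gens r s" and ne: "gen_index l \<noteq> gen_index m"
  shows "letter l * letter m - letter m * letter l \<in> I0"
proof -
  have rel: "letter l * letter m - letter m * letter l \<in> I0"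
    if "l \<in> gens r s" "m \<in> gens r s" "gen_index l \<noteq> gen_index m"
      "\<not> (\<exists>i. l = VarInv i)" "\<not> (\<exists>i. m = VarInv i)" for l m
  proof (cases l; cases m)
    fix i j assume "l = Var i" "m = Der j"
    then have "letter (Der j) * letter (Var i) - letter (Var i) * letter (Der j) - (if j = i then 1 else 0) \<in> (I0::'k free set)"
      using that by (intro rel_dx) (auto simp: gens_iff)
    then show ?thesis using \<open>l = Var i\<close> \<open>m = Der j\<close> that I0_uminus by fastforce
  next
    fix i j assume "l = Der i" "m = Var j"
    then have "letter (Der i) * letter (Var j) - letter (Var j) * letter (Der i) - (if i = j then 1 else 0) \<in> (I0::'k free set)"
      using that by (intro rel_dx) (auto simp: gens_iff)
    then show ?thesis using \<open>l = Der i\<close> \<open>m = Var j\<close> that by simp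
  qed (use that in \<open>auto intro!: rel_xx rel_dd simp: gens_iff\<close>)
  have inv: "letter l * letter m - letter m * letter l \<in> I0"
    if "l \<in> gens r s" "m \<in> gens r s" "gen_index l \<noteq> gen_index m" "\<not> (\<exists>i. m = VarInv i)" for l m
  proof (cases l)
    case (VarInv i)
    then have "letter (Var i) * letter m - letter m * letter (Var i) \<in> (I0::'k free set)"
      using that by (intro rel) (auto simp: gens_iff)
    then show ?thesis using var_inv_comm[of i "letter m"] VarInv that by (auto simp: gens_iff)
  qed (use rel that in auto)
  show ?thesis
  proof (cases m)
    case (VarInv j)
    have "letter (Var j) * letter l - letter l * letter (Var j) \<in> (I0::'k free set)"
      using I0_uminus[OF inv[of l "Var j"]] VarInv assms by (auto simp: gens_iff)
    then have "letter m * letter l - letter l * letter m \<in> (I0::'k free set)"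
      using var_inv_comm[of j "letter l"] VarInv assms by (auto simp: gens_iff)
    then show ?thesis using I0_uminus by fastforce
  qed (use inv assms in auto)
qed

lemma euler_letter:
  assumes j: "j \<in> {1..n}" and l: "l \<in> gens r s"
  shows "euler0 j * letter l - letter l * euler0 j - const (of_int (gen_weight l j)) * letter l \<in> I0"
proof -
  let ?x = "letter (Var j) :: 'k free" and ?d = "letter (Der j) :: 'k free"
  have F: "?x \<in> carrier F" "?d \<in> carrier F" "letter l \<in> carrier F"
    using j l by (auto simp: gens_iff)
  note rel = rel_dx_same[OF j]
  have var: "euler0 j * ?x - ?x * euler0 j - ?x \<in> I0"
    using I0_l[OF rel F(1)] by (simp add: euler0_def algebra_simps)
  show ?thesis
  proof (cases "gen_index l = j")
    case False
    have "?x * (?d * letter l - letter l * ?d) + (?x * letter l - letter l * ?x) * ?d \<in> I0"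
      using F False j l
      by (intro I0_add I0_l[OF letters_comm] I0_r[OF letters_comm]) (auto simp: gens_iff)
    then show ?thesis using False by (simp add: euler0_def gen_weight_def algebra_simps)
  next
    case True
    show ?thesis
    proof (cases l)
      case (Var i)
      then show ?thesis using var True by (simp add: gen_weight_def)
    next
      case (Der i)
      have "- ((?d * ?x - ?x * ?d - 1) * ?d) \<in> I0" using I0_uminus[OF I0_r[OF rel F(2)]] .
      then show ?thesis using Der True
        by (simp add: gen_weight_def euler0_def const_uminus algebra_simps)
    next
      case (VarInv i)
      let ?z = "letter (VarInv j) :: 'k free"
      have i: "i = j" "j \<in> {r+1..n}" using VarInv True l by (auto simp: gens_iff)
      then have z: "?z \<in> carrier F" by (auto simp: gens_iff)
      note 1 = rel_xz[OF i(2)] and 2 = rel_zx[OF i(2)]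
      have e: "euler0 j \<in> carrier F" using j by auto
      \<comment> \<open>Again the relation for \<open>Var j\<close> is multiplied by the inverse
        from both sides and corrected by the inverse relations; this reverses the sign of the
        weight.\<close>
      have "- (?z * (euler0 j * ?x - ?x * euler0 j - ?x) * ?z) + (?z * euler0 j) * (?x * ?z - 1)
          - (?z * ?x - 1) * (euler0 j * ?z) - (?z * ?x - 1) * ?z \<in> I0"
        using z e F
        by (intro I0_add I0_diff I0_uminus I0_r[OF I0_l[OF var]] I0_l[OF 1] I0_r[OF 2]) auto
      moreover have "- (?z * (euler0 j * ?x - ?x * euler0 j - ?x) * ?z) + (?z * euler0 j) * (?x * ?z - 1)
          - (?z * ?x - 1) * (euler0 j * ?z) - (?z * ?x - 1) * ?z = euler0 j * ?z - ?z * euler0 j + ?z"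
        by (simp add: algebra_simps)
      ultimately show ?thesis using VarInv i by (simp add: gen_weight_def const_uminus)
    qed
  qed
qed

lemma euler_word:
  assumes j: "j \<in> {1..n}" and w: "set w \<subseteq> gens r s"
  shows "euler0 j * word w - word w * euler0 j - const (of_int (word_weight w j)) * word w \<in> I0"
  using w
proof (induction w)
  case (Cons l w)
  let ?A = "euler0 j * letter l - letter l * euler0 j - const (of_int (gen_weight l j)) * letter l"
  let ?B = "euler0 j * word w - word w * euler0 j - const (of_int (word_weight w j)) * word w"
  have F: "letter l \<in> carrier F" "word w \<in> carrier F" using Cons.prems by auto
  have "?A * word w + letter l * ?B \<in> I0"
    using Cons F by (intro I0_add I0_l I0_r euler_letter[OF j]) auto
  moreover have "?A * word w + letter l * ?B =
      euler0 j * word (l # w) - word (l # w) * euler0 j - const (of_int (word_weight (l # w) j)) * word (l # w)"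
    unfolding word_Cons
    by (simp add: algebra_simps const_add of_int_left_comm[of "letter l"])
  ultimately show ?case by simp
qed (simp add: word_Nil)

lemma lin_word:
  assumes w: "set w \<subseteq> gens r s"
  shows "lin c * word w - word w * lin c - const (\<Sum>i=1..n. c i * of_int (word_weight w i)) * word w \<in> I0"
proof -
  have "(\<Sum>i=1..n. const (c i) * (euler0 i * word w - word w * euler0 i - const (of_int (word_weight w i)) * word w)) \<in> I0"
    using w by (intro I0_sum I0_l euler_word) auto
  moreover have "(\<Sum>i=1..n. const (c i) * (euler0 i * word w - word w * euler0 i - const (of_int (word_weight w i)) * word w)) =
     lin c * word w - word w * lin c - const (\<Sum>i=1..n. c i * of_int (word_weight w i)) * word w"
  proof -
    have "const (c i) * (word w * euler0 i) = word w * (const (c i) * euler0 i)" for i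
      by (metis const_comm mult.assoc)
    then show ?thesis
      by (simp add: lin_def sum_distrib_left sum_distrib_right sum_subtractf const_sum const_mult
          right_diff_distrib mult.assoc)
  qed
  ultimately show ?thesis by simp
qed

lemma act_euler0: "act ak (euler0 i) g b = (ak i + of_int (b i)) * g b"
proof -
  have e: "b + gen_weight (Der i) + gen_weight (Var i) = b"
    by (auto simp: gen_weight_def fun_eq_iff)
  show ?thesis unfolding euler0_def act_mult act_letter e by simp
qed

lemma act_lin: "act ak (lin c) g b = (\<Sum>i=1..n. c i * (ak i + of_int (b i))) * g b"
  by (simp add: lin_def act_sum act_mult act_const act_euler0 sum_distrib_right sum_distrib_left mult_ac)

subsection \<open>Polynomials in the Euler operators\<close>

text \<open>Representatives in the free algebra of the elements of Sym(t); their images commute only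
  modulo \<open>I0\<close>.\<close>

inductive_set tpoly :: "'k free set" where
  tpoly_const: "const c \<in> tpoly"
| tpoly_euler: "i \<in> {1..n} \<Longrightarrow> euler0 i \<in> tpoly"
| tpoly_add: "\<lbrakk>p \<in> tpoly; q \<in> tpoly\<rbrakk> \<Longrightarrow> p + q \<in> tpoly"
| tpoly_mult: "\<lbrakk>p \<in> tpoly; q \<in> tpoly\<rbrakk> \<Longrightarrow> p * q \<in> tpoly"

lemma tpoly_F: "p \<in> tpoly \<Longrightarrow> p \<in> carrier F"
  by (induction rule: tpoly.induct) auto

lemma tpoly_1: "1 \<in> tpoly"
  using tpoly_const[of 1] by simp

lemma tpoly_sum: "(\<And>i. i \<in> A \<Longrightarrow> f i \<in> tpoly) \<Longrightarrow> sum f A \<in> tpoly"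
  using tpoly_const[of 0] by (induction A rule: infinite_finite_induct) (auto intro: tpoly_add)

lemma act_tpoly: "p \<in> tpoly \<Longrightarrow> act ak p g b = act ak p (\<lambda>_. 1) b * g b"
proof (induction arbitrary: g rule: tpoly.induct)
  case (tpoly_add p q)
  show ?case
    by (simp only: act_add tpoly_add.IH(1)[of g] tpoly_add.IH(2)[of g] distrib_right)
next
  case (tpoly_mult p q)
  have "act ak (p * q) h b = act ak q (\<lambda>_. 1) b * act ak p h b" for h
    unfolding act_mult by (rule tpoly_mult.IH(2))
  then show ?case by (simp only: tpoly_mult.IH(1)[of g] mult.assoc)
qed (simp_all add: act_const act_euler0)

text \<open>The Euler operator of index \<open>i\<close> has eigenvalue
  \<open>\<alpha> i + b i\<close> at the weight \<open>b\<close>, so subtracting the constant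
  \<open>\<alpha> i\<close> realizes the coordinate \<open>b i\<close>.\<close>

lemma tpoly_realize:
  assumes "pfun n \<phi>"
  shows "\<exists>p\<in>tpoly. \<forall>g b. act ak p g b = \<phi> b * g b"
  using assms
proof (induction rule: pfun.induct)
  case (pfun_const c)
  show ?case by (rule bexI[OF _ tpoly_const[of c]]) (simp add: act_const)
next
  case (pfun_coord i)
  show ?case
    by (rule bexI[OF _ tpoly_add[OF tpoly_euler[OF pfun_coord] tpoly_const[of "- ak i"]]])
      (simp add: act_add act_const act_euler0 algebra_simps)
next
  case (pfun_add f h)
  then obtain p q where "p \<in> tpoly" "\<forall>g b. act ak p g b = f b * g b"
    "q \<in> tpoly" "\<forall>g b. act ak q g b = h b * g b" by blast
  then show ?case by (intro bexI[OF _ tpoly_add[of p q]]) (simp_all add: act_add distrib_right)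
next
  case (pfun_mult f h)
  then obtain p q where "p \<in> tpoly" "\<forall>g b. act ak p g b = f b * g b"
    "q \<in> tpoly" "\<forall>g b. act ak q g b = h b * g b" by blast
  then show ?case by (intro bexI[OF _ tpoly_mult[of p q]]) (simp_all add: act_mult mult_ac)
qed

lemma letter_tpoly:
  assumes p: "p \<in> tpoly" and l: "l \<in> gens r s"
  shows "\<exists>q\<in>tpoly. letter l * p - q * letter l \<in> I0"
  using p
proof (induction rule: tpoly.induct)
  case (tpoly_const c)
  show ?case
    by (rule bexI[OF _ tpoly.tpoly_const[of c]]) (simp add: const_comm)
next
  case (tpoly_euler i)
  have "- (euler0 i * letter l - letter l * euler0 i - const (of_int (gen_weight l i)) * letter l) \<in> I0"
    by (rule I0_uminus[OF euler_letter[OF tpoly_euler l]])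
  then have "letter l * euler0 i - (euler0 i + const (- of_int (gen_weight l i))) * letter l \<in> I0"
    by (simp add: algebra_simps const_uminus)
  moreover have "euler0 i + const (- of_int (gen_weight l i)) \<in> tpoly"
    using tpoly_euler by (intro tpoly.intros)
  ultimately show ?case by blast
next
  case (tpoly_add p q)
  then obtain p' q' where p': "p' \<in> tpoly" "letter l * p - p' * letter l \<in> I0"
    and q': "q' \<in> tpoly" "letter l * q - q' * letter l \<in> I0" by blast
  have "letter l * (p + q) - (p' + q') * letter l \<in> I0"
    using I0_add[OF p'(2) q'(2)] by (simp add: algebra_simps)
  then show ?case using p' q' tpoly.tpoly_add by blast
next
  case (tpoly_mult p q)
  then obtain p' q' where p': "p' \<in> tpoly" "letter l * p - p' * letter l \<in> I0"
    and q': "q' \<in> tpoly" "letter l * q - q' * letter l \<in> I0" by blast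
  have "(letter l * p - p' * letter l) * q + p' * (letter l * q - q' * letter l) \<in> I0"
    using p' q' tpoly_mult.hyps by (intro I0_add I0_l I0_r) (auto intro: tpoly_F)
  then have "letter l * (p * q) - (p' * q') * letter l \<in> I0"
    by (simp add: algebra_simps)
  then show ?case using p' q' tpoly.tpoly_mult by blast
qed

text \<open>A letter of the index of \<open>l\<close> and of opposite sign exists by the hypothesis
  on the weight. On the way to it, letters of other index commute with \<open>l\<close>, and a
  letter of the same index and sign takes over the role of \<open>l\<close>. The pair that finally
  meets is a polynomial in the Euler operators, which \<open>letter_tpoly\<close> moves to the
  front.\<close>

lemma cancel_letter:
  assumes "l \<in> gens r s" "set w \<subseteq> gens r s"
    and "gen_sign l * word_weight w (gen_index l) < 0"
  shows "\<exists>p\<in>tpoly. \<exists>w'. set w' \<subseteq> gens r s \<and> Suc (length w') = length w \<and>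
    word_weight w' = gen_weight l + word_weight w \<and> letter l * word w - p * word w' \<in> I0"
  using assms
proof (induction w arbitrary: l)
  case (Cons m w)
  have lF: "letter l \<in> carrier F" "letter m \<in> carrier F" "word w \<in> carrier F" using Cons.prems by auto
  have sgn: "gen_sign l \<in> {1, -1}" for l by (cases l) auto
  have mw: "m \<in> gens r s" "set w \<subseteq> gens r s" using Cons.prems by auto
  show ?case
  proof (cases "gen_index m = gen_index l \<and> gen_sign m = - gen_sign l")
    case True
    let ?i = "gen_index l"
    have i: "?i \<in> {1..n}" using Cons.prems(1) by (cases l) (auto simp: gens_def)
    have "\<exists>p\<in>tpoly. letter l * letter m - p \<in> I0"
    proof (cases l; cases m)
      fix i j assume l: "l = Var i" "m = VarInv j"
      then have "letter l * letter m - 1 \<in> I0"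
        using True Cons.prems rel_xz[of i] by (auto simp: gens_iff)
      then show ?thesis using tpoly_1 by blast
    next
      fix i j assume l: "l = VarInv i" "m = Var j"
      then have "letter l * letter m - 1 \<in> I0"
        using True Cons.prems rel_zx[of i] by (auto simp: gens_iff)
      then show ?thesis using tpoly_1 by blast
    next
      fix i j assume l: "l = Var i" "m = Der j"
      then have "letter l * letter m - euler0 ?i \<in> I0"
        using True by (simp add: euler0_def)
      then show ?thesis using tpoly_euler[OF i] by blast
    next
      fix a j assume l: "l = Der a" "m = Var j"
      have "letter l * letter m - (euler0 ?i + 1) \<in> I0"
        using rel_dx_same[OF i] l True by (simp add: euler0_def algebra_simps)
      then show ?thesis using tpoly_add[OF tpoly_euler[OF i] tpoly_1] by blast
    qed (use True in auto)
    then obtain p where p: "p \<in> tpoly" "letter l * letter m - p \<in> I0" by blast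
    have "letter l * word (m # w) - p * word w \<in> I0"
      using I0_r[OF p(2) lF(3)] by (simp add: word_Cons algebra_simps)
    moreover have "word_weight w = gen_weight l + word_weight (m # w)"
      using True by (auto simp: gen_weight_def fun_eq_iff)
    ultimately show ?thesis
      using p(1) Cons.prems(2) by (intro bexI[of _ p] exI[of _ w] conjI; simp only: list.set length_Cons insert_subset)
  next
    case False
    show ?thesis
    proof (cases "gen_index m = gen_index l")
      case True
      then have same: "gen_sign m = gen_sign l" using False sgn[of l] sgn[of m] by auto
      have "gen_sign m * word_weight w (gen_index m) < 0"
        using Cons.prems(3) True same sgn[of l] by (auto simp: gen_weight_def)
      from Cons.IH[OF mw this] obtain p w' where p: "p \<in> tpoly" "set w' \<subseteq> gens r s"
        "Suc (length w') = length w" "word_weight w' = gen_weight m + word_weight w"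
        "letter m * word w - p * word w' \<in> I0" by blast
      obtain q where q: "q \<in> tpoly" "letter l * p - q * letter l \<in> I0"
        using letter_tpoly[OF p(1)] Cons.prems(1) by blast
      have "letter l * (letter m * word w - p * word w') + (letter l * p - q * letter l) * word w' \<in> I0"
        using p q lF by (intro I0_add I0_l I0_r) auto
      then have "letter l * word (m # w) - q * word (l # w') \<in> I0"
        by (simp add: word_Cons algebra_simps)
      moreover have "word_weight (l # w') = gen_weight l + word_weight (m # w)"
        by (simp only: word_weight.simps p(4))
      moreover have "set (l # w') \<subseteq> gens r s" "Suc (length (l # w')) = length (m # w)"
        using p(2,3) Cons.prems(1) by simp_all
      ultimately show ?thesis using q(1) by blast
    next
      case neq: False
      have "gen_sign l * word_weight w (gen_index l) < 0"
        using Cons.prems(3) neq by (auto simp: gen_weight_def)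
      from Cons.IH[OF Cons.prems(1) mw(2) this] obtain p w' where p: "p \<in> tpoly" "set w' \<subseteq> gens r s"
        "Suc (length w') = length w" "word_weight w' = gen_weight l + word_weight w"
        "letter l * word w - p * word w' \<in> I0" by blast
      obtain q where q: "q \<in> tpoly" "letter m * p - q * letter m \<in> I0"
        using letter_tpoly[OF p(1)] Cons.prems(2) by auto
      have c: "letter l * letter m - letter m * letter l \<in> I0"
        using neq Cons.prems by (intro letters_comm) auto
      have "(letter l * letter m - letter m * letter l) * word w +
          letter m * (letter l * word w - p * word w') + (letter m * p - q * letter m) * word w' \<in> I0"
        using p q lF c by (intro I0_add I0_l I0_r) auto
      then have "letter l * word (m # w) - q * word (m # w') \<in> I0"
        by (simp add: word_Cons algebra_simps)
      moreover have "word_weight (m # w') = gen_weight l + word_weight (m # w)"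
        by (simp only: word_weight.simps p(4) add.left_commute)
      moreover have "set (m # w') \<subseteq> gens r s" "Suc (length (m # w')) = length (m # w)"
        using p(2,3) mw(1) by simp_all
      ultimately show ?thesis using q(1) by blast
    qed
  qed
qed simp

text \<open>The tail compensates the weight of the first letter, so \<open>cancel_letter\<close>
  applies and leaves a word of weight zero that is shorter by two letters. It follows that the part
  of weight zero of the Weyl algebra is Sym(t).\<close>

lemma weight_zero_word:
  assumes "set w \<subseteq> gens r s" "word_weight w = 0"
  shows "\<exists>p\<in>tpoly. word w - p \<in> I0"
  using assms
proof (induction "length w" arbitrary: w rule: less_induct)
  case less
  show ?case
  proof (cases w)
    case Nil
    have "word [] - 1 \<in> I0" by (simp add: word_Nil)
    then show ?thesis unfolding Nil using tpoly_1 by blast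
  next
    case (Cons l v)
    have "gen_weight l (gen_index l) + word_weight v (gen_index l) = 0"
      using fun_cong[OF less.prems(2), of "gen_index l"] Cons by simp
    then have "gen_sign l * word_weight v (gen_index l) < 0"
      by (cases l) (auto simp: gen_weight_def)
    moreover have "l \<in> gens r s" "set v \<subseteq> gens r s" using less.prems(1) Cons by auto
    moreover have "gen_weight l + word_weight v = 0"
      using less.prems(2) unfolding Cons word_weight.simps .
    ultimately obtain p w' where p: "p \<in> tpoly"
      "set w' \<subseteq> gens r s" "Suc (length w') = length v" "word_weight w' = 0"
      "letter l * word v - p * word w' \<in> I0" using cancel_letter[of l v] by metis
    obtain q where q: "q \<in> tpoly" "word w' - q \<in> I0"
      using less.hyps[OF _ p(2,4)] p(3) Cons by auto
    have "letter l * word v - p * word w' + p * (word w' - q) \<in> I0"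
      using p q by (intro I0_add I0_l tpoly_F)
    then have "word w - p * q \<in> I0" by (simp add: Cons word_Cons algebra_simps)
    then show ?thesis using tpoly_mult[OF p(1) q(1)] by blast
  qed
qed

end

section \<open>Invariants and the simple module\<close>

context weyl_data
begin

text \<open>\<open>G0\<close> is the preimage of \<open>\<A>\<^sup>\<gg>\<close> in the free algebra, and \<open>Lam\<close> is the set of weights of \<open>\<A>\<^sup>\<gg>\<close>.\<close>

definition coeffs :: "(nat \<Rightarrow> 'k) set" where
  "coeffs = {c \<in> coord_space {1..n}. torus_elem r s c \<in> \<gg>}"

definition G0 :: "'k free set" where
  "G0 = {p \<in> carrier F. \<forall>c\<in>coeffs. lin c * p - p * lin c \<in> I0}"

definition pair :: "(nat \<Rightarrow> 'k) \<Rightarrow> (nat \<Rightarrow> int) \<Rightarrow> 'k" where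
  "pair c u = (\<Sum>i=1..n. c i * of_int (u i))"

definition Lam :: "(nat \<Rightarrow> int) set" where
  "Lam = {u. (\<forall>i. i \<notin> {1..n} \<longrightarrow> u i = 0) \<and> (\<forall>c\<in>coeffs. pair c u = 0)}"

lemma pair_simps:
  "pair c 0 = 0" "pair c (u + v) = pair c u + pair c v" "pair c (u - v) = pair c u - pair c v"
  "pair c (- u) = - pair c u" "pair c (\<lambda>i. t * u i) = of_int t * pair c u"
  by (simp_all add: pair_def distrib_left right_diff_distrib sum.distrib sum_subtractf sum_negf
      sum_distrib_left mult_ac)

lemma Lam_closed [intro]:
  "0 \<in> Lam" "\<lbrakk>u \<in> Lam; v \<in> Lam\<rbrakk> \<Longrightarrow> u + v \<in> Lam" "\<lbrakk>u \<in> Lam; v \<in> Lam\<rbrakk> \<Longrightarrow> u - v \<in> Lam"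
  "u \<in> Lam \<Longrightarrow> - u \<in> Lam" "u \<in> Lam \<Longrightarrow> (\<lambda>i. t * u i) \<in> Lam"
  by (simp_all add: Lam_def pair_simps)

lemma G0_F: "p \<in> G0 \<Longrightarrow> p \<in> carrier F"
  by (simp add: G0_def)

lemma G0_I0: "p \<in> I0 \<Longrightarrow> p \<in> G0"
  unfolding G0_def mem_Collect_eq using I0_F by (intro conjI ballI I0_diff I0_l I0_r F_lin) auto

lemma G0_const: "const c \<in> G0"
  by (simp add: G0_def const_comm)

lemma G0_add: "\<lbrakk>p \<in> G0; q \<in> G0\<rbrakk> \<Longrightarrow> p + q \<in> G0"
  unfolding G0_def using I0_add
  by (fastforce simp: algebra_simps dest: bspec)

lemma G0_mult: "\<lbrakk>p \<in> G0; q \<in> G0\<rbrakk> \<Longrightarrow> p * q \<in> G0"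
proof -
  assume pq: "p \<in> G0" "q \<in> G0"
  have "lin c * (p * q) - (p * q) * lin c \<in> I0" if "c \<in> coeffs" for c
  proof -
    have "(lin c * p - p * lin c) * q + p * (lin c * q - q * lin c) \<in> I0"
      using pq that by (intro I0_add I0_l I0_r) (auto simp: G0_def)
    then show ?thesis by (simp add: algebra_simps)
  qed
  then show ?thesis using pq by (auto simp: G0_def)
qed

lemma G0_uminus: "p \<in> G0 \<Longrightarrow> - p \<in> G0"
  using G0_mult[OF G0_const[of "-1"], of p] by (simp add: const_uminus)

lemma G0_diff: "\<lbrakk>p \<in> G0; q \<in> G0\<rbrakk> \<Longrightarrow> p - q \<in> G0"
  using G0_add[of p "- q"] G0_uminus by simp

lemma G0_0: "0 \<in> G0" and G0_1: "1 \<in> G0"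
  using G0_const[of 0] G0_const[of 1] by simp_all

lemma G0_sum: "(\<And>i. i \<in> A \<Longrightarrow> f i \<in> G0) \<Longrightarrow> sum f A \<in> G0"
  by (induction A rule: infinite_finite_induct) (auto intro: G0_add G0_0)

lemma euler0_word: "euler0 i = word [Var i, Der i]"
  by (simp add: word_Cons word_Nil euler0_def)

lemma word_G0:
  assumes w: "set w \<subseteq> gens r s" "word_weight w \<in> Lam"
  shows "word w \<in> G0"
proof -
  have "lin c * word w - word w * lin c \<in> I0" if "c \<in> coeffs" for c
    using lin_word[OF w(1), of c] w(2) that by (simp add: Lam_def pair_def)
  then show ?thesis using w by (auto simp: G0_def)
qed

lemma euler0_G0: "i \<in> {1..n} \<Longrightarrow> euler0 i \<in> G0"
  unfolding euler0_word
proof (rule word_G0)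
  have "word_weight [Var i, Der i] = 0" by (auto simp: gen_weight_def fun_eq_iff)
  then show "word_weight [Var i, Der i] \<in> Lam" using Lam_closed(1) by simp
qed (auto simp: gens_iff)

lemma tpoly_G0: "p \<in> tpoly \<Longrightarrow> p \<in> G0"
  by (induction rule: tpoly.induct) (auto intro: G0_const euler0_G0 G0_add G0_mult)

lemma word_weight_outside: "set w \<subseteq> gens r s \<Longrightarrow> i \<notin> {1..n} \<Longrightarrow> word_weight w i = 0"
proof (induction w)
  case (Cons l w)
  then have "gen_index l \<noteq> i" by (cases l) (auto simp: gens_def)
  then show ?case using Cons by (simp add: gen_weight_def)
qed simp

text \<open>Taking the commutator with \<open>lin c\<close> multiplies the entry at
  \<open>(b', b)\<close> by \<open>pair c (b' - b)\<close>, and for an invariant this commutator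
  acts by zero.\<close>

lemma entry_G0_Lam:
  assumes p: "p \<in> G0" and nz: "entry ak p b' b \<noteq> 0"
  shows "b' - b \<in> Lam"
proof -
  have "b' \<in> targets p b" using nz entry_eq_0 by blast
  then obtain w where w: "w \<in> Poly_Mapping.keys p" "b' = b + word_weight (letters w)"
    by (auto simp: targets_def)
  have "set (letters w) \<subseteq> gens r s" using G0_F[OF p] w(1) by (simp add: carrier_F)
  then have "(b' - b) i = 0" if "i \<notin> {1..n}" for i
    using word_weight_outside that w(2) by simp
  moreover have "pair c (b' - b) = 0" if c: "c \<in> coeffs" for c
  proof -
    define \<tau> where "\<tau> x = (\<Sum>i=1..n. c i * (ak i + of_int (x i)))" for x :: "nat \<Rightarrow> int"
    define \<delta> :: "(nat \<Rightarrow> int) \<Rightarrow> 'k" where "\<delta> = (\<lambda>x. if x = b' then 1 else 0)"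
    have "act ak (lin c) \<delta> = (\<lambda>x. \<tau> b' * \<delta> x)"
      by (rule ext) (simp add: act_lin \<tau>_def \<delta>_def)
    then have "act ak (lin c * p) \<delta> b = \<tau> b' * entry ak p b' b"
      by (simp add: act_mult act_fun_scale entry_def \<delta>_def)
    moreover have "act ak (p * lin c) \<delta> b = \<tau> b * entry ak p b' b"
      by (simp add: act_mult act_lin \<tau>_def entry_def \<delta>_def)
    moreover have "act ak (lin c * p - p * lin c) \<delta> b = 0"
      using p c by (intro act_I0) (simp add: G0_def)
    ultimately have "(\<tau> b' - \<tau> b) * entry ak p b' b = 0"
      by (simp add: act_diff left_diff_distrib)
    then have "\<tau> b' - \<tau> b = 0" using nz by simp
    moreover have "\<tau> b' - \<tau> b = pair c (b' - b)"
      by (simp add: \<tau>_def pair_def algebra_simps flip: sum_subtractf)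
    ultimately show ?thesis by simp
  qed
  ultimately show ?thesis by (simp add: Lam_def)
qed

subsection \<open>Homogeneous elements\<close>

definition homog :: "(nat \<Rightarrow> int) \<Rightarrow> 'k free set" where
  "homog u = {q \<in> carrier F. \<forall>w\<in>Poly_Mapping.keys q. word_weight (letters w) = u}"

lemma word_homog: "set w \<subseteq> gens r s \<Longrightarrow> word w \<in> homog (word_weight w)"
  by (auto simp: homog_def)

lemma homog_mult:
  assumes "p \<in> homog u" "q \<in> homog v"
  shows "p * q \<in> homog (u + v)"
proof -
  have "word_weight (letters w) = u + v" if w: "w \<in> Poly_Mapping.keys (p * q)" for w
  proof -
    obtain x y where "w = x + y" "x \<in> Poly_Mapping.keys p" "y \<in> Poly_Mapping.keys q"
      using w keys_mult[of p q] by blast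
    then show ?thesis
      using assms by (simp add: homog_def plus_free_monoid_def word_weight_append)
  qed
  then show ?thesis using assms by (simp add: homog_def F_closed)
qed

lemma entry_homog: "q \<in> homog u \<Longrightarrow> b' \<noteq> b + u \<Longrightarrow> entry ak q b' b = 0"
  by (rule entry_eq_0) (auto simp: homog_def targets_def)

lemma homog_decomp:
  assumes "q \<in> homog u"
  shows "q = (\<Sum>w\<in>Poly_Mapping.keys q. const (Poly_Mapping.lookup q w) * word (letters w))"
    and "\<And>w. w \<in> Poly_Mapping.keys q \<Longrightarrow> set (letters w) \<subseteq> gens r s \<and> word_weight (letters w) = u"
proof -
  show "q = (\<Sum>w\<in>Poly_Mapping.keys q. const (Poly_Mapping.lookup q w) * word (letters w))"
  proof -
    have "Poly_Mapping.single w c = const c * word (letters w)" for w c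
      using single_word[of "letters w" c] by simp
    from this[symmetric] show ?thesis
      by (simp only:) (rule poly_mapping_eq_sum_single)
  qed
  show "\<And>w. w \<in> Poly_Mapping.keys q \<Longrightarrow> set (letters w) \<subseteq> gens r s \<and> word_weight (letters w) = u"
    using assms by (simp add: homog_def carrier_F)
qed

lemma ad_const:
  "const x * (e * q - q * e - const y * q) = e * (const x * q) - const x * q * e - const y * (const x * q)"
  by (simp only: right_diff_distrib mult.assoc const_left_comm[of e] const_left_comm[of "const y"])

lemma const_ad:
  "const x * (e * q - q * e - const y * q) = const x * e * q - q * (const x * e) - const (x * y) * q"
  by (simp only: right_diff_distrib mult.assoc const_left_comm[of q] const_mult)

lemma euler_homog:
  assumes "q \<in> homog u" "j \<in> {1..n}"
  shows "euler0 j * q - q * euler0 j - const (of_int (u j)) * q \<in> I0"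
proof -
  let ?W = "\<lambda>w. word (letters w) :: 'k free" and ?c = "\<lambda>w. const (Poly_Mapping.lookup q w) :: 'k free"
  have "(\<Sum>w\<in>Poly_Mapping.keys q. ?c w * (euler0 j * ?W w - ?W w * euler0 j - const (of_int (u j)) * ?W w)) \<in> I0"
    using homog_decomp(2)[OF assms(1)] assms(2) euler_word[of j]
    by (intro I0_sum I0_l F_closed) metis
  also have "(\<Sum>w\<in>Poly_Mapping.keys q. ?c w * (euler0 j * ?W w - ?W w * euler0 j - const (of_int (u j)) * ?W w)) =
     euler0 j * (\<Sum>w\<in>Poly_Mapping.keys q. ?c w * ?W w) - (\<Sum>w\<in>Poly_Mapping.keys q. ?c w * ?W w) * euler0 j
       - const (of_int (u j)) * (\<Sum>w\<in>Poly_Mapping.keys q. ?c w * ?W w)"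
    by (simp only: ad_const sum_subtractf sum_distrib_left sum_distrib_right)
  finally show ?thesis unfolding homog_decomp(1)[OF assms(1), symmetric] .
qed

lemma lin_homog:
  assumes "q \<in> homog u"
  shows "lin c * q - q * lin c - const (pair c u) * q \<in> I0"
proof -
  have "(\<Sum>i=1..n. const (c i) * (euler0 i * q - q * euler0 i - const (of_int (u i)) * q)) \<in> I0"
    using assms by (intro I0_sum I0_l euler_homog) auto
  also have "(\<Sum>i=1..n. const (c i) * (euler0 i * q - q * euler0 i - const (of_int (u i)) * q)) =
      lin c * q - q * lin c - const (pair c u) * q"
    by (simp only: const_ad lin_def pair_def sum_distrib_left sum_distrib_right sum_subtractf const_sum)
  finally show ?thesis .
qed

lemma homog_0_tpoly:
  assumes "q \<in> homog 0"
  shows "\<exists>p\<in>tpoly. q - p \<in> I0"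
proof -
  have "\<forall>w\<in>Poly_Mapping.keys q. \<exists>p\<in>tpoly. word (letters w) - p \<in> I0"
    using homog_decomp(2)[OF assms] weight_zero_word by blast
  then obtain f where f: "\<And>w. w \<in> Poly_Mapping.keys q \<Longrightarrow> f w \<in> tpoly \<and> word (letters w) - f w \<in> I0"
    by metis
  let ?c = "\<lambda>w. const (Poly_Mapping.lookup q w) :: 'k free"
  have "(\<Sum>w\<in>Poly_Mapping.keys q. ?c w * (word (letters w) - f w)) \<in> I0"
    using f by (intro I0_sum I0_l) auto
  also have "(\<Sum>w\<in>Poly_Mapping.keys q. ?c w * (word (letters w) - f w)) =
      (\<Sum>w\<in>Poly_Mapping.keys q. ?c w * word (letters w)) - (\<Sum>w\<in>Poly_Mapping.keys q. ?c w * f w)"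
    by (simp add: right_diff_distrib sum_subtractf)
  finally have "q - (\<Sum>w\<in>Poly_Mapping.keys q. ?c w * f w) \<in> I0"
    unfolding homog_decomp(1)[OF assms, symmetric] .
  moreover have "(\<Sum>w\<in>Poly_Mapping.keys q. ?c w * f w) \<in> tpoly"
    using f by (intro tpoly_sum tpoly_mult tpoly_const) auto
  ultimately show ?thesis by blast
qed

definition comp :: "'k free \<Rightarrow> (nat \<Rightarrow> int) \<Rightarrow> 'k free" where
  "comp p u = (\<Sum>w\<in>{w \<in> Poly_Mapping.keys p. word_weight (letters w) = u}.
     Poly_Mapping.single w (Poly_Mapping.lookup p w))"

definition weights :: "'k free \<Rightarrow> (nat \<Rightarrow> int) set" where
  "weights p = (\<lambda>w. word_weight (letters w)) ` Poly_Mapping.keys p"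

lemma comp_homog:
  assumes "p \<in> carrier F"
  shows "comp p u \<in> homog u"
proof -
  have "Poly_Mapping.lookup (comp p u) w = (if word_weight (letters w) = u then Poly_Mapping.lookup p w else 0)" for w
  proof -
    have "Poly_Mapping.lookup (comp p u) w = (\<Sum>v\<in>{v \<in> Poly_Mapping.keys p. word_weight (letters v) = u}.
        if v = w then Poly_Mapping.lookup p w else 0)"
      unfolding comp_def lookup_sum by (intro sum.cong) (auto simp: lookup_single when_def)
    also have "\<dots> = (if w \<in> Poly_Mapping.keys p \<and> word_weight (letters w) = u then Poly_Mapping.lookup p w else 0)"
      by (subst sum.delta) auto
    finally show ?thesis by (simp add: in_keys_iff)
  qed
  then have "Poly_Mapping.keys (comp p u) = {w \<in> Poly_Mapping.keys p. word_weight (letters w) = u}"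
    by (auto simp: in_keys_iff split: if_splits)
  then show ?thesis using assms by (auto simp: homog_def carrier_F)
qed

lemma sum_comp: "p = (\<Sum>u\<in>weights p. comp p u)"
  unfolding comp_def weights_def
  by (subst sum.image_gen[OF finite_keys, symmetric]) (rule poly_mapping_eq_sum_single)

lemma finite_weights: "finite (weights p)"
  by (simp add: weights_def)

text \<open>For a weight \<open>u\<close> outside \<open>Lam\<close> pick \<open>t \<in> \<gg>\<close> with \<open>u(t) \<noteq> 0\<close>; then \<open>1 - u(t)\<inverse> ad t\<close> fixes an
  invariant, kills its component of weight \<open>u\<close> and fixes the components with weight in \<open>Lam\<close>.\<close>

lemma G0_decomp:
  assumes p: "p \<in> G0"
  shows "p - (\<Sum>u\<in>weights p \<inter> Lam. comp p u) \<in> I0"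
proof -
  let ?X = "\<lambda>k. \<Sum>u\<in>weights p. const (k u) * comp p u"
  have pF: "p \<in> carrier F" using p by (rule G0_F)
  have compF: "comp p u \<in> carrier F" for u using comp_homog[OF pF] by (simp add: homog_def)
  have XF: "?X k \<in> carrier F" for k by (intro F_sum F_closed compF)
  \<comment> \<open>\<open>k u\<close> is the factor that the operators applied so far put on the
    component of weight \<open>u\<close>; each of them kills one more weight outside
    \<open>Lam\<close>.\<close>
  have "\<exists>k. (\<forall>u\<in>weights p \<inter> Lam. k u = 1) \<and> (\<forall>u\<in>B. k u = 0) \<and> p - ?X k \<in> I0"
    if "finite B" "B \<subseteq> weights p - Lam" for B
    using that
  proof (induction B rule: finite_induct)
    case empty
    have "p - ?X (\<lambda>_. 1) \<in> I0" using sum_comp[of p] by simp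
    then show ?case by (intro exI[of _ "\<lambda>_. 1"]) simp
  next
    case (insert v B)
    then obtain k where k: "\<forall>u\<in>weights p \<inter> Lam. k u = 1" "\<forall>u\<in>B. k u = 0" "p - ?X k \<in> I0" by auto
    have "\<forall>i. i \<notin> {1..n} \<longrightarrow> v i = 0"
      using insert.prems pF word_weight_outside by (auto simp: weights_def carrier_F)
    then obtain c where c: "c \<in> coeffs" "pair c v \<noteq> 0" using insert.prems by (auto simp: Lam_def)
    let ?Y = "\<Sum>u\<in>weights p. const (k u * pair c u) * comp p u"
    have "(\<Sum>u\<in>weights p. const (k u) * (lin c * comp p u - comp p u * lin c - const (pair c u) * comp p u)) \<in> I0"
      by (intro I0_sum I0_l lin_homog comp_homog pF F_closed)
    also have "(\<Sum>u\<in>weights p. const (k u) * (lin c * comp p u - comp p u * lin c - const (pair c u) * comp p u)) =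
        (lin c * ?X k - ?X k * lin c) - ?Y"
    proof -
      have "const y * (const x * q) = const (x * y) * q" for x y q
        by (simp only: const_mult const_left_comm[of "const y"] mult.assoc)
      then show ?thesis by (simp only: ad_const sum_subtractf sum_distrib_left sum_distrib_right)
    qed
    finally have 1: "(lin c * ?X k - ?X k * lin c) - ?Y \<in> I0" .
    have "(lin c * p - p * lin c) - (lin c * (p - ?X k) - (p - ?X k) * lin c) \<in> I0"
      using p c
      by (intro I0_diff[OF _ I0_diff[OF I0_l[OF k(3) F_lin] I0_r[OF k(3) F_lin]]]) (simp add: G0_def)
    then have 2: "lin c * ?X k - ?X k * lin c \<in> I0" by (simp add: algebra_simps)
    have Y: "?Y \<in> I0" using I0_diff[OF 2 1] by simp
    let ?k = "\<lambda>u. k u * (1 - pair c u / pair c v)"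
    have "?X ?k = ?X k - const (1 / pair c v) * ?Y"
    proof -
      have "const (?k u) * comp p u = const (k u) * comp p u -
          const (1 / pair c v) * (const (k u * pair c u) * comp p u)" for u
      proof -
        have "?k u = k u - (1 / pair c v) * (k u * pair c u)" by (simp add: algebra_simps)
        then show ?thesis by (simp only: const_diff const_mult left_diff_distrib mult.assoc)
      qed
      then show ?thesis by (simp add: sum_subtractf sum_distrib_left)
    qed
    then have "p - ?X ?k = (p - ?X k) + const (1 / pair c v) * ?Y" by (simp only: diff_diff_eq2 add_diff_eq diff_add_eq)
    then have "p - ?X ?k \<in> I0" using I0_add[OF k(3) I0_l[OF Y F_closed(2)]] by (simp only:)
    then show ?case
      using k c by (intro exI[of _ ?k]) (auto simp: Lam_def)
  qed
  from this[of "weights p - Lam"] finite_weights obtain k where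
    k: "\<forall>u\<in>weights p \<inter> Lam. k u = 1" "\<forall>u\<in>weights p - Lam. k u = 0" "p - ?X k \<in> I0" by auto
  have "?X k = (\<Sum>u\<in>weights p \<inter> Lam. const (k u) * comp p u)"
    using k(2) finite_weights by (intro sum.mono_neutral_right) auto
  also have "\<dots> = (\<Sum>u\<in>weights p \<inter> Lam. comp p u)"
    using k(1) by (intro sum.cong) auto
  finally show ?thesis using k(3) by simp
qed

subsection \<open>The weights of the simple module\<close>

abbreviation T :: "nat set" where "T \<equiv> integral_idx r \<alpha>"

definition S :: "(nat \<Rightarrow> int) set" where
  "S = {b \<in> Lam. \<forall>i\<in>T. (0 \<le> \<alpha> i + of_int (b i)) = (0 \<le> \<alpha> i)}"

lemma S_0: "0 \<in> S"
  by (simp add: S_def Lam_closed)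

lemma S_Lam: "b \<in> S \<Longrightarrow> b \<in> Lam"
  by (simp add: S_def)

text \<open>For \<open>i \<le> r\<close> a coordinate is lowered by \<open>Der i\<close> alone, and
  the coefficient of \<open>Der i\<close> vanishes where the coordinate is 0. So a nonnegative
  integral coordinate cannot become negative.\<close>

lemma word_coeff_nonneg:
  assumes "set w \<subseteq> gens r s" "i \<in> T" "0 \<le> \<alpha> i + of_int (b i)" "word_coeff ak w b \<noteq> 0"
  shows "0 \<le> \<alpha> i + of_int ((b + word_weight w) i)"
  using assms
proof (induction w)
  case (Cons l w)
  let ?b = "b + word_weight w"
  have IH: "0 \<le> \<alpha> i + of_int (?b i)" using Cons by simp
  have nz: "gen_coeff ak l ?b \<noteq> 0" using Cons.prems by simp
  show ?case
  proof (cases "l = Der i")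
    case True
    obtain z where z: "\<alpha> i = of_int z" using Cons.prems(2) by (auto simp: integral_idx_def elim: Ints_cases)
    have "(of_rat (\<alpha> i + of_int (?b i)) :: 'k) \<noteq> 0"
      using nz True by (simp add: of_rat_add)
    then have "\<alpha> i + of_int (?b i) \<noteq> 0" by (metis of_rat_0)
    with IH have "1 \<le> z + ?b i" by (simp add: z flip: of_int_add)
    then have "0 \<le> z + (?b i - 1)" by simp
    then have "(0::rat) \<le> of_int (z + (?b i - 1))" by (simp only: of_int_0_le_iff)
    then show ?thesis using True by (simp add: z gen_weight_def algebra_simps)
  next
    case False
    have "l \<noteq> VarInv i" using Cons.prems(1,2) by (auto simp: gens_iff integral_idx_def)
    then have "0 \<le> gen_weight l i" using False by (cases l) (auto simp: gen_weight_def)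
    then have "(0::rat) \<le> of_int (gen_weight l i)" by simp
    then show ?thesis using IH by simp
  qed
qed simp

lemma entry_nonneg:
  assumes p: "p \<in> carrier F" and i: "i \<in> T" "0 \<le> \<alpha> i + of_int (b i)" and nz: "entry ak p b' b \<noteq> 0"
  shows "0 \<le> \<alpha> i + of_int (b' i)"
proof -
  from sum.not_neutral_contains_not_neutral[OF nz[unfolded entry_def act_def]]
  obtain w where w: "w \<in> Poly_Mapping.keys p"
    "Poly_Mapping.lookup p w * word_coeff ak (letters w) b * (if b + word_weight (letters w) = b' then 1 else 0) \<noteq> 0"
    by blast
  then have "word_coeff ak (letters w) b \<noteq> 0" "b' = b + word_weight (letters w)"
    by (auto split: if_splits)
  then show ?thesis
    using word_coeff_nonneg[of "letters w" i b] p i w(1) by (simp add: carrier_F)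
qed

text \<open>The weights in \<open>S\<close> span a subquotient, so the truncated matrices still multiply.\<close>

lemma entry_mult_S:
  assumes p: "p \<in> G0" and q: "q \<in> G0" and b: "b \<in> S" "b'' \<in> S"
  shows "entry ak (p * q) b'' b = (\<Sum>b'\<in>targets q b \<inter> S. entry ak p b'' b' * entry ak q b' b)"
proof -
  have "entry ak p b'' b' * entry ak q b' b = 0" if b': "b' \<notin> S" for b'
  proof (rule ccontr)
    assume "entry ak p b'' b' * entry ak q b' b \<noteq> 0"
    then have nz: "entry ak p b'' b' \<noteq> 0" "entry ak q b' b \<noteq> 0" by auto
    have "(b' - b) + b \<in> Lam" using entry_G0_Lam[OF q nz(2)] b(1) S_Lam by blast
    then have "b' \<in> Lam" by simp
    then obtain i where i: "i \<in> T" "(0 \<le> \<alpha> i + of_int (b' i)) \<noteq> (0 \<le> \<alpha> i)"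
      using b' by (auto simp: S_def)
    show False
    proof (cases "0 \<le> \<alpha> i")
      case True
      then have "0 \<le> \<alpha> i + of_int (b i)" using b(1) i(1) by (auto simp: S_def)
      then show False using entry_nonneg[OF G0_F[OF q] i(1) _ nz(2)] i True by simp
    next
      case False
      then have "0 \<le> \<alpha> i + of_int (b'' i)" using entry_nonneg[OF G0_F[OF p] i(1) _ nz(1)] i by simp
      then show False using b(2) i(1) False by (auto simp: S_def)
    qed
  qed
  then show ?thesis
    unfolding entry_mult by (intro sum.mono_neutral_right finite_targets) auto
qed

text \<open>Coordinates are raised by \<open>Var\<close> and lowered by \<open>Der\<close> for
  \<open>i \<le> r\<close> and by \<open>VarInv\<close> otherwise. The coefficient of
  \<open>Der i\<close> vanishes only on the step from 0 to -1, which the condition on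
  \<open>b\<close> rules out.\<close>

lemma monomial_word:
  assumes "\<forall>i. i \<notin> {1..n} \<longrightarrow> u i = 0"
  shows "\<exists>w. set w \<subseteq> gens r s \<and> word_weight w = u \<and>
    (\<forall>b. (\<forall>i\<in>T. 0 \<le> \<alpha> i + of_int (b i) \<longrightarrow> 0 \<le> \<alpha> i + of_int (b i) + of_int (u i)) \<longrightarrow>
      word_coeff ak w b \<noteq> 0)"
  using assms
proof (induction "\<Sum>i=1..n. nat \<bar>u i\<bar>" arbitrary: u rule: less_induct)
  case less
  show ?case
  proof (cases "u = 0")
    case True
    then show ?thesis by (intro exI[of _ "[]"]) simp
  next
    case False
    then obtain i where i: "u i \<noteq> 0" by (auto simp: fun_eq_iff)
    then have iN: "i \<in> {1..n}" using less.prems by blast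
    define l where "l = (if 0 < u i then Var i else if i \<le> r then Der i else VarInv i)"
    define u' where "u' = u - gen_weight l"
    have l: "l \<in> gens r s" "gen_index l = i" "gen_sign l = sgn (u i)"
      using iN i by (auto simp: l_def gens_iff)
    have u': "u' j = (if j = i then u i - sgn (u i) else u j)" for j
      using l by (simp add: u'_def gen_weight_def)
    have "(\<Sum>j=1..n. nat \<bar>u' j\<bar>) < (\<Sum>j=1..n. nat \<bar>u j\<bar>)"
      using iN i by (intro sum_strict_mono_ex1) (auto simp: u' sgn_if intro!: bexI[of _ i])
    moreover have "\<forall>i. i \<notin> {1..n} \<longrightarrow> u' i = 0" using less.prems iN by (auto simp: u')
    ultimately obtain w where w: "set w \<subseteq> gens r s" "word_weight w = u'"
      "\<And>b. (\<forall>i\<in>T. 0 \<le> \<alpha> i + of_int (b i) \<longrightarrow> 0 \<le> \<alpha> i + of_int (b i) + of_int (u' i)) \<Longrightarrow>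
        word_coeff ak w b \<noteq> 0"
      using less.hyps[of u'] by blast
    have "word_coeff ak (l # w) b \<noteq> 0"
      if b: "\<forall>i\<in>T. 0 \<le> \<alpha> i + of_int (b i) \<longrightarrow> 0 \<le> \<alpha> i + of_int (b i) + of_int (u i)" for b
    proof -
      have "word_coeff ak w b \<noteq> 0"
      proof (rule w(3), intro ballI impI)
        fix j assume j: "j \<in> T" "0 \<le> \<alpha> j + of_int (b j)"
        show "0 \<le> \<alpha> j + of_int (b j) + of_int (u' j)"
        proof (cases "j = i \<and> 0 < u i")
          case True
          then have "0 \<le> u' j" by (simp add: u')
          then have "(0::rat) \<le> of_int (u' j)" by simp
          then show ?thesis using j by linarith
        next
          case False
          then have "u j \<le> u' j" using i by (auto simp: u' sgn_if)
          then have "of_int (u j) \<le> (of_int (u' j) :: rat)" by simp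
          then show ?thesis using bspec[OF b j(1)] j(2) by linarith
        qed
      qed
      moreover have "gen_coeff ak l (b + word_weight w) \<noteq> 0"
      proof (cases "0 < u i \<or> r < i")
        case True
        then show ?thesis by (auto simp: l_def)
      next
        case neg: False
        then have ld: "l = Der i" "u' i = u i + 1" "i \<le> r" using i by (auto simp: l_def u')
        show ?thesis
        proof
          assume "gen_coeff ak l (b + word_weight w) = 0"
          then have "(of_rat (\<alpha> i + of_int (b i + u' i)) :: 'k) = of_rat 0"
            using ld w(2) by (simp add: of_rat_add)
          then have z: "\<alpha> i + of_int (b i + u' i) = 0" by (simp only: of_rat_eq_iff)
          then have "\<alpha> i = of_int (- (b i + u' i))" by (simp add: eq_neg_iff_add_eq_0)
          then have "i \<in> T" using iN ld by (auto simp: integral_idx_def)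
          moreover have "(0::rat) \<le> of_int (- u' i)" using neg i ld by (simp only: of_int_0_le_iff) simp
          then have "0 \<le> \<alpha> i + of_int (b i)" using z by simp
          ultimately have "0 \<le> \<alpha> i + of_int (b i) + of_int (u i)" using b by blast
          then show False using z ld by simp
        qed
      qed
      ultimately show ?thesis by simp
    qed
    moreover have "word_weight (l # w) = u"
      unfolding word_weight.simps w(2) u'_def by (rule add_diff_cancel_left'[symmetric, THEN sym, THEN trans[rotated]]) simp
    ultimately show ?thesis using l w by (intro exI[of _ "l # w"]) auto
  qed
qed

lemma monomial:
  assumes "u \<in> Lam"
  shows "\<exists>m. m \<in> G0 \<and> m \<in> homog u \<and> (\<forall>b\<in>S. b + u \<in> S \<longrightarrow> entry ak m (b + u) b \<noteq> 0)"
proof -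
  obtain w where w: "set w \<subseteq> gens r s" "word_weight w = u"
    "\<And>b. (\<forall>i\<in>T. 0 \<le> \<alpha> i + of_int (b i) \<longrightarrow> 0 \<le> \<alpha> i + of_int (b i) + of_int (u i)) \<Longrightarrow>
      word_coeff ak w b \<noteq> 0"
    using monomial_word[of u] assms by (auto simp: Lam_def)
  have "entry ak (word w) (b + u) b \<noteq> 0" if b: "b \<in> S" "b + u \<in> S" for b
  proof -
    have "word_coeff ak w b \<noteq> 0"
      by (rule w(3)) (use b in \<open>auto simp: S_def add.assoc\<close>)
    then show ?thesis using w(2) by (simp add: entry_word)
  qed
  then show ?thesis
    using word_G0[of w] word_homog[of w] w(1,2) assms by (intro exI[of _ "word w"]) auto
qed

text \<open>\<open>K\<close> is the preimage of the maximal left ideal with quotient \<open>L(\<alpha>)\<close>, and \<open>Ker\<close> is the preimage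
  of the annihilator.\<close>

definition K :: "'k free set" where "K = {p \<in> G0. \<forall>b\<in>S. entry ak p b 0 = 0}"

definition Ker :: "'k free set" where "Ker = {p \<in> G0. \<forall>b\<in>S. \<forall>b'\<in>S. entry ak p b' b = 0}"

lemma K_left: "\<lbrakk>q \<in> G0; p \<in> K\<rbrakk> \<Longrightarrow> q * p \<in> K"
  unfolding K_def by (auto simp: entry_mult_S S_0 G0_mult intro!: sum.neutral)

lemma K_add: "\<lbrakk>q \<in> K; p \<in> K\<rbrakk> \<Longrightarrow> q + p \<in> K"
  unfolding K_def by (auto simp: entry_add G0_add)

text \<open>Column 0 of \<open>p * m\<close>, for a monomial \<open>m\<close> of weight
  \<open>b\<close>, is column \<open>b\<close> of \<open>p\<close> up to a nonzero factor. So
  \<open>K\<close>, which sees column 0 only, detects all columns over \<open>S\<close> after right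
  multiplication.\<close>

lemma Ker_iff:
  assumes p: "p \<in> G0"
  shows "p \<in> Ker \<longleftrightarrow> (\<forall>q\<in>G0. p * q \<in> K)"
proof
  assume "p \<in> Ker"
  then show "\<forall>q\<in>G0. p * q \<in> K"
    by (auto simp: Ker_def K_def entry_mult_S S_0 G0_mult intro!: sum.neutral)
next
  assume *: "\<forall>q\<in>G0. p * q \<in> K"
  have "entry ak p b' b = 0" if b: "b \<in> S" "b' \<in> S" for b b'
  proof -
    obtain m where m: "m \<in> G0" "m \<in> homog b" "entry ak m b 0 \<noteq> 0"
      using monomial[OF S_Lam[OF b(1)]] b S_0 by (auto dest!: bspec[of S _ 0])
    have "0 = entry ak (p * m) b' 0" using * m b by (auto simp: K_def)
    also have "\<dots> = (\<Sum>x\<in>targets m 0 \<inter> S. entry ak p b' x * entry ak m x 0)"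
      by (rule entry_mult_S[OF p m(1) S_0 b(2)])
    also have "\<dots> = (\<Sum>x\<in>targets m 0 \<inter> S. if x = b then entry ak p b' b * entry ak m b 0 else 0)"
      using entry_homog[OF m(2), of _ 0] by (intro sum.cong) auto
    also have "\<dots> = entry ak p b' b * entry ak m b 0"
      using b(1) entry_eq_0[of b m 0 ak] m(3) by (auto simp: finite_targets)
    finally show ?thesis using m(3) by simp
  qed
  then show "p \<in> Ker" using p by (simp add: Ker_def)
qed

text \<open>A left ideal containing \<open>\<pi>\<^sub>i - \<alpha>\<^sub>i\<close> contains the homogeneous components of its elements, which
  are eigenvectors modulo the ideal.\<close>

lemma separate_weights:
  assumes K: "\<And>p q. \<lbrakk>p \<in> K'; q \<in> K'\<rbrakk> \<Longrightarrow> p + q \<in> K'" "\<And>p q. \<lbrakk>p \<in> G0; q \<in> K'\<rbrakk> \<Longrightarrow> p * q \<in> K'"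
    and V: "finite V" "v \<notin> V"
    and outside: "\<And>u i. \<lbrakk>u \<in> insert v V; i \<notin> {1..n}\<rbrakk> \<Longrightarrow> u i = 0"
    and a: "\<And>u i. \<lbrakk>u \<in> insert v V; i \<in> {1..n}\<rbrakk> \<Longrightarrow> euler0 i * a u - const (ak i + of_int (u i)) * a u \<in> K'"
    and sum: "(\<Sum>u\<in>insert v V. a u) \<in> K'"
  shows "a v \<in> K'"
  using V outside a sum
proof (induction V arbitrary: a rule: finite_induct)
  case (insert x V)
  have neg: "- p \<in> K'" if "p \<in> K'" for p
    using K(2)[OF G0_const[of "-1"] that] by (simp add: const_uminus)
  have Ksum: "sum f A \<in> K'" if "finite A" "A \<noteq> {}" "\<And>i. i \<in> A \<Longrightarrow> f i \<in> K'" for f and A :: "(nat \<Rightarrow> int) set"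
    using that by (induction A rule: finite_ne_induct) (auto intro: K(1))
  obtain i where ne: "x i \<noteq> v i" using insert.prems(1) by (metis ext insertI1)
  then have i: "i \<in> {1..n}" using insert.prems(2)[of x i] insert.prems(2)[of v i] by auto
  \<comment> \<open>Modulo the ideal, \<open>e\<close> annihilates the summand \<open>a x\<close>
    and multiplies every other \<open>a u\<close> by \<open>u i - x i\<close>, which is nonzero at
    \<open>v\<close>.\<close>
  define e where "e = euler0 i - const (ak i + of_int (x i))"
  have e: "e \<in> G0" unfolding e_def by (intro G0_diff euler0_G0 G0_const i)
  let ?U = "insert v (insert x V)"
  define a' where "a' u = const (of_int (u i - x i)) * a u" for u
  have "e * (\<Sum>u\<in>?U. a u) + - (\<Sum>u\<in>?U. euler0 i * a u - const (ak i + of_int (u i)) * a u) \<in> K'"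
    using insert.prems(3) i insert.hyps by (intro K(1)[OF K(2)[OF e insert.prems(4)] neg[OF Ksum]]) auto
  also have "e * (\<Sum>u\<in>?U. a u) + - (\<Sum>u\<in>?U. euler0 i * a u - const (ak i + of_int (u i)) * a u) = (\<Sum>u\<in>?U. a' u)"
    unfolding e_def a'_def sum_distrib_left sum_negf[symmetric] sum.distrib[symmetric]
    by (intro sum.cong refl) (simp add: algebra_simps const_add const_diff)
  also have "(\<Sum>u\<in>?U. a' u) = (\<Sum>u\<in>insert v V. a' u)"
  proof -
    have "(\<Sum>u\<in>?U. a' u) = (\<Sum>u\<in>insert x (insert v V). a' u)" by (simp only: insert_commute)
    also have "\<dots> = a' x + (\<Sum>u\<in>insert v V. a' u)"
      using insert.hyps insert.prems(1) by (intro sum.insert) auto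
    also have "a' x = 0" by (simp add: a'_def)
    finally show ?thesis by simp
  qed
  finally have s: "(\<Sum>u\<in>insert v V. a' u) \<in> K'" .
  have "euler0 j * a' u - const (ak j + of_int (u j)) * a' u \<in> K'" if "u \<in> insert v V" "j \<in> {1..n}" for u j
  proof -
    have "const (of_int (u i - x i)) * (euler0 j * a u - const (ak j + of_int (u j)) * a u) \<in> K'"
      using that insert.prems by (intro K(2) G0_const) auto
    also have "const (of_int (u i - x i)) * (euler0 j * a u - const (ak j + of_int (u j)) * a u) =
        euler0 j * a' u - const (ak j + of_int (u j)) * a' u"
      unfolding a'_def right_diff_distrib const_left_comm[of "euler0 j"]
        const_left_comm[of "const (ak j + of_int (u j))"] ..
    finally show ?thesis .
  qed
  note eig = this
  have "a' v \<in> K'"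
  proof (rule insert.IH[OF _ _ eig s])
    show "v \<notin> V" using insert.prems(1) by simp
    show "u i = 0" if "u \<in> insert v V" "i \<notin> {1..n}" for u i
      by (rule insert.prems(2)) (use that in auto)
  qed
  then have "const (1 / of_int (v i - x i)) * a' v \<in> K'" by (intro K(2) G0_const)
  also have "const (1 / of_int (v i - x i)) * a' v = a v"
  proof -
    have "(1 / of_int (v i - x i)) * of_int (v i - x i) = (1::'k)" using ne by simp
    then show ?thesis unfolding a'_def mult.assoc[symmetric] const_mult[symmetric] by simp
  qed
  finally show ?case .
qed simp

lemma tpoly_mod_left_ideal:
  assumes K: "\<And>p q. \<lbrakk>p \<in> K'; q \<in> K'\<rbrakk> \<Longrightarrow> p + q \<in> K'" "\<And>p q. \<lbrakk>p \<in> G0; q \<in> K'\<rbrakk> \<Longrightarrow> p * q \<in> K'"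
    and 0: "0 \<in> K'" and e: "\<And>i. i \<in> {1..n} \<Longrightarrow> euler0 i - const (ak i) \<in> K'"
    and p: "p \<in> tpoly"
  shows "p - const (entry ak p 0 0) \<in> K'"
  using p
proof (induction rule: tpoly.induct)
  case (tpoly_const c)
  then show ?case using 0 by (simp add: entry_def act_const)
next
  case (tpoly_euler i)
  then show ?case using e by (simp add: entry_def act_euler0)
next
  case (tpoly_add p q)
  show ?case using K(1)[OF tpoly_add.IH] by (simp add: entry_add const_add algebra_simps)
next
  case (tpoly_mult p q)
  have "entry ak (p * q) 0 0 = entry ak p 0 0 * entry ak q 0 0"
  proof -
    note A = act_tpoly[OF tpoly_mult.hyps(2), of _ 0]
    have "entry ak (p * q) 0 0 = act ak q (\<lambda>_. 1) 0 * entry ak p 0 0"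
      unfolding entry_def act_mult by (rule A)
    moreover have "entry ak q 0 0 = act ak q (\<lambda>_. 1) 0"
      unfolding entry_def by (rule trans[OF A]) simp
    ultimately show ?thesis by (simp add: mult.commute)
  qed
  moreover have "p * (q - const (entry ak q 0 0)) + const (entry ak q 0 0) * (p - const (entry ak p 0 0)) \<in> K'"
    using tpoly_mult by (intro K G0_const tpoly_G0)
  moreover have "p * (q - const (entry ak q 0 0)) + const (entry ak q 0 0) * (p - const (entry ak p 0 0)) =
      p * q - const (entry ak p 0 0 * entry ak q 0 0)"
    by (simp add: right_diff_distrib const_comm[of "entry ak q 0 0" p] mult_single mult.commute)
  ultimately show ?case by (simp only:)
qed

text \<open>Suppose an element of \<open>K'\<close> has a nonzero entry at \<open>(b, 0)\<close>
  with \<open>b \<in> S\<close>. Its component of weight \<open>b\<close> lies in \<open>K'\<close>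
  by \<open>separate_weights\<close>, and a monomial of weight \<open>- b\<close> with nonzero entry
  from \<open>b\<close> to 0 brings it back to weight 0. There it is a polynomial in the Euler
  operators, hence a nonzero scalar modulo \<open>K'\<close>, and 1 would lie in
  \<open>K'\<close>.\<close>

lemma K_maximal:
  assumes K: "\<And>p q. \<lbrakk>p \<in> K'; q \<in> K'\<rbrakk> \<Longrightarrow> p + q \<in> K'" "\<And>p q. \<lbrakk>p \<in> G0; q \<in> K'\<rbrakk> \<Longrightarrow> p * q \<in> K'"
    and sub: "K' \<subseteq> G0" and I0: "I0 \<subseteq> K'"
    and e: "\<And>i. i \<in> {1..n} \<Longrightarrow> euler0 i - const (ak i) \<in> K'" and 1: "1 \<notin> K'"
  shows "K' \<subseteq> K"
proof
  fix p assume p: "p \<in> K'"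
  have pG: "p \<in> G0" and pF: "p \<in> carrier F" using p sub G0_F by auto
  have neg: "- p \<in> K'" if "p \<in> K'" for p
    using K(2)[OF G0_const[of "-1"] that] by (simp add: const_uminus)
  have minus: "p - q \<in> K'" if "p \<in> K'" "q \<in> K'" for p q
    using K(1)[OF that(1) neg[OF that(2)]] by simp
  show "p \<in> K"
  proof (rule ccontr)
    assume "p \<notin> K"
    then obtain b where b: "b \<in> S" "entry ak p b 0 \<noteq> 0" using pG by (auto simp: K_def)
    let ?U = "weights p \<inter> Lam"
    have dec: "p - (\<Sum>u\<in>?U. comp p u) \<in> I0" by (rule G0_decomp[OF pG])
    have ent: "entry ak p b 0 = (\<Sum>u\<in>?U. entry ak (comp p u) b 0)"
      using entry_cong_I0[OF dec] by (simp add: entry_sum)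
    have "entry ak (comp p u) b 0 = 0" if "u \<noteq> b" for u
      using entry_homog[OF comp_homog[OF pF], of b 0 u] that by simp
    moreover obtain u where "u \<in> ?U" "entry ak (comp p u) b 0 \<noteq> 0"
      using b(2) unfolding ent by (rule sum.not_neutral_contains_not_neutral)
    ultimately have "b \<in> ?U" "entry ak (comp p b) b 0 \<noteq> 0" by metis+
    define q where "q = comp p b"
    have sumK: "(\<Sum>u\<in>insert b (?U - {b}). comp p u) \<in> K'"
      using minus[OF p subsetD[OF I0 dec]] by (simp only: insert_Diff[OF \<open>b \<in> ?U\<close>]) simp
    have cG: "comp p u \<in> G0" if "u \<in> Lam" for u
    proof -
      have "lin c * comp p u - comp p u * lin c \<in> I0" if "c \<in> coeffs" for c
        using lin_homog[OF comp_homog[OF pF], of c u] \<open>u \<in> Lam\<close> that by (simp add: Lam_def)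
      then show ?thesis using comp_homog[OF pF, of u] by (simp add: G0_def homog_def)
    qed
    have "q \<in> K'"
      unfolding q_def
    proof (rule separate_weights[OF K _ _ _ _ sumK])
      fix u i assume u: "u \<in> insert b (?U - {b})" and i: "i \<in> {1..n}"
      have uL: "u \<in> Lam" using u \<open>b \<in> ?U\<close> by auto
      have "(euler0 i * comp p u - comp p u * euler0 i - const (of_int (u i)) * comp p u) +
          comp p u * (euler0 i - const (ak i)) \<in> K'"
        using euler_homog[OF comp_homog[OF pF] i, of u] I0 cG[OF uL] e[OF i] by (intro K) auto
      then show "euler0 i * comp p u - const (ak i + of_int (u i)) * comp p u \<in> K'"
        by (simp add: algebra_simps const_add const_comm[of "ak i"])
    qed (use \<open>b \<in> ?U\<close> finite_weights in \<open>auto simp: Lam_def\<close>)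
    obtain m where m: "m \<in> G0" "m \<in> homog (- b)" "entry ak m 0 b \<noteq> 0"
      using monomial[OF Lam_closed(4)[OF S_Lam[OF b(1)]]] b(1) S_0 by (auto dest!: bspec[of S _ b])
    have mq: "m * q \<in> K'" using K(2)[OF m(1) \<open>q \<in> K'\<close>] .
    have "m * q \<in> homog 0" using homog_mult[OF m(2) comp_homog[OF pF, of b]] by (simp add: q_def)
    then obtain t where t: "t \<in> tpoly" "m * q - t \<in> I0" using homog_0_tpoly by blast
    have tK: "t - const (entry ak t 0 0) \<in> K'"
      using I0 I0_0 by (intro tpoly_mod_left_ideal[OF K _ e t(1)]) auto
    have "t \<in> K'" using minus[OF mq subsetD[OF I0 t(2)]] by simp
    then have cK: "const (entry ak t 0 0) \<in> K'" using minus[OF _ tK, of t] by simp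
    have "entry ak t 0 0 = entry ak (m * q) 0 0" using entry_cong_I0[OF t(2)] by simp
    also have "\<dots> = (\<Sum>x\<in>targets q 0. entry ak m 0 x * entry ak q x 0)" by (rule entry_mult)
    also have "\<dots> = (\<Sum>x\<in>targets q 0. if x = b then entry ak m 0 b * entry ak q b 0 else 0)"
      using entry_homog[OF comp_homog[OF pF, of b], of _ 0] by (intro sum.cong) (auto simp: q_def)
    also have "\<dots> = entry ak m 0 b * entry ak q b 0"
      using entry_eq_0[of b q 0 ak] by (auto simp: finite_targets)
    finally have "entry ak t 0 0 \<noteq> 0" using m(3) \<open>entry ak (comp p b) b 0 \<noteq> 0\<close> by (simp add: q_def)
    then have "const (1 / entry ak t 0 0) * const (entry ak t 0 0) = 1" by (simp add: mult_single)
    then show False using K(2)[OF G0_const cK] 1 by metis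
  qed
qed

end

section \<open>The primitive quotient\<close>

lemma (in ring) generated_submodule_left_ideal:
  assumes "H \<subseteq> carrier R"
  shows "left_ideal (generated_submodule R (left_regular R) H) R"
    and "H \<subseteq> generated_submodule R (left_regular R) H"
    and "\<lbrakk>left_ideal I R; H \<subseteq> I\<rbrakk> \<Longrightarrow> generated_submodule R (left_regular R) H \<subseteq> I"
proof -
  have eq: "generated_submodule R (left_regular R) H = \<Inter>{I. left_ideal I R \<and> H \<subseteq> I}"
    by (simp add: generated_submodule_def left_ideal_def)
  have "left_ideal (carrier R) R" by (simp add: left_ideal_iff)
  then have ne: "carrier R \<in> {I. left_ideal I R \<and> H \<subseteq> I}" using assms by simp
  have in_ideal: "\<zero> \<in> I" "\<lbrakk>x \<in> I; y \<in> I\<rbrakk> \<Longrightarrow> x \<oplus> y \<in> I" "\<lbrakk>a \<in> carrier R; x \<in> I\<rbrakk> \<Longrightarrow> a \<otimes> x \<in> I"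
    if "left_ideal I R" for I a x y
    using that by (simp_all add: left_ideal_iff)
  show "left_ideal (generated_submodule R (left_regular R) H) R"
    unfolding eq left_ideal_iff[of "\<Inter> _"]
  proof (intro conjI ballI)
    show "\<Inter> {I. left_ideal I R \<and> H \<subseteq> I} \<subseteq> carrier R" using ne by (rule Inter_lower)
  qed (use in_ideal in auto)
  show "H \<subseteq> generated_submodule R (left_regular R) H" unfolding eq by blast
  show "\<lbrakk>left_ideal I R; H \<subseteq> I\<rbrakk> \<Longrightarrow> generated_submodule R (left_regular R) H \<subseteq> I"
    unfolding eq by blast
qed

lemma (in ring) ideal_quotient_left_ideal:
  assumes P: "left_ideal P R"
  shows "ideal {a \<in> carrier R. \<forall>b\<in>carrier R. a \<otimes> b \<in> P} R" (is "ideal ?J R")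
proof -
  have P': "P \<subseteq> carrier R" "\<zero> \<in> P" "\<And>x y. \<lbrakk>x \<in> P; y \<in> P\<rbrakk> \<Longrightarrow> x \<oplus> y \<in> P"
    "\<And>a x. \<lbrakk>a \<in> carrier R; x \<in> P\<rbrakk> \<Longrightarrow> a \<otimes> x \<in> P"
    using P unfolding left_ideal_iff by blast+
  have neg: "\<ominus> x \<in> P" if "x \<in> P" for x
  proof -
    have "\<ominus> x = (\<ominus> \<one>) \<otimes> x" using that P'(1) by (metis l_minus l_one one_closed subsetD)
    then show ?thesis using P'(4)[of "\<ominus> \<one>" x] that by simp
  qed
  show ?thesis
  proof (rule idealI[OF ring_axioms])
    show "subgroup ?J (add_monoid R)"
    proof (rule subgroup.intro)
      fix x assume x: "x \<in> ?J"
      then have "\<ominus> x \<in> ?J" by (auto simp: l_minus neg)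
      then show "inv\<^bsub>add_monoid R\<^esub> x \<in> ?J" by (simp add: a_inv_def)
    qed (auto simp: P' l_distr)
  next
    fix a x assume "a \<in> ?J" "x \<in> carrier R"
    then show "x \<otimes> a \<in> ?J" by (auto simp: m_assoc P'(4))
  next
    fix a x assume "a \<in> ?J" "x \<in> carrier R"
    then show "a \<otimes> x \<in> ?J" by (auto simp: m_assoc)
  qed
qed

context weyl_data
begin

abbreviation W :: "'k weyl ring" where "W \<equiv> weyl_alg r s"
abbreviation wc :: "'k free \<Rightarrow> 'k weyl" where "wc \<equiv> weyl_class r s"
abbreviation A :: "'k weyl ring" where "A \<equiv> invariants r s \<gg>"

lemma W_eq: "W = F Quot I0"
  by (simp add: weyl_alg_def I0_def)

lemma wc_eq: "wc p = I0 +>\<^bsub>F\<^esub> p"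
  by (simp add: weyl_class_def I0_def)

lemma ring_W: "ring W"
  unfolding W_eq by (rule ideal.quotient_is_ring[OF ideal_I0])

lemma wc_hom: "ring_hom_ring F W wc"
  unfolding W_eq wc_eq[abs_def] by (rule ideal.rcos_ring_hom_ring[OF ideal_I0])

lemma wc_carrier: "carrier W = wc ` carrier F"
  by (auto simp: W_eq wc_eq[abs_def] FactRing_def A_RCOSETS_def')

lemma wc_simps:
  "\<lbrakk>p \<in> carrier F; q \<in> carrier F\<rbrakk> \<Longrightarrow> wc p \<oplus>\<^bsub>W\<^esub> wc q = wc (p + q)"
  "\<lbrakk>p \<in> carrier F; q \<in> carrier F\<rbrakk> \<Longrightarrow> wc p \<otimes>\<^bsub>W\<^esub> wc q = wc (p * q)"
  "p \<in> carrier F \<Longrightarrow> \<ominus>\<^bsub>W\<^esub> wc p = wc (- p)"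
  "\<lbrakk>p \<in> carrier F; q \<in> carrier F\<rbrakk> \<Longrightarrow> wc p \<ominus>\<^bsub>W\<^esub> wc q = wc (p - q)"
  "\<zero>\<^bsub>W\<^esub> = wc 0" "\<one>\<^bsub>W\<^esub> = wc 1"
proof -
  interpret h: ring_hom_ring F W wc by (rule wc_hom)
  show 1: "wc p \<oplus>\<^bsub>W\<^esub> wc q = wc (p + q)" if "p \<in> carrier F" "q \<in> carrier F" for p q
    using h.hom_add[OF that] by simp
  show "wc p \<otimes>\<^bsub>W\<^esub> wc q = wc (p * q)" if "p \<in> carrier F" "q \<in> carrier F" for p q
    using h.hom_mult[OF that] by simp
  show 2: "\<ominus>\<^bsub>W\<^esub> wc p = wc (- p)" if "p \<in> carrier F" for p
    using h.hom_a_inv[OF that] that by simp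
  show "wc p \<ominus>\<^bsub>W\<^esub> wc q = wc (p - q)" if "p \<in> carrier F" "q \<in> carrier F" for p q
    unfolding a_minus_def using 1[of p "- q"] 2[of q] that by simp
  show "\<zero>\<^bsub>W\<^esub> = wc 0" using h.hom_zero by simp
  show "\<one>\<^bsub>W\<^esub> = wc 1" using h.hom_one by simp
qed

lemma wc_0_iff: "p \<in> carrier F \<Longrightarrow> wc p = \<zero>\<^bsub>W\<^esub> \<longleftrightarrow> p \<in> I0"
  using ideal.rcos_const_imp_mem[OF ideal_I0, of p] ring.a_rcos_zero[OF ring_F ideal_I0, of p]
  unfolding W_eq wc_eq by (auto simp: FactRing_def)

lemma wc_eq_iff:
  assumes "p \<in> carrier F" "q \<in> carrier F"
  shows "wc p = wc q \<longleftrightarrow> p - q \<in> I0"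
proof -
  interpret ring W by (rule ring_W)
  have c: "wc p \<in> carrier W" "wc q \<in> carrier W" using assms by (auto simp: wc_carrier)
  have "wc p = wc q \<longleftrightarrow> wc p \<ominus>\<^bsub>W\<^esub> wc q = \<zero>\<^bsub>W\<^esub>"
    using c by (simp add: r_right_minus_eq)
  then show ?thesis using assms by (simp add: wc_simps(4) wc_0_iff)
qed

lemma scalar_wc: "scalar r s c = wc (const c)"
  by (simp add: scalar_def)

lemma euler_wc: "euler r s i = wc (euler0 i)"
  by (simp add: euler_def euler0_def)

lemma torus_elem_wc: "torus_elem r s c = wc (lin c)"
proof -
  interpret ring W by (rule ring_W)
  have "(\<Oplus>\<^bsub>W\<^esub>i\<in>D. scalar r s (c i) \<otimes>\<^bsub>W\<^esub> euler r s i) = wc (\<Sum>i\<in>D. const (c i) * euler0 i)"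
    if "D \<subseteq> {1..n}" for D
    using finite_subset[OF that finite_atLeastAtMost] that
  proof (induction D rule: finite_induct)
    case empty
    then show ?case by (simp add: wc_simps)
  next
    case (insert i D)
    have eF: "euler0 j \<in> carrier F" if "j \<in> insert i D" for j using insert.prems that by blast
    then have trm: "scalar r s (c j) \<otimes>\<^bsub>W\<^esub> euler r s j = wc (const (c j) * euler0 j)"
        "wc (const (c j) * euler0 j) \<in> carrier W" if "j \<in> insert i D" for j
      using that by (simp_all add: scalar_wc euler_wc wc_simps wc_carrier)
    have "(\<Oplus>\<^bsub>W\<^esub>j\<in>insert i D. scalar r s (c j) \<otimes>\<^bsub>W\<^esub> euler r s j) =
        scalar r s (c i) \<otimes>\<^bsub>W\<^esub> euler r s i \<oplus>\<^bsub>W\<^esub> (\<Oplus>\<^bsub>W\<^esub>j\<in>D. scalar r s (c j) \<otimes>\<^bsub>W\<^esub> euler r s j)"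
      using insert.hyps trm by (intro finsum_insert) auto
    also have "\<dots> = wc (const (c i) * euler0 i) \<oplus>\<^bsub>W\<^esub> wc (\<Sum>j\<in>D. const (c j) * euler0 j)"
      using insert trm by simp
    also have "\<dots> = wc (const (c i) * euler0 i + (\<Sum>j\<in>D. const (c j) * euler0 j))"
      using eF by (intro wc_simps(1) F_sum F_closed(6)) auto
    finally show ?case using insert.hyps by simp
  qed
  from this[of "{1..n}"] show ?thesis by (simp add: torus_elem_def lin_def)
qed

text \<open>Independence of the Euler operators is read off from eigenvalues: shifting the weight by
  the \<open>j\<close>-th unit vector changes the eigenvalue of \<open>lin c\<close> by
  \<open>c j\<close>. This makes the description in \<open>dual_basis\<close> meaningful.\<close>

lemma torus_elem_inj:
  fixes c c' :: "nat \<Rightarrow> 'k"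
  assumes c: "c \<in> coord_space {1..n}" "c' \<in> coord_space {1..n}"
    and eq: "torus_elem r s c = torus_elem r s c'"
  shows "c = c'"
proof
  fix j
  show "c j = c' j"
  proof (cases "j \<in> {1..n}")
    case True
    have "lin c - lin c' \<in> I0" using eq F_lin by (simp add: torus_elem_wc wc_eq_iff)
    then have *: "(\<Sum>i=1..n. c i * (ak i + of_int (b i))) = (\<Sum>i=1..n. c' i * (ak i + of_int (b i)))" for b
      using act_I0[of "lin c - lin c'" "\<lambda>_. 1" b] by (simp add: act_diff act_lin)
    let ?e = "\<lambda>i. if i = j then 1 else 0 :: int"
    have "(\<Sum>i=1..n. x i * (ak i + of_int (?e i))) = (\<Sum>i=1..n. x i * (ak i + of_int ((\<lambda>_. 0) i))) + x j" for x :: "nat \<Rightarrow> 'k"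
    proof -
      have "(\<Sum>i=1..n. x i * (ak i + of_int (?e i))) = (\<Sum>i=1..n. x i * ak i + (if i = j then x i else 0))"
        by (intro sum.cong) (auto simp: algebra_simps)
      then show ?thesis using True by (simp add: sum.distrib)
    qed
    then show ?thesis using *[of ?e] *[of "\<lambda>_. 0"] by simp
  next
    case False
    then show ?thesis using c by (simp add: coord_space_def)
  qed
qed

context
  assumes g: "torus_subspace r s \<gg>"
begin

lemma gg_eq: "\<gg> = (\<lambda>c. wc (lin c)) ` coeffs"
  using g unfolding torus_subspace_def torus_def coeffs_def torus_elem_wc[abs_def] by blast

lemma dual_basis_lin: "c \<in> coord_space {1..n} \<Longrightarrow> dual_basis r s i (wc (lin c)) = c i"
  unfolding dual_basis_def torus_elem_wc[symmetric]
  by (subst the_equality[of _ c]) (auto intro: torus_elem_inj[symmetric] simp del: One_nat_def)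

lemma eta_lin: "c \<in> coeffs \<Longrightarrow> eta r s \<gg> i (wc (lin c)) = c i"
  using gg_eq by (auto simp: eta_def dual_basis_lin coeffs_def)

lemma eta_comb_lin: "c \<in> coeffs \<Longrightarrow> eta_comb r s \<gg> D x (wc (lin c)) = (\<Sum>i\<in>D. x i * c i)"
  by (simp add: eta_comb_def eta_lin)

lemma eta_comb_eq_iff:
  "eta_comb r s \<gg> D x = eta_comb r s \<gg> Y y \<longleftrightarrow> (\<forall>c\<in>coeffs. (\<Sum>i\<in>D. x i * c i) = (\<Sum>i\<in>Y. y i * c i))"
proof
  assume "eta_comb r s \<gg> D x = eta_comb r s \<gg> Y y"
  then show "\<forall>c\<in>coeffs. (\<Sum>i\<in>D. x i * c i) = (\<Sum>i\<in>Y. y i * c i)"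
    by (metis eta_comb_lin)
next
  assume *: "\<forall>c\<in>coeffs. (\<Sum>i\<in>D. x i * c i) = (\<Sum>i\<in>Y. y i * c i)"
  show "eta_comb r s \<gg> D x = eta_comb r s \<gg> Y y"
  proof
    fix t
    show "eta_comb r s \<gg> D x t = eta_comb r s \<gg> Y y t"
    proof (cases "t \<in> \<gg>")
      case True
      then obtain c where "c \<in> coeffs" "t = wc (lin c)" using gg_eq by blast
      then show ?thesis using * by (simp add: eta_comb_lin)
    next
      case False
      then show ?thesis by (simp add: eta_comb_def eta_def)
    qed
  qed
qed

lemma eta_comb_0_iff: "eta_comb r s \<gg> D x = (\<lambda>_. 0) \<longleftrightarrow> (\<forall>c\<in>coeffs. (\<Sum>i\<in>D. x i * c i) = 0)"
  using eta_comb_eq_iff[of D x "{}" x] by (simp add: eta_comb_def[of _ _ _ "{}"])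

lemma carrier_A: "carrier A = wc ` G0"
proof -
  have "wc p \<in> carrier A \<longleftrightarrow> p \<in> G0" if p: "p \<in> carrier F" for p
  proof -
    have "wc (lin c) \<otimes>\<^bsub>W\<^esub> wc p \<ominus>\<^bsub>W\<^esub> wc p \<otimes>\<^bsub>W\<^esub> wc (lin c) = \<zero>\<^bsub>W\<^esub> \<longleftrightarrow> lin c * p - p * lin c \<in> I0" for c
      using p F_lin[of c] wc_0_iff[of "lin c * p - p * lin c"] by (simp add: wc_simps(2,4))
    then show ?thesis
      unfolding invariants_def using p by (subst gg_eq) (auto simp: G0_def wc_carrier)
  qed
  moreover have "carrier A \<subseteq> wc ` carrier F" by (auto simp: invariants_def wc_carrier)
  ultimately show ?thesis using G0_F by blast
qed

lemma A_simps [simp]: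
  "monoid.mult A = monoid.mult W" "add A = add W" "one A = one W" "ring.zero A = ring.zero W"
  by (simp_all add: invariants_def)

lemma subring_A: "subring (carrier A) W"
proof (rule ring.subringI[OF ring_W])
  show "carrier A \<subseteq> carrier W" using G0_F by (auto simp: carrier_A wc_carrier)
  show "\<one>\<^bsub>W\<^esub> \<in> carrier A" using G0_1 by (auto simp: carrier_A wc_simps)
next
  fix a assume "a \<in> carrier A"
  then show "\<ominus>\<^bsub>W\<^esub> a \<in> carrier A" using G0_uminus G0_F by (auto simp: carrier_A wc_simps)
next
  fix a b assume "a \<in> carrier A" "b \<in> carrier A"
  then obtain p q where pq: "p \<in> G0" "q \<in> G0" "a = wc p" "b = wc q" by (auto simp: carrier_A)
  then show "a \<otimes>\<^bsub>W\<^esub> b \<in> carrier A" "a \<oplus>\<^bsub>W\<^esub> b \<in> carrier A"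
    using G0_mult[OF pq(1,2)] G0_add[OF pq(1,2)] G0_F by (simp_all add: carrier_A wc_simps)
qed

lemma A_eq: "A = W\<lparr>carrier := carrier A\<rparr>"
  by (simp add: invariants_def)

lemma ring_A: "ring A"
  by (subst A_eq) (rule ring.subring_is_ring[OF ring_W subring_A])

lemma wc_A_simps:
  "\<lbrakk>p \<in> G0; q \<in> G0\<rbrakk> \<Longrightarrow> wc p \<oplus>\<^bsub>W\<^esub> wc q = wc (p + q)"
  "\<lbrakk>p \<in> G0; q \<in> G0\<rbrakk> \<Longrightarrow> wc p \<otimes>\<^bsub>W\<^esub> wc q = wc (p * q)"
  using G0_F by (simp_all add: wc_simps)

lemma ideal_A_image:
  assumes Z: "Z \<subseteq> G0" "0 \<in> Z" and add: "\<And>p q. \<lbrakk>p \<in> Z; q \<in> Z\<rbrakk> \<Longrightarrow> p + q \<in> Z"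
    and l: "\<And>p q. \<lbrakk>p \<in> G0; q \<in> Z\<rbrakk> \<Longrightarrow> p * q \<in> Z" and r: "\<And>p q. \<lbrakk>p \<in> G0; q \<in> Z\<rbrakk> \<Longrightarrow> q * p \<in> Z"
  shows "ideal (wc ` Z) A"
proof (rule idealI[OF ring_A])
  interpret ring A by (rule ring_A)
  have neg: "- p \<in> Z" if "p \<in> Z" for p
    using l[OF G0_const[of "-1"] that] by (simp add: const_uminus)
  show "subgroup (wc ` Z) (add_monoid A)"
  proof (rule subgroup.intro)
    show "wc ` Z \<subseteq> carrier (add_monoid A)" using Z by (auto simp: carrier_A)
    show "\<one>\<^bsub>add_monoid A\<^esub> \<in> wc ` Z" using Z by (simp add: wc_simps)
    show "x \<otimes>\<^bsub>add_monoid A\<^esub> y \<in> wc ` Z" if "x \<in> wc ` Z" "y \<in> wc ` Z" for x y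
      using that Z add by (auto simp: wc_A_simps subset_iff)
  next
    fix x assume "x \<in> wc ` Z"
    then obtain p where p: "p \<in> Z" "x = wc p" by blast
    have "\<ominus>\<^bsub>A\<^esub> x = wc (- p)"
    proof (rule minus_equality)
      show "wc (- p) \<oplus>\<^bsub>A\<^esub> x = \<zero>\<^bsub>A\<^esub>"
        using p Z neg[OF p(1)] by (simp add: wc_A_simps wc_simps(5) subset_iff)
      show "x \<in> carrier A" "wc (- p) \<in> carrier A" using p Z neg by (auto simp: carrier_A)
    qed
    then show "inv\<^bsub>add_monoid A\<^esub> x \<in> wc ` Z" using neg p(1) by (simp add: a_inv_def)
  qed
next
  fix a x assume "a \<in> wc ` Z" "x \<in> carrier A"
  then obtain p q where "p \<in> Z" "a = wc p" "q \<in> G0" "x = wc q" by (auto simp: carrier_A)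
  then show "x \<otimes>\<^bsub>A\<^esub> a \<in> wc ` Z" "a \<otimes>\<^bsub>A\<^esub> x \<in> wc ` Z"
    using l[of q p] r[of q p] Z by (auto simp: wc_A_simps subset_iff)
qed

definition \<chi> :: "'k weyl \<Rightarrow> 'k" where "\<chi> = eta_comb r s \<gg> {1..n} ak"

abbreviation C :: "'k weyl set" where "C \<equiv> char_ideal r s \<gg> \<chi>"
abbreviation B :: "'k weyl set ring" where "B \<equiv> B_alg r s \<gg> \<chi>"

lemma char_gens_A: "{t \<ominus>\<^bsub>W\<^esub> scalar r s (\<chi> t) | t. t \<in> \<gg>} \<subseteq> wc ` {p \<in> G0. \<forall>b\<in>Lam. \<forall>b'. entry ak p b' b = 0}"
proof
  fix x assume "x \<in> {t \<ominus>\<^bsub>W\<^esub> scalar r s (\<chi> t) | t. t \<in> \<gg>}"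
  then obtain c where c: "c \<in> coeffs" "x = wc (lin c) \<ominus>\<^bsub>W\<^esub> wc (const (\<chi> (wc (lin c))))"
    by (subst (asm) (2) gg_eq) (auto simp: scalar_wc)
  let ?p = "lin c - const (\<chi> (wc (lin c)))"
  have "lin c \<in> tpoly"
    unfolding lin_def by (intro tpoly_sum tpoly_mult tpoly_const tpoly_euler)
  then have "?p \<in> G0" by (intro G0_diff tpoly_G0 G0_const)
  moreover have "entry ak ?p b' b = 0" if "b \<in> Lam" for b b'
  proof -
    have "(\<Sum>i=1..n. c i * (ak i + of_int (b i))) = (\<Sum>i=1..n. ak i * c i) + pair c b"
      by (simp add: pair_def algebra_simps sum.distrib)
    also have "pair c b = 0" using that c(1) by (simp add: Lam_def)
    finally show ?thesis
      by (simp add: entry_def act_diff act_lin act_const \<chi>_def eta_comb_lin[OF c(1)])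
  qed
  moreover have "x = wc ?p" using c(2) F_lin by (simp add: wc_simps)
  ultimately show "x \<in> wc ` {p \<in> G0. \<forall>b\<in>Lam. \<forall>b'. entry ak p b' b = 0}" by blast
qed

lemma char_gens_carrier: "{t \<ominus>\<^bsub>W\<^esub> scalar r s (\<chi> t) | t. t \<in> \<gg>} \<subseteq> carrier A"
  using char_gens_A by (auto simp: carrier_A)

lemma ideal_C: "ideal C A"
  unfolding char_ideal_def by (rule ring.genideal_ideal[OF ring_A char_gens_carrier])

text \<open>At weights in \<open>Lam\<close> an element \<open>t\<close> of \<open>\<gg>\<close>
  acts by the scalar \<open>\<chi> t\<close>, so the generators act by zero there. The elements with
  this property form a two-sided ideal, because invariants map weights in \<open>Lam\<close> to
  weights in \<open>Lam\<close>.\<close>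

lemma C_entry:
  assumes "p \<in> G0" "wc p \<in> C" "b \<in> Lam"
  shows "entry ak p b' b = 0"
proof -
  let ?Z = "{p \<in> G0. \<forall>b\<in>Lam. \<forall>b'. entry ak p b' b = 0}"
  have "entry ak (q * p) b' b = 0" if pq: "p \<in> G0" "q \<in> ?Z" "b \<in> Lam" for p q b b'
  proof -
    have "entry ak q b' x * entry ak p x b = 0" for x
    proof (cases "entry ak p x b = 0")
      case False
      then have "(x - b) + b \<in> Lam" using entry_G0_Lam[OF pq(1)] pq(3) Lam_closed(2) by blast
      then show ?thesis using pq(2) by simp
    qed simp
    then show ?thesis unfolding entry_mult by (intro sum.neutral ballI)
  qed
  then have "ideal (wc ` ?Z) A"
    by (intro ideal_A_image) (auto simp: G0_0 entry_add G0_add G0_mult entry_mult)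
  then have "C \<subseteq> wc ` ?Z"
    unfolding char_ideal_def using char_gens_A by (rule ring.genideal_minimal[OF ring_A])
  then obtain q where q: "q \<in> ?Z" "wc p = wc q" using assms(2) by blast
  then have "p - q \<in> I0" using assms(1) by (simp add: wc_eq_iff G0_F)
  then show ?thesis using entry_cong_I0 q(1) assms(3) by simp
qed

definition h :: "'k free \<Rightarrow> 'k weyl set" where "h p = C +>\<^bsub>A\<^esub> wc p"

lemma ring_B: "ring B"
  unfolding B_alg_def by (rule ideal.quotient_is_ring[OF ideal_C])

lemma h_image: "h ` G0 = carrier B"
  by (auto simp: h_def B_alg_def FactRing_def A_RCOSETS_def' carrier_A)

lemma h_simps:
  "\<lbrakk>p \<in> G0; q \<in> G0\<rbrakk> \<Longrightarrow> h (p + q) = h p \<oplus>\<^bsub>B\<^esub> h q"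
  "\<lbrakk>p \<in> G0; q \<in> G0\<rbrakk> \<Longrightarrow> h (p * q) = h p \<otimes>\<^bsub>B\<^esub> h q"
  "h 0 = \<zero>\<^bsub>B\<^esub>" "h 1 = \<one>\<^bsub>B\<^esub>"
proof -
  interpret hh: ring_hom_ring A B "(+>\<^bsub>A\<^esub>) C"
    unfolding B_alg_def by (rule ideal.rcos_ring_hom_ring[OF ideal_C])
  have c: "wc p \<in> carrier A" if "p \<in> G0" for p using that by (simp add: carrier_A)
  show "h (p + q) = h p \<oplus>\<^bsub>B\<^esub> h q" if "p \<in> G0" "q \<in> G0"
    using hh.hom_add[OF c c, OF that] that by (simp add: h_def wc_A_simps)
  show "h (p * q) = h p \<otimes>\<^bsub>B\<^esub> h q" if "p \<in> G0" "q \<in> G0"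
    using hh.hom_mult[OF c c, OF that] that by (simp add: h_def wc_A_simps)
  show "h 0 = \<zero>\<^bsub>B\<^esub>" using hh.hom_zero by (simp add: h_def wc_simps)
  show "h 1 = \<one>\<^bsub>B\<^esub>" using hh.hom_one by (simp add: h_def wc_simps)
qed

lemma h_0_Ker:
  assumes "p \<in> G0" "h p = \<zero>\<^bsub>B\<^esub>" "b \<in> Lam"
  shows "entry ak p b' b = 0"
proof -
  have "wc p \<in> carrier A" using assms(1) by (simp add: carrier_A)
  moreover have "C +>\<^bsub>A\<^esub> wc p = C" using assms(2) by (simp add: h_def B_alg_def FactRing_def)
  ultimately have "wc p \<in> C" by (rule ideal.rcos_const_imp_mem[OF ideal_C])
  then show ?thesis using C_entry assms by blast
qed

lemma h_I0: "p \<in> I0 \<Longrightarrow> h p = \<zero>\<^bsub>B\<^esub>"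
  using h_simps(3) wc_eq_iff[of p 0] I0_F by (simp add: h_def subset_iff)

lemma h_diff_0: "\<lbrakk>p \<in> G0; q \<in> G0; h p = h q\<rbrakk> \<Longrightarrow> h (p - q) = \<zero>\<^bsub>B\<^esub>"
proof -
  interpret ring B by (rule ring_B)
  assume pq: "p \<in> G0" "q \<in> G0" "h p = h q"
  have c: "h (p - q) \<in> carrier B" "h q \<in> carrier B" using h_image G0_diff pq by blast+
  have "h (p - q) \<oplus>\<^bsub>B\<^esub> h q = h q"
    using h_simps(1)[OF G0_diff[OF pq(1,2)] pq(2)] pq(3) by simp
  then show "h (p - q) = \<zero>\<^bsub>B\<^esub>" using c by simp
qed

definition P :: "'k weyl set set" where "P = h ` K"

lemma h_P_iff: "p \<in> G0 \<Longrightarrow> h p \<in> P \<longleftrightarrow> p \<in> K"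
proof
  assume p: "p \<in> G0" "h p \<in> P"
  then obtain q where q: "q \<in> K" "h p = h q" by (auto simp: P_def)
  have "q \<in> G0" using q(1) by (simp add: K_def)
  then have "entry ak (p - q) b 0 = 0" for b
    using h_0_Ker[OF G0_diff h_diff_0 Lam_closed(1)] p(1) q(2) by simp
  then have "p - q \<in> K" using G0_diff[OF p(1) \<open>q \<in> G0\<close>] by (simp add: K_def)
  then have "(p - q) + q \<in> K" using K_add q(1) by blast
  then show "p \<in> K" by simp
qed (simp add: P_def)

lemma K_0: "0 \<in> K" by (simp add: K_def G0_0)

lemma left_ideal_image:
  assumes "D \<subseteq> G0" "0 \<in> D" "\<And>p q. \<lbrakk>p \<in> D; q \<in> D\<rbrakk> \<Longrightarrow> p + q \<in> D" "\<And>p q. \<lbrakk>p \<in> G0; q \<in> D\<rbrakk> \<Longrightarrow> p * q \<in> D"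
  shows "left_ideal (h ` D) B"
  unfolding ring.left_ideal_iff[OF ring_B]
proof (intro conjI ballI)
  show "h ` D \<subseteq> carrier B" using assms(1) h_image by blast
  show "\<zero>\<^bsub>B\<^esub> \<in> h ` D" using assms(2) h_simps(3) by (metis imageI)
next
  fix x y assume "x \<in> h ` D" "y \<in> h ` D"
  then obtain p q where "p \<in> D" "q \<in> D" "x = h p" "y = h q" by blast
  moreover have "h (p + q) = h p \<oplus>\<^bsub>B\<^esub> h q" using assms(1) calculation by (intro h_simps(1)) auto
  ultimately show "x \<oplus>\<^bsub>B\<^esub> y \<in> h ` D" using assms(3)[of p q] by auto
next
  fix a x assume "a \<in> carrier B" "x \<in> h ` D"
  then obtain p q where "p \<in> G0" "q \<in> D" "a = h p" "x = h q" using h_image by blast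
  moreover have "h (p * q) = h p \<otimes>\<^bsub>B\<^esub> h q" using assms(1) calculation by (intro h_simps(2)) auto
  ultimately show "a \<otimes>\<^bsub>B\<^esub> x \<in> h ` D" using assms(4)[of p q] by auto
qed

lemma left_ideal_P: "left_ideal P B"
  unfolding P_def
proof (rule left_ideal_image)
  show "K \<subseteq> G0" by (auto simp: K_def)
qed (rule K_0, erule (1) K_add, erule (1) K_left)

lemma P_proper: "P \<noteq> carrier B"
proof
  assume "P = carrier B"
  then have "h 1 \<in> P" using G0_1 h_image by blast
  then have "1 \<in> K" using h_P_iff G0_1 by simp
  then show False using S_0 by (auto simp: K_def entry_def)
qed

lemma tpoly_entry_mult:
  assumes "p \<in> tpoly" "q \<in> tpoly"
  shows "entry ak (p * q) 0 0 = entry ak p 0 0 * entry ak q 0 0"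
proof -
  note A = act_tpoly[OF assms(2), of _ 0]
  have "entry ak (p * q) 0 0 = act ak q (\<lambda>_. 1) 0 * entry ak p 0 0"
    unfolding entry_def act_mult by (rule A)
  moreover have "entry ak q 0 0 = act ak q (\<lambda>_. 1) 0"
    unfolding entry_def by (rule trans[OF A]) simp
  ultimately show ?thesis by (simp add: mult.commute)
qed

abbreviation Sy :: "'k weyl ring" where "Sy \<equiv> sym_torus r s"

lemma torus_gens_W: "range (scalar r s) \<union> torus r s \<subseteq> carrier W"
  by (auto simp: scalar_wc torus_def torus_elem_wc wc_carrier)

lemma ring_Sy: "ring Sy"
  unfolding sym_torus_def by (rule ring.generate_ring_is_ring[OF ring_W torus_gens_W])

lemma Sy_simps [simp]:
  "monoid.mult Sy = monoid.mult W" "add Sy = add W" "one Sy = one W" "ring.zero Sy = ring.zero W"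
  by (simp_all add: sym_torus_def)

lemma Sy_tpoly: "carrier Sy \<subseteq> wc ` tpoly"
proof
  fix x assume "x \<in> carrier Sy"
  then have "x \<in> generate_ring W (range (scalar r s) \<union> torus r s)" by (simp add: sym_torus_def)
  then show "x \<in> wc ` tpoly"
  proof (induction rule: generate_ring.induct)
    case one
    then show ?case using tpoly_1 by (simp add: wc_simps)
  next
    case (incl x)
    have "lin c \<in> tpoly" for c
      unfolding lin_def by (intro tpoly_sum tpoly_mult tpoly_const tpoly_euler)
    then show ?case using incl tpoly_const by (auto simp: scalar_wc torus_def torus_elem_wc)
  next
    case (a_inv x)
    then obtain p where p: "p \<in> tpoly" "x = wc p" by blast
    have "- p \<in> tpoly" using tpoly_mult[OF tpoly_const[of "-1"] p(1)] by (simp add: const_uminus)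
    then show ?case using p tpoly_F by (simp add: wc_simps)
  next
    case (eng_add x y)
    then obtain p q where "p \<in> tpoly" "x = wc p" "q \<in> tpoly" "y = wc q" by blast
    then show ?case using tpoly_F tpoly_add by (simp add: wc_simps)
  next
    case (eng_mult x y)
    then obtain p q where "p \<in> tpoly" "x = wc p" "q \<in> tpoly" "y = wc q" by blast
    then show ?case using tpoly_F tpoly_mult by (simp add: wc_simps)
  qed
qed

lemma point_gens_Sy: "{euler r s i \<ominus>\<^bsub>W\<^esub> scalar r s (ak i) | i. i \<in> {1..n}} \<subseteq> carrier Sy"
proof
  fix x assume "x \<in> {euler r s i \<ominus>\<^bsub>W\<^esub> scalar r s (ak i) | i. i \<in> {1..n}}"
  then obtain i where i: "i \<in> {1..n}" "x = euler r s i \<ominus>\<^bsub>W\<^esub> scalar r s (ak i)" by blast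
  let ?c = "\<lambda>j. if j = i then 1 else 0 :: 'k"
  have "lin ?c = euler0 i"
    using i(1) by (simp add: lin_def if_distrib[of "\<lambda>x. x * _"] if_distrib[of const] cong: if_cong)
  then have "euler r s i = torus_elem r s ?c" by (simp add: euler_wc torus_elem_wc)
  moreover have "?c \<in> coord_space {1..n}" using i(1) by (auto simp: coord_space_def)
  ultimately have "(euler r s i :: 'k weyl) \<in> torus r s" unfolding torus_def by (rule image_eqI)
  then have "x \<in> generate_ring W (range (scalar r s) \<union> torus r s)"
    unfolding i(2) a_minus_def by (intro generate_ring.intros) auto
  then show "x \<in> carrier Sy" by (simp add: sym_torus_def)
qed

text \<open>On \<open>tpoly\<close> the entry at \<open>(0, 0)\<close> is evaluation at the point
  \<open>\<alpha>\<close>, which is multiplicative and vanishes on the generators.\<close>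

lemma max_ideal_sub: "max_ideal r s ak \<subseteq> wc ` {p \<in> tpoly. entry ak p 0 0 = 0}"
proof -
  interpret ring Sy by (rule ring_Sy)
  let ?Z = "{p \<in> tpoly. entry ak p 0 0 = 0}"
  let ?I = "carrier Sy \<inter> wc ` ?Z"
  have closed: "x \<oplus>\<^bsub>W\<^esub> y \<in> carrier Sy" "x \<otimes>\<^bsub>W\<^esub> y \<in> carrier Sy" if "x \<in> carrier Sy" "y \<in> carrier Sy" for x y
    using add.m_closed[OF that] m_closed[OF that] by simp_all
  have "ideal ?I Sy"
  proof (rule idealI[OF ring_Sy])
    show "subgroup ?I (add_monoid Sy)"
    proof (rule subgroup.intro)
      show "\<one>\<^bsub>add_monoid Sy\<^esub> \<in> ?I"
        using zero_closed tpoly_const[of 0] by (auto simp: wc_simps)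
    next
      fix x y assume xy: "x \<in> ?I" "y \<in> ?I"
      then obtain p q where "p \<in> ?Z" "x = wc p" "q \<in> ?Z" "y = wc q" by blast
      then show "x \<otimes>\<^bsub>add_monoid Sy\<^esub> y \<in> ?I"
        using xy closed(1)[of x y] tpoly_F tpoly_add by (auto simp: wc_simps entry_add)
    next
      fix x assume x: "x \<in> ?I"
      then obtain p where p: "p \<in> ?Z" "x = wc p" by blast
      have np: "- p \<in> ?Z"
        using p(1) tpoly_mult[OF tpoly_const[of "-1"], of p] entry_diff[of ak 0 p]
        by (simp add: const_uminus)
      obtain y where y: "y \<in> carrier Sy" "y \<oplus>\<^bsub>Sy\<^esub> x = \<zero>\<^bsub>Sy\<^esub>" 
        using x a_inv_closed[of x] l_neg[of x] by blast
      obtain q where q: "q \<in> tpoly" "y = wc q" using y(1) Sy_tpoly by blast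
      have "q - (- p) \<in> I0"
        using y(2) p q np tpoly_F by (simp add: wc_simps(1) wc_0_iff)
      then have "y = wc (- p)" using q np tpoly_F by (simp add: wc_eq_iff)
      moreover have "\<ominus>\<^bsub>Sy\<^esub> x = y" using y x by (intro minus_equality) auto
      ultimately have "\<ominus>\<^bsub>Sy\<^esub> x \<in> ?I" using y(1) np by (metis (no_types, lifting) Int_iff imageI)
      then show "inv\<^bsub>add_monoid Sy\<^esub> x \<in> ?I" by (simp add: a_inv_def)
    qed auto
  next
    fix a x assume ax: "a \<in> ?I" "x \<in> carrier Sy"
    then obtain p q where "p \<in> ?Z" "a = wc p" "q \<in> tpoly" "x = wc q" using Sy_tpoly by blast
    then show "x \<otimes>\<^bsub>Sy\<^esub> a \<in> ?I" "a \<otimes>\<^bsub>Sy\<^esub> x \<in> ?I"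
      using ax closed(2)[of a x] closed(2)[of x a] tpoly_F tpoly_mult by (auto simp: wc_simps tpoly_entry_mult)
  qed
  moreover have "{euler r s i \<ominus>\<^bsub>W\<^esub> scalar r s (ak i) | i. i \<in> {1..n}} \<subseteq> ?I"
  proof
    fix x assume x: "x \<in> {euler r s i \<ominus>\<^bsub>W\<^esub> scalar r s (ak i) | i. i \<in> {1..n}}"
    then obtain i where i: "i \<in> {1..n}" "x = euler r s i \<ominus>\<^bsub>W\<^esub> scalar r s (ak i)" by blast
    have "euler0 i + const (- ak i) \<in> tpoly" using i(1) by (intro tpoly.intros)
    then have "euler0 i - const (ak i) \<in> ?Z"
      by (simp add: const_uminus entry_diff) (simp add: entry_def act_euler0 act_const)
    moreover have "x = wc (euler0 i - const (ak i))" using i by (simp add: euler_wc scalar_wc wc_simps F_euler0)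
    ultimately show "x \<in> ?I" using x point_gens_Sy by blast
  qed
  ultimately show ?thesis
    unfolding max_ideal_def using genideal_minimal by blast
qed

lemma max_ideal_gens: "i \<in> {1..n} \<Longrightarrow> wc (euler0 i - const (ak i)) \<in> max_ideal r s ak"
  unfolding max_ideal_def using ring.genideal_self[OF ring_Sy point_gens_Sy]
  by (fastforce simp: euler_wc scalar_wc wc_simps F_euler0)

definition N0 :: "'k weyl set set" where
  "N0 = generated_submodule B (left_regular B) ((\<lambda>a. C +>\<^bsub>A\<^esub> a) ` max_ideal r s ak)"

lemma max_ideal_P: "(\<lambda>a. C +>\<^bsub>A\<^esub> a) ` max_ideal r s ak \<subseteq> P"
proof -
  have "p \<in> K" if p: "p \<in> tpoly" "entry ak p 0 0 = 0" for p
  proof -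
    have "entry ak p b 0 = 0" for b
    proof (cases "b = 0")
      case False
      then show ?thesis unfolding entry_def by (subst act_tpoly[OF p(1)]) auto
    qed (use p in simp)
    then show ?thesis using tpoly_G0[OF p(1)] by (simp add: K_def)
  qed
  then show ?thesis using max_ideal_sub by (fastforce simp: P_def h_def)
qed

lemma N0_props: "left_ideal N0 B" "(\<lambda>a. C +>\<^bsub>A\<^esub> a) ` max_ideal r s ak \<subseteq> N0" "N0 \<subseteq> P"
proof -
  have "(\<lambda>a. C +>\<^bsub>A\<^esub> a) ` max_ideal r s ak \<subseteq> carrier B"
    using max_ideal_P left_ideal_P unfolding ring.left_ideal_iff[OF ring_B] by blast
  note * = ring.generated_submodule_left_ideal[OF ring_B this]
  show "left_ideal N0 B" "(\<lambda>a. C +>\<^bsub>A\<^esub> a) ` max_ideal r s ak \<subseteq> N0" "N0 \<subseteq> P"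
    unfolding N0_def using * left_ideal_P max_ideal_P by blast+
qed

lemma left_ideals_below_P:
  assumes Q: "left_ideal Q B" "N0 \<subseteq> Q" "Q \<noteq> carrier B"
  shows "Q \<subseteq> P"
proof -
  interpret ring B by (rule ring_B)
  have Q': "Q \<subseteq> carrier B" "\<zero>\<^bsub>B\<^esub> \<in> Q" "\<And>x y. \<lbrakk>x \<in> Q; y \<in> Q\<rbrakk> \<Longrightarrow> x \<oplus>\<^bsub>B\<^esub> y \<in> Q"
    "\<And>a x. \<lbrakk>a \<in> carrier B; x \<in> Q\<rbrakk> \<Longrightarrow> a \<otimes>\<^bsub>B\<^esub> x \<in> Q"
    using Q(1) unfolding left_ideal_iff by blast+
  define K' where "K' = {p \<in> G0. h p \<in> Q}"
  have "K' \<subseteq> K"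
  proof (rule K_maximal)
    show "p + q \<in> K'" if "p \<in> K'" "q \<in> K'" for p q
      using that Q'(3) by (simp add: K'_def G0_add h_simps)
    show "p * q \<in> K'" if "p \<in> G0" "q \<in> K'" for p q
      using that Q'(4) h_image by (auto simp: K'_def G0_mult h_simps)
    show "K' \<subseteq> G0" by (auto simp: K'_def)
    show "I0 \<subseteq> K'" using G0_I0 h_I0 Q'(2) by (auto simp: K'_def)
    show "euler0 i - const (ak i) \<in> K'" if "i \<in> {1..n}" for i
    proof -
      have "h (euler0 i - const (ak i)) \<in> N0"
        using max_ideal_gens[OF that] N0_props(2) by (auto simp: h_def)
      then show ?thesis using Q(2) euler0_G0[OF that] by (auto simp: K'_def intro: G0_diff G0_const)
    qed
    show "1 \<notin> K'"
    proof
      assume "1 \<in> K'"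
      then have "\<one>\<^bsub>B\<^esub> \<in> Q" by (simp add: K'_def h_simps)
      then have "a \<in> Q" if "a \<in> carrier B" for a using Q'(4)[OF that] that by fastforce
      then show False using Q(3) Q'(1) by blast
    qed
  qed
  show ?thesis
  proof
    fix x assume "x \<in> Q"
    then obtain p where "p \<in> G0" "x = h p" using Q'(1) h_image by blast
    then show "x \<in> P" using \<open>x \<in> Q\<close> \<open>K' \<subseteq> K\<close> by (auto simp: K'_def P_def)
  qed
qed

abbreviation J :: "'k weyl set set" where "J \<equiv> J_ideal r s \<gg> \<chi> ak"

lemma J_eq: "J = {a \<in> carrier B. \<forall>b\<in>carrier B. a \<otimes>\<^bsub>B\<^esub> b \<in> P}"
  unfolding J_ideal_def L_module_def M_module_def N0_def[symmetric]
  by (rule ring.annihilator_unique_simple_quotient[OF ring_B N0_props(1) left_ideal_P N0_props(3) P_proper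
      left_ideals_below_P])

lemma ideal_J: "ideal J B"
  unfolding J_eq by (rule ring.ideal_quotient_left_ideal[OF ring_B left_ideal_P])

lemma h_J_iff: "p \<in> G0 \<Longrightarrow> h p \<in> J \<longleftrightarrow> p \<in> Ker"
  unfolding J_eq Ker_iff h_image[symmetric]
  by (auto simp: h_simps(2)[symmetric] h_P_iff G0_mult)

text \<open>The whole tower of subring and quotients is collapsed into a single map from
  \<open>G0\<close> with kernel \<open>Ker\<close>; the Goldie rank is computed from this
  presentation.\<close>

lemma quotient_presentation:
  "\<exists>H. ring (B Quot J) \<and> H ` G0 = carrier (B Quot J) \<and>
    (\<forall>p\<in>G0. \<forall>q\<in>G0. H (p + q) = H p \<oplus>\<^bsub>B Quot J\<^esub> H q \<and> H (p * q) = H p \<otimes>\<^bsub>B Quot J\<^esub> H q) \<and>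
    (\<forall>p\<in>G0. H p = \<zero>\<^bsub>B Quot J\<^esub> \<longleftrightarrow> p \<in> Ker)"
proof (intro exI conjI ballI)
  let ?H = "\<lambda>p. J +>\<^bsub>B\<^esub> h p"
  interpret J: ideal J B by (rule ideal_J)
  interpret hh: ring_hom_ring B "B Quot J" "(+>\<^bsub>B\<^esub>) J" by (rule J.rcos_ring_hom_ring)
  show "ring (B Quot J)" by (rule J.quotient_is_ring)
  show "?H ` G0 = carrier (B Quot J)"
  proof -
    have "carrier (B Quot J) = (\<lambda>a. J +>\<^bsub>B\<^esub> a) ` carrier B"
      unfolding FactRing_def A_RCOSETS_def' partial_object.simps by blast
    then show ?thesis unfolding h_image[symmetric] image_image by (rule sym)
  qed
  fix p assume p: "p \<in> G0"
  have hp: "h p \<in> carrier B" using p h_image by blast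
  show "?H p = \<zero>\<^bsub>B Quot J\<^esub> \<longleftrightarrow> p \<in> Ker"
  proof -
    have z: "\<zero>\<^bsub>B Quot J\<^esub> = J" by (simp only: FactRing_def ring.simps)
    show ?thesis
      unfolding z h_J_iff[OF p, symmetric]
      using J.rcos_const_imp_mem[OF hp] J.a_rcos_zero[OF ideal_J, of "h p"] by blast
  qed
  fix q assume q: "q \<in> G0"
  have hq: "h q \<in> carrier B" using q h_image by blast
  show "?H (p + q) = ?H p \<oplus>\<^bsub>B Quot J\<^esub> ?H q" using hh.hom_add[OF hp hq] by (simp only: h_simps(1)[OF p q])
  show "?H (p * q) = ?H p \<otimes>\<^bsub>B Quot J\<^esub> ?H q" using hh.hom_mult[OF hp hq] by (simp only: h_simps(2)[OF p q])
qed

end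

end

section \<open>Linear systems over polynomial functions\<close>

text \<open>Elimination without division: an unknown \<open>v\<close> whose coefficient in the
  equation \<open>e\<close> is nonzero is removed from the other equations by cross-multiplication.
  Lifting a solution back multiplies it by that coefficient, and it stays nonzero because, by
  \<open>dom\<close>, the polynomial functions on \<open>D\<close> form a domain.\<close>

lemma pfun_linear_system:
  fixes a :: "'e \<Rightarrow> 'u \<Rightarrow> (nat \<Rightarrow> int) \<Rightarrow> 'k::field_char_0"
  assumes dom: "\<And>f g. \<lbrakk>pfun n f; pfun n g; \<forall>x\<in>D. f x * g x = 0\<rbrakk> \<Longrightarrow>
      (\<forall>x\<in>D. f x = 0) \<or> (\<forall>x\<in>D. (g x :: 'k) = 0)"
    and D: "D \<noteq> {}"
    and E: "finite E" and U: "finite U" "card E < card U"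
    and a: "\<And>e u. \<lbrakk>e \<in> E; u \<in> U\<rbrakk> \<Longrightarrow> pfun n (a e u)"
  shows "\<exists>c. (\<forall>u\<in>U. pfun n (c u)) \<and> (\<exists>u\<in>U. \<exists>x\<in>D. c u x \<noteq> 0) \<and>
    (\<forall>e\<in>E. \<forall>x\<in>D. (\<Sum>u\<in>U. c u x * a e u x) = 0)"
  using E U a
proof (induction E arbitrary: U a rule: finite_induct)
  case empty
  then obtain u where "u \<in> U" by fastforce
  then show ?case using D by (intro exI[of _ "\<lambda>_ _. 1"]) (auto intro: pfun_const)
next
  case (insert e E)
  show ?case
  proof (cases "\<forall>u\<in>U. \<forall>x\<in>D. a e u x = 0")
    case True
    have "card E < card U" using insert by simp
    from insert.IH[of U a, OF insert.prems(1) this] insert.prems(3) obtain c where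
      "\<forall>u\<in>U. pfun n (c u)" "\<exists>u\<in>U. \<exists>x\<in>D. c u x \<noteq> 0"
      "\<forall>e\<in>E. \<forall>x\<in>D. (\<Sum>u\<in>U. c u x * a e u x) = 0" by blast
    then show ?thesis using True by (intro exI[of _ c]) auto
  next
    case False
    then obtain v where v: "v \<in> U" "\<exists>x\<in>D. a e v x \<noteq> 0" by blast
    define a' where "a' = (\<lambda>e' u x. a e v x * a e' u x - a e' v x * a e u x)"
    have "card E < card (U - {v})" using insert.prems(1,2) insert.hyps v(1) by simp
    moreover have "pfun n (a' e' u)" if "e' \<in> E" "u \<in> U - {v}" for e' u
      unfolding a'_def using that v(1) insert.prems(3) by (intro pfun_diff pfun_mult) auto
    ultimately obtain c where c: "\<forall>u\<in>U - {v}. pfun n (c u)" "\<exists>u\<in>U - {v}. \<exists>x\<in>D. c u x \<noteq> 0"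
      "\<forall>e'\<in>E. \<forall>x\<in>D. (\<Sum>u\<in>U - {v}. c u x * a' e' u x) = 0"
      using insert.IH[of "U - {v}" a'] insert.prems(1) by blast
    define c' where "c' = (\<lambda>u x. if u = v then - (\<Sum>u\<in>U - {v}. c u x * a e u x) else a e v x * c u x)"
    have split: "(\<Sum>u\<in>U. c' u x * a e' u x) =
        - (\<Sum>u\<in>U - {v}. c u x * a e u x) * a e' v x + (\<Sum>u\<in>U - {v}. a e v x * c u x * a e' u x)" for e' x
    proof -
      have "(\<Sum>u\<in>U - {v}. c' u x * a e' u x) = (\<Sum>u\<in>U - {v}. a e v x * c u x * a e' u x)"
        by (intro sum.cong) (auto simp: c'_def)
      then show ?thesis using insert.prems(1) v(1) by (subst sum.remove[of U v]) (auto simp: c'_def)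
    qed
    have "pfun n (c' u)" if u: "u \<in> U" for u
    proof (cases "u = v")
      case True
      have "pfun n (\<lambda>x. 0 - (\<Sum>u\<in>U - {v}. c u x * a e u x))"
        using c(1) insert.prems(3) by (intro pfun_diff pfun_const pfun_sum pfun_mult) auto
      moreover have "c' u = (\<lambda>x. 0 - (\<Sum>u\<in>U - {v}. c u x * a e u x))"
        using True by (simp add: c'_def)
      ultimately show ?thesis by (simp only:)
    next
      case False
      have "pfun n (\<lambda>x. a e v x * c u x)"
        using c(1) insert.prems(3) v(1) u False by (intro pfun_mult) auto
      moreover have "c' u = (\<lambda>x. a e v x * c u x)" using False by (simp add: c'_def)
      ultimately show ?thesis by (simp only:)
    qed
    moreover have "\<exists>u\<in>U. \<exists>x\<in>D. c' u x \<noteq> 0"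
    proof -
      obtain u y where u: "u \<in> U - {v}" "y \<in> D" "c u y \<noteq> 0" using c(2) by blast
      have "\<not> (\<forall>x\<in>D. a e v x * c u x = 0)"
        using dom[of "a e v" "c u"] u v c(1) insert.prems(3)[of e v] by blast
      then show ?thesis using u(1) by (intro bexI[of _ u]) (auto simp: c'_def)
    qed
    moreover have "(\<Sum>u\<in>U. c' u x * a e' u x) = 0" if "e' \<in> insert e E" "x \<in> D" for e' x
    proof (cases "e' = e")
      case True
      show ?thesis unfolding split True by (simp add: sum_distrib_left sum_distrib_right mult_ac)
    next
      case False
      have "(\<Sum>u\<in>U - {v}. c u x * a' e' u x) = 0" using c(3) that False by blast
      then show ?thesis
        unfolding split
        by (simp add: a'_def sum_distrib_left sum_distrib_right algebra_simps sum_subtractf)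
    qed
    ultimately show ?thesis by blast
  qed
qed

text \<open>Take the lexicographic maxima of both sets.\<close>

lemma unique_sum:
  fixes U V :: "(nat \<Rightarrow> int) set"
  assumes "finite N" "finite U" "U \<noteq> {}" "finite V" "V \<noteq> {}"
  shows "\<exists>u0\<in>U. \<exists>v0\<in>V. \<forall>u\<in>U. \<forall>v\<in>V. (\<forall>i\<in>N. u i + v i = u0 i + v0 i) \<longrightarrow>
    (\<forall>i\<in>N. u i = u0 i \<and> v i = v0 i)"
  using assms
proof (induction N arbitrary: U V rule: finite_induct)
  case (insert i N)
  have ex: "\<exists>u\<in>U. u i = Max ((\<lambda>u. u i) ` U)" if "finite U" "U \<noteq> {}" for U :: "(nat \<Rightarrow> int) set"
  proof -
    have "Max ((\<lambda>u. u i) ` U) \<in> (\<lambda>u. u i) ` U" using that by (intro Max_in) auto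
    then obtain u where "Max ((\<lambda>u. u i) ` U) = u i" "u \<in> U" by (rule imageE)
    then show ?thesis by (intro bexI[of _ u]) simp_all
  qed
  define U' where "U' = {u \<in> U. u i = Max ((\<lambda>u. u i) ` U)}"
  define V' where "V' = {v \<in> V. v i = Max ((\<lambda>v. v i) ` V)}"
  have "finite U'" "U' \<noteq> {}" "finite V'" "V' \<noteq> {}"
    using insert.prems ex[of U] ex[of V] by (auto simp: U'_def V'_def)
  from insert.IH[OF this] obtain u0 v0 where u0: "u0 \<in> U'" "v0 \<in> V'"
    "\<forall>u\<in>U'. \<forall>v\<in>V'. (\<forall>i\<in>N. u i + v i = u0 i + v0 i) \<longrightarrow> (\<forall>i\<in>N. u i = u0 i \<and> v i = v0 i)" by blast
  have "\<forall>j\<in>insert i N. u j = u0 j \<and> v j = v0 j"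
    if uv: "u \<in> U" "v \<in> V" and eq: "\<forall>j\<in>insert i N. u j + v j = u0 j + v0 j" for u v
  proof -
    have "u i \<le> u0 i" "v i \<le> v0 i"
      using uv u0(1,2) insert.prems(1,3) by (auto simp: U'_def V'_def)
    then have *: "u i = u0 i" "v i = v0 i" using bspec[OF eq, of i] by auto
    then have "u \<in> U'" "v \<in> V'" using uv u0(1,2) by (auto simp: U'_def V'_def)
    moreover have "\<forall>i\<in>N. u i + v i = u0 i + v0 i" using eq by blast
    ultimately have "\<forall>i\<in>N. u i = u0 i \<and> v i = v0 i" using u0(3) by blast
    then show ?thesis using * by simp
  qed
  moreover have "u0 \<in> U" "v0 \<in> V" using u0(1,2) by (simp_all add: U'_def V'_def)
  ultimately show ?case by blast
qed auto

text \<open>With \<open>x\<close> the root of order \<open>d + 1\<close> of \<open>N / m\<close>, it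
  suffices that \<open>(2 * j * c + 1) * x ^ j < 1\<close> for some \<open>j\<close>, and this holds
  since \<open>j * x ^ j\<close> tends to 0. The order \<open>d + 1\<close> instead of
  \<open>d\<close> admits \<open>d = 0\<close>.\<close>

lemma exponential_beats_power:
  fixes m N c d :: nat
  assumes "N < m"
  shows "\<exists>j. N ^ j * (2 * (j * c) + 1) ^ d < m ^ j"
proof (cases "N = 0")
  case True
  then show ?thesis using assms by (intro exI[of _ 1]) simp
next
  case False
  define x where "x = root (Suc d) (real N / real m)"
  have q: "0 < real N / real m" "real N / real m < 1" using False assms by auto
  have x: "0 < x" "x < 1" "x ^ Suc d = real N / real m"
    using q real_root_pow_pos2[of "Suc d" "real N / real m"]
    by (simp_all add: x_def real_root_gt_zero)
  have "(\<lambda>j. 2 * real c * (real j * x ^ j) + x ^ j) \<longlonglongrightarrow> 2 * real c * 0 + 0"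
    using x by (intro tendsto_intros powser_times_n_limit_0 LIMSEQ_power_zero) auto
  then have "eventually (\<lambda>j. 2 * real c * (real j * x ^ j) + x ^ j < 1) sequentially"
    by (rule order_tendstoD(2)) simp
  then obtain j where j: "2 * real c * (real j * x ^ j) + x ^ j < 1"
    using eventually_happens[of _ sequentially] by auto
  let ?A = "real (2 * (j * c) + 1)"
  have "?A * x ^ j < 1" using j by (simp add: algebra_simps)
  moreover have "0 < ?A * x ^ j" 
    by (intro mult_pos_pos zero_less_power x(1)) (rule of_nat_0_less_iff[THEN iffD2], simp)
  ultimately have "(?A * x ^ j) ^ Suc d < 1" by (intro power_less_one_iff[THEN iffD2]) auto
  moreover have "(?A * x ^ j) ^ Suc d = ?A ^ Suc d * (real N / real m) ^ j"
    unfolding power_mult_distrib x(3)[symmetric] by (simp only: power_mult[symmetric] mult.commute)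
  ultimately have "?A ^ Suc d * (real N / real m) ^ j < 1" by (simp only:)
  then have "?A ^ Suc d * real N ^ j / real m ^ j < 1"
    by (simp only: power_divide times_divide_eq_right)
  moreover have "0 < real m ^ j" using assms by simp
  ultimately have "?A ^ Suc d * real N ^ j < real m ^ j" by (simp only: pos_divide_less_eq mult_1)
  moreover have "?A ^ d \<le> ?A ^ Suc d" by (intro power_increasing) auto
  then have "?A ^ d * real N ^ j \<le> ?A ^ Suc d * real N ^ j" by (intro mult_right_mono) auto
  ultimately have "?A ^ d * real N ^ j < real m ^ j" by linarith
  then have "real (N ^ j * (2 * (j * c) + 1) ^ d) < real (m ^ j)"
    by (simp only: of_nat_mult of_nat_power mult.commute)
  then show ?thesis by (intro exI[of _ j]) (simp only: of_nat_less_iff)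
qed

section \<open>The Goldie rank\<close>

text \<open>What a type contributes to the rank: \<open>Lam\<close> splits along \<open>J0\<close>,
  the factor of \<open>S\<close> over \<open>J0\<close> is finite, and an integral \<open>e\<close>
  points into the interior of the cone on the remaining integral coordinates. The sign of
  \<open>e\<close> is opposite to that of the vector in the sign decomposition, as
  \<open>sign_form\<close> is negative on increasing coordinates where \<open>\<alpha> i\<close> is
  nonnegative.\<close>

locale weyl_type = weyl_data r s \<gg> \<alpha> for r s \<gg> and \<alpha> :: "nat \<Rightarrow> rat" +
  fixes J0 :: "nat set" and e :: "nat \<Rightarrow> int"
  assumes g: "torus_subspace r s \<gg>"
    and J0_T: "J0 \<subseteq> T"
    and split_Lam: "u \<in> Lam \<Longrightarrow> (\<lambda>i. if i \<in> J0 then u i else 0) \<in> Lam"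
    and e_Lam: "e \<in> Lam" and e_J: "j \<in> J0 \<Longrightarrow> e j = 0"
    and e_pos: "i \<in> T - J0 \<Longrightarrow> 0 < (if 0 \<le> \<alpha> i then e i else - e i)"
    and finite_SJ: "finite {d \<in> S. \<forall>i. i \<notin> J0 \<longrightarrow> d i = 0}"
begin

definition SJ :: "(nat \<Rightarrow> int) set" where "SJ = {d \<in> S. \<forall>i. i \<notin> J0 \<longrightarrow> d i = 0}"

definition jp :: "(nat \<Rightarrow> int) \<Rightarrow> nat \<Rightarrow> int" where "jp u = (\<lambda>i. if i \<in> J0 then u i else 0)"

definition LI :: "(nat \<Rightarrow> int) set" where "LI = {u \<in> Lam. \<forall>j\<in>J0. u j = 0}"

abbreviation sg :: "nat \<Rightarrow> int" where "sg i \<equiv> if 0 \<le> \<alpha> i then 1 else -1"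

text \<open>Points so far inside the cone that adding a weight bounded by \<open>M\<close> on
  \<open>T - J0\<close> does not change the sign of a coordinate there.\<close>

definition deep :: "int \<Rightarrow> (nat \<Rightarrow> int) set" where
  "deep M = {b \<in> LI. \<forall>i\<in>T - J0. M \<le> sg i * b i}"

lemma finite_T: "finite T"
  by (rule finite_subset[of _ "{1..r}"]) (auto simp: integral_idx_def)

lemma jp_Lam: "u \<in> Lam \<Longrightarrow> jp u \<in> Lam"
  unfolding jp_def by (rule split_Lam)

lemma jp_simps: "jp (u + v) = jp u + jp v" "jp (u - v) = jp u - jp v" "jp (- u) = - jp u"
  "jp 0 = 0" "jp (jp u) = jp u"
  by (auto simp: jp_def fun_eq_iff)

lemma LI_iff: "u \<in> LI \<longleftrightarrow> u \<in> Lam \<and> jp u = 0"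
  by (auto simp: LI_def jp_def fun_eq_iff)

lemma LI_closed:
  "0 \<in> LI" "\<lbrakk>u \<in> LI; v \<in> LI\<rbrakk> \<Longrightarrow> u + v \<in> LI" "\<lbrakk>u \<in> LI; v \<in> LI\<rbrakk> \<Longrightarrow> u - v \<in> LI"
  "u \<in> LI \<Longrightarrow> (\<lambda>i. t * u i) \<in> LI" "e \<in> LI"
  using e_Lam e_J by (auto simp: LI_def)

lemma S_iff: "b \<in> S \<longleftrightarrow> b \<in> Lam \<and> jp b \<in> SJ \<and> (\<forall>i\<in>T - J0. (0 \<le> \<alpha> i + of_int (b i)) = (0 \<le> \<alpha> i))"
  using jp_Lam[of b] J0_T by (auto simp: S_def SJ_def jp_def)

lemma SJ_S: "d \<in> SJ \<Longrightarrow> d \<in> S" and SJ_Lam: "d \<in> SJ \<Longrightarrow> d \<in> Lam" and jp_SJ: "d \<in> SJ \<Longrightarrow> jp d = d"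
  and SJ_0: "0 \<in> SJ"
  using S_0 by (auto simp: SJ_def S_def jp_def fun_eq_iff)

lemma finite_SJ': "finite SJ"
  using finite_SJ by (simp add: SJ_def)

lemma sign_kept:
  fixes b :: int and a :: rat
  assumes "0 \<le> (if 0 \<le> a then 1 else -1) * b"
  shows "(0 \<le> a + of_int b) = (0 \<le> a)"
proof -
  have "(0::rat) \<le> of_int ((if 0 \<le> a then 1 else -1) * b)" using assms by (simp only: of_int_0_le_iff)
  then show ?thesis by (auto split: if_splits)
qed

lemma deep_S:
  assumes b: "b \<in> deep M" and u: "u \<in> Lam" "jp u \<in> SJ" and M: "\<And>i. i \<in> T - J0 \<Longrightarrow> \<bar>u i\<bar> \<le> M"
  shows "b + u \<in> S"
  unfolding S_iff
proof (intro conjI ballI)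
  have "b \<in> Lam" "jp b = 0" using b by (auto simp: deep_def LI_iff)
  then show "b + u \<in> Lam" "jp (b + u) \<in> SJ" using u by (auto simp: jp_simps)
  fix i assume i: "i \<in> T - J0"
  have "M \<le> sg i * b i" using b i by (simp add: deep_def)
  then have "0 \<le> sg i * (b + u) i" using M[OF i] by (auto simp: distrib_left split: if_splits)
  then show "(0 \<le> \<alpha> i + of_int ((b + u) i)) = (0 \<le> \<alpha> i)" by (rule sign_kept)
qed

text \<open>Restrict both functions to the line joining a point where \<open>f\<close> does not
  vanish with a point where \<open>g\<close> does not. Its integral points stay in
  \<open>LI\<close>, and polynomials in one variable form a domain.\<close>

lemma LI_domain:
  fixes f g :: "(nat \<Rightarrow> int) \<Rightarrow> 'a"
  assumes f: "pfun n f" and g: "pfun n g" and fg: "\<forall>x\<in>LI. f x * g x = 0"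
  shows "(\<forall>x\<in>LI. f x = 0) \<or> (\<forall>x\<in>LI. g x = 0)"
proof (rule ccontr)
  assume "\<not> ?thesis"
  then obtain x y where x: "x \<in> LI" "f x \<noteq> 0" and y: "y \<in> LI" "g y \<noteq> 0" by blast
  let ?c = "\<lambda>t i. x i + t * (y - x) i + t * (t - 1) * (0 :: nat \<Rightarrow> int) i"
  have c: "?c t = x + (\<lambda>i. t * (y - x) i)" for t by (auto simp: fun_eq_iff)
  have cL: "?c t \<in> LI" for t unfolding c using x y by (intro LI_closed)
  obtain p q where p: "\<And>t. f (?c t) = poly p (of_int t)" and q: "\<And>t. g (?c t) = poly q (of_int t)"
    using pfun_curve[OF f, of x "y - x" 0] pfun_curve[OF g, of x "y - x" 0] by blast
  have "poly (p * q) (of_int t) = 0" for t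
    using fg cL[of t] p[of t] q[of t] by auto
  then have "p * q = 0" by (intro poly_eq_0_if_almost_all_ints[of "{}"]) auto
  then have "p = 0 \<or> q = 0" by simp
  moreover have "?c 0 = x" "?c 1 = y" by (auto simp: fun_eq_iff)
  ultimately show False using p[of 0] q[of 1] x y by auto
qed

text \<open>The curve \<open>x + t (y - x) + t (t - 1) z\<close> passes through \<open>y\<close> at \<open>t = 1\<close> and stays deep inside
  the cone at all other integers \<open>t\<close>.\<close>

lemma deep_dense:
  assumes f: "pfun n f" and z: "\<forall>b\<in>deep M. f b = 0" and y: "y \<in> LI"
  shows "f y = 0"
proof -
  define x where "x = (\<lambda>i. \<bar>M\<bar> * e i)"
  have x: "x \<in> LI" unfolding x_def by (intro LI_closed)
  define A where "A = (\<Sum>i\<in>T. \<bar>y i - x i\<bar>)"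
  have A: "\<bar>y i - x i\<bar> \<le> A" if "i \<in> T" for i
    unfolding A_def using finite_T that by (intro member_le_sum) auto
  have A0: "0 \<le> A" by (simp add: A_def sum_nonneg)
  \<comment> \<open>\<open>A\<close> bounds the drift of the linear term per unit of
    \<open>t\<close>. Since \<open>\<bar>t\<bar> \<le> t * (t - 1)\<close> for every integer
    \<open>t\<close> except 1, the quadratic term with direction \<open>A * e\<close> outweighs this
    drift.\<close>
  define w where "w = (\<lambda>i. A * e i)"
  have w: "w \<in> LI" unfolding w_def by (intro LI_closed)
  let ?c = "\<lambda>t i. x i + t * (y - x) i + t * (t - 1) * w i"
  have c: "?c t = x + (\<lambda>i. t * (y - x) i) + (\<lambda>i. (t * (t - 1)) * w i)" for t by (auto simp: fun_eq_iff)
  have cL: "?c t \<in> LI" for t unfolding c using x y w by (intro LI_closed)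
  have cd: "?c t \<in> deep M" if t: "t \<noteq> 1" for t
    unfolding deep_def
  proof (intro CollectI conjI ballI)
    fix i assume i: "i \<in> T - J0"
    have se: "1 \<le> sg i * e i" using e_pos[OF i] by (auto split: if_splits)
    have "\<bar>M\<bar> * 1 \<le> \<bar>M\<bar> * (sg i * e i)" using se by (intro mult_left_mono) auto
    then have 1: "M \<le> sg i * x i" by (simp add: x_def algebra_simps split: if_splits)
    have "\<bar>t\<bar> \<le> t * (t - 1)"
    proof (cases "t \<le> 0")
      case True
      then have "- t * 1 \<le> - t * (1 - t)" by (intro mult_left_mono) auto
      then show ?thesis using True by (simp add: algebra_simps)
    next
      case False
      then have "t * 1 \<le> t * (t - 1)" using t by (intro mult_left_mono) auto
      then show ?thesis using False by simp
    qed
    then have "\<bar>t\<bar> * A \<le> t * (t - 1) * A" using A0 by (intro mult_right_mono)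
    also have "\<dots> * 1 \<le> t * (t - 1) * A * (sg i * e i)"
    proof (rule mult_left_mono[OF se])
      have "0 \<le> t * (t - 1)" using \<open>\<bar>t\<bar> \<le> t * (t - 1)\<close> by linarith
      then show "0 \<le> t * (t - 1) * A" using A0 by (rule mult_nonneg_nonneg)
    qed
    finally have 2: "\<bar>t\<bar> * A \<le> sg i * (t * (t - 1) * w i)" by (simp add: w_def algebra_simps split: if_splits)
    have "\<bar>t * (y - x) i\<bar> \<le> \<bar>t\<bar> * A" using A[of i] i by (simp add: abs_mult mult_left_mono)
    then have 3: "- (\<bar>t\<bar> * A) \<le> sg i * (t * (y - x) i)" by (auto split: if_splits)
    have "sg i * ?c t i = sg i * x i + sg i * (t * (y - x) i) + sg i * (t * (t - 1) * w i)"
      by (simp add: distrib_left)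
    then show "M \<le> sg i * ?c t i" using 1 2 3 by linarith
  qed (rule cL)
  obtain p where p: "\<And>t. f (?c t) = poly p (of_int t)"
    using pfun_curve[OF f, of x "y - x" w] by blast
  have "poly p (of_int t) = 0" if t: "t \<notin> {1}" for t
  proof -
    have "t \<noteq> 1" using t by simp
    from bspec[OF z cd[OF this]] show ?thesis unfolding p .
  qed
  then have "p = 0" by (intro poly_eq_0_if_almost_all_ints[of "{1}"]) auto
  moreover have "?c 1 = y" by (auto simp: fun_eq_iff)
  ultimately show ?thesis using p[of 1] by simp
qed

lemma deep_point: "(\<lambda>i. \<bar>M\<bar> * e i) \<in> deep M"
  unfolding deep_def
proof (intro CollectI conjI ballI)
  fix i assume i: "i \<in> T - J0"
  have "\<bar>M\<bar> * 1 \<le> \<bar>M\<bar> * (sg i * e i)" using e_pos[OF i] by (intro mult_left_mono) (auto split: if_splits)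
  then show "M \<le> sg i * (\<bar>M\<bar> * e i)" by (simp add: algebra_simps split: if_splits)
qed (intro LI_closed)

lemma entry_homog_left:
  assumes "m \<in> homog u"
  shows "entry ak (m * p) x b = entry ak m x (x - u) * entry ak p (x - u) b"
proof -
  have "entry ak (m * p) x b = (\<Sum>y\<in>targets p b. if y = x - u then entry ak m x (x - u) * entry ak p (x - u) b else 0)"
    unfolding entry_mult
  proof (intro sum.cong refl)
    fix y
    have "entry ak m x y = 0" if "y \<noteq> x - u"
      using entry_homog[OF assms, of x y] that by (metis add_diff_cancel_right')
    then show "entry ak m x y * entry ak p y b = (if y = x - u then entry ak m x (x - u) * entry ak p (x - u) b else 0)"
      by auto
  qed
  also have "\<dots> = entry ak m x (x - u) * entry ak p (x - u) b"
    using entry_eq_0[of "x - u" p b ak] by (auto simp: finite_targets)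
  finally show ?thesis .
qed

lemma entry_diag_left:
  assumes "\<forall>g b. act ak t g b = \<phi> b * g b"
  shows "entry ak (t * p) b' b = \<phi> b' * entry ak p b' b"
proof -
  have "act ak t (\<lambda>x. if x = b' then 1 else 0) = (\<lambda>x. \<phi> b' * (if x = b' then 1 else 0))"
    using assms by (intro ext) auto
  then show ?thesis by (simp add: entry_def act_mult act_fun_scale)
qed

text \<open>A Lagrange product: for every other point of the finite set \<open>SJ\<close> there is a
  factor that vanishes at it, taken in a coordinate where it differs from \<open>d\<close>. Realized
  in \<open>tpoly\<close>, it selects the weights over \<open>d\<close> up to nonzero
  factors.\<close>

lemma separate_SJ:
  assumes d: "d \<in> SJ"
  shows "\<exists>\<phi> :: (nat \<Rightarrow> int) \<Rightarrow> 'a. pfun n \<phi> \<and> (\<forall>b. jp b \<in> SJ \<longrightarrow> (\<phi> b = 0 \<longleftrightarrow> jp b \<noteq> d))"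
proof -
  have "\<exists>j\<in>J0. d' j \<noteq> d j" if "d' \<in> SJ - {d}" for d'
    using that d by (auto simp: SJ_def fun_eq_iff) metis
  then obtain j where j: "\<And>d'. d' \<in> SJ - {d} \<Longrightarrow> j d' \<in> J0 \<and> d' (j d') \<noteq> d (j d')" by metis
  define \<phi> :: "(nat \<Rightarrow> int) \<Rightarrow> 'a" where
    "\<phi> b = (\<Prod>d'\<in>SJ - {d}. of_int (b (j d')) - of_int (d' (j d')))" for b
  have "pfun n \<phi>"
    unfolding \<phi>_def
  proof (intro pfun_prod pfun_diff pfun_const pfun_coord)
    fix d' assume "d' \<in> SJ - {d}"
    then have "j d' \<in> T" using j J0_T by blast
    then show "j d' \<in> {1..n}" by (auto simp: integral_idx_def)
  qed
  moreover have "\<phi> b = 0 \<longleftrightarrow> jp b \<noteq> d" if b: "jp b \<in> SJ" for b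
  proof
    assume "\<phi> b = 0"
    then obtain d' where d': "d' \<in> SJ - {d}" "b (j d') = d' (j d')"
      using finite_SJ' by (auto simp: \<phi>_def)
    then have "jp b (j d') = d' (j d')" using j[OF d'(1)] by (simp add: jp_def)
    then show "jp b \<noteq> d" using j[OF d'(1)] by auto
  next
    assume "jp b \<noteq> d"
    then have mem: "jp b \<in> SJ - {d}" using b by simp
    then have "b (j (jp b)) = jp b (j (jp b))" using j[OF mem] by (simp add: jp_def)
    then show "\<phi> b = 0" unfolding \<phi>_def using mem finite_SJ' by (intro prod_zero bexI[of _ "jp b"]) auto
  qed
  ultimately show ?thesis by blast
qed

section \<open>Growth of the number of lattice points in boxes\<close>

definition box :: "nat \<Rightarrow> (nat \<Rightarrow> int) set" where
  "box k = {u \<in> LI. \<forall>i. \<bar>u i\<bar> \<le> int k}"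

lemma box_bounds: "finite (box k)" "0 < card (box k)" "card (box k) \<le> (2 * k + 1) ^ n"
proof -
  let ?B = "{f :: nat \<Rightarrow> int. \<forall>x. (x \<in> {1..n} \<longrightarrow> f x \<in> {- int k..int k}) \<and> (x \<notin> {1..n} \<longrightarrow> f x = 0)}"
  have "u x \<in> {- int k..int k}" "x \<notin> {1..n} \<Longrightarrow> u x = 0" if "u \<in> box k" for u x
  proof -
    have "\<bar>u x\<bar> \<le> int k" using that by (simp add: box_def)
    then show "u x \<in> {- int k..int k}" by auto
    show "x \<notin> {1..n} \<Longrightarrow> u x = 0" using that by (simp add: box_def LI_def Lam_def)
  qed
  then have sub: "box k \<subseteq> ?B" by blast
  have finB: "finite ?B" by (rule finite_set_of_finite_funs) auto
  show fin: "finite (box k)" by (rule finite_subset[OF sub finB])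
  have "0 \<in> box k" using LI_closed(1) by (simp add: box_def)
  then show "0 < card (box k)" using fin card_gt_0_iff by blast
  have inj: "inj_on (\<lambda>f. restrict f {1..n}) ?B"
  proof (rule inj_onI)
    fix f f' assume ff: "f \<in> ?B" "f' \<in> ?B" "restrict f {1..n} = restrict f' {1..n}"
    show "f = f'"
    proof
      fix x show "f x = f' x"
      proof (cases "x \<in> {1..n}")
        case True
        then show ?thesis using fun_cong[OF ff(3), of x] by simp
      qed (use ff in auto)
    qed
  qed
  have "card (box k) \<le> card ?B" by (rule card_mono[OF finB sub])
  also have "\<dots> = card ((\<lambda>f. restrict f {1..n}) ` ?B)" by (rule card_image[OF inj, symmetric])
  also have "\<dots> \<le> card (PiE {1..n} (\<lambda>_. {- int k..int k}))"
    by (rule card_mono) (auto intro!: finite_PiE)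
  also have "\<dots> = (2 * k + 1) ^ n" by (simp add: card_PiE nat_add_distrib nat_mult_distrib)
  finally show "card (box k) \<le> (2 * k + 1) ^ n" .
qed

text \<open>Otherwise iteration from \<open>box 0\<close> in steps of \<open>c\<close> gives
  \<open>m ^ j \<le> N ^ j * card (box (j * c))\<close> for all \<open>j\<close>, against the
  polynomial bound on the number of points.\<close>

lemma box_growth:
  assumes "N < m"
  shows "\<exists>k. N * card (box (k + c)) < m * card (box k)"
proof (rule ccontr)
  assume "\<not> ?thesis"
  then have step: "m * card (box k) \<le> N * card (box (k + c))" for k by (meson not_less)
  have "m ^ j \<le> N ^ j * card (box (j * c))" for j
  proof (induction j)
    case 0
    then show ?case using box_bounds(2)[of 0] by simp
  next
    case (Suc j)
    have "m ^ Suc j \<le> m * (N ^ j * card (box (j * c)))" using Suc by simp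
    also have "\<dots> \<le> N ^ j * (N * card (box (j * c + c)))"
      using step[of "j * c"] by (simp add: mult.left_commute)
    finally show ?case by (simp add: algebra_simps)
  qed
  moreover obtain j where "N ^ j * (2 * (j * c) + 1) ^ n < m ^ j"
    using exponential_beats_power[OF assms] by blast
  moreover have "N ^ j * card (box (j * c)) \<le> N ^ j * (2 * (j * c) + 1) ^ n"
    using box_bounds(3) by (rule mult_le_mono2)
  ultimately show False by (meson le_trans not_less)
qed

section \<open>Upper and lower bounds for independent left ideals\<close>

lemma Ker_0: "0 \<in> Ker" by (simp add: Ker_def G0_0)

text \<open>Let \<open>y i \<in> L i\<close> have a nonzero entry in a row of \<open>LI\<close>. If \<open>m > |SJ|\<close>, then for large \<open>k\<close> the
  elements \<open>mon u * y i\<close> with \<open>u \<in> box k\<close> outnumber the pairs of a point of \<open>SJ\<close> and a degree that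
  index their entries in a row of \<open>LI\<close>, so they satisfy a nontrivial linear relation on these rows
  with polynomial coefficients \<open>cf\<close>. The factor \<open>E\<close> kills all other rows, so the relation holds
  modulo \<open>Ker\<close>; its leading term with respect to a unique sum of degrees does not vanish.\<close>

lemma independent_left_ideals_bound:
  assumes L: "\<And>i. i < m \<Longrightarrow> L i \<subseteq> G0"
    and L_add: "\<And>i p q. \<lbrakk>i < m; p \<in> L i; q \<in> L i\<rbrakk> \<Longrightarrow> p + q \<in> L i"
    and L_0: "\<And>i. i < m \<Longrightarrow> 0 \<in> L i"
    and L_mult: "\<And>i p q. \<lbrakk>i < m; p \<in> G0; q \<in> L i\<rbrakk> \<Longrightarrow> p * q \<in> L i"
    and nz: "\<And>i. i < m \<Longrightarrow> \<not> L i \<subseteq> Ker"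
    and indep: "\<And>a. \<lbrakk>\<And>i. i < m \<Longrightarrow> a i \<in> L i; (\<Sum>i<m. a i) \<in> Ker\<rbrakk> \<Longrightarrow> \<forall>i<m. a i \<in> Ker"
  shows "m \<le> card SJ"
proof (rule ccontr)
  assume "\<not> m \<le> card SJ"
  then have mN: "card SJ < m" by simp
  have L_sum: "sum f A \<in> L i" if "i < m" "\<And>u. u \<in> A \<Longrightarrow> f u \<in> L i" for f i and A :: "(nat \<Rightarrow> int) set"
    using that(2) by (induction A rule: infinite_finite_induct) (auto intro: L_0[OF that(1)] L_add[OF that(1)])
  have "\<exists>y x b. y \<in> L i \<and> x \<in> LI \<and> b \<in> S \<and> entry ak y x b \<noteq> 0" if i: "i < m" for i
  proof -
    obtain w where w: "w \<in> L i" "w \<notin> Ker" using nz[OF i] by blast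
    then obtain b b' where b: "b \<in> S" "b' \<in> S" "entry ak w b' b \<noteq> 0"
      using L[OF i] by (auto simp: Ker_def)
    \<comment> \<open>A monomial of weight \<open>- jp b'\<close> moves the nonzero row
      \<open>b'\<close> into \<open>LI\<close> without leaving \<open>S\<close>, where its entry is
      nonzero.\<close>
    let ?u = "- jp b'"
    have b'J: "jp b' \<in> SJ" "b' \<in> Lam" using b(2) S_iff by auto
    have uL: "?u \<in> Lam" using b'J SJ_Lam by (intro Lam_closed)
    have j0: "jp (b' + ?u) = 0" by (simp only: jp_simps add.right_inverse)
    have x: "b' + ?u \<in> LI" unfolding LI_iff using b'J uL j0 by blast
    have xS: "b' + ?u \<in> S"
      unfolding S_iff using x b(2) j0 SJ_0 by (auto simp: LI_iff S_iff jp_def)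
    obtain \<mu> where \<mu>: "\<mu> \<in> G0" "\<mu> \<in> homog ?u" "entry ak \<mu> (b' + ?u) b' \<noteq> 0"
      using monomial[OF uL] b(2) xS by blast
    have "entry ak (\<mu> * w) (b' + ?u) b = entry ak \<mu> (b' + ?u) b' * entry ak w b' b"
      using entry_homog_left[OF \<mu>(2), of w "b' + ?u" b] by (simp only: add_diff_cancel_right')
    then have "entry ak (\<mu> * w) (b' + ?u) b \<noteq> 0" using \<mu>(3) b(3) by simp
    then show ?thesis using L_mult[OF i \<mu>(1) w(1)] x b(1) by blast
  qed
  then obtain y t src where y: "\<And>i. i < m \<Longrightarrow> y i \<in> L i" and t: "\<And>i. i < m \<Longrightarrow> t i \<in> LI"
    and src: "\<And>i. i < m \<Longrightarrow> src i \<in> S" and yts: "\<And>i. i < m \<Longrightarrow> entry ak (y i) (t i) (src i) \<noteq> 0"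
    by metis
  have yG: "y i \<in> G0" if "i < m" for i using y L that by blast
  obtain mon where mon: "\<And>u. u \<in> Lam \<Longrightarrow> mon u \<in> G0" "\<And>u. u \<in> Lam \<Longrightarrow> mon u \<in> homog u"
    "\<And>u b. \<lbrakk>u \<in> Lam; b \<in> S; b + u \<in> S\<rbrakk> \<Longrightarrow> entry ak (mon u) (b + u) b \<noteq> 0"
    using monomial by metis
  \<comment> \<open>A crude common bound for the coordinates of all weights of the
    \<open>y i\<close>; what matters is that it does not depend on \<open>k\<close>.\<close>
  define c where "c = nat (\<Sum>i<m. \<Sum>v\<in>weights (y i). \<Sum>j=1..n. \<bar>v j\<bar>)"
  have c: "\<bar>v j\<bar> \<le> int c" if i: "i < m" and v: "v \<in> weights (y i)" and v0: "\<And>j. j \<notin> {1..n} \<Longrightarrow> v j = 0" for i v j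
  proof (cases "j \<in> {1..n}")
    case True
    have "\<bar>v j\<bar> \<le> (\<Sum>j=1..n. \<bar>v j\<bar>)" using True by (intro member_le_sum) auto
    also have "\<dots> \<le> (\<Sum>v\<in>weights (y i). \<Sum>j=1..n. \<bar>v j\<bar>)"
      using v finite_weights by (intro member_le_sum[of v _ "\<lambda>v. \<Sum>j=1..n. \<bar>v j\<bar>"]) (auto intro: sum_nonneg)
    also have "\<dots> \<le> (\<Sum>i<m. \<Sum>v\<in>weights (y i). \<Sum>j=1..n. \<bar>v j\<bar>)"
      using i by (intro member_le_sum[of i _ "\<lambda>i. \<Sum>v\<in>weights (y i). \<Sum>j=1..n. \<bar>v j\<bar>"]) (auto intro!: sum_nonneg)
    finally show ?thesis by (simp add: c_def)
  qed (use v0 in simp)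
  obtain k where k: "card SJ * card (box (k + c)) < m * card (box k)" using box_growth[OF mN] by blast
  \<comment> \<open>The degree \<open>b' - b\<close> from a column over \<open>d \<in> SJ\<close> to
    a row in \<open>LI\<close> is \<open>w - d\<close> with \<open>w \<in> LI\<close>. Multiplying
    \<open>y i\<close> by a monomial with degree in \<open>box k\<close> keeps \<open>w\<close> in
    \<open>box (k + c)\<close>.\<close>
  define V where "V = (\<lambda>(d, w). w - d) ` (SJ \<times> box (k + c))"
  define a where "a = (\<lambda>v (i, u) x. entry ak (mon u * y i) x (x - v))"
  have pf: "pfun n (\<lambda>x. entry ak p x (x - v))" if "p \<in> G0" for p v
  proof -
    have "pfun n (\<lambda>b. entry ak p (b + v) b)" using G0_F[OF that] by (intro pfun_entry) (simp add: carrier_F)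
    then have "pfun n (\<lambda>x. entry ak p (x - v + v) (x - v))" by (rule pfun_shift_diff)
    then show ?thesis by simp
  qed
  have cf_ex: "\<exists>cf. (\<forall>u\<in>{..<m} \<times> box k. pfun n (cf u)) \<and> (\<exists>u\<in>{..<m} \<times> box k. \<exists>x\<in>LI. cf u x \<noteq> 0) \<and>
      (\<forall>v\<in>V. \<forall>x\<in>LI. (\<Sum>u\<in>{..<m} \<times> box k. cf u x * a v u x) = 0)"
  proof (rule pfun_linear_system[OF LI_domain])
    show "LI \<noteq> {}" using LI_closed(1) by blast
    show "finite V" unfolding V_def using finite_SJ' box_bounds(1) by blast
    have "card V \<le> card (SJ \<times> box (k + c))"
      unfolding V_def by (rule card_image_le) (simp add: finite_SJ' box_bounds(1))
    then show "card V < card ({..<m} \<times> box k)" using k by (simp add: card_cartesian_product)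
    show "finite ({..<m} \<times> box k)" using box_bounds(1) by simp
    fix v u assume "u \<in> {..<m} \<times> box k"
    then obtain i w where "u = (i, w)" "i < m" "w \<in> Lam" by (auto simp: box_def LI_def)
    then show "pfun n (a v u)" using pf[of "mon w * y i" v] mon(1) yG by (simp add: a_def G0_mult)
  qed
  obtain cf where cf: "\<And>i u. \<lbrakk>i < m; u \<in> box k\<rbrakk> \<Longrightarrow> pfun n (cf (i, u))"
    and cf_nz: "\<exists>i<m. \<exists>u\<in>box k. \<exists>x\<in>LI. cf (i, u) x \<noteq> 0"
    and cf_eq: "\<And>v x. \<lbrakk>v \<in> V; x \<in> LI\<rbrakk> \<Longrightarrow> (\<Sum>i<m. \<Sum>u\<in>box k. cf (i, u) x * entry ak (mon u * y i) x (x - v)) = 0"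
  proof -
    from cf_ex obtain cf where 1: "\<forall>u\<in>{..<m} \<times> box k. pfun n (cf u)"
      and 2: "\<exists>u\<in>{..<m} \<times> box k. \<exists>x\<in>LI. cf u x \<noteq> 0"
      and 3: "\<forall>v\<in>V. \<forall>x\<in>LI. (\<Sum>u\<in>{..<m} \<times> box k. cf u x * a v u x) = 0" by blast
    have "(\<Sum>i<m. \<Sum>u\<in>box k. cf (i, u) x * entry ak (mon u * y i) x (x - v)) =
        (\<Sum>u\<in>{..<m} \<times> box k. cf u x * a v u x)" for v x
      unfolding sum.cartesian_product by (intro sum.cong) (auto simp: a_def)
    with 1 2 3 show ?thesis by (intro that[of cf]) auto
  qed
  obtain \<phi> :: "(nat \<Rightarrow> int) \<Rightarrow> 'a" where \<phi>: "pfun n \<phi>" "\<And>b. jp b \<in> SJ \<Longrightarrow> \<phi> b = 0 \<longleftrightarrow> jp b \<noteq> 0"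
    using separate_SJ[OF SJ_0] by blast
  obtain E where E: "E \<in> tpoly" "\<forall>g b. act ak E g b = \<phi> b * g b" using tpoly_realize[OF \<phi>(1)] by blast
  have "\<exists>p\<in>tpoly. \<forall>g b. act ak p g b = cf (i, u) b * g b" if "i < m" "u \<in> box k" for i u
    using tpoly_realize[OF cf[OF that]] .
  then obtain Q where Q: "\<And>i u. \<lbrakk>i < m; u \<in> box k\<rbrakk> \<Longrightarrow> Q i u \<in> tpoly \<and> (\<forall>g b. act ak (Q i u) g b = cf (i, u) b * g b)"
    by metis
  define \<theta> where "\<theta> i = E * (\<Sum>u\<in>box k. Q i u * (mon u * y i))" for i
  have boxLam: "u \<in> Lam" if "u \<in> box k" for u using that by (simp add: box_def LI_def)
  have \<theta>L: "\<theta> i \<in> L i" if i: "i < m" for i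
    unfolding \<theta>_def
  proof (intro L_mult[OF i tpoly_G0[OF E(1)]] L_sum[OF i])
    fix u assume u: "u \<in> box k"
    have "mon u * y i \<in> L i" by (rule L_mult[OF i mon(1)[OF boxLam[OF u]] y[OF i]])
    moreover have "Q i u \<in> G0" using Q[OF i u] tpoly_G0 by blast
    ultimately show "Q i u * (mon u * y i) \<in> L i" using L_mult[OF i] by blast
  qed
  have \<theta>_entry: "entry ak (\<theta> i) b' b = \<phi> b' * (\<Sum>u\<in>box k. cf (i, u) b' * entry ak (mon u * y i) b' b)"
    if i: "i < m" for i b b'
  proof -
    have "entry ak (Q i u * (mon u * y i)) b' b = cf (i, u) b' * entry ak (mon u * y i) b' b" if "u \<in> box k" for u
      using Q[OF i that] by (intro entry_diag_left) blast
    then show ?thesis unfolding \<theta>_def entry_diag_left[OF E(2)] entry_sum by simp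
  qed
  have "(\<Sum>i<m. \<theta> i) \<in> Ker"
    unfolding Ker_def
  proof (intro CollectI conjI ballI)
    show "(\<Sum>i<m. \<theta> i) \<in> G0" using \<theta>L L by (intro G0_sum) auto
    fix b b' assume b: "b \<in> S" "b' \<in> S"
    have eq: "entry ak (\<Sum>i<m. \<theta> i) b' b =
        \<phi> b' * (\<Sum>i<m. \<Sum>u\<in>box k. cf (i, u) b' * entry ak (mon u * y i) b' b)"
      by (simp add: entry_sum \<theta>_entry sum_distrib_left)
    have bJ: "jp b \<in> SJ" "jp b' \<in> SJ" "b \<in> Lam" "b' \<in> Lam" using b by (auto simp: S_iff)
    show "entry ak (\<Sum>i<m. \<theta> i) b' b = 0"
    proof (cases "jp b' = 0")
      case False
      then show ?thesis using eq \<phi>(2) bJ by simp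
    next
      case True
      then have b'L: "b' \<in> LI" using bJ by (simp add: LI_iff)
      show ?thesis
      proof (cases "b' - b \<in> V")
        case True
        have "b' - (b' - b) = b" by simp
        then show ?thesis using cf_eq[OF True b'L] eq by simp
      next
        case notV: False
        have "entry ak (mon u * y i) b' b = 0" if iu: "i < m" "u \<in> box k" for i u
        proof (rule ccontr)
          assume "entry ak (mon u * y i) b' b \<noteq> 0"
          then have "entry ak (y i) (b' - u) b \<noteq> 0"
            using entry_homog_left[OF mon(2)[OF boxLam[OF iu(2)]], of "y i" b' b] by auto
          then have "b' - u \<in> targets (y i) b" using entry_eq_0 by blast
          then obtain v where v: "v \<in> weights (y i)" "b' - u = b + v" by (auto simp: targets_def weights_def)
          have uL: "u \<in> LI" using iu(2) by (simp add: box_def)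
          have v': "v = b' - u - b" using v(2) by simp
          have vL: "v \<in> Lam" unfolding v' using bJ boxLam[OF iu(2)] by (intro Lam_closed)
          let ?w = "b' - b + jp b"
          have w: "?w \<in> LI"
            unfolding LI_iff jp_simps using True bJ SJ_Lam by (auto intro!: Lam_closed)
          have "\<bar>?w j\<bar> \<le> int (k + c)" for j
          proof (cases "j \<in> J0")
            case True
            then show ?thesis using w by (simp add: LI_def)
          next
            case False
            then have "?w j = u j + v j" by (simp add: v' jp_def)
            moreover have "\<bar>u j\<bar> \<le> int k" using iu(2) by (simp add: box_def)
            moreover have "\<bar>v j\<bar> \<le> int c" using c[OF iu(1) v(1)] vL by (auto simp: Lam_def)
            ultimately show ?thesis by simp
          qed
          then have "?w \<in> box (k + c)" using w by (simp add: box_def)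
          moreover have "b' - b = ?w - jp b" by simp
          ultimately have "b' - b \<in> V" unfolding V_def using bJ(1) by (intro image_eqI[of _ _ "(jp b, ?w)"]) auto
          then show False using notV by simp
        qed
        then show ?thesis using eq by simp
      qed
    qed
  qed
  then have \<theta>K: "\<theta> i \<in> Ker" if "i < m" for i using indep[of \<theta>] \<theta>L that by blast
  obtain i where i: "i < m" and "\<exists>u\<in>box k. \<exists>x\<in>LI. cf (i, u) x \<noteq> 0" using cf_nz by blast
  define U' where "U' = {u \<in> box k. \<exists>x\<in>LI. cf (i, u) x \<noteq> 0}"
  have U': "finite U'" "U' \<noteq> {}"
    using box_bounds(1) \<open>\<exists>u\<in>box k. \<exists>x\<in>LI. cf (i, u) x \<noteq> 0\<close> by (auto simp: U'_def)
  \<comment> \<open>Only columns over the single point \<open>\<delta>\<close> are examined. Among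
    the degrees of \<open>y i\<close> that start there, \<open>unique_sum\<close> finds a product
    degree \<open>s\<close> that arises in exactly one way, so that no cancellation is possible in
    it.\<close>
  define \<delta> where "\<delta> = jp (src i)"
  have \<delta>: "\<delta> \<in> SJ" using src[OF i] by (simp add: \<delta>_def S_iff)
  define V' where "V' = {v. jp v = - \<delta> \<and> (\<exists>x\<in>LI. entry ak (y i) x (x - v) \<noteq> 0)}"
  have V'_weights: "V' \<subseteq> weights (y i)"
  proof
    fix v assume "v \<in> V'"
    then obtain x where "entry ak (y i) x (x - v) \<noteq> 0" by (auto simp: V'_def)
    then have "x \<in> targets (y i) (x - v)" using entry_eq_0 by blast
    then obtain v' where "v' \<in> weights (y i)" "x = x - v + v'" by (auto simp: targets_def weights_def)
    moreover from this(2) have "v' = v" by (metis add.commute add_diff_cancel_left' diff_add_cancel)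
    ultimately show "v \<in> weights (y i)" by simp
  qed
  have V'_Lam: "v \<in> Lam" if "v \<in> V'" for v
  proof -
    obtain x where "entry ak (y i) x (x - v) \<noteq> 0" using \<open>v \<in> V'\<close> by (auto simp: V'_def)
    then have "x - (x - v) \<in> Lam" by (rule entry_G0_Lam[OF yG[OF i]])
    then show ?thesis by simp
  qed
  have "t i - src i \<in> V'"
  proof -
    have e: "t i - (t i - src i) = src i" by simp
    have "entry ak (y i) (t i) (t i - (t i - src i)) \<noteq> 0" unfolding e by (rule yts[OF i])
    moreover have "jp (t i) = 0" using t[OF i] by (simp add: LI_iff)
    then have "jp (t i - src i) = - \<delta>" by (simp only: jp_simps \<delta>_def diff_0)
    ultimately show ?thesis using t[OF i] unfolding V'_def by blast
  qed
  then have V': "finite V'" "V' \<noteq> {}" using V'_weights finite_weights finite_subset by blast+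
  obtain u0 v0 where u0: "u0 \<in> U'" and v0: "v0 \<in> V'" and uniq: "\<And>u v. \<lbrakk>u \<in> U'; v \<in> V';
      \<forall>i\<in>{1..n}. u i + v i = u0 i + v0 i\<rbrakk> \<Longrightarrow> \<forall>i\<in>{1..n}. u i = u0 i \<and> v i = v0 i"
    using unique_sum[OF finite_atLeastAtMost U' V', of 1 n] by blast
  have u0L: "u0 \<in> LI" "u0 \<in> Lam" and v0L: "v0 \<in> Lam" using u0 V'_Lam[OF v0] by (auto simp: U'_def box_def LI_def)
  define s where "s = u0 + v0"
  have sL: "s \<in> Lam" using u0L v0L by (auto simp: s_def)
  have js: "jp (- s) = \<delta>" using u0L v0 by (simp add: s_def jp_simps LI_iff V'_def)
  define f where "f x = cf (i, u0) x * (entry ak (mon u0) x (x - u0) * entry ak (y i) (x - u0) (x - s))" for x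
  have lead: "(\<Sum>u\<in>box k. cf (i, u) x * entry ak (mon u * y i) x (x - s)) = f x" if x: "x \<in> LI" for x
  proof -
    have "cf (i, u) x * entry ak (mon u * y i) x (x - s) = (if u = u0 then f x else 0)" if u: "u \<in> box k" for u
    proof (cases "u = u0")
      case True
      then show ?thesis using entry_homog_left[OF mon(2)[OF u0L(2)]] by (simp add: f_def)
    next
      case False
      have "cf (i, u) x * entry ak (mon u * y i) x (x - s) = 0"
      proof (rule ccontr)
        assume nz: "cf (i, u) x * entry ak (mon u * y i) x (x - s) \<noteq> 0"
        then have "u \<in> U'" using u x by (auto simp: U'_def)
        have uLI: "u \<in> LI" using u by (simp add: box_def)
        let ?v = "s - u"
        have "x - u - ?v = x - s" by (simp add: fun_eq_iff)
        then have "entry ak (y i) (x - u) (x - u - ?v) \<noteq> 0"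
          using nz entry_homog_left[OF mon(2)[OF boxLam[OF u]], of "y i" x "x - s"] by auto
        moreover have "jp ?v = - \<delta>"
        proof -
          have "jp s = - \<delta>" using js by (simp only: jp_simps minus_equation_iff[of _ \<delta>] minus_minus[symmetric])
          then show ?thesis using uLI by (simp only: jp_simps LI_iff) simp
        qed
        moreover have "x - u \<in> LI" using x uLI by (intro LI_closed)
        ultimately have "?v \<in> V'" unfolding V'_def by blast
        moreover have "\<forall>i\<in>{1..n}. u i + ?v i = u0 i + v0 i" by (simp add: s_def)
        ultimately have "\<forall>i\<in>{1..n}. u i = u0 i" using uniq[OF \<open>u \<in> U'\<close>] by blast
        moreover have "u i = u0 i" if "i \<notin> {1..n}" for i
          using that u0L(2) boxLam[OF u] by (simp add: Lam_def)
        ultimately show False using False by (auto simp: fun_eq_iff)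
      qed
      then show ?thesis using False by simp
    qed
    then have "(\<Sum>u\<in>box k. cf (i, u) x * entry ak (mon u * y i) x (x - s)) = (\<Sum>u\<in>box k. if u = u0 then f x else 0)"
      by (intro sum.cong) auto
    also have "\<dots> = f x" using u0 box_bounds(1) by (simp add: U'_def)
    finally show ?thesis .
  qed
  define M where "M = (\<Sum>i\<in>T. \<bar>s i\<bar> + \<bar>u0 i\<bar>)"
  have M: "\<bar>s i\<bar> \<le> M" "\<bar>u0 i\<bar> \<le> M" "0 \<le> M" if "i \<in> T" for i
  proof -
    have "\<bar>s i\<bar> + \<bar>u0 i\<bar> \<le> M"
      unfolding M_def using finite_T that by (intro member_le_sum[of i T "\<lambda>i. \<bar>s i\<bar> + \<bar>u0 i\<bar>"]) auto
    then show "\<bar>s i\<bar> \<le> M" "\<bar>u0 i\<bar> \<le> M" by auto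
    then show "0 \<le> M" by linarith
  qed
  have deep0: "x \<in> S" if "x \<in> deep M" for x
    using deep_S[OF that Lam_closed(1)] SJ_0 M(3) by (auto simp: jp_simps)
  have deep_f: "f x = 0" if x: "x \<in> deep M" for x
  proof -
    have xL: "x \<in> LI" using x by (simp add: deep_def)
    have "x + - s \<in> S" by (rule deep_S[OF x Lam_closed(4)[OF sL]]) (use js \<delta> M in auto)
    then have "x - s \<in> S" by (simp only: diff_conv_add_uminus)
    then have "entry ak (\<theta> i) x (x - s) = 0" using \<theta>K[OF i] deep0[OF x] by (simp add: Ker_def)
    then have "\<phi> x * f x = 0" using \<theta>_entry[OF i] lead[OF xL] by simp
    moreover have "\<phi> x \<noteq> 0" using \<phi>(2)[of x] xL SJ_0 by (simp add: LI_iff)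
    ultimately show "f x = 0" by simp
  qed
  have pf1: "pfun n (cf (i, u0))" using cf[OF i] u0 by (simp add: U'_def)
  have pf2: "pfun n (\<lambda>x. entry ak (mon u0) x (x - u0))" by (rule pf[OF mon(1)[OF u0L(2)]])
  have pf3: "pfun n (\<lambda>x. entry ak (y i) (x - u0) (x - s))"
  proof -
    have "pfun n (\<lambda>x. entry ak (y i) (x - u0) (x - u0 - v0))"
      using pfun_shift_diff[OF pf[OF yG[OF i], of v0], of u0] .
    moreover have "x - u0 - v0 = x - s" for x by (simp add: s_def fun_eq_iff)
    ultimately show ?thesis by (simp only:)
  qed
  \<comment> \<open>\<open>f\<close> is a product of three polynomial functions, none of which
    vanishes on all of \<open>LI\<close>: \<open>cf\<close> because \<open>u0 \<in> U'\<close>, the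
    monomial because it is nonzero between points of \<open>S\<close>, and \<open>y i\<close>
    because \<open>v0 \<in> V'\<close>.\<close>
  have "pfun n f" unfolding f_def[abs_def] by (intro pfun_mult pf1 pf2 pf3)
  then have "\<forall>x\<in>LI. f x = 0" using deep_dense deep_f by blast
  then have "(\<forall>x\<in>LI. cf (i, u0) x = 0) \<or> (\<forall>x\<in>LI. entry ak (mon u0) x (x - u0) * entry ak (y i) (x - u0) (x - s) = 0)"
    unfolding f_def by (rule LI_domain[OF pf1 pfun_mult[OF pf2 pf3]])
  then have "(\<forall>x\<in>LI. entry ak (mon u0) x (x - u0) = 0) \<or> (\<forall>x\<in>LI. entry ak (y i) (x - u0) (x - s) = 0)"
    using LI_domain[OF pf2 pf3] u0 by (auto simp: U'_def)
  then show False
  proof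
    assume z: "\<forall>x\<in>LI. entry ak (mon u0) x (x - u0) = 0"
    define x where "x = (\<lambda>i. \<bar>M\<bar> * e i)"
    have x: "x \<in> deep M" unfolding x_def by (rule deep_point)
    have "x + - u0 \<in> S"
      by (rule deep_S[OF x Lam_closed(4)[OF u0L(2)]]) (use u0L SJ_0 M in \<open>auto simp: jp_simps LI_iff\<close>)
    then have "x - u0 \<in> S" by (simp only: diff_conv_add_uminus)
    moreover have "x - u0 + u0 = x" by simp
    ultimately have "entry ak (mon u0) x (x - u0) \<noteq> 0" using mon(3)[OF u0L(2), of "x - u0"] deep0[OF x] by simp
    then show False using z x by (simp add: deep_def)
  next
    assume z: "\<forall>x\<in>LI. entry ak (y i) (x - u0) (x - s) = 0"
    obtain x where x: "x \<in> LI" "entry ak (y i) x (x - v0) \<noteq> 0" using v0 by (auto simp: V'_def)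
    have "x + u0 \<in> LI" using x u0L by (intro LI_closed)
    then have "entry ak (y i) (x + u0 - u0) (x + u0 - s) = 0" using z by blast
    moreover have "x + u0 - u0 = x" "x + u0 - s = x - v0" by (simp_all add: s_def fun_eq_iff)
    ultimately show False using x(2) by simp
  qed
qed

lemma independent_left_ideals:
  "\<exists>L. (\<forall>i<card SJ. L i \<subseteq> G0 \<and> Ker \<subseteq> L i \<and> \<not> L i \<subseteq> Ker \<and> (\<forall>p\<in>L i. \<forall>q\<in>L i. p + q \<in> L i) \<and>
      (\<forall>p\<in>G0. \<forall>q\<in>L i. p * q \<in> L i)) \<and>
    (\<forall>a. (\<forall>i<card SJ. a i \<in> L i) \<and> (\<Sum>i<card SJ. a i) \<in> Ker \<longrightarrow> (\<forall>i<card SJ. a i \<in> Ker))"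
proof -
  obtain d where d: "bij_betw d {..<card SJ} SJ"
    using ex_bij_betw_nat_finite[OF finite_SJ'] by (auto simp: atLeast0LessThan)
  have dS: "d i \<in> SJ" if "i < card SJ" for i using d that by (auto simp: bij_betw_def)
  define L where "L i = {p \<in> G0. \<forall>b\<in>S. \<forall>b'\<in>S. jp b \<noteq> d i \<longrightarrow> entry ak p b' b = 0}" for i
  have "\<not> L i \<subseteq> Ker" if i: "i < card SJ" for i
  proof -
    \<comment> \<open>The diagonal element that realizes the Lagrange product of \<open>d i\<close>
      lies in \<open>L i\<close> and has a nonzero entry at \<open>(d i, d i)\<close>.\<close>
    obtain \<phi> :: "(nat \<Rightarrow> int) \<Rightarrow> 'a" where \<phi>: "pfun n \<phi>" "\<And>b. jp b \<in> SJ \<Longrightarrow> \<phi> b = 0 \<longleftrightarrow> jp b \<noteq> d i"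
      using separate_SJ[OF dS[OF i]] by blast
    obtain E where E: "E \<in> tpoly" "\<forall>g b. act ak E g b = \<phi> b * g b" using tpoly_realize[OF \<phi>(1)] by blast
    have ent: "entry ak E b' b = \<phi> b * (if b = b' then 1 else 0)" for b b'
      using E(2) by (simp add: entry_def)
    have "E \<in> L i" using tpoly_G0[OF E(1)] \<phi>(2) by (auto simp: L_def ent S_iff)
    moreover have "d i \<in> S" "jp (d i) = d i" using SJ_S jp_SJ dS[OF i] by auto
    then have "entry ak E (d i) (d i) \<noteq> 0" using \<phi>(2)[of "d i"] dS[OF i] by (simp add: ent)
    then have "E \<notin> Ker" using \<open>d i \<in> S\<close> by (auto simp: Ker_def)
    ultimately show ?thesis by blast
  qed
  moreover have "p * q \<in> L i" if "p \<in> G0" "q \<in> L i" for p q i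
    using that by (auto simp: L_def G0_mult entry_mult_S intro!: sum.neutral)
  moreover have "a i \<in> Ker" if a: "\<forall>i<card SJ. a i \<in> L i" "(\<Sum>i<card SJ. a i) \<in> Ker" and i: "i < card SJ" for a i
    unfolding Ker_def
  proof (intro CollectI conjI ballI)
    show "a i \<in> G0" using a i by (auto simp: L_def)
    fix b b' assume b: "b \<in> S" "b' \<in> S"
    show "entry ak (a i) b' b = 0"
    proof (cases "jp b = d i")
      case False
      then show ?thesis using a(1) i b by (auto simp: L_def)
    next
      case True
      have "entry ak (a j) b' b = (if j = i then entry ak (a i) b' b else 0)" if j: "j < card SJ" for j
      proof (cases "j = i")
        case False
        then have "d j \<noteq> d i" using d i j by (auto simp: bij_betw_def inj_on_def)
        then show ?thesis using a(1) j b True False by (auto simp: L_def)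
      qed simp
      then have "(\<Sum>j<card SJ. entry ak (a j) b' b) = (\<Sum>j<card SJ. if j = i then entry ak (a i) b' b else 0)"
        by (intro sum.cong) auto
      also have "\<dots> = entry ak (a i) b' b" using i by simp
      finally show ?thesis using a(2) b by (simp add: Ker_def entry_sum)
    qed
  qed
  ultimately show ?thesis
    by (intro exI[of _ L]) (auto simp: L_def Ker_def G0_add entry_add)
qed

text \<open>Left ideals of the quotient are pulled back to \<open>G0\<close> for the upper bound,
  and those of \<open>independent_left_ideals\<close> are pushed forward for the lower one.
  Vanishing in the quotient is membership in \<open>Ker\<close>, so both bounds are statements about
  matrix entries.\<close>

theorem goldie_rank_primitive_quotient:
  "goldie_rank (B_alg r s \<gg> \<chi> Quot J_ideal r s \<gg> \<chi> ak) = card SJ"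
proof -
  let ?R = "B_alg r s \<gg> \<chi> Quot J_ideal r s \<gg> \<chi> ak"
  obtain H where ring: "ring ?R" and H: "H ` G0 = carrier ?R"
    and add: "\<And>p q. \<lbrakk>p \<in> G0; q \<in> G0\<rbrakk> \<Longrightarrow> H (p + q) = H p \<oplus>\<^bsub>?R\<^esub> H q"
    and mult: "\<And>p q. \<lbrakk>p \<in> G0; q \<in> G0\<rbrakk> \<Longrightarrow> H (p * q) = H p \<otimes>\<^bsub>?R\<^esub> H q"
    and ker: "\<And>p. p \<in> G0 \<Longrightarrow> H p = \<zero>\<^bsub>?R\<^esub> \<longleftrightarrow> p \<in> Ker"
  proof -
    from quotient_presentation[OF g] obtain H where H: "ring ?R \<and> H ` G0 = carrier ?R \<and>
      (\<forall>p\<in>G0. \<forall>q\<in>G0. H (p + q) = H p \<oplus>\<^bsub>?R\<^esub> H q \<and> H (p * q) = H p \<otimes>\<^bsub>?R\<^esub> H q) \<and>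
      (\<forall>p\<in>G0. H p = \<zero>\<^bsub>?R\<^esub> \<longleftrightarrow> p \<in> Ker)" by (rule exE)
    show ?thesis by (rule that[of H]) (use H in blast)+
  qed
  interpret R: ring ?R by (rule ring)
  have H0: "H 0 = \<zero>\<^bsub>?R\<^esub>" using ker[OF G0_0] Ker_0 by simp
  have Hc: "H p \<in> carrier ?R" if "p \<in> G0" for p using H that by blast
  have sum: "(\<Oplus>\<^bsub>?R\<^esub>i\<in>{..<m}. H (p i)) = H (\<Sum>i<m. p i)" if "\<And>i. i < m \<Longrightarrow> p i \<in> G0" for p and m :: nat
    using that
  proof (induction m)
    case (Suc m)
    have "(\<Oplus>\<^bsub>?R\<^esub>i\<in>insert m {..<m}. H (p i)) = H (p m) \<oplus>\<^bsub>?R\<^esub> (\<Oplus>\<^bsub>?R\<^esub>i\<in>{..<m}. H (p i))"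
      using Suc.prems Hc by (intro R.finsum_insert) auto
    also have "\<dots> = H (p m + (\<Sum>i<m. p i))"
      using Suc by (subst add) (auto intro: G0_sum)
    finally show ?case by (simp add: lessThan_Suc add.commute)
  qed (simp add: H0)
  have diff: "p - q \<in> Ker" if pq: "p \<in> G0" "q \<in> G0" "H p = H q" for p q
  proof -
    have "H (p - q) \<oplus>\<^bsub>?R\<^esub> H q = H q" using add[OF G0_diff[OF pq(1,2)] pq(2)] pq(3) by simp
    then have "H (p - q) = \<zero>\<^bsub>?R\<^esub>" using Hc[OF pq(2)] Hc[OF G0_diff[OF pq(1,2)]] by simp
    then show ?thesis using ker G0_diff[OF pq(1,2)] by blast
  qed
  have upper: "m \<le> card SJ" if "contains_direct_sum ?R m" for m
  proof -
    from that[unfolded contains_direct_sum_def] obtain I where II: "(\<forall>i<m. left_ideal (I i) ?R \<and> I i \<noteq> {\<zero>\<^bsub>?R\<^esub>}) \<and>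
      (\<forall>a. (\<forall>i<m. a i \<in> I i) \<and> (\<Oplus>\<^bsub>?R\<^esub>i\<in>{..<m}. a i) = \<zero>\<^bsub>?R\<^esub> \<longrightarrow> (\<forall>i<m. a i = \<zero>\<^bsub>?R\<^esub>))"
      by (rule exE)
    have I: "\<And>i. i < m \<Longrightarrow> left_ideal (I i) ?R \<and> I i \<noteq> {\<zero>\<^bsub>?R\<^esub>}"
      and indep: "\<And>a. \<lbrakk>\<forall>i<m. a i \<in> I i; (\<Oplus>\<^bsub>?R\<^esub>i\<in>{..<m}. a i) = \<zero>\<^bsub>?R\<^esub>\<rbrakk> \<Longrightarrow> \<forall>i<m. a i = \<zero>\<^bsub>?R\<^esub>"
      using II by blast+
    have I': "I i \<subseteq> carrier ?R" "\<zero>\<^bsub>?R\<^esub> \<in> I i" "\<And>x y. \<lbrakk>x \<in> I i; y \<in> I i\<rbrakk> \<Longrightarrow> x \<oplus>\<^bsub>?R\<^esub> y \<in> I i"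
      "\<And>a x. \<lbrakk>a \<in> carrier ?R; x \<in> I i\<rbrakk> \<Longrightarrow> a \<otimes>\<^bsub>?R\<^esub> x \<in> I i" if "i < m" for i
      using I[OF that] unfolding R.left_ideal_iff by blast+
    define L where "L i = {p \<in> G0. H p \<in> I i}" for i
    show ?thesis
    proof (rule independent_left_ideals_bound)
      show "L i \<subseteq> G0" for i by (auto simp: L_def)
      show "p + q \<in> L i" if "i < m" "p \<in> L i" "q \<in> L i" for i p q
        using that I'(3) by (simp add: L_def G0_add add)
      show "0 \<in> L i" if "i < m" for i using I'(2)[OF that] by (simp add: L_def G0_0 H0)
      show "p * q \<in> L i" if "i < m" "p \<in> G0" "q \<in> L i" for i p q
        using that I'(4) Hc by (simp add: L_def G0_mult mult)
      show "\<not> L i \<subseteq> Ker" if i: "i < m" for i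
      proof -
        obtain x where x: "x \<in> I i" "x \<noteq> \<zero>\<^bsub>?R\<^esub>" using I[OF i] I'(2)[OF i] by blast
        then obtain p where "p \<in> G0" "x = H p" using I'(1)[OF i] H by blast
        then show ?thesis using x ker by (auto simp: L_def)
      qed
    next
      fix a assume a: "\<And>i. i < m \<Longrightarrow> a i \<in> L i" "(\<Sum>i<m. a i) \<in> Ker"
      have aG: "a i \<in> G0" if "i < m" for i using a(1)[OF that] by (simp add: L_def)
      have "(\<Oplus>\<^bsub>?R\<^esub>i\<in>{..<m}. H (a i)) = \<zero>\<^bsub>?R\<^esub>"
        using sum[OF aG] ker[of "\<Sum>i<m. a i"] a(2) aG G0_sum[of "{..<m}" a] by simp
      then have "\<forall>i<m. H (a i) = \<zero>\<^bsub>?R\<^esub>" using indep[of "\<lambda>i. H (a i)"] a(1) by (simp add: L_def)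
      then show "\<forall>i<m. a i \<in> Ker" using ker aG by blast
    qed
  qed
  have lower: "contains_direct_sum ?R (card SJ)"
  proof -
    from independent_left_ideals obtain L where
      LL: "(\<forall>i<card SJ. L i \<subseteq> G0 \<and> Ker \<subseteq> L i \<and> \<not> L i \<subseteq> Ker \<and> (\<forall>p\<in>L i. \<forall>q\<in>L i. p + q \<in> L i) \<and>
        (\<forall>p\<in>G0. \<forall>q\<in>L i. p * q \<in> L i)) \<and>
        (\<forall>a. (\<forall>i<card SJ. a i \<in> L i) \<and> (\<Sum>i<card SJ. a i) \<in> Ker \<longrightarrow> (\<forall>i<card SJ. a i \<in> Ker))"
      by (rule exE)
    have L: "\<And>i. i < card SJ \<Longrightarrow> L i \<subseteq> G0 \<and> Ker \<subseteq> L i \<and> \<not> L i \<subseteq> Ker \<and>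
        (\<forall>p\<in>L i. \<forall>q\<in>L i. p + q \<in> L i) \<and> (\<forall>p\<in>G0. \<forall>q\<in>L i. p * q \<in> L i)"
      and indep: "\<And>a. \<lbrakk>\<forall>i<card SJ. a i \<in> L i; (\<Sum>i<card SJ. a i) \<in> Ker\<rbrakk> \<Longrightarrow> \<forall>i<card SJ. a i \<in> Ker"
      using LL by blast+
    have "left_ideal (H ` L i) ?R \<and> H ` L i \<noteq> {\<zero>\<^bsub>?R\<^esub>}" if i: "i < card SJ" for i
    proof -
      have Li: "L i \<subseteq> G0" "0 \<in> L i" "\<And>p q. \<lbrakk>p \<in> L i; q \<in> L i\<rbrakk> \<Longrightarrow> p + q \<in> L i"
        "\<And>p q. \<lbrakk>p \<in> G0; q \<in> L i\<rbrakk> \<Longrightarrow> p * q \<in> L i" "\<not> L i \<subseteq> Ker"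
        using L[OF i] Ker_0 by blast+
      have "left_ideal (H ` L i) ?R"
        unfolding R.left_ideal_iff
      proof (intro conjI ballI)
        show "H ` L i \<subseteq> carrier ?R" using Li(1) H by blast
        show "\<zero>\<^bsub>?R\<^esub> \<in> H ` L i" using Li(2) H0 by (metis imageI)
      next
        fix x y assume "x \<in> H ` L i" "y \<in> H ` L i"
        then obtain p q where pq: "p \<in> L i" "q \<in> L i" "x = H p" "y = H q" by blast
        then have "x \<oplus>\<^bsub>?R\<^esub> y = H (p + q)" using add[of p q] Li(1) by auto
        then show "x \<oplus>\<^bsub>?R\<^esub> y \<in> H ` L i" using Li(3)[OF pq(1,2)] by blast
      next
        fix x y assume "x \<in> carrier ?R" "y \<in> H ` L i"
        then obtain p q where pq: "p \<in> G0" "q \<in> L i" "x = H p" "y = H q" using H by blast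
        then have "x \<otimes>\<^bsub>?R\<^esub> y = H (p * q)" using mult[of p q] Li(1) by auto
        then show "x \<otimes>\<^bsub>?R\<^esub> y \<in> H ` L i" using Li(4)[OF pq(1,2)] by blast
      qed
      moreover obtain p where "p \<in> L i" "p \<notin> Ker" using Li(5) by blast
      then have "H p \<in> H ` L i" "H p \<noteq> \<zero>\<^bsub>?R\<^esub>" using ker Li(1) by auto
      then have "H ` L i \<noteq> {\<zero>\<^bsub>?R\<^esub>}" by blast
      ultimately show ?thesis by blast
    qed
    moreover have "\<forall>i<card SJ. a i = \<zero>\<^bsub>?R\<^esub>"
      if a: "\<forall>i<card SJ. a i \<in> H ` L i" "(\<Oplus>\<^bsub>?R\<^esub>i\<in>{..<card SJ}. a i) = \<zero>\<^bsub>?R\<^esub>" for a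
    proof -
      have "\<forall>i. \<exists>p. i < card SJ \<longrightarrow> p \<in> L i \<and> a i = H p" using a(1) by blast
      then obtain p where p: "\<And>i. i < card SJ \<Longrightarrow> p i \<in> L i \<and> a i = H (p i)" by metis
      have pG: "p i \<in> G0" if "i < card SJ" for i using p[OF that] L[OF that] by blast
      have "(\<Oplus>\<^bsub>?R\<^esub>i\<in>{..<card SJ}. a i) = (\<Oplus>\<^bsub>?R\<^esub>i\<in>{..<card SJ}. H (p i))"
        using p pG Hc by (intro R.finsum_cong') auto
      also have "\<dots> = H (\<Sum>i<card SJ. p i)" by (rule sum[OF pG])
      finally have "(\<Sum>i<card SJ. p i) \<in> Ker" using a(2) ker[of "\<Sum>i<card SJ. p i"] pG G0_sum[of "{..<card SJ}" p] by simp
      then have "\<forall>i<card SJ. p i \<in> Ker" using indep p by blast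
      then show ?thesis using p ker pG by simp
    qed
    ultimately show ?thesis
      unfolding contains_direct_sum_def by (intro exI[of _ "\<lambda>i. H ` L i"]) blast
  qed
  show ?thesis
    unfolding goldie_rank_def using lower upper by (rule Greatest_equality)
qed

end

section \<open>Weights of a given type\<close>

lemma eta_comb_restrict:
  assumes "J \<subseteq> {1..r+s}"
  shows "eta_comb r s \<gg> J x = eta_comb r s \<gg> {1..r+s} (restrict_coords J x)"
proof
  fix t
  have "(\<Sum>i=1..r+s. restrict_coords J x i * eta r s \<gg> i t) = (\<Sum>i\<in>J. restrict_coords J x i * eta r s \<gg> i t)"
    using assms by (intro sum.mono_neutral_right) (auto simp: restrict_coords_def)
  also have "\<dots> = (\<Sum>i\<in>J. x i * eta r s \<gg> i t)"
    by (intro sum.cong) (auto simp: restrict_coords_def)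
  finally show "eta_comb r s \<gg> J x t = eta_comb r s \<gg> {1..r+s} (restrict_coords J x) t"
    by (simp add: eta_comb_def)
qed

lemma eta_comb_eq_Vg:
  assumes J: "J \<subseteq> {1..r+s}"
  shows "eta_comb r s \<gg> J x = eta_comb r s \<gg> J y \<longleftrightarrow> restrict_coords J (\<lambda>i. x i - y i) \<in> Vg r s \<gg>"
proof -
  have "eta_comb r s \<gg> J x = eta_comb r s \<gg> J y \<longleftrightarrow> eta_comb r s \<gg> J (\<lambda>i. x i - y i) = (\<lambda>_. 0)"
    by (simp add: eta_comb_def fun_eq_iff left_diff_distrib sum_subtractf)
  moreover have "restrict_coords J (\<lambda>i. x i - y i) \<in> coord_space {1..r+s}"
    using J by (auto simp: coord_space_def restrict_coords_def)
  ultimately show ?thesis by (simp add: Vg_def eta_comb_restrict[OF J])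
qed

lemma of_typeD:
  assumes "of_type r s \<gg> \<alpha> Jp Jm"
  obtains e c where "Jp \<union> Jm \<subseteq> integral_idx r \<alpha>" "\<forall>j\<in>Jp. 0 \<le> \<alpha> j" "\<forall>j\<in>Jm. \<alpha> j < 0"
    "e \<in> rat_Vg r s \<gg>"
    "\<forall>u\<in>rat_Vg r s \<gg>. (\<Sum>j\<in>Jp \<union> Jm. c j * sign_form \<alpha> j u) = 0"
    "\<forall>i\<in>integral_idx r \<alpha> - (Jp \<union> Jm). 0 < sign_form \<alpha> i e"
    "\<forall>j\<in>Jp \<union> Jm. sign_form \<alpha> j e = 0 \<and> 0 < c j"
proof -
  obtain J where dec: "sign_decomposition r s \<gg> \<alpha> J" and J: "Jp = {j \<in> J. 0 \<le> \<alpha> j}" "Jm = {j \<in> J. \<alpha> j < 0}"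
    using assms unfolding of_type_def sign_configuration_def by blast
  have un: "Jp \<union> Jm = J" using J by auto
  obtain e c where ec: "J \<subseteq> integral_idx r \<alpha>" "e \<in> rat_Vg r s \<gg>"
    "\<forall>u\<in>rat_Vg r s \<gg>. (\<Sum>i\<in>integral_idx r \<alpha>. c i * sign_form \<alpha> i u) = 0"
    "\<forall>i\<in>integral_idx r \<alpha> - J. sign_form \<alpha> i e > 0 \<and> c i = 0"
    "\<forall>j\<in>J. sign_form \<alpha> j e = 0 \<and> c j > 0"
    using dec unfolding sign_decomposition_def by blast
  have fin: "finite (integral_idx r \<alpha>)"
    by (rule finite_subset[of _ "{1..r}"]) (auto simp: integral_idx_def)
  have "(\<Sum>j\<in>J. c j * sign_form \<alpha> j u) = 0" if "u \<in> rat_Vg r s \<gg>" for u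
  proof -
    have "(\<Sum>i\<in>integral_idx r \<alpha>. c i * sign_form \<alpha> i u) = (\<Sum>j\<in>J. c j * sign_form \<alpha> j u)"
      using ec(1,4) fin by (intro sum.mono_neutral_right) auto
    then show ?thesis using ec(3) that by simp
  qed
  then show ?thesis
    using that[of e c] ec J unfolding un by auto
qed

text \<open>Proved for an arbitrary weight of the type, since it is applied to
  \<open>x \<alpha>\<close> in place of \<open>\<alpha>\<close>.\<close>

lemma goldie_rank_of_type:
  fixes \<gg> :: "('k::field_char_0) weyl set"
  assumes g: "torus_subspace r s \<gg>" and type: "of_type r s \<gg> \<alpha> Jp Jm"
  shows "goldie_rank (B_alg r s \<gg> (eta_comb r s \<gg> {1..r+s} (\<lambda>i. of_rat (\<alpha> i))) Quot
      J_ideal r s \<gg> (eta_comb r s \<gg> {1..r+s} (\<lambda>i. of_rat (\<alpha> i))) (\<lambda>i. of_rat (\<alpha> i))) =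
    card {d :: nat \<Rightarrow> int. (\<forall>i. i \<notin> Jp \<union> Jm \<longrightarrow> d i = 0) \<and> (\<lambda>i. of_int (d i)) \<in> Vg r s \<gg> \<and>
      (\<forall>j\<in>Jp. 0 \<le> \<alpha> j + of_int (d j)) \<and> (\<forall>j\<in>Jm. \<alpha> j + of_int (d j) < 0)}"
    (is "_ = card ?D")
proof -
  interpret W: weyl_data r s \<gg> \<alpha> .
  let ?T = "integral_idx r \<alpha>" and ?J = "Jp \<union> Jm"
  obtain e c where JT: "?J \<subseteq> ?T" and Jp[rule_format]: "\<forall>j\<in>Jp. 0 \<le> \<alpha> j" and Jm[rule_format]: "\<forall>j\<in>Jm. \<alpha> j < 0"
    and e: "e \<in> rat_Vg r s \<gg>"
    and c[rule_format]: "\<forall>u\<in>rat_Vg r s \<gg>. (\<Sum>j\<in>?J. c j * sign_form \<alpha> j u) = 0"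
    and eT[rule_format]: "\<forall>i\<in>?T - ?J. 0 < sign_form \<alpha> i e"
    and eJ[rule_format]: "\<forall>j\<in>?J. sign_form \<alpha> j e = 0 \<and> 0 < c j"
    using of_typeD[OF type] .
  have TN: "?T \<subseteq> {1..r+s}" by (auto simp: integral_idx_def)
  then have JN: "?J \<subseteq> {1..r+s}" using JT by blast
  have finJ: "finite ?J" using JN finite_subset by blast
  have Lam_Vg: "u \<in> W.Lam \<longleftrightarrow> (\<lambda>i. of_int (u i)) \<in> Vg r s \<gg>" for u
    by (auto simp: W.Lam_def W.pair_def Vg_def coord_space_def W.eta_comb_0_iff[OF g] mult.commute)
  have Lam_rat: "u \<in> W.Lam \<longleftrightarrow> (\<lambda>i. of_int (u i)) \<in> rat_Vg r s \<gg>" for u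
    by (simp add: Lam_Vg rat_Vg_def)
  obtain M where M: "M > 0" "\<forall>i\<in>{1..r+s}. of_nat M * e i \<in> \<int>"
    using common_denominator[of "{1..r+s}" e] by blast
  \<comment> \<open>Denominators are cleared to get a lattice vector, and the sign is reversed: a
    positive sign form at a nonnegative coordinate means a decreasing one, whereas the vector wanted
    leads away from the walls.\<close>
  define e' where "e' i = - \<lfloor>of_nat M * e i\<rfloor>" for i
  have e_off: "e i = 0" if "i \<notin> {1..r+s}" for i
  proof -
    have "(of_rat (e i) :: 'k) = 0" using e that by (auto simp: rat_Vg_def Vg_def coord_space_def)
    then show ?thesis by simp
  qed
  have e': "of_int (e' i) = - (of_nat M * e i)" for i
  proof (cases "i \<in> {1..r+s}")
    case True
    then show ?thesis using M(2) by (simp add: e'_def of_int_floor)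
  qed (simp add: e'_def e_off)
  have e'_sgn: "e' i = 0 \<longleftrightarrow> e i = 0" "0 < e' i \<longleftrightarrow> e i < 0" "e' i < 0 \<longleftrightarrow> 0 < e i" for i
  proof -
    have "e' i = 0 \<longleftrightarrow> (of_int (e' i) :: rat) = 0" by (simp only: of_int_eq_0_iff)
    then show "e' i = 0 \<longleftrightarrow> e i = 0" using M(1) by (simp add: e')
    have "0 < e' i \<longleftrightarrow> (0::rat) < of_int (e' i)" by (simp only: of_int_0_less_iff)
    then show "0 < e' i \<longleftrightarrow> e i < 0" using M(1) by (simp add: e' mult_less_0_iff)
    have "e' i < 0 \<longleftrightarrow> of_int (e' i) < (0::rat)" by (simp only: of_int_less_0_iff)
    then show "e' i < 0 \<longleftrightarrow> 0 < e i" using M(1) by (simp add: e' zero_less_mult_iff)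
  qed
  \<comment> \<open>The sign forms are bounded above on the finite factor, and by the positive relation between
    them also below.\<close>
  have fin_SJ: "finite {d \<in> W.S. \<forall>i. i \<notin> ?J \<longrightarrow> d i = 0}"
  proof (rule finite_subset)
    define A where "A = (\<Sum>k\<in>?J. c k * \<bar>\<alpha> k\<bar>)"
    define R where "R = \<lceil>\<Sum>j\<in>?J. \<bar>\<alpha> j\<bar> + A / c j\<rceil>"
    have A0: "0 \<le> A" unfolding A_def using eJ by (intro sum_nonneg mult_nonneg_nonneg) (auto simp: less_imp_le)
    show "{d \<in> W.S. \<forall>i. i \<notin> ?J \<longrightarrow> d i = 0} \<subseteq>
        {f. \<forall>x. (x \<in> ?J \<longrightarrow> f x \<in> {- R..R}) \<and> (x \<notin> ?J \<longrightarrow> f x = 0)}"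
    proof (intro subsetI CollectI allI conjI impI)
      fix d j assume d: "d \<in> {d \<in> W.S. \<forall>i. i \<notin> ?J \<longrightarrow> d i = 0}" and j: "j \<in> ?J"
      let ?u = "\<lambda>i. of_int (d i) :: rat"
      have "?u \<in> rat_Vg r s \<gg>" using d by (simp add: W.S_def flip: Lam_rat)
      note z = c[OF this]
      have le: "sign_form \<alpha> k ?u \<le> \<bar>\<alpha> k\<bar>" if "k \<in> ?J" for k
      proof -
        have "k \<in> ?T" using JT that by blast
        then have "(0 \<le> \<alpha> k + ?u k) = (0 \<le> \<alpha> k)" using d by (simp add: W.S_def)
        then show ?thesis by (auto simp: sign_form_def)
      qed
      have "c j * sign_form \<alpha> j ?u = - (\<Sum>k\<in>?J - {j}. c k * sign_form \<alpha> k ?u)"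
        using z sum.remove[OF finJ j, of "\<lambda>k. c k * sign_form \<alpha> k ?u"] by simp
      moreover have "(\<Sum>k\<in>?J - {j}. c k * sign_form \<alpha> k ?u) \<le> (\<Sum>k\<in>?J - {j}. c k * \<bar>\<alpha> k\<bar>)"
        using le eJ by (intro sum_mono mult_left_mono) (auto simp: less_imp_le)
      moreover have "(\<Sum>k\<in>?J - {j}. c k * \<bar>\<alpha> k\<bar>) \<le> A"
        unfolding A_def using finJ eJ by (intro sum_mono2) (auto simp: less_imp_le)
      ultimately have "- A \<le> c j * sign_form \<alpha> j ?u" by linarith
      then have "- (A / c j) \<le> sign_form \<alpha> j ?u" using eJ[OF j] by (simp add: field_simps)
      then have "\<bar>sign_form \<alpha> j ?u\<bar> \<le> \<bar>\<alpha> j\<bar> + A / c j"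
      proof -
        have "0 \<le> A / c j" using A0 eJ[OF j] by simp
        then show ?thesis using le[OF j] \<open>- (A / c j) \<le> sign_form \<alpha> j ?u\<close> by linarith
      qed
      then have "\<bar>?u j\<bar> \<le> \<bar>\<alpha> j\<bar> + A / c j" by (simp add: sign_form_def split: if_splits)
      also have "\<dots> \<le> (\<Sum>j\<in>?J. \<bar>\<alpha> j\<bar> + A / c j)"
        using finJ j A0 eJ by (intro member_le_sum[of j _ "\<lambda>j. \<bar>\<alpha> j\<bar> + A / c j"])
          (auto intro!: add_nonneg_nonneg divide_nonneg_nonneg simp: less_imp_le)
      also have "\<dots> \<le> of_int R" unfolding R_def by (rule le_of_int_ceiling)
      finally have "of_int \<bar>d j\<bar> \<le> (of_int R :: rat)" by simp
      then have "\<bar>d j\<bar> \<le> R" by (simp only: of_int_le_iff)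
      then show "d j \<in> {- R..R}" by auto
    qed auto
    show "finite {f. \<forall>x. (x \<in> ?J \<longrightarrow> f x \<in> {- R..R}) \<and> (x \<notin> ?J \<longrightarrow> f x = 0)}"
      by (rule finite_set_of_finite_funs[OF finJ]) simp
  qed
  interpret Y: weyl_type r s \<gg> \<alpha> ?J e'
  proof (intro weyl_type.intro)
    show "torus_subspace r s \<gg>" "?J \<subseteq> ?T" "finite {d \<in> W.S. \<forall>i. i \<notin> ?J \<longrightarrow> d i = 0}"
      by (rule g JT fin_SJ)+
  next
    fix u assume u: "u \<in> W.Lam"
    let ?x = "\<lambda>i. of_int (u i) :: 'k"
    \<comment> \<open>As \<open>u\<close> pairs to zero with \<open>\<gg>\<close>, its part in
      \<open>J\<close> and the negative of its part in \<open>I\<close> give the same functional. It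
      lies in both summands of the direct sum decomposition of the dual space and hence
      vanishes.\<close>
    have "\<forall>k\<in>W.coeffs. (\<Sum>i\<in>?J. ?x i * k i) = (\<Sum>i\<in>{1..r+s} - ?J. - ?x i * k i)"
    proof
      fix k assume "k \<in> W.coeffs"
      then have "(\<Sum>i=1..r+s. ?x i * k i) = 0" using u by (simp add: W.Lam_def W.pair_def mult.commute)
      then show "(\<Sum>i\<in>?J. ?x i * k i) = (\<Sum>i\<in>{1..r+s} - ?J. - ?x i * k i)"
        using sum.subset_diff[OF JN, of "\<lambda>i. ?x i * k i"] by (simp add: sum_negf eq_neg_iff_add_eq_0 add.commute)
    qed
    then have "eta_comb r s \<gg> ?J ?x = eta_comb r s \<gg> ({1..r+s} - ?J) (\<lambda>i. - ?x i)"
      using W.eta_comb_eq_iff[OF g] by blast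
    then have "eta_comb r s \<gg> ?J ?x \<in> range (eta_comb r s \<gg> ?J) \<inter> range (eta_comb r s \<gg> ({1..r+s} - ?J))"
      by (metis IntI rangeI)
    then have "eta_comb r s \<gg> ?J ?x = (\<lambda>_. 0)"
      using type unfolding of_type_def dual_splits_def Let_def by auto
    then have "eta_comb r s \<gg> ?J ?x = eta_comb r s \<gg> ?J (\<lambda>_. 0)" by (simp add: eta_comb_def)
    then have "restrict_coords ?J ?x \<in> Vg r s \<gg>" using eta_comb_eq_Vg[OF JN, of \<gg> ?x "\<lambda>_. 0"] by simp
    moreover have "restrict_coords ?J ?x = (\<lambda>i. of_int (if i \<in> ?J then u i else 0))"
      by (auto simp: restrict_coords_def)
    ultimately show "(\<lambda>i. if i \<in> ?J then u i else 0) \<in> W.Lam" unfolding Lam_Vg by simp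
  next
    have "(\<lambda>i. of_rat (- (of_nat M * e i)) :: 'k) \<in> Vg r s \<gg>"
      using e by (auto simp: rat_Vg_def Vg_def coord_space_def eta_comb_def fun_eq_iff of_rat_mult of_rat_minus
          mult.assoc sum_negf simp flip: sum_distrib_left)
    then show "e' \<in> W.Lam" unfolding Lam_rat by (simp add: e' rat_Vg_def)
  next
    fix j assume "j \<in> ?J"
    then show "e' j = 0" using eJ[of j] by (auto simp: e'_sgn sign_form_def split: if_splits)
  next
    fix i assume "i \<in> ?T - ?J"
    then show "0 < (if 0 \<le> \<alpha> i then e' i else - e' i)"
      using eT[of i] by (auto simp: e'_sgn sign_form_def)
  qed
  have "Y.SJ = ?D"
  proof (intro Set.set_eqI iffI)
    fix d assume "d \<in> Y.SJ"
    then have d: "d \<in> W.Lam" "\<forall>i. i \<notin> ?J \<longrightarrow> d i = 0" "\<forall>i\<in>?T. (0 \<le> \<alpha> i + of_int (d i)) = (0 \<le> \<alpha> i)"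
      by (auto simp: Y.SJ_def W.S_def)
    have "0 \<le> \<alpha> j + of_int (d j)" if "j \<in> Jp" for j using d(3) JT Jp[OF that] that by blast
    moreover have "\<alpha> j + of_int (d j) < 0" if "j \<in> Jm" for j
    proof -
      have "j \<in> ?T" using JT that by blast
      then show ?thesis using d(3) Jm[OF that] by (meson not_le)
    qed
    ultimately show "d \<in> ?D" using d by (simp add: Lam_Vg)
  next
    fix d assume d: "d \<in> ?D"
    have "(0 \<le> \<alpha> i + of_int (d i)) = (0 \<le> \<alpha> i)" if "i \<in> ?T" for i
    proof (cases "i \<in> ?J")
      case True
      then show ?thesis using d Jp[of i] Jm[of i] by (auto simp: not_le[symmetric])
    qed (use d in simp)
    then show "d \<in> Y.SJ" using d by (simp add: Y.SJ_def W.S_def Lam_Vg)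
  qed
  then show ?thesis
    using Y.goldie_rank_primitive_quotient by (simp add: W.\<chi>_def[OF g])
qed

section \<open>Comparison of the rank, the dilated polytope and the orthant\<close>

theorem theorem39:
  fixes \<gg> :: "('k::{alg_closed_field,field_char_0}) weyl set"
    and r s :: nat
    and \<alpha> :: "nat \<Rightarrow> rat"
    and Jp Jm J :: "nat set"
    and \<chi> :: "'k weyl \<Rightarrow> 'k"
    and a0 :: rat
    and f :: "rat \<Rightarrow> rat"
  assumes g: "torus_subspace r s \<gg>"
    and type: "of_type r s \<gg> \<alpha> Jp Jm"
    and J: "J = Jp \<union> Jm"
    and chi: "\<chi> = eta_comb r s \<gg> {1..r+s} (\<lambda>i. of_rat (\<alpha> i))"
    and ne: "restrict_coords J \<alpha> \<noteq> z_point Jm"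
    and a0: "\<exists>v \<in> V0 r s \<gg> J. z_point Jm = (\<lambda>j. a0 * restrict_coords J \<alpha> j + v j)"
    and f: "f = (\<lambda>x. (x - a0) / (1 - a0))"
  shows "a0 \<noteq> 1 \<and>
    (\<exists>q. quasi_polynomial q \<and>
      (\<forall>x::nat. x > 0 \<and> of_type r s \<gg> (\<lambda>i. of_nat x * \<alpha> i) Jp Jm \<longrightarrow>
        (let grk = goldie_rank
              (B_alg r s \<gg> (\<lambda>t. of_nat x * \<chi> t) Quot
                J_ideal r s \<gg> (\<lambda>t. of_nat x * \<chi> t) (\<lambda>i. of_rat (of_nat x * \<alpha> i)))
         in f (of_nat x) \<ge> 0 \<and>
            grk = ehrhart J (translate_by (P_polytope r s \<gg> \<alpha> Jp Jm) (\<lambda>j. - z_point Jm j))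
                    (f (of_nat x)) \<and>
            of_nat grk = q (int x))))"
proof -
  obtain c where JT: "J \<subseteq> integral_idx r \<alpha>" and Jp[rule_format]: "\<forall>j\<in>Jp. 0 \<le> \<alpha> j" and Jm[rule_format]: "\<forall>j\<in>Jm. \<alpha> j < 0"
    and c[rule_format]: "\<forall>u\<in>rat_Vg r s \<gg>. (\<Sum>j\<in>J. c j * sign_form \<alpha> j u) = 0"
    and c_pos[rule_format]: "\<forall>j\<in>J. 0 < c j"
    using of_typeD[OF type] unfolding J by metis
  have JN: "J \<subseteq> {1..r+s}" using JT by (auto simp: integral_idx_def)
  then have finJ: "finite J" using finite_subset by blast
  have ints: "\<alpha> j \<in> \<int>" if "j \<in> J" for j using JT that by (auto simp: integral_idx_def)
  have disj: "j \<notin> Jm" if "j \<in> Jp" for j using Jp[OF that] Jm by fastforce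
  obtain Q :: "(nat \<Rightarrow> rat) set" where
    Q: "Vg r s \<gg> = {\<gamma> \<in> coord_space {1..r+s}. \<forall>q\<in>Q. (\<Sum>i=1..r+s. of_rat (q i) * \<gamma> i) = 0}"
    using type unfolding of_type_def rational_subspace_def by blast
  define \<sigma> :: "nat \<Rightarrow> rat" where "\<sigma> j = (if j \<in> Jm then -1 else 1)" for j
  have \<sigma>2: "\<sigma> j * \<sigma> j = 1" "\<sigma> j * (\<sigma> j * x) = x" for j x by (auto simp: \<sigma>_def)
  define z where "z = z_point Jm"
  \<comment> \<open>This is where rationality of \<open>\<gg>\<close> enters: functionals over the
    field are replaced by the rational equations \<open>Q\<close>.\<close>
  have VgJ: "(\<lambda>i. of_rat (restrict_coords J u i)) \<in> Vg r s \<gg> \<longleftrightarrow> (\<forall>q\<in>Q. (\<Sum>j\<in>J. q j * u j) = 0)" for u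
  proof -
    have "(\<Sum>i=1..r+s. of_rat (q i) * (of_rat (restrict_coords J u i) :: 'k)) = of_rat (\<Sum>j\<in>J. q j * u j)" for q
    proof -
      have "(\<Sum>i=1..r+s. of_rat (q i) * (of_rat (restrict_coords J u i) :: 'k)) =
          (\<Sum>i\<in>J. of_rat (q i) * of_rat (restrict_coords J u i))"
        using JN by (intro sum.mono_neutral_right) (auto simp: restrict_coords_def)
      also have "\<dots> = (\<Sum>j\<in>J. of_rat (q j * u j))"
        by (intro sum.cong) (auto simp: restrict_coords_def of_rat_mult)
      finally show ?thesis by (simp add: of_rat_sum)
    qed
    moreover have "(\<lambda>i. of_rat (restrict_coords J u i) :: 'k) \<in> coord_space {1..r+s}"
      using JN by (auto simp: coord_space_def restrict_coords_def)
    ultimately show ?thesis by (simp add: Q)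
  qed
  have eta_J: "eta_comb r s \<gg> J (\<lambda>j. of_rat (x j)) = eta_comb r s \<gg> J (\<lambda>j. of_rat (y j)) \<longleftrightarrow>
      (\<forall>q\<in>Q. (\<Sum>j\<in>J. q j * x j) = (\<Sum>j\<in>J. q j * y j))" for x y
  proof -
    have "restrict_coords J (\<lambda>i. of_rat (x i) - of_rat (y i) :: 'k) = (\<lambda>i. of_rat (restrict_coords J (\<lambda>i. x i - y i) i))"
      by (auto simp: restrict_coords_def of_rat_diff)
    then show ?thesis
      unfolding eta_comb_eq_Vg[OF JN] by (simp add: VgJ right_diff_distrib sum_subtractf)
  qed
  define \<beta> where "\<beta> q = (\<Sum>j\<in>J. q j * \<alpha> j)" for q
  have z_eq: "(\<Sum>j\<in>J. q j * z j) = a0 * \<beta> q" if "q \<in> Q" for q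
  proof -
    obtain v where v: "v \<in> V0 r s \<gg> J" "z = (\<lambda>j. a0 * restrict_coords J \<alpha> j + v j)" using a0 by (auto simp: z_def)
    have "eta_comb r s \<gg> J (\<lambda>j. of_rat (v j)) = eta_comb r s \<gg> J (\<lambda>j. of_rat 0)"
      using v(1) by (simp add: V0_def eta_comb_def)
    then have "(\<Sum>j\<in>J. q j * v j) = 0" using eta_J[of v "\<lambda>_. 0"] that by simp
    moreover have "(\<Sum>j\<in>J. q j * z j) = (\<Sum>j\<in>J. a0 * (q j * \<alpha> j) + q j * v j)"
      by (intro sum.cong) (auto simp: v(2) restrict_coords_def algebra_simps)
    ultimately show ?thesis by (simp add: \<beta>_def sum.distrib sum_distrib_left)
  qed
  \<comment> \<open>The polytope is bounded: in the coordinates of the orthant, the relation with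
    positive coefficients among the sign forms reads
    \<open>(\<Sum>j\<in>J. c j * n j) = 0\<close>.\<close>
  have pos: "n j = 0" if n: "\<And>j. j \<in> J \<Longrightarrow> 0 \<le> n j" and eq: "\<And>q. q \<in> Q \<Longrightarrow> (\<Sum>j\<in>J. q j * (\<sigma> j * n j)) = 0"
      and j: "j \<in> J" for n j
  proof -
    let ?u = "restrict_coords J (\<lambda>j. \<sigma> j * n j)"
    have "?u \<in> rat_Vg r s \<gg>" using eq VgJ[of "\<lambda>j. \<sigma> j * n j"] by (simp add: rat_Vg_def)
    from c[OF this] have "(\<Sum>j\<in>J. c j * n j) = 0"
    proof -
      have "c j * sign_form \<alpha> j ?u = - (c j * n j)" if "j \<in> J" for j
        using that Jp[of j] Jm[of j] disj[of j] J by (auto simp: sign_form_def restrict_coords_def \<sigma>_def)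
      then have "(\<Sum>j\<in>J. c j * sign_form \<alpha> j ?u) = (\<Sum>j\<in>J. - (c j * n j))" by (intro sum.cong) auto
      then show ?thesis using c[OF \<open>?u \<in> rat_Vg r s \<gg>\<close>] by (simp add: sum_negf)
    qed
    then have "c j * n j = 0"
      using sum_nonneg_eq_0_iff[OF finJ, of "\<lambda>j. c j * n j"] n c_pos j by (auto simp: less_imp_le)
    then show ?thesis using c_pos[OF j] by simp
  qed
  \<comment> \<open>\<open>w x\<close> consists of the nonnegative coordinates of \<open>x\<alpha>\<^sub>J - z\<close>; all equations are transported to
    the orthant by the signs \<open>\<sigma>\<close>.\<close>
  define w where "w x j = \<sigma> j * (x * \<alpha> j - z j)" for x j
  have w_eq: "(\<Sum>j\<in>J. q j * (\<sigma> j * w x j)) = (x - a0) * \<beta> q" if "q \<in> Q" for q x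
    using z_eq[OF that]
    by (simp add: w_def \<sigma>2 \<beta>_def right_diff_distrib sum_subtractf left_diff_distrib sum_distrib_left mult.left_commute)
  have z_off: "z j = 0" if "j \<notin> Jm" for j using that by (simp add: z_def z_point_def)
  have zm: "z j = -1" if "j \<in> Jm" for j using that by (simp add: z_def z_point_def)
  have w1_nonneg: "0 \<le> w 1 j" if "j \<in> J" for j
  proof (cases "j \<in> Jm")
    case True
    from ints[OF that] obtain k where k: "\<alpha> j = of_int k" by (auto elim: Ints_cases)
    have "k < 0" using Jm[OF True] by (simp add: k)
    then have "0 \<le> - k - 1" by simp
    then have "(0::rat) \<le> of_int (- k - 1)" by (simp only: of_int_0_le_iff)
    then show ?thesis using True by (simp add: w_def \<sigma>_def zm k)
  next
    case False
    then show ?thesis using that Jp[of j] J by (auto simp: w_def \<sigma>_def z_off)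
  qed
  have w1_nz: "\<exists>j\<in>J. w 1 j \<noteq> 0"
  proof (rule ccontr)
    assume "\<not> (\<exists>j\<in>J. w 1 j \<noteq> 0)"
    then have "\<alpha> j = z j" if "j \<in> J" for j using that by (auto simp: w_def \<sigma>_def split: if_splits)
    then have "restrict_coords J \<alpha> = z"
      using z_off J by (auto simp: restrict_coords_def)
    then show False using ne by (simp add: z_def)
  qed
  \<comment> \<open>\<open>w 1\<close> is a point of the orthant, nonzero because
    \<open>\<alpha>\<close> and \<open>z\<close> differ on \<open>J\<close>. By \<open>pos\<close>
    its right-hand side \<open>(1 - a0) * \<beta> q\<close> cannot vanish for all \<open>q\<close>,
    and \<open>a0 \<noteq> 1\<close> follows.\<close>
  have \<beta>_nz: "\<exists>q\<in>Q. (1 - a0) * \<beta> q \<noteq> 0"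
  proof (rule ccontr)
    assume *: "\<not> (\<exists>q\<in>Q. (1 - a0) * \<beta> q \<noteq> 0)"
    obtain j where j: "j \<in> J" "w 1 j \<noteq> 0" using w1_nz by blast
    have "w 1 j = 0"
    proof (rule pos[OF w1_nonneg _ j(1)])
      show "(\<Sum>j\<in>J. q j * (\<sigma> j * w 1 j)) = 0" if "q \<in> Q" for q
        unfolding w_eq[OF that] using * that by blast
    qed
    then show False using j(2) by contradiction
  qed
  then have a0_ne: "a0 \<noteq> 1" by auto
  \<comment> \<open>For \<open>t \<le> 0\<close> the point \<open>n - t * w 1\<close> still lies in
    the orthant and solves the homogeneous equations, so it is zero; being a sum of two nonnegative
    terms, it forces \<open>n\<close> to be zero.\<close>
  have no_neg: "n j = 0" if n: "\<And>j. j \<in> J \<Longrightarrow> 0 \<le> n j"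
      and eq: "\<And>q. q \<in> Q \<Longrightarrow> (\<Sum>j\<in>J. q j * (\<sigma> j * n j)) = t * (1 - a0) * \<beta> q" and t: "t \<le> 0" and j: "j \<in> J"
      for n t j
  proof -
    have "(\<Sum>i\<in>J. q i * (\<sigma> i * (n i - t * w 1 i))) = 0" if q: "q \<in> Q" for q
    proof -
      have "(\<Sum>i\<in>J. q i * (\<sigma> i * (n i - t * w 1 i))) =
          (\<Sum>i\<in>J. q i * (\<sigma> i * n i)) - t * (\<Sum>i\<in>J. q i * (\<sigma> i * w 1 i))"
        by (simp add: right_diff_distrib sum_subtractf sum_distrib_left mult.left_commute)
      then show ?thesis using eq[OF q] w_eq[OF q, of 1] by simp
    qed
    moreover have "0 \<le> n i - t * w 1 i" if "i \<in> J" for i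
      using n[OF that] mult_nonpos_nonneg[OF t w1_nonneg[OF that]] by linarith
    ultimately have "n j - t * w 1 j = 0" using pos[of "\<lambda>i. n i - t * w 1 i"] j by blast
    moreover have "t * w 1 j \<le> 0" using w1_nonneg[OF j] t by (simp add: mult_nonpos_nonneg)
    ultimately show ?thesis using n[OF j] by linarith
  qed
  define cone where "cone x = {n :: nat \<Rightarrow> int. (\<forall>j\<in>J. 0 \<le> n j) \<and> (\<forall>j. j \<notin> J \<longrightarrow> n j = 0) \<and>
    (\<forall>q\<in>Q. (\<Sum>j\<in>J. q j * (\<sigma> j * of_int (n j))) = (of_int x - a0) * \<beta> q)}" for x :: int
  have rank: "f (of_nat x) \<ge> 0 \<and>
      goldie_rank (B_alg r s \<gg> (\<lambda>t. of_nat x * \<chi> t) Quot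
        J_ideal r s \<gg> (\<lambda>t. of_nat x * \<chi> t) (\<lambda>i. of_rat (of_nat x * \<alpha> i))) = card (cone (int x)) \<and>
      ehrhart J (translate_by (P_polytope r s \<gg> \<alpha> Jp Jm) (\<lambda>j. - z_point Jm j)) (f (of_nat x)) = card (cone (int x))"
    if x: "of_type r s \<gg> (\<lambda>i. of_nat x * \<alpha> i) Jp Jm" for x :: nat
  proof -
    let ?x = "of_nat x :: rat"
    have xp: "j \<in> Jp \<Longrightarrow> 0 \<le> ?x * \<alpha> j" and xm: "j \<in> Jm \<Longrightarrow> ?x * \<alpha> j < 0" for j
      using of_typeD[OF x] by blast+
    have xint: "?x * \<alpha> j \<in> \<int>" if "j \<in> J" for j using ints[OF that] by simp
    have wx_int: "w ?x j \<in> \<int>" if "j \<in> J" for j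
      using xint[OF that] by (auto simp: w_def \<sigma>_def z_def z_point_def)
    have wx_nonneg: "0 \<le> w ?x j" if "j \<in> J" for j
    proof (cases "j \<in> Jm")
      case True
      from xint[OF that] obtain k where k: "?x * \<alpha> j = of_int k" by (auto elim: Ints_cases)
      have "k < 0" using xm[OF True] by (simp add: k)
      then have "0 \<le> - k - 1" by simp
      then have "(0::rat) \<le> of_int (- k - 1)" by (simp only: of_int_0_le_iff)
      then show ?thesis using True by (simp add: w_def \<sigma>_def zm k)
    next
      case False
      then show ?thesis using that xp[of j] J by (auto simp: w_def \<sigma>_def z_off)
    qed
    define t where "t = f ?x"
    have t: "t * (1 - a0) = ?x - a0" using a0_ne by (simp add: t_def f)
    \<comment> \<open>\<open>w x\<close> is a point of the orthant with right-hand side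
      \<open>t * (1 - a0) * \<beta> q\<close>. For negative \<open>t\<close> it would be zero by
      \<open>no_neg\<close>, so that \<open>\<beta>\<close> would vanish on
      \<open>Q\<close>.\<close>
    have t0: "0 \<le> t"
    proof (rule ccontr)
      assume neg: "\<not> 0 \<le> t"
      have "w ?x j = 0" if "j \<in> J" for j
        using no_neg[of "w ?x" t j] wx_nonneg w_eq t neg that by simp
      then have "(?x - a0) * \<beta> q = 0" if "q \<in> Q" for q using w_eq[OF that, of ?x] by simp
      moreover have "?x - a0 \<noteq> 0" using t[symmetric] neg a0_ne by simp
      ultimately show False using \<beta>_nz by auto
    qed
    have \<chi>x: "(\<lambda>t. of_nat x * \<chi> t) = eta_comb r s \<gg> {1..r+s} (\<lambda>i. of_rat (?x * \<alpha> i))"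
      by (auto simp: chi eta_comb_def sum_distrib_left of_rat_mult mult.assoc)
    let ?D = "{d :: nat \<Rightarrow> int. (\<forall>i. i \<notin> Jp \<union> Jm \<longrightarrow> d i = 0) \<and> (\<lambda>i. of_int (d i)) \<in> Vg r s \<gg> \<and>
      (\<forall>j\<in>Jp. 0 \<le> ?x * \<alpha> j + of_int (d j)) \<and> (\<forall>j\<in>Jm. ?x * \<alpha> j + of_int (d j) < 0)}"
    define W where "W j = (if j \<in> J then \<lfloor>w ?x j\<rfloor> else 0)" for j
    define S where "S j = (if j \<in> Jm then -1 else 1 :: int)" for j
    have S: "of_int (S j) = \<sigma> j" "S j * (S j * k) = k" for j k by (auto simp: S_def \<sigma>_def)
    have W: "of_int (W j) = w ?x j" if "j \<in> J" for j using wx_int[OF that] that by (simp add: W_def of_int_floor)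
    \<comment> \<open>A weight \<open>d\<close> is sent to \<open>x \<alpha> + d - z\<close>,
      reflected into the orthant by the signs. For integral coordinates in \<open>Jm\<close> the
      shift by \<open>z = -1\<close> turns negativity into being at most 0 after translation, which
      is nonnegativity after reflection.\<close>
    have "bij_betw (\<lambda>d j. W j + S j * d j) ?D (cone (int x))"
    proof (rule bij_betwI[where g = "\<lambda>n j. S j * (n j - W j)"])
      have Vg_d: "(\<lambda>i. of_int (d i)) \<in> Vg r s \<gg> \<longleftrightarrow> (\<forall>q\<in>Q. (\<Sum>j\<in>J. q j * of_int (d j)) = 0)"
        if "\<forall>i. i \<notin> J \<longrightarrow> d i = 0" for d
      proof -
        have "(\<lambda>i. of_int (d i) :: 'k) = (\<lambda>i. of_rat (restrict_coords J (\<lambda>j. of_int (d j)) i))"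
          using that by (auto simp: restrict_coords_def)
        then show ?thesis using VgJ[of "\<lambda>j. of_int (d j)"] by simp
      qed
      have sum: "(\<Sum>j\<in>J. q j * (\<sigma> j * of_int (W j + S j * d j))) = (?x - a0) * \<beta> q + (\<Sum>j\<in>J. q j * of_int (d j))"
        if "q \<in> Q" for q d
      proof -
        have "(\<Sum>j\<in>J. q j * (\<sigma> j * of_int (W j + S j * d j))) =
            (\<Sum>j\<in>J. q j * (\<sigma> j * w ?x j) + q j * of_int (d j))"
          by (intro sum.cong) (auto simp: W S \<sigma>2 distrib_left)
        then show ?thesis using w_eq[OF that] by (simp add: sum.distrib)
      qed
      have sgn: "0 \<le> W j + S j * k \<longleftrightarrow> (if j \<in> Jm then ?x * \<alpha> j + of_int k < 0 else 0 \<le> ?x * \<alpha> j + of_int k)"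
        if j: "j \<in> J" for j k
      proof -
        obtain l where l: "?x * \<alpha> j = of_int l" using xint[OF j] by (auto elim: Ints_cases)
        have "of_int (W j) = \<sigma> j * (of_int l - z j)" using W[OF j] l by (simp add: w_def)
        then have "W j = (if j \<in> Jm then - l - 1 else l)"
          by (auto simp: \<sigma>_def zm z_off simp flip: of_int_add of_int_minus of_int_diff)
        moreover have "?x * \<alpha> j + of_int k < 0 \<longleftrightarrow> l + k < 0" "0 \<le> ?x * \<alpha> j + of_int k \<longleftrightarrow> 0 \<le> l + k"
          unfolding l of_int_add[symmetric] by (simp_all only: of_int_less_0_iff of_int_0_le_iff)
        ultimately show ?thesis by (auto simp: S_def)
      qed
      show "(\<lambda>d j. W j + S j * d j) \<in> ?D \<rightarrow> cone (int x)"
      proof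
        fix d assume d: "d \<in> ?D"
        have "\<forall>j\<in>J. 0 \<le> W j + S j * d j" using d sgn disj J by auto
        moreover have "\<forall>j. j \<notin> J \<longrightarrow> W j + S j * d j = 0" using d J by (simp add: W_def)
        moreover have "\<forall>q\<in>Q. (\<Sum>j\<in>J. q j * of_int (d j)) = 0" using d Vg_d[of d] J by simp
        ultimately show "(\<lambda>j. W j + S j * d j) \<in> cone (int x)" using sum[of _ d] by (simp add: cone_def)
      qed
      show "(\<lambda>n j. S j * (n j - W j)) \<in> cone (int x) \<rightarrow> ?D"
      proof
        fix n assume n: "n \<in> cone (int x)"
        let ?d = "\<lambda>j. S j * (n j - W j)"
        have nd: "W j + S j * ?d j = n j" for j by (simp add: S)
        have off: "\<forall>i. i \<notin> J \<longrightarrow> ?d i = 0" using n by (simp add: cone_def W_def)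
        have "\<forall>q\<in>Q. (\<Sum>j\<in>J. q j * of_int (?d j)) = 0"
        proof
          fix q assume q: "q \<in> Q"
          have "(\<Sum>j\<in>J. q j * (\<sigma> j * of_int (n j))) = (?x - a0) * \<beta> q" using n q by (simp add: cone_def)
          then show "(\<Sum>j\<in>J. q j * of_int (?d j)) = 0" using sum[OF q, of ?d] unfolding nd by simp
        qed
        then have "(\<lambda>i. of_int (?d i)) \<in> Vg r s \<gg>" using Vg_d[OF off] by blast
        moreover have "0 \<le> ?x * \<alpha> j + of_int (?d j)" if "j \<in> Jp" for j
          using sgn[of j "?d j"] n that disj[OF that] J unfolding nd by (auto simp: cone_def)
        moreover have "?x * \<alpha> j + of_int (?d j) < 0" if "j \<in> Jm" for j
          using sgn[of j "?d j"] n that J unfolding nd by (auto simp: cone_def)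
        ultimately show "?d \<in> ?D" using off J by blast
      qed
    qed (simp_all add: S)
    then have card_D: "card ?D = card (cone (int x))" by (rule bij_betw_same_card)
    let ?P = "translate_by (P_polytope r s \<gg> \<alpha> Jp Jm) (\<lambda>j. - z_point Jm j)"
    have P: "P_polytope r s \<gg> \<alpha> Jp Jm = {d \<in> coord_space J. (\<forall>q\<in>Q. (\<Sum>j\<in>J. q j * d j) = \<beta> q) \<and>
        (\<forall>j\<in>Jp. d j \<ge> 0) \<and> (\<forall>j\<in>Jm. d j \<le> -1)}"
      unfolding P_polytope_def J[symmetric] eta_J \<beta>_def ..
    have lattice: "(\<lambda>d j. t * d j) ` ?P \<inter> std_lattice J = (\<lambda>n j. \<sigma> j * of_int (n j)) ` cone (int x)"
    proof (intro Set.set_eqI iffI)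
      fix y assume y: "y \<in> (\<lambda>d j. t * d j) ` ?P \<inter> std_lattice J"
      then obtain d where d: "d \<in> P_polytope r s \<gg> \<alpha> Jp Jm" "y = (\<lambda>j. t * (d j - z j))"
        by (auto simp: translate_by_def z_def)
      have y_off: "y j = 0" if "j \<notin> J" for j using y that by (auto simp: std_lattice_def coord_space_def)
      define n where "n j = \<lfloor>\<sigma> j * y j\<rfloor>" for j
      have "\<sigma> j * y j \<in> \<int>" for j
        using y y_off[of j] by (cases "j \<in> J") (auto simp: std_lattice_def \<sigma>_def)
      then have n: "of_int (n j) = \<sigma> j * y j" for j by (simp add: n_def of_int_floor)
      have "0 \<le> n j" if j: "j \<in> J" for j
      proof -
        have "0 \<le> \<sigma> j * (d j - z j)"
          using d(1) j J disj[of j] unfolding P by (auto simp: \<sigma>_def zm z_off)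
        then have "0 \<le> t * (\<sigma> j * (d j - z j))" using t0 by (rule mult_nonneg_nonneg[rotated])
        then have "(0::rat) \<le> of_int (n j)" by (simp add: n d(2) mult.left_commute)
        then show ?thesis by (simp only: of_int_0_le_iff)
      qed
      moreover have "n j = 0" if "j \<notin> J" for j using y_off[OF that] by (simp add: n_def)
      moreover have "(\<Sum>j\<in>J. q j * (\<sigma> j * of_int (n j))) = (?x - a0) * \<beta> q" if q: "q \<in> Q" for q
      proof -
        have "(\<Sum>j\<in>J. q j * (\<sigma> j * of_int (n j))) = t * ((\<Sum>j\<in>J. q j * d j) - (\<Sum>j\<in>J. q j * z j))"
          by (simp add: n \<sigma>2 d(2) sum_distrib_left right_diff_distrib sum_subtractf mult.left_commute)
        also have "(\<Sum>j\<in>J. q j * d j) = \<beta> q" using d(1) q unfolding P by blast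
        also have "t * (\<beta> q - (\<Sum>j\<in>J. q j * z j)) = t * (1 - a0) * \<beta> q"
          unfolding z_eq[OF q] by (simp add: algebra_simps)
        finally show ?thesis using t by simp
      qed
      ultimately have "n \<in> cone (int x)" by (simp add: cone_def)
      moreover have "y = (\<lambda>j. \<sigma> j * of_int (n j))" by (simp add: n \<sigma>2)
      ultimately show "y \<in> (\<lambda>n j. \<sigma> j * of_int (n j)) ` cone (int x)" by blast
    next
      fix y assume "y \<in> (\<lambda>n j. \<sigma> j * of_int (n j)) ` cone (int x)"
      then obtain n where n: "n \<in> cone (int x)" "y = (\<lambda>j. \<sigma> j * of_int (n j))" by blast
      have nn: "\<And>j. j \<in> J \<Longrightarrow> 0 \<le> n j" "\<And>j. j \<notin> J \<Longrightarrow> n j = 0"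
        and eq: "\<And>q. q \<in> Q \<Longrightarrow> (\<Sum>j\<in>J. q j * y j) = t * (1 - a0) * \<beta> q"
        using n t by (auto simp: cone_def)
      have lat: "y \<in> std_lattice J"
        using nn(2) n(2) by (auto simp: std_lattice_def coord_space_def \<sigma>_def)
      have "\<exists>d\<in>P_polytope r s \<gg> \<alpha> Jp Jm. y = (\<lambda>j. t * (d j - z j))"
      proof (cases "t = 0")
        case True
        \<comment> \<open>For \<open>t = 0\<close> the point cannot be divided by \<open>t\<close>.
          It is zero by \<open>pos\<close>, and zero is the image of any point of the polytope; the
          point \<open>\<alpha>\<close> shows that there is one.\<close>
        have "(of_int (n j) :: rat) = 0" if "j \<in> J" for j
          using pos[of "\<lambda>j. of_int (n j)" j] nn(1) eq n(2) True that by simp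
        then have y0: "y = (\<lambda>j. t * (restrict_coords J \<alpha> j - z j))" using True nn(2) n(2) by fastforce
        have "restrict_coords J \<alpha> \<in> P_polytope r s \<gg> \<alpha> Jp Jm"
          unfolding P
        proof (intro CollectI conjI ballI)
          show "restrict_coords J \<alpha> \<in> coord_space J" by (simp add: coord_space_def restrict_coords_def)
          show "(\<Sum>j\<in>J. q j * restrict_coords J \<alpha> j) = \<beta> q" for q
            unfolding \<beta>_def by (intro sum.cong) (auto simp: restrict_coords_def)
          show "0 \<le> restrict_coords J \<alpha> j" if "j \<in> Jp" for j using Jp[OF that] by (simp add: restrict_coords_def)
          show "restrict_coords J \<alpha> j \<le> -1" if "j \<in> Jm" for j
            using w1_nonneg[of j] that J by (simp add: restrict_coords_def w_def \<sigma>_def zm)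
        qed
        then show ?thesis using y0 by blast
      next
        case False
        define d where "d j = y j / t + z j" for j
        have "d \<in> P_polytope r s \<gg> \<alpha> Jp Jm"
          unfolding P
        proof (intro CollectI conjI ballI)
          show "d \<in> coord_space J"
            using n(2) nn(2) J z_off by (auto simp: coord_space_def d_def)
          show "(\<Sum>j\<in>J. q j * d j) = \<beta> q" if q: "q \<in> Q" for q
          proof -
            have "(\<Sum>j\<in>J. q j * d j) = (\<Sum>j\<in>J. q j * y j) / t + (\<Sum>j\<in>J. q j * z j)"
              by (simp add: d_def distrib_left sum.distrib sum_divide_distrib)
            then show ?thesis using eq[OF q] z_eq[OF q] False by (simp add: algebra_simps)
          qed
          have sy: "0 \<le> of_int (n j) / t" if "j \<in> J" for j using nn(1)[OF that] t0 by simp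
          show "0 \<le> d j" if "j \<in> Jp" for j
            using sy[of j] that disj[OF that] J by (simp add: d_def n(2) \<sigma>_def z_off)
          show "d j \<le> -1" if "j \<in> Jm" for j
            using sy[of j] that J by (simp add: d_def n(2) \<sigma>_def zm)
        qed
        moreover have "y = (\<lambda>j. t * (d j - z j))" using False by (simp add: d_def)
        ultimately show ?thesis by blast
      qed
      then obtain d where d: "d \<in> P_polytope r s \<gg> \<alpha> Jp Jm" "y = (\<lambda>j. t * (d j - z j))" by blast
      show "y \<in> (\<lambda>d j. t * d j) ` ?P \<inter> std_lattice J"
      proof (rule IntI[OF image_eqI lat])
        show "(\<lambda>j. d j + - z_point Jm j) \<in> ?P" unfolding translate_by_def using d(1) by blast
        show "y = (\<lambda>j. t * (d j + - z_point Jm j))" using d(2) by (simp add: z_def)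
      qed
    qed
    have "inj_on (\<lambda>n j. \<sigma> j * of_int (n j)) (cone (int x))"
    proof (rule inj_onI, rule ext)
      fix n n' :: "nat \<Rightarrow> int" and j assume "(\<lambda>j. \<sigma> j * of_int (n j)) = (\<lambda>j. \<sigma> j * of_int (n' j))"
      from fun_cong[OF this, of j] show "n j = n' j" by (auto simp: \<sigma>_def split: if_splits)
    qed
    then have "ehrhart J ?P t = card (cone (int x))" unfolding ehrhart_def lattice by (rule card_image)
    then show ?thesis
      using t0 goldie_rank_of_type[OF g x] card_D unfolding t_def \<chi>x by simp
  qed
  obtain q where q: "quasi_polynomial q"
    "\<And>x::nat. \<lbrakk>0 < x; 0 \<le> f (of_nat x)\<rbrakk> \<Longrightarrow> q (int x) = of_nat (card (cone (int x)))"
  proof (cases "a0 < 1")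
    case True
    \<comment> \<open>The signs \<open>\<sigma>\<close> are absorbed into the coefficients of the
      equations, so that the unknowns are plain nonnegative integers.\<close>
    let ?Q = "(\<lambda>q j. q j * \<sigma> j) ` Q" and ?b = "\<lambda>q. \<beta> (\<lambda>j. q j * \<sigma> j)"
    have b: "?b (\<lambda>j. q j * \<sigma> j) = \<beta> q" for q by (simp add: mult.assoc \<sigma>2)
    obtain q0 where q0: "q0 \<in> Q" "\<beta> q0 \<noteq> 0" using \<beta>_nz by auto
    have "quasi_poly_pos (\<lambda>x. of_nat (card {n. (\<forall>j\<in>J. 0 \<le> n j) \<and> (\<forall>j. j \<notin> J \<longrightarrow> n j = 0) \<and>
      (\<forall>q\<in>?Q. (\<Sum>j\<in>J. q j * of_int (n j)) = (of_int x - a0) * ?b q)}))"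
    proof (rule cone_line_quasi_poly[OF finJ True])
      show "(\<lambda>j. q0 j * \<sigma> j) \<in> ?Q" using q0 by blast
      show "?b (\<lambda>j. q0 j * \<sigma> j) \<noteq> 0" unfolding b by (rule q0)
      fix n :: "nat \<Rightarrow> int" and t
      assume n: "\<forall>j\<in>J. 0 \<le> n j" "\<forall>j. j \<notin> J \<longrightarrow> n j = 0" "n \<noteq> (\<lambda>_. 0)"
        and eq: "\<forall>q\<in>?Q. (\<Sum>j\<in>J. q j * of_int (n j)) = t * ?b q"
      show "0 < t"
      proof (rule ccontr)
        assume "\<not> 0 < t"
        then have "t / (1 - a0) \<le> 0" using True by (simp add: divide_nonpos_pos)
        moreover have "(\<Sum>j\<in>J. q j * (\<sigma> j * of_int (n j))) = t / (1 - a0) * (1 - a0) * \<beta> q" if "q \<in> Q" for q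
          using eq that b[of q] True by (simp add: mult.assoc)
        ultimately have "(of_int (n j) :: rat) = 0" if "j \<in> J" for j
          using no_neg[of "\<lambda>j. of_int (n j)" "t / (1 - a0)" j] n(1) that by simp
        then have "n j = 0" for j using n(2) by (cases "j \<in> J") auto
        then show False using n(3) by auto
      qed
    qed
    moreover have "{n. (\<forall>j\<in>J. 0 \<le> n j) \<and> (\<forall>j. j \<notin> J \<longrightarrow> n j = 0) \<and>
      (\<forall>q\<in>?Q. (\<Sum>j\<in>J. q j * of_int (n j)) = (of_int x - a0) * ?b q)} = cone x" for x
      unfolding cone_def ball_simps b by (simp add: mult.assoc)
    ultimately have "quasi_poly_pos (\<lambda>x. of_nat (card (cone x)))" by simp
    from quasi_poly_pos_imp_quasi_polynomial[OF this] obtain q where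
      q: "quasi_polynomial q" "\<forall>x>0. q x = of_nat (card (cone x))" by blast
    show ?thesis by (rule that[OF q(1)]) (use q(2) in simp)
  next
    case False
    then have a1: "1 < a0" using a0_ne by simp
    obtain q where q: "quasi_polynomial q"
      "\<forall>x::nat. 0 < x \<and> x \<le> nat \<lceil>a0\<rceil> \<longrightarrow> q (int x) = of_nat (card (cone (int x)))"
      using quasi_polynomial_finite_values[of "nat \<lceil>a0\<rceil>" "\<lambda>x. of_nat (card (cone (int x)))"] by blast
    show ?thesis
    proof (rule that[OF q(1)])
      fix x :: nat assume x: "0 < x" "0 \<le> f (of_nat x)"
      \<comment> \<open>The denominator \<open>1 - a0\<close> of \<open>f\<close> is negative here,
        so \<open>0 \<le> f x\<close>, which \<open>rank\<close> derives from the type of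
        \<open>x \<alpha>\<close>, bounds \<open>x\<close> by \<open>a0\<close>.\<close>
      then have "of_nat x \<le> a0" using a1 by (simp add: f zero_le_divide_iff)
      then have "x \<le> nat \<lceil>a0\<rceil>" by linarith
      then show "q (int x) = of_nat (card (cone (int x)))" using q(2) x(1) by blast
    qed
  qed
  show ?thesis
    using a0_ne q(1) rank q(2) by (intro conjI exI[of _ q]) (auto simp: Let_def)
qed

end
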